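(* Let $\tau$ be an action of a finite abelian group $G$ on $(\mathbb{C}^n,0)$, $n\ge 1$, of the form $g\circ(x_1,\dots,x_n)=(\chi_1(g)x_1,\dots,\chi_n(g)x_n)$ with $\chi_1,\dots,\chi_n$ characters of $G$, having no fixed points outside of the origin (i.e. all $\chi_i$ are nontrivial). Let $f:(\mathbb{C}^n,0)\to(\mathbb{C},0)$ be a $\tau$-invariant analytic function germ with an isolated singularity at the origin. If $\mu(f)=l(\tau)-1$, then $f$ is equivariantly stable.
   Context: $\mu(f)=\dim_{\mathbb{C}} \mathbb{C}\{x_1,\dots,x_n\}/\langle \partial f/\partial x_1,\dots,\partial f/\partial x_n\rangle$ is the Milnor number of $f$. $l(\tau)$ is the length (cardinality) of the shortest $G$-orbit of a point not fixed by the whole group $G$. Equivariant stability: let $\mathfrak{m}_G$ be the maximal ideal of the ring of $G$-invariant analytic function germs at $0\in\mathbb{C}^n$ (the invariant germs vanishing at $0$). For $r\ge 1$ let $\mathcal{O}^r_G$ be the (finite-dimensional) space of $r$-jets at $0$ of elements of $\mathfrak{m}_G$, and let $D^r_G$ be the group of $r$-jets at $0$ of $G$-equivariant germs of analytic diffeomorphisms $(\mathbb{C}^n,0)\to(\mathbb{C}^n,0)$, which acts on $\mathcal{O}^r_G$ by change of coordinates. A germ $f\in\mathfrak{m}_G$ is equivariantly stable if for all large enough $r$ the $D^r_G$-orbit of the $r$-jet of $f$ is open in $\mathcal{O}^r_G$. *)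

theory Defs
  imports "HOL-Analysis.Analysis" "HOL-Algebra.Group_Action" "HOL-Algebra.QuotRing"
    "HOL-Algebra.Embedded_Algebras"
begin

section \<open>Analytic function germs at the origin\<close>

text \<open>
  A germ at \<open>0 \<in> \<complex>\<^sup>n\<close> is represented by any function defined on the whole space whose restriction to
  a neighbourhood of \<open>0\<close> has that germ; every notion below depends only on the germ. Multi-indices
  are functions \<open>'n \<Rightarrow> nat\<close>, and power series are families of coefficients.
\<close>

type_synonym 'n mindex = "'n \<Rightarrow> nat"
type_synonym 'n series = "'n mindex \<Rightarrow> complex"

definition mdeg :: "'n::finite mindex \<Rightarrow> nat" where
  "mdeg \<alpha> = (\<Sum>i\<in>UNIV. \<alpha> i)"

definition mpow :: "complex ^ 'n::finite \<Rightarrow> 'n mindex \<Rightarrow> complex" where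
  "mpow x \<alpha> = (\<Prod>i\<in>UNIV. (x $ i) ^ \<alpha> i)"

definition has_series :: "(complex ^ 'n::finite \<Rightarrow> complex) \<Rightarrow> 'n series \<Rightarrow> bool" where
  "has_series f a \<longleftrightarrow> (\<forall>\<^sub>F x in nhds 0. ((\<lambda>\<alpha>. a \<alpha> * mpow x \<alpha>) has_sum f x) UNIV)"

definition analytic_germ :: "(complex ^ 'n::finite \<Rightarrow> complex) \<Rightarrow> bool" where
  "analytic_germ f \<longleftrightarrow> (\<exists>a. has_series f a)"

text \<open>For an analytic germ the expansion is unique, by the identity theorem for power series.\<close>

definition series_of :: "(complex ^ 'n::finite \<Rightarrow> complex) \<Rightarrow> 'n series" where
  "series_of f = (THE a. has_series f a)"

definition partial_deriv :: "(complex ^ 'n::finite \<Rightarrow> complex) \<Rightarrow> 'n \<Rightarrow> complex ^ 'n \<Rightarrow> complex" where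
  "partial_deriv f i x = deriv (\<lambda>t. f (x + axis i t)) 0"

definition isolated_singularity :: "(complex ^ 'n::finite \<Rightarrow> complex) \<Rightarrow> bool" where
  "isolated_singularity f \<longleftrightarrow>
     (\<forall>i. partial_deriv f i 0 = 0) \<and> (\<forall>\<^sub>F x in at 0. \<exists>i. partial_deriv f i x \<noteq> 0)"


section \<open>The Milnor number\<close>

text \<open>The ring \<open>\<complex>{x\<^sub>1,\<dots>,x\<^sub>n}\<close> of convergent power series, with the Cauchy product.\<close>

definition conv_series_ring :: "'n::finite series ring" where
  "conv_series_ring =
     \<lparr>carrier = {a. \<forall>\<^sub>F x in nhds 0. (\<lambda>\<alpha>. a \<alpha> * mpow x \<alpha>) summable_on UNIV},
      mult = (\<lambda>a b \<gamma>. \<Sum>(\<alpha>, \<beta>)\<in>{(\<alpha>, \<beta>). \<forall>i. \<alpha> i + \<beta> i = \<gamma> i}. a \<alpha> * b \<beta>),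
      one = (\<lambda>\<alpha>. if \<alpha> = (\<lambda>_. 0) then 1 else 0),
      zero = (\<lambda>_. 0),
      add = (\<lambda>a b \<alpha>. a \<alpha> + b \<alpha>)\<rparr>"

definition const_series :: "complex \<Rightarrow> 'n::finite series" where
  "const_series c = (\<lambda>\<alpha>. if \<alpha> = (\<lambda>_. 0) then c else 0)"

definition jacobian_ideal :: "(complex ^ 'n::finite \<Rightarrow> complex) \<Rightarrow> 'n series set" where
  "jacobian_ideal f =
     Idl\<^bsub>conv_series_ring\<^esub> ((\<lambda>i. series_of (partial_deriv f i)) ` UNIV)"

text \<open>
  Scalars are the classes of the constants in the quotient, so dimension over this set is
  dimension over \<open>\<complex>\<close> (also in the zero ring, where it is \<open>0\<close>).
\<close>

definition milnor_number :: "(complex ^ 'n::finite \<Rightarrow> complex) \<Rightarrow> enat" where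
  "milnor_number f =
     (let J = jacobian_ideal f;
          Q = conv_series_ring Quot J;
          K = range (\<lambda>c. J +>\<^bsub>conv_series_ring\<^esub> const_series c)
      in if ring.finite_dimension Q K (carrier Q) then enat (ring.dim Q K (carrier Q)) else \<infinity>)"


section \<open>Diagonal actions\<close>

definition complex_units :: "complex monoid" where
  "complex_units = \<lparr>carrier = - {0}, mult = (*), one = 1\<rparr>"

text \<open>The binder symbol for vectors is also the usual letter for characters; the latter are
  called \<open>\<xi>\<close> here.\<close>

definition diag_act :: "('n::finite \<Rightarrow> 'g \<Rightarrow> complex) \<Rightarrow> 'g \<Rightarrow> complex ^ 'n \<Rightarrow> complex ^ 'n" where
  "diag_act \<xi> g x = (\<chi> i. \<xi> i g * x $ i)"

definition fixed_point ::
    "('g, 'b) monoid_scheme \<Rightarrow> ('n::finite \<Rightarrow> 'g \<Rightarrow> complex) \<Rightarrow> complex ^ 'n \<Rightarrow> bool" where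
  "fixed_point G \<xi> x \<longleftrightarrow> (\<forall>g\<in>carrier G. diag_act \<xi> g x = x)"

definition min_orbit_length ::
    "('g, 'b) monoid_scheme \<Rightarrow> ('n::finite \<Rightarrow> 'g \<Rightarrow> complex) \<Rightarrow> nat" where
  "min_orbit_length G \<xi> = Inf {card (orbit G (diag_act \<xi>) x) | x. \<not> fixed_point G \<xi> x}"

definition invariant_germ ::
    "('g, 'b) monoid_scheme \<Rightarrow> ('n::finite \<Rightarrow> 'g \<Rightarrow> complex) \<Rightarrow> (complex ^ 'n \<Rightarrow> complex) \<Rightarrow> bool" where
  "invariant_germ G \<xi> f \<longleftrightarrow> (\<forall>g\<in>carrier G. \<forall>\<^sub>F x in nhds 0. f (diag_act \<xi> g x) = f x)"


section \<open>Equivariant stability\<close>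

definition inv_max_ideal ::
    "('g, 'b) monoid_scheme \<Rightarrow> ('n::finite \<Rightarrow> 'g \<Rightarrow> complex) \<Rightarrow> (complex ^ 'n \<Rightarrow> complex) set" where
  "inv_max_ideal G \<xi> = {f. analytic_germ f \<and> invariant_germ G \<xi> f \<and> f 0 = 0}"

definition analytic_map_germ :: "(complex ^ 'n::finite \<Rightarrow> complex ^ 'n) \<Rightarrow> bool" where
  "analytic_map_germ \<phi> \<longleftrightarrow> (\<forall>i. analytic_germ (\<lambda>x. \<phi> x $ i))"

definition diffeo_germ :: "(complex ^ 'n::finite \<Rightarrow> complex ^ 'n) \<Rightarrow> bool" where
  "diffeo_germ \<phi> \<longleftrightarrow> analytic_map_germ \<phi> \<and> \<phi> 0 = 0 \<and>
     (\<exists>\<psi>. analytic_map_germ \<psi> \<and> \<psi> 0 = 0 \<and>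
          (\<forall>\<^sub>F x in nhds 0. \<psi> (\<phi> x) = x) \<and> (\<forall>\<^sub>F x in nhds 0. \<phi> (\<psi> x) = x))"

definition equivariant_germ ::
    "('g, 'b) monoid_scheme \<Rightarrow> ('n::finite \<Rightarrow> 'g \<Rightarrow> complex) \<Rightarrow> (complex ^ 'n \<Rightarrow> complex ^ 'n) \<Rightarrow> bool"
  where "equivariant_germ G \<xi> \<phi> \<longleftrightarrow>
     (\<forall>g\<in>carrier G. \<forall>\<^sub>F x in nhds 0. \<phi> (diag_act \<xi> g x) = diag_act \<xi> g (\<phi> x))"

text \<open>An \<open>r\<close>-jet is the family of Taylor coefficients, cut off above degree \<open>r\<close>.\<close>

definition jet :: "nat \<Rightarrow> (complex ^ 'n::finite \<Rightarrow> complex) \<Rightarrow> 'n series" where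
  "jet r f = (\<lambda>\<alpha>. if mdeg \<alpha> \<le> r then series_of f \<alpha> else 0)"

definition jet_poly :: "nat \<Rightarrow> 'n::finite series \<Rightarrow> complex ^ 'n \<Rightarrow> complex" where
  "jet_poly r a x = (\<Sum>\<alpha> | mdeg \<alpha> \<le> r. a \<alpha> * mpow x \<alpha>)"

definition inv_jets ::
    "('g, 'b) monoid_scheme \<Rightarrow> ('n::finite \<Rightarrow> 'g \<Rightarrow> complex) \<Rightarrow> nat \<Rightarrow> 'n series set" where
  "inv_jets G \<xi> r = jet r ` inv_max_ideal G \<xi>"

definition diffeo_jets ::
    "('g, 'b) monoid_scheme \<Rightarrow> ('n::finite \<Rightarrow> 'g \<Rightarrow> complex) \<Rightarrow> nat \<Rightarrow> ('n \<Rightarrow> 'n series) set" where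
  "diffeo_jets G \<xi> r =
     (\<lambda>\<phi> i. jet r (\<lambda>x. \<phi> x $ i)) ` {\<phi>. diffeo_germ \<phi> \<and> equivariant_germ G \<xi> \<phi>}"

text \<open>
  Change of coordinates on jets, computed on polynomial representatives: as \<open>\<phi> 0 = 0\<close>, the jet of
  \<open>f \<circ> \<phi>\<close> depends only on the jets of \<open>f\<close> and \<open>\<phi>\<close>. (Using \<open>f \<circ> \<phi>\<close> or \<open>f \<circ> \<phi>\<inverse>\<close> yields the same
  orbits.)
\<close>

definition jet_act :: "nat \<Rightarrow> ('n::finite \<Rightarrow> 'n series) \<Rightarrow> 'n series \<Rightarrow> 'n series" where
  "jet_act r \<Phi> a = jet r (\<lambda>x. jet_poly r a (\<chi> i. jet_poly r (\<Phi> i) x))"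

text \<open>
  The product topology on functions induces the usual vector space topology on the
  finite-dimensional space \<open>inv_jets G \<xi> r\<close>, as all jets vanish off the finite set of
  multi-indices of degree at most \<open>r\<close>.
\<close>

definition equivariantly_stable ::
    "('g, 'b) monoid_scheme \<Rightarrow> ('n::finite \<Rightarrow> 'g \<Rightarrow> complex) \<Rightarrow> (complex ^ 'n \<Rightarrow> complex) \<Rightarrow> bool" where
  "equivariantly_stable G \<xi> f \<longleftrightarrow>
     f \<in> inv_max_ideal G \<xi> \<and>
     (\<forall>\<^sub>F r in sequentially.
        openin (top_of_set (inv_jets G \<xi> r))
          {jet_act r \<Phi> (jet r f) | \<Phi>. \<Phi> \<in> diffeo_jets G \<xi> r})"

end

theory Submission
  imports Defs "HOL-Library.Function_Algebras" "HOL-Library.Poly_Mapping"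
    "HOL-Complex_Analysis.Cauchy_Integral_Formula" "HOL-Number_Theory.Cong"
begin

text \<open>
  Let \<open>l\<close> be the least length of a nontrivial orbit. The \<open>i\<close>-th axis contains orbits of length
  \<open>m\<^sub>i\<close>, the order of \<open>\<chi>\<^sub>i\<close>, so \<open>l \<le> m\<^sub>i\<close>. As \<open>\<mu>(f) = l - 1\<close>, any \<open>l\<close> polynomials are linearly
  dependent modulo the Jacobian ideal. This forces every invariant germ vanishing at \<open>0\<close> into that
  ideal. Indeed, take \<open>m = m\<^sub>i\<close> minimal and restrict to the block of coordinates on which the kernel
  of \<open>\<chi>\<^sub>i\<close> acts trivially, so that \<open>G\<close> acts through a cyclic group of order \<open>m\<close>. The deformation
  \<open>\<partial>\<^sub>jf + x\<^sub>j\<^sup>M\<close> with \<open>M\<close> congruent to \<open>-1\<close> modulo \<open>m\<close> respects the weights, and the monomials in the box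
  \<open>{0,\<dots>,M-1}\<^sup>k\<close> are a basis modulo it. Their weights are equidistributed up to \<open>\<plusminus>1\<close> in a single weight, and
  this survives in the local algebra at \<open>0\<close>, the part where the \<open>x\<^sub>j\<close> act nilpotently. As the dimension of
  the latter is less than \<open>l \<le> m\<close>, either \<open>k\<close> is odd and its invariants are the constants, or \<open>k\<close> is even
  and it has dimension one. In the second case the linear part of the \<open>\<partial>\<^sub>jf\<close> is invertible on the block,
  and its coordinates can be eliminated.

  Hence the derivative of \<open>\<Phi> \<mapsto> f \<circ> \<Phi>\<close> maps onto the invariant jets at every \<open>\<Phi>\<close>, by pulling back along
  \<open>\<Phi>\<close>. Newton's iteration then shows that the orbit is open, as polynomial maps with invertible linear part
  are germs of diffeomorphisms.
\<close>

section \<open>Polynomials as finitely supported families of coefficients\<close>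

text \<open>The grading is only by weights modulo m and \<open>f\<close> need not be
  quasihomogeneous, so no product formula gives the weight dimensions of the Milnor algebra. With M
  above all degrees of the F_j, the leading monomials x_j^M of the deformed generators are pairwise
  coprime, so the box is a basis whatever the F_j are, and counting weights in it is elementary. The
  price is zeros away from the origin. They are harmless: where some x_j acts invertibly it permutes
  the weight spaces cyclically, its weight being a unit modulo m, so splitting that part off
  subtracts one and the same number from all dimensions. What remains has dimension a in every
  weight, up to (-1)^k in one of them, and total m a + (-1)^k < l <= m. This leaves a = 0 for even
  k, and a = 1 with m = l for odd k. Ideals are taken modulo degree N. Any l powers of x_j being
  dependent, x_j^(l-1) lies in the ideal up to degree N, and N > n l suffices for truncation not to
  hide anything. Convergence enters mainly through the Milnor number and the inversion of coordinate
  changes.\<close>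

type_synonym 'n mpoly = "('n \<Rightarrow> nat) \<Rightarrow>\<^sub>0 complex"

abbreviation mon :: "('n \<Rightarrow> nat) \<Rightarrow> 'n mpoly" where
  "mon \<alpha> \<equiv> Poly_Mapping.single \<alpha> 1"

abbreviation cst :: "complex \<Rightarrow> 'n mpoly" where
  "cst c \<equiv> Poly_Mapping.single 0 c"

abbreviation "lookup \<equiv> poly_mapping.lookup"

abbreviation "keys \<equiv> Poly_Mapping.keys"

text \<open>As simplification rules these would turn multi-indices into abstractions that no longer match.\<close>

declare plus_fun_apply [simp del] zero_fun_apply [simp del]

definition expo :: "'n \<Rightarrow> nat \<Rightarrow> ('n \<Rightarrow> nat)" where
  "expo j d = (\<lambda>i. if i = j then d else 0)"

lemma expo_simps [simp]: "expo j d j = d" "i \<noteq> j \<Longrightarrow> expo j d i = 0"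
  by (auto simp: expo_def)

lemma mdeg_add [simp]: "mdeg (\<alpha> + \<beta>) = mdeg \<alpha> + mdeg \<beta>"
  by (simp add: mdeg_def sum.distrib plus_fun_apply)

lemma mdeg_zero [simp]: "mdeg 0 = 0"
  by (simp add: mdeg_def zero_fun_apply)

lemma mdeg_expo [simp]: "mdeg (expo j d) = d"
  by (simp add: mdeg_def expo_def)

lemma mdeg_eq_0_iff [simp]: "mdeg \<alpha> = 0 \<longleftrightarrow> \<alpha> = 0"
  by (auto simp: mdeg_def fun_eq_iff zero_fun_apply)

lemma finite_mdeg_le: "finite {\<alpha>::'n::finite \<Rightarrow> nat. mdeg \<alpha> \<le> r}"
proof (rule finite_subset)
  show "{\<alpha>::'n \<Rightarrow> nat. mdeg \<alpha> \<le> r} \<subseteq> PiE UNIV (\<lambda>_. {..r})"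
  proof
    fix \<alpha> :: "'n \<Rightarrow> nat" assume "\<alpha> \<in> {\<alpha>. mdeg \<alpha> \<le> r}"
    then have "\<alpha> i \<le> r" for i
      using member_le_sum[of i UNIV \<alpha>] by (simp add: mdeg_def)
    then show "\<alpha> \<in> PiE UNIV (\<lambda>_. {..r})" by auto
  qed
qed (auto intro: finite_PiE)

lemma mindex_split: "d \<le> \<alpha> j \<Longrightarrow> \<exists>\<gamma>. \<alpha> = \<gamma> + expo j d"
  by (rule exI[of _ "\<lambda>i. if i = j then \<alpha> i - d else \<alpha> i"]) (auto simp: fun_eq_iff expo_def plus_fun_apply)

lemma lookup_single_mult:
  "lookup (Poly_Mapping.single \<beta> c * p :: 'n mpoly) \<gamma> = (if \<beta> \<le> \<gamma> then c * lookup p (\<gamma> - \<beta>) else 0)"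
proof -
  have "lookup (Poly_Mapping.single \<beta> c * p) \<gamma> =
      Sum_any (\<lambda>l. (c when \<beta> = l) * Sum_any (\<lambda>q. lookup p q when \<gamma> = l + q))"
    by (simp add: lookup_mult lookup_single)
  also have "\<dots> = Sum_any (\<lambda>l. (c * Sum_any (\<lambda>q. lookup p q when \<gamma> = l + q)) when \<beta> = l)"
    by (rule arg_cong[where f = Sum_any]) (simp add: fun_eq_iff when_def)
  also have "\<dots> = c * Sum_any (\<lambda>q. lookup p q when \<gamma> = \<beta> + q)"
    by (rule Sum_any_when_equal')
  also have "Sum_any (\<lambda>q. lookup p q when \<gamma> = \<beta> + q) = (if \<beta> \<le> \<gamma> then lookup p (\<gamma> - \<beta>) else 0)"
  proof (cases "\<beta> \<le> \<gamma>")
    case True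
    then have "\<beta> + (\<gamma> - \<beta>) = \<gamma>"
      by (simp add: fun_eq_iff le_fun_def plus_fun_apply)
    then have "\<gamma> = \<beta> + q \<longleftrightarrow> \<gamma> - \<beta> = q" for q
      by (metis add_left_cancel)
    then have "Sum_any (\<lambda>q. lookup p q when \<gamma> = \<beta> + q) = Sum_any (\<lambda>q. lookup p q when \<gamma> - \<beta> = q)"
      by presburger
    also have "\<dots> = lookup p (\<gamma> - \<beta>)"
      by (rule Sum_any_when_equal')
    finally show ?thesis using True by (simp only: if_True)
  next
    case False
    then have "\<gamma> \<noteq> \<beta> + q" for q by (auto simp: le_fun_def plus_fun_apply)
    then have "Sum_any (\<lambda>q. lookup p q when \<gamma> = \<beta> + q) = Sum_any (\<lambda>q. 0)"
      by (simp add: when_def)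
    with False show ?thesis by simp
  qed
  finally show ?thesis by (simp split: if_splits)
qed

lemma lookup_cst_mult [simp]: "lookup (cst c * p :: 'n mpoly) \<gamma> = c * lookup p \<gamma>"
  by (simp add: lookup_single_mult le_fun_def fun_diff_def zero_fun_apply)

lemma single_as_mult: "Poly_Mapping.single \<alpha> c = cst c * mon (\<alpha> :: 'n \<Rightarrow> nat)"
  by (simp add: mult_single)

lemma mon_mult: "mon \<alpha> * mon \<beta> = mon (\<alpha> + \<beta> :: 'n \<Rightarrow> nat)"
  by (simp add: mult_single)

lemma cst_mult: "cst c * cst d = (cst (c * d) :: 'n mpoly)"
  by (simp add: mult_single)

lemma mpoly_sum_keys:
  assumes "finite A" "keys p \<subseteq> A"
  shows "p = (\<Sum>\<alpha>\<in>A. Poly_Mapping.single \<alpha> (lookup p \<alpha>))"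
proof (rule poly_mapping_eqI)
  fix k
  have "(\<Sum>\<alpha>\<in>A. lookup (Poly_Mapping.single \<alpha> (lookup p \<alpha>)) k) = (\<Sum>\<alpha>\<in>A. if \<alpha> = k then lookup p k else 0)"
    by (rule sum.cong) (auto simp: lookup_single)
  then show "lookup p k = lookup (\<Sum>\<alpha>\<in>A. Poly_Mapping.single \<alpha> (lookup p \<alpha>)) k"
    using assms by (auto simp: lookup_sum in_keys_iff)
qed

lemma mpoly_induct_keys:
  fixes p :: "'n mpoly"
  assumes "\<And>\<alpha> c. \<alpha> \<in> keys p \<Longrightarrow> P (Poly_Mapping.single \<alpha> c)" "P 0" "\<And>p q. P p \<Longrightarrow> P q \<Longrightarrow> P (p + q)"
  shows "P p"
proof -
  have "P (\<Sum>\<alpha>\<in>B. Poly_Mapping.single \<alpha> (lookup p \<alpha>))" if "B \<subseteq> keys p" for B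
    using finite_subset[OF that finite_keys] that by (induct B) (use assms in auto)
  from this[of "keys p"] show ?thesis
    using mpoly_sum_keys[of "keys p" p] by simp
qed

lemma mpoly_induct:
  fixes p :: "'n mpoly"
  assumes "\<And>\<alpha> c. P (Poly_Mapping.single \<alpha> c)" "\<And>p q. P p \<Longrightarrow> P q \<Longrightarrow> P (p + q)"
  shows "P p"
  by (rule mpoly_induct_keys) (use assms assms(1)[of 0 0] in auto)

interpretation mp: vector_space "\<lambda>c (p :: 'n mpoly). cst c * p"
  by standard (simp_all add: distrib_left distrib_right single_add cst_mult mult.assoc[symmetric])

text \<open>Restriction to a set of monomials. With \<open>supp_in V\<close> this sets the variables
  outside \<open>V\<close> to zero; with a condition on characters it extracts an isotypic
  part.\<close>

definition pick :: "(('n \<Rightarrow> nat) \<Rightarrow> bool) \<Rightarrow> 'n mpoly \<Rightarrow> 'n mpoly" where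
  "pick Q p = Abs_poly_mapping (\<lambda>\<alpha>. if Q \<alpha> then lookup p \<alpha> else 0)"

lemma lookup_pick [simp]: "lookup (pick Q p) \<alpha> = (if Q \<alpha> then lookup p \<alpha> else 0)"
proof -
  have "finite {\<alpha>. (if Q \<alpha> then lookup p \<alpha> else 0) \<noteq> 0}"
    by (rule finite_subset[OF _ finite_keys[of p]]) (auto simp: in_keys_iff split: if_splits)
  then show ?thesis by (simp add: pick_def)
qed

lemma keys_pick [simp]: "keys (pick Q p) = {\<alpha>\<in>keys p. Q \<alpha>}"
  by (auto simp: in_keys_iff simp del: lookup_not_eq_zero_eq_in_keys split: if_splits)

lemma pick_add: "pick Q (p + q) = pick Q p + pick Q q"
  by (rule poly_mapping_eqI) (simp add: lookup_add)

lemma pick_diff: "pick Q (p - q) = pick Q p - pick Q q"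
  by (rule poly_mapping_eqI) (simp add: lookup_minus)

lemma pick_zero [simp]: "pick Q 0 = 0"
  by (rule poly_mapping_eqI) simp

lemma pick_sum: "pick Q (sum f A) = (\<Sum>a\<in>A. pick Q (f a))"
  by (induct A rule: infinite_finite_induct) (auto simp: pick_add)

lemma pick_single: "pick Q (Poly_Mapping.single \<alpha> c) = (if Q \<alpha> then Poly_Mapping.single \<alpha> c else 0)"
  by (rule poly_mapping_eqI) (auto simp: lookup_single when_def)

lemma pick_id: "(\<And>\<alpha>. \<alpha> \<in> keys p \<Longrightarrow> Q \<alpha>) \<Longrightarrow> pick Q p = p"
  by (rule poly_mapping_eqI) (auto simp: in_keys_iff)

lemma pick_cst_mult: "pick Q (cst c * p) = cst c * pick Q p"
  by (rule poly_mapping_eqI) simp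

text \<open>Bilinearity reduces this to pairs of monomials. The predicates on the factors may
  differ: if one factor has a known weight, selecting a weight in the product means selecting a
  shifted weight in the other factor.\<close>

lemma pick_mult:
  fixes p q :: "'n mpoly"
  assumes "\<And>\<alpha> \<beta>. \<alpha> \<in> keys p \<Longrightarrow> \<beta> \<in> keys q \<Longrightarrow> Q (\<alpha> + \<beta>) \<longleftrightarrow> Q' \<alpha> \<and> Q'' \<beta>"
  shows "pick Q (p * q) = pick Q' p * pick Q'' q"
proof (rule mpoly_induct_keys[of p])
  fix \<alpha> c assume \<alpha>: "\<alpha> \<in> keys p"
  show "pick Q (Poly_Mapping.single \<alpha> c * q) = pick Q' (Poly_Mapping.single \<alpha> c) * pick Q'' q"
    by (rule mpoly_induct_keys[of q])
       (use assms \<alpha> in \<open>auto simp: mult_single pick_single pick_add distrib_left\<close>)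
qed (auto simp: pick_add distrib_right)

lemma keys_mult_mdeg:
  "\<gamma> \<in> keys (p * q :: 'n mpoly) \<Longrightarrow> \<exists>\<alpha>\<in>keys p. \<exists>\<beta>\<in>keys q. \<gamma> = \<alpha> + \<beta>"
  using keys_mult[of p q] by blast

text \<open>Linear extension of a map given on monomials; normal forms and formal derivatives arise
  from it.\<close>

definition lin :: "(('n \<Rightarrow> nat) \<Rightarrow> 'n mpoly) \<Rightarrow> 'n mpoly \<Rightarrow> 'n mpoly" where
  "lin \<phi> p = (\<Sum>\<alpha>\<in>keys p. cst (lookup p \<alpha>) * \<phi> \<alpha>)"

lemma lin_superset:
  assumes "finite A" "keys p \<subseteq> A"
  shows "lin \<phi> p = (\<Sum>\<alpha>\<in>A. cst (lookup p \<alpha>) * \<phi> \<alpha>)"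
  unfolding lin_def by (rule sum.mono_neutral_left) (use assms in \<open>auto simp: in_keys_iff\<close>)

lemma lin_add: "lin \<phi> (p + q) = lin \<phi> p + lin \<phi> q"
proof -
  let ?A = "keys p \<union> keys q"
  show ?thesis
    using keys_add[of p q]
    by (simp add: lin_superset[of ?A p] lin_superset[of ?A q] lin_superset[of ?A "p + q"] lookup_add
        single_add distrib_right sum.distrib)
qed

lemma lin_zero [simp]: "lin \<phi> 0 = 0"
  by (simp add: lin_def)

lemma lin_single [simp]: "lin \<phi> (Poly_Mapping.single \<alpha> c) = cst c * \<phi> \<alpha>"
proof -
  have "keys (Poly_Mapping.single \<alpha> c) \<subseteq> {\<alpha>}" by simp
  note lin_superset[OF _ this, of \<phi>]
  then show ?thesis
    by (simp only: sum.insert sum.empty finite.intros lookup_single_eq add_0_right empty_iff simp_thms)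
qed

lemma lin_cst_mult: "lin \<phi> (cst c * p) = cst c * lin \<phi> p"
proof -
  have "keys (cst c * p) \<subseteq> keys p" by (auto simp: in_keys_iff)
  note lin_superset[OF finite_keys this, of \<phi>]
  also have "(\<Sum>\<alpha>\<in>keys p. cst (lookup (cst c * p) \<alpha>) * \<phi> \<alpha>) = cst c * lin \<phi> p"
    unfolding lin_def sum_distrib_left lookup_cst_mult
    by (simp only: cst_mult[symmetric] mult.assoc)
  finally show ?thesis .
qed

lemma lin_uminus: "lin \<phi> (- p) = - lin \<phi> p"
  using lin_add[of \<phi> p "- p"] by (simp add: eq_neg_iff_add_eq_0 add.commute)

lemma lin_diff: "lin \<phi> (p - q) = lin \<phi> p - lin \<phi> q"
  using lin_add[of \<phi> p "- q"] by (simp add: lin_uminus)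

lemma lin_sum: "lin \<phi> (sum f A) = (\<Sum>a\<in>A. lin \<phi> (f a))"
  by (induct A rule: infinite_finite_induct) (auto simp: lin_add)

lemma lin_mon_mult: "lin \<phi> (mon \<gamma> * p) = lin (\<lambda>\<beta>. \<phi> (\<gamma> + \<beta>)) p"
  by (rule mpoly_induct[of _ p]) (auto simp: lin_add distrib_left mult_single)

lemma lin_cong: "(\<And>\<alpha>. \<alpha> \<in> keys p \<Longrightarrow> \<phi> \<alpha> = \<psi> \<alpha>) \<Longrightarrow> lin \<phi> p = lin \<psi> p"
  by (auto simp: lin_def intro: sum.cong)

lemma lin_mon: "lin mon p = p"
  by (rule mpoly_induct[of _ p]) (auto simp: lin_add mult_single)

lemma lin_uminus_fun: "lin (\<lambda>\<alpha>. - \<phi> \<alpha>) p = - lin \<phi> p"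
  by (simp add: lin_def sum_negf)

lemma lin_swap: "lin (\<lambda>\<alpha>. lin (\<phi> \<alpha>) q) p = lin (\<lambda>\<beta>. lin (\<lambda>\<alpha>. \<phi> \<alpha> \<beta>) p) q"
  unfolding lin_def sum_distrib_left by (subst sum.swap) (simp add: mult_ac)

lemma lin_in_subspace:
  assumes "mp.subspace U" "\<And>\<alpha>. \<alpha> \<in> keys p \<Longrightarrow> \<phi> \<alpha> \<in> U"
  shows "lin \<phi> p \<in> U"
  unfolding lin_def using assms by (intro mp.subspace_sum mp.subspace_scale) auto

section \<open>Ideals of polynomials and truncation by degree\<close>

definition is_ideal :: "'n mpoly set \<Rightarrow> bool" where
  "is_ideal J \<longleftrightarrow> 0 \<in> J \<and> (\<forall>a\<in>J. \<forall>b\<in>J. a + b \<in> J) \<and> (\<forall>a\<in>J. \<forall>r. r * a \<in> J)"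

lemma is_idealD:
  assumes "is_ideal J"
  shows "0 \<in> J" "a \<in> J \<Longrightarrow> b \<in> J \<Longrightarrow> a + b \<in> J" "a \<in> J \<Longrightarrow> r * a \<in> J" "a \<in> J \<Longrightarrow> a * r \<in> J"
    "a \<in> J \<Longrightarrow> - a \<in> J" "a \<in> J \<Longrightarrow> b \<in> J \<Longrightarrow> a - b \<in> J"
proof -
  show *: "0 \<in> J" "a \<in> J \<Longrightarrow> b \<in> J \<Longrightarrow> a + b \<in> J" "\<And>a r. a \<in> J \<Longrightarrow> r * a \<in> J" for a b
    using assms by (auto simp: is_ideal_def)
  then show "a \<in> J \<Longrightarrow> a * r \<in> J" by (metis mult.commute)
  show **: "\<And>a. a \<in> J \<Longrightarrow> - a \<in> J" using *(3)[of _ "-1"] by simp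
  show "a \<in> J \<Longrightarrow> b \<in> J \<Longrightarrow> a - b \<in> J" using *(2)[of a "- b"] ** by simp
qed

lemma is_ideal_sum: "is_ideal J \<Longrightarrow> (\<And>a. a \<in> A \<Longrightarrow> f a \<in> J) \<Longrightarrow> sum f A \<in> J"
  by (induct A rule: infinite_finite_induct) (auto intro: is_idealD)

lemma is_ideal_subspace: "is_ideal J \<Longrightarrow> mp.subspace J"
  by (auto simp: mp.subspace_def is_ideal_def)

text \<open>The N-th power of the maximal ideal of the origin.\<close>

definition mpw :: "nat \<Rightarrow> 'n::finite mpoly set" where
  "mpw N = {p. \<forall>\<alpha>\<in>keys p. N \<le> mdeg \<alpha>}"

lemma is_ideal_mpw: "is_ideal (mpw N)"
  unfolding is_ideal_def mpw_def
proof (intro conjI ballI allI, goal_cases)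
  case (2 a b) then show ?case using keys_add[of a b] by fastforce
next
  case (3 a r) then show ?case
    by (auto dest!: keys_mult_mdeg simp: trans_le_add2)
qed auto

lemma mpw_iff: "p \<in> mpw N \<longleftrightarrow> (\<forall>\<alpha>. mdeg \<alpha> < N \<longrightarrow> lookup p \<alpha> = 0)"
  by (auto simp: mpw_def in_keys_iff not_less[symmetric])

lemma mpw_mult: "a \<in> mpw M \<Longrightarrow> b \<in> mpw N \<Longrightarrow> a * b \<in> mpw (M + N)"
  by (auto simp: mpw_def dest!: keys_mult_mdeg simp: add_mono)

lemma mpw_mono: "M \<le> N \<Longrightarrow> mpw N \<subseteq> mpw M"
  by (auto simp: mpw_def)

text \<open>The ideal generated by the \<open>F j\<close> together with the N-th power of the
  maximal ideal. Because of the second summand a polynomial with nonzero constant term is a unit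
  modulo this ideal, as in the local ring, although only polynomials occur.\<close>

definition gen_ideal :: "('n::finite \<Rightarrow> 'n mpoly) \<Rightarrow> 'n set \<Rightarrow> nat \<Rightarrow> 'n mpoly set" where
  "gen_ideal F S N = {p. \<exists>b. p - (\<Sum>j\<in>S. b j * F j) \<in> mpw N}"

lemma is_ideal_gen_ideal: "is_ideal (gen_ideal F S N)"
  unfolding is_ideal_def gen_ideal_def
proof (safe, goal_cases)
  case 1 show ?case by (rule exI[of _ "\<lambda>_. 0"]) (simp add: is_idealD(1)[OF is_ideal_mpw])
next
  case (2 a b f g)
  from is_idealD(2)[OF is_ideal_mpw 2] show ?case
    by (intro exI[of _ "\<lambda>j. f j + g j"]) (simp add: algebra_simps sum.distrib)
next
  case (3 a f r)
  from is_idealD(3)[OF is_ideal_mpw 3, of r] show ?case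
    by (intro exI[of _ "\<lambda>j. r * f j"]) (simp add: algebra_simps sum_distrib_left)
qed

lemma gen_in_gen_ideal: "j \<in> S \<Longrightarrow> F j \<in> gen_ideal F S N"
  unfolding gen_ideal_def
  by (rule CollectI, rule exI[of _ "\<lambda>i. if i = j then 1 else 0"])
     (simp add: if_distrib[where f = "\<lambda>x. x * _"] is_idealD(1)[OF is_ideal_mpw] cong: if_cong)

lemma mpw_subset_gen_ideal: "mpw N \<subseteq> gen_ideal F S N"
  unfolding gen_ideal_def by (auto intro!: exI[of _ "\<lambda>_. 0"])

lemma gen_ideal_subset:
  assumes "is_ideal J" "\<And>j. j \<in> S \<Longrightarrow> F j \<in> J" "mpw N \<subseteq> J"
  shows "gen_ideal F S N \<subseteq> J"
proof
  fix p assume "p \<in> gen_ideal F S N"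
  then obtain b where "p - (\<Sum>j\<in>S. b j * F j) \<in> J" using assms(3) by (auto simp: gen_ideal_def)
  moreover have "(\<Sum>j\<in>S. b j * F j) \<in> J" using assms(1,2) by (intro is_ideal_sum is_idealD(3))
  ultimately show "p \<in> J" using is_idealD(2)[OF assms(1)] by force
qed

definition supp_in :: "'n set \<Rightarrow> ('n \<Rightarrow> nat) \<Rightarrow> bool" where
  "supp_in V \<alpha> \<longleftrightarrow> (\<forall>i. i \<notin> V \<longrightarrow> \<alpha> i = 0)"

lemma supp_in_add [simp]: "supp_in V (\<alpha> + \<beta>) \<longleftrightarrow> supp_in V \<alpha> \<and> supp_in V \<beta>"
  by (auto simp: supp_in_def plus_fun_apply)

lemma supp_in_expo [simp]: "supp_in V (expo j d) \<longleftrightarrow> j \<in> V \<or> d = 0"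
  by (auto simp: supp_in_def expo_def)

lemma supp_in_zero [simp]: "supp_in V 0"
  by (auto simp: supp_in_def zero_fun_apply)

definition pvars :: "'n set \<Rightarrow> 'n mpoly set" where
  "pvars S = {p. \<forall>\<alpha>\<in>keys p. supp_in S \<alpha>}"

lemma subspace_keys: "mp.subspace {p. \<forall>\<alpha>\<in>keys p. Q \<alpha>}"
  unfolding mp.subspace_def
proof (intro conjI ballI allI, goal_cases)
  case (2 a b) then show ?case using keys_add[of a b] by blast
qed (auto simp: in_keys_iff)

lemma pvars_mult: "p \<in> pvars S \<Longrightarrow> q \<in> pvars S \<Longrightarrow> p * q \<in> pvars S"
  by (auto simp: pvars_def dest!: keys_mult_mdeg)

section \<open>Normal forms under monomial rewriting\<close>

text \<open>The rules are x_j^(d j) -> - F_j for j in \<open>T\<close>, and monomials in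
  \<open>Z\<close> count as zero; \<open>\<nu>\<close> decreases with every step. There are two
  uses: \<open>Z\<close> empty with degrees going down (the deformed generators), and
  \<open>Z\<close> the monomials of degree at least N with degrees going up (elimination of
  variables).\<close>

locale rewriting =
  fixes T :: "'n set" and d :: "'n \<Rightarrow> nat" and F :: "'n \<Rightarrow> 'n mpoly"
    and Z :: "('n \<Rightarrow> nat) \<Rightarrow> bool" and \<nu> :: "('n \<Rightarrow> nat) \<Rightarrow> nat"
  assumes Z_tail: "\<And>j \<gamma> \<beta>. j \<in> T \<Longrightarrow> Z (\<gamma> + expo j (d j)) \<Longrightarrow> \<beta> \<in> keys (F j) \<Longrightarrow> Z (\<gamma> + \<beta>)"
    and decr: "\<And>j \<gamma> \<beta>. j \<in> T \<Longrightarrow> \<not> Z (\<gamma> + expo j (d j)) \<Longrightarrow> \<beta> \<in> keys (F j) \<Longrightarrow> \<not> Z (\<gamma> + \<beta>)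
      \<Longrightarrow> \<nu> (\<gamma> + \<beta>) < \<nu> (\<gamma> + expo j (d j))"
begin

definition red :: "('n \<Rightarrow> nat) \<Rightarrow> bool" where
  "red \<alpha> \<longleftrightarrow> \<not> Z \<alpha> \<and> (\<forall>j\<in>T. \<alpha> j < d j)"

text \<open>An arbitrary applicable rule; by \<open>nf_rule\<close> the choice does not influence
  the normal form.\<close>

definition pivot :: "('n \<Rightarrow> nat) \<Rightarrow> 'n \<times> ('n \<Rightarrow> nat)" where
  "pivot \<alpha> = (SOME (j, \<gamma>). j \<in> T \<and> \<alpha> = \<gamma> + expo j (d j))"

lemma pivot:
  assumes "\<not> red \<alpha>" "\<not> Z \<alpha>"
  obtains j \<gamma> where "pivot \<alpha> = (j, \<gamma>)" "j \<in> T" "\<alpha> = \<gamma> + expo j (d j)"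
proof -
  from assms obtain j where "j \<in> T" "d j \<le> \<alpha> j" by (auto simp: red_def not_less)
  then have "\<exists>x. case x of (j, \<gamma>) \<Rightarrow> j \<in> T \<and> \<alpha> = \<gamma> + expo j (d j)"
    using mindex_split[of "d j" \<alpha> j] by auto
  from someI_ex[OF this] show ?thesis
    using that unfolding pivot_def[symmetric] by (cases "pivot \<alpha>") auto
qed

text \<open>The first argument is fuel. By \<open>nfk_indep\<close> any amount above
  \<open>\<nu> \<alpha>\<close> gives the same result, so \<open>nf\<close> satisfies the intended
  recursion.\<close>

primrec nfk :: "nat \<Rightarrow> ('n \<Rightarrow> nat) \<Rightarrow> 'n mpoly" where
  "nfk 0 \<alpha> = 0"
| "nfk (Suc k) \<alpha> = (if Z \<alpha> then 0 else if red \<alpha> then mon \<alpha>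
     else case pivot \<alpha> of (j, \<gamma>) \<Rightarrow> - lin (\<lambda>\<beta>. nfk k (\<gamma> + \<beta>)) (F j))"

definition nf :: "('n \<Rightarrow> nat) \<Rightarrow> 'n mpoly" where
  "nf \<alpha> = nfk (Suc (\<nu> \<alpha>)) \<alpha>"

lemma nfk_Z: "Z \<alpha> \<Longrightarrow> nfk k \<alpha> = 0"
  by (cases k) auto

lemma nfk_indep: "\<nu> \<alpha> < k \<Longrightarrow> \<nu> \<alpha> < k' \<Longrightarrow> nfk k \<alpha> = nfk k' \<alpha>"
proof (induct k arbitrary: \<alpha> k')
  case (Suc k)
  from Suc.prems obtain k'' where k': "k' = Suc k''" by (cases k') auto
  show ?case
  proof (cases "Z \<alpha> \<or> red \<alpha>")
    case False
    then obtain j \<gamma> where j: "pivot \<alpha> = (j, \<gamma>)" "j \<in> T" "\<alpha> = \<gamma> + expo j (d j)"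
      using pivot by blast
    have "nfk k (\<gamma> + \<beta>) = nfk k'' (\<gamma> + \<beta>)" if "\<beta> \<in> keys (F j)" for \<beta>
    proof (cases "Z (\<gamma> + \<beta>)")
      case nZ: False
      from decr[OF j(2) _ that nZ] False j(3) have "\<nu> (\<gamma> + \<beta>) < \<nu> \<alpha>" by auto
      with Suc.prems k' show ?thesis by (intro Suc.hyps) auto
    qed (simp add: nfk_Z)
    with False show ?thesis by (auto simp: j(1) k' intro!: lin_cong)
  qed (auto simp: k')
qed simp

lemma nf_Z: "Z \<alpha> \<Longrightarrow> nf \<alpha> = 0"
  by (simp add: nf_def)

lemma nf_red: "red \<alpha> \<Longrightarrow> nf \<alpha> = mon \<alpha>"
  by (simp add: nf_def red_def)

lemma nf_pivot:
  assumes "\<not> red \<alpha>" "\<not> Z \<alpha>" "pivot \<alpha> = (j, \<gamma>)"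
  shows "nf \<alpha> = - lin (\<lambda>\<beta>. nf (\<gamma> + \<beta>)) (F j)"
proof -
  obtain j' \<gamma>' where "pivot \<alpha> = (j', \<gamma>')" "j' \<in> T" "\<alpha> = \<gamma>' + expo j' (d j')"
    using pivot[OF assms(1,2)] .
  moreover from this(1) have "j' = j" "\<gamma>' = \<gamma>" using assms(3) by simp_all
  ultimately have j: "j \<in> T" "\<alpha> = \<gamma> + expo j (d j)" by (simp_all only:)
  have "nfk (\<nu> \<alpha>) (\<gamma> + \<beta>) = nf (\<gamma> + \<beta>)" if "\<beta> \<in> keys (F j)" for \<beta>
  proof (cases "Z (\<gamma> + \<beta>)")
    case nZ: False
    from decr[OF j(1) _ that nZ] assms(2) j(2) have "\<nu> (\<gamma> + \<beta>) < \<nu> \<alpha>" by auto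
    then show ?thesis unfolding nf_def by (intro nfk_indep) auto
  qed (simp add: nfk_Z nf_Z)
  then show ?thesis
    unfolding nf_def[of \<alpha>] using assms by (auto intro!: lin_cong)
qed

text \<open>Leading monomials of different rules are coprime, so the two ways of reducing a monomial
  divisible by both of them agree after one further reduction.\<close>

lemma nf_rule: "j \<in> T \<Longrightarrow> nf (\<gamma> + expo j (d j)) = - lin (\<lambda>\<beta>. nf (\<gamma> + \<beta>)) (F j)"
proof (induct "\<nu> (\<gamma> + expo j (d j))" arbitrary: j \<gamma> rule: less_induct)
  case less
  let ?\<alpha> = "\<gamma> + expo j (d j)"
  show ?case
  proof (cases "Z ?\<alpha>")
    case True
    then have "lin (\<lambda>\<beta>. nf (\<gamma> + \<beta>)) (F j) = lin (\<lambda>_. 0) (F j)"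
      by (intro lin_cong nf_Z) (rule Z_tail[OF less.prems])
    with True show ?thesis by (simp add: nf_Z lin_def)
  next
    case nZ: False
    have nr: "\<not> red ?\<alpha>" using less.prems unfolding red_def by (metis expo_simps(1) not_add_less2 plus_fun_apply)
    then obtain k \<delta> where k: "pivot ?\<alpha> = (k, \<delta>)" "k \<in> T" "?\<alpha> = \<delta> + expo k (d k)"
      using pivot nZ by blast
    note eq = nf_pivot[OF nr nZ k(1)]
    show ?thesis
    proof (cases "k = j")
      case True
      then have "\<delta> = \<gamma>" using k(3) by simp
      then show ?thesis unfolding eq using True by simp
    next
      case False
      have "d j \<le> \<delta> j" using False fun_cong[OF k(3), of j] by (simp add: plus_fun_apply)
      from mindex_split[of "d j" \<delta> j, OF this] obtain \<epsilon> where \<epsilon>: "\<delta> = \<epsilon> + expo j (d j)" ..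
      have "\<gamma> + expo j (d j) = (\<epsilon> + expo k (d k)) + expo j (d j)"
        using k(3) unfolding \<epsilon> by (simp only: ac_simps)
      then have \<gamma>: "\<gamma> = \<epsilon> + expo k (d k)"
        by (rule add_right_imp_eq)
      \<comment> \<open>After one of the two competing rules has been used, the monomial is zero or
        smaller in \<open>\<nu>\<close>, so by induction the other rule may be used on it. This
        serves both orders of reduction, whence the general indices \<open>i\<close> and
        \<open>j'\<close>.\<close>
      have IH: "nf (\<epsilon> + \<beta> + expo j' (d j')) = - lin (\<lambda>\<beta>'. nf (\<epsilon> + \<beta> + \<beta>')) (F j')"
        if \<beta>: "\<beta> \<in> keys (F i)" and ij: "i \<in> T" "j' \<in> T"
          and sum: "?\<alpha> = \<epsilon> + expo j' (d j') + expo i (d i)" for i j' \<beta>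
      proof (cases "Z (\<epsilon> + \<beta> + expo j' (d j'))")
        case True
        then have "lin (\<lambda>\<beta>'. nf (\<epsilon> + \<beta> + \<beta>')) (F j') = lin (\<lambda>_. 0) (F j')"
          using Z_tail[OF ij(2), of "\<epsilon> + \<beta>"] by (intro lin_cong nf_Z) auto
        with True show ?thesis by (simp add: nf_Z lin_def)
      next
        case nZ': False
        have "\<nu> (\<epsilon> + expo j' (d j') + \<beta>) < \<nu> ?\<alpha>"
          unfolding sum
        proof (rule decr[OF ij(1) _ \<beta>])
          show "\<not> Z (\<epsilon> + expo j' (d j') + expo i (d i))" using nZ unfolding sum .
          show "\<not> Z (\<epsilon> + expo j' (d j') + \<beta>)" using nZ' by (simp add: ac_simps)
        qed
        then show ?thesis by (intro less.hyps ij) (simp add: ac_simps)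
      qed
      have "nf ?\<alpha> = - lin (\<lambda>\<beta>. nf (\<epsilon> + \<beta> + expo j (d j))) (F k)"
        unfolding eq \<epsilon> by (simp add: ac_simps)
      also have "\<dots> = lin (\<lambda>\<beta>. lin (\<lambda>\<beta>'. nf (\<epsilon> + \<beta> + \<beta>')) (F j)) (F k)"
        unfolding lin_uminus_fun[symmetric]
        by (intro lin_cong, subst IH[of _ k j]) (use k less.prems \<epsilon> in \<open>auto simp: lin_uminus_fun\<close>)
      also have "\<dots> = lin (\<lambda>\<beta>'. lin (\<lambda>\<beta>. nf (\<epsilon> + \<beta>' + \<beta>)) (F k)) (F j)"
        by (subst lin_swap) (simp add: ac_simps)
      also have "\<dots> = - lin (\<lambda>\<beta>'. nf (\<epsilon> + \<beta>' + expo k (d k))) (F j)"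
        unfolding lin_uminus_fun[symmetric]
        by (intro lin_cong, subst IH[of _ j k]) (use k less.prems \<gamma> in \<open>auto simp: lin_uminus_fun\<close>)
      also have "\<dots> = - lin (\<lambda>\<beta>. nf (\<gamma> + \<beta>)) (F j)"
        unfolding \<gamma> by (simp add: ac_simps)
      finally show ?thesis .
    qed
  qed
qed

lemma lin_nf_gen: "j \<in> T \<Longrightarrow> lin nf (p * (mon (expo j (d j)) + F j)) = 0"
proof (rule mpoly_induct[of _ p], goal_cases)
  case (1 \<alpha> c)
  have "lin nf (mon \<alpha> * (mon (expo j (d j)) + F j)) = 0"
    using nf_rule[OF 1, of \<alpha>] unfolding lin_mon_mult by (simp add: lin_add)
  then show ?case
    unfolding single_as_mult[of \<alpha> c] mult.assoc lin_cst_mult by simp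
qed (simp add: lin_add distrib_right)

text \<open>\<open>Q\<close> relates a monomial to the terms of its normal form. It passes backwards
  along each rewriting step, and so holds for all terms by induction on \<open>\<nu>\<close>; it is
  used for weights and for the variables that occur.\<close>

lemma nf_keys:
  assumes "\<And>\<alpha>. Q \<alpha> \<alpha>" "\<And>j \<gamma> \<beta> \<delta>. j \<in> T \<Longrightarrow> \<beta> \<in> keys (F j) \<Longrightarrow> Q (\<gamma> + \<beta>) \<delta> \<Longrightarrow> Q (\<gamma> + expo j (d j)) \<delta>"
    and "\<delta> \<in> keys (nf \<alpha>)"
  shows "red \<delta> \<and> Q \<alpha> \<delta>"
proof -
  have "nf \<alpha> \<in> {p. \<forall>\<delta>\<in>keys p. red \<delta> \<and> Q \<alpha> \<delta>}"
  proof (induct "\<nu> \<alpha>" arbitrary: \<alpha> rule: less_induct)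
    case less
    consider "Z \<alpha>" | "red \<alpha>" | "\<not> Z \<alpha>" "\<not> red \<alpha>" by blast
    then show ?case
    proof cases
      case 3
      then obtain j \<gamma> where j: "pivot \<alpha> = (j, \<gamma>)" "j \<in> T" "\<alpha> = \<gamma> + expo j (d j)"
        using pivot by blast
      have "lin (\<lambda>\<beta>. nf (\<gamma> + \<beta>)) (F j) \<in> {p. \<forall>\<delta>\<in>keys p. red \<delta> \<and> Q \<alpha> \<delta>}"
      proof (rule lin_in_subspace[OF subspace_keys])
        fix \<beta> assume \<beta>: "\<beta> \<in> keys (F j)"
        show "nf (\<gamma> + \<beta>) \<in> {p. \<forall>\<delta>\<in>keys p. red \<delta> \<and> Q \<alpha> \<delta>}"
        proof (cases "Z (\<gamma> + \<beta>)")
          case nZ: False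
          from decr[OF j(2) _ \<beta> nZ] 3 j(3) have "\<nu> (\<gamma> + \<beta>) < \<nu> \<alpha>" by auto
          from less[OF this] assms(2)[OF j(2) \<beta>] j(3) show ?thesis by blast
        qed (simp add: nf_Z)
      qed
      then show ?thesis unfolding nf_pivot[OF 3(2,1) j(1)] by (simp add: in_keys_iff)
    qed (use assms(1) in \<open>auto simp: nf_Z nf_red split: if_splits\<close>)
  qed
  with assms(3) show ?thesis by auto
qed

lemma lin_nf_red: "(\<And>\<alpha>. \<alpha> \<in> keys p \<Longrightarrow> red \<alpha>) \<Longrightarrow> lin nf p = p"
  using lin_cong[of p nf mon] by (simp add: nf_red lin_mon)

lemma lin_nf_Z: "(\<And>\<alpha>. \<alpha> \<in> keys p \<Longrightarrow> Z \<alpha>) \<Longrightarrow> lin nf p = 0"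
  using lin_cong[of p nf "\<lambda>_. 0"] by (simp add: nf_Z lin_def)

text \<open>Each rewriting step subtracts a multiple of a generator. Together with
  \<open>lin_nf_gen\<close> this shows that the kernel of the normal form is no larger than the
  ideal.\<close>

lemma diff_lin_nf_ideal:
  assumes J: "is_ideal J" and "\<And>j. j \<in> T \<Longrightarrow> mon (expo j (d j)) + F j \<in> J" "\<And>\<alpha>. Z \<alpha> \<Longrightarrow> mon \<alpha> \<in> J"
  shows "p - lin nf p \<in> J"
proof -
  note JD = is_idealD[OF J]
  have mon: "mon \<alpha> - nf \<alpha> \<in> J" for \<alpha>
  proof (induct "\<nu> \<alpha>" arbitrary: \<alpha> rule: less_induct)
    case less
    consider "Z \<alpha>" | "red \<alpha>" | "\<not> Z \<alpha>" "\<not> red \<alpha>" by blast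
    then show ?case
    proof cases
      case 3
      then obtain j \<gamma> where j: "pivot \<alpha> = (j, \<gamma>)" "j \<in> T" "\<alpha> = \<gamma> + expo j (d j)"
        using pivot by blast
      have "lin (\<lambda>\<beta>. mon (\<gamma> + \<beta>) - nf (\<gamma> + \<beta>)) (F j) \<in> J"
      proof (rule lin_in_subspace[OF is_ideal_subspace[OF J]])
        fix \<beta> assume \<beta>: "\<beta> \<in> keys (F j)"
        show "mon (\<gamma> + \<beta>) - nf (\<gamma> + \<beta>) \<in> J"
        proof (cases "Z (\<gamma> + \<beta>)")
          case nZ: False
          from decr[OF j(2) _ \<beta> nZ] 3 j(3) have "\<nu> (\<gamma> + \<beta>) < \<nu> \<alpha>" by auto
          from less[OF this] show ?thesis .
        qed (use assms in \<open>simp add: nf_Z\<close>)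
      qed
      also have "lin (\<lambda>\<beta>. mon (\<gamma> + \<beta>) - nf (\<gamma> + \<beta>)) (F j) = mon \<gamma> * F j + nf \<alpha>"
      proof -
        have "mon \<gamma> * F j = lin (\<lambda>\<beta>. mon (\<gamma> + \<beta>)) (F j)"
          using lin_mon_mult[of mon \<gamma> "F j"] by (simp add: lin_mon)
        then show ?thesis unfolding nf_pivot[OF 3(2,1) j(1)]
          by (simp add: lin_def algebra_simps sum_subtractf)
      qed
      finally have "mon \<gamma> * F j + nf \<alpha> \<in> J" .
      from JD(6)[OF JD(3)[OF assms(2)[OF j(2)], of "mon \<gamma>"] this]
      show ?thesis unfolding distrib_left mon_mult j(3)[symmetric] by simp
    qed (use assms JD in \<open>auto simp: nf_Z nf_red\<close>)
  qed
  have "p - lin nf p = lin (\<lambda>\<alpha>. mon \<alpha> - nf \<alpha>) p"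
    using lin_mon[of p] by (simp add: lin_def right_diff_distrib sum_subtractf)
  then show ?thesis
    using lin_in_subspace[OF is_ideal_subspace[OF J], of p] mon by simp
qed

end

section \<open>Dimensions of graded kernels\<close>

context vector_space
begin

lemma finite_basis_of_subspace:
  assumes "E \<subseteq> span S" "finite S"
  obtains B where "finite B" "B \<subseteq> E" "independent B" "E \<subseteq> span B" "card B = dim E"
proof -
  obtain B where B: "B \<subseteq> E" "independent B" "E \<subseteq> span B" "card B = dim E"
    by (rule basis_exists)
  then have "finite B"
    using independent_span_bound[OF assms(2) B(2)] assms(1) by auto
  with B that show ?thesis by blast
qed

lemma rank_nullity_on:
  assumes E: "subspace E" "E \<subseteq> span S" "finite S"
    and T: "\<And>x y. T (x + y) = T x + T y" "\<And>c x. T (scale c x) = scale c (T x)"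
  shows "dim E = dim {x\<in>E. T x = 0} + dim (T ` E)"
proof -
  let ?K = "{x\<in>E. T x = 0}"
  have T0: "T 0 = 0" using T(2)[of 0 0] by simp
  have Tsum: "T (\<Sum>v\<in>A. scale (u v) v) = (\<Sum>v\<in>A. scale (u v) (T v))" for A u
    by (induct A rule: infinite_finite_induct) (auto simp: T T0)
  obtain BK where BK: "BK \<subseteq> ?K" "independent BK" "?K \<subseteq> span BK" "card BK = dim ?K"
    by (rule basis_exists)
  have "BK \<subseteq> E" using BK(1) by auto
  then obtain B where B: "BK \<subseteq> B" "B \<subseteq> E" "independent B" "E \<subseteq> span B"
    using maximal_independent_subset_extend[OF _ BK(2)] by blast
  have finB: "finite B"
    using independent_span_bound[OF E(3) B(3)] B(2) E(2) by auto
  have dimE: "dim E = card B"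
    using basis_card_eq_dim[OF B(2,4,3)] by simp
  define C where "C = B - BK"
  have finC: "finite C" "finite BK" using finB B(1) by (auto simp: C_def finite_subset)
  have zero: "u v = 0" if "(\<Sum>v\<in>C. scale (u v) (T v)) = 0" "v \<in> C" for u v
  proof -
    let ?w = "\<Sum>v\<in>C. scale (u v) v"
    have "?w \<in> E" using B(2) by (intro subspace_sum[OF E(1)] subspace_scale[OF E(1)]) (auto simp: C_def)
    then have "?w \<in> ?K" using that(1) by (simp add: Tsum)
    then have "?w \<in> span BK" using BK(3) by blast
    then obtain g where g: "?w = (\<Sum>b\<in>BK. scale (g b) b)"
      unfolding span_finite[OF finC(2)] by blast
    define h where "h b = (if b \<in> BK then g b else - u b)" for b
    have "(\<Sum>b\<in>B. scale (h b) b) = (\<Sum>b\<in>BK. scale (h b) b) + (\<Sum>b\<in>C. scale (h b) b)"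
      unfolding C_def sum.subset_diff[OF B(1) finB] by (rule add.commute)
    also have "\<dots> = ?w + (\<Sum>b\<in>C. scale (- u b) b)"
      unfolding g by (intro arg_cong2[where f = plus] sum.cong) (auto simp: h_def C_def)
    also have "\<dots> = 0" by (simp add: sum_negf)
    finally have "h v = 0"
      using independentD[OF B(3) finB order_refl] that(2) by (auto simp: C_def)
    then show "u v = 0" using that(2) by (simp add: h_def C_def)
  qed
  have inj: "inj_on T C"
  proof (rule inj_onI, rule ccontr)
    fix x y assume xy: "x \<in> C" "y \<in> C" "T x = T y" "x \<noteq> y"
    let ?u = "\<lambda>v. if v = x then 1 else if v = y then -1 else 0"
    have "(\<Sum>v\<in>C. scale (?u v) (T v)) = (\<Sum>v\<in>{x, y}. scale (?u v) (T v))"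
      by (rule sum.mono_neutral_right) (use finC xy in auto)
    also have "\<dots> = 0" using xy by simp
    finally have "(\<Sum>v\<in>C. scale (?u v) (T v)) = 0" .
    from zero[of ?u x, OF this xy(1)] show False by simp
  qed
  have "independent (T ` C)"
  proof (rule independent_if_scalars_zero)
    fix f x assume "(\<Sum>x\<in>T ` C. scale (f x) x) = 0" "x \<in> T ` C"
    then show "f x = 0" using zero[of "\<lambda>v. f (T v)"] by (auto simp: sum.reindex[OF inj])
  qed (use finC in auto)
  moreover have "T ` C \<subseteq> T ` E" using B(2) by (auto simp: C_def)
  moreover have "T ` E \<subseteq> span (T ` C)"
  proof
    fix y assume "y \<in> T ` E"
    then obtain x where x: "x \<in> E" "y = T x" by auto
    then obtain u where "x = (\<Sum>b\<in>B. scale (u b) b)"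
      using B(4) unfolding span_finite[OF finB] by blast
    then have "y = (\<Sum>b\<in>B. scale (u b) (T b))" by (simp add: x Tsum)
    also have "\<dots> = (\<Sum>b\<in>C. scale (u b) (T b))"
      by (rule sum.mono_neutral_right) (use finB BK(1) in \<open>auto simp: C_def\<close>)
    also have "\<dots> \<in> span (T ` C)" by (intro span_sum span_scale span_base) auto
    finally show "y \<in> span (T ` C)" .
  qed
  ultimately have "dim (T ` E) = card (T ` C)" using basis_card_eq_dim by metis
  also have "\<dots> = card C" by (rule card_image[OF inj])
  finally show ?thesis
    using dimE BK(4) card_Diff_subset[OF finC(2) B(1)] card_mono[OF finB B(1)] by (simp add: C_def)
qed

lemma dim_mono_finite:
  assumes "A \<subseteq> E" "E \<subseteq> span S" "finite S"
  shows "dim A \<le> dim E"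
proof -
  obtain B where B: "finite B" "B \<subseteq> E" "independent B" "E \<subseteq> span B" "card B = dim E"
    by (rule finite_basis_of_subspace[OF assms(2,3)])
  from dim_le_card[of A B] B assms(1) show ?thesis by auto
qed

end

section \<open>Functions of residues modulo m\<close>

lemma int_residue_generator:
  fixes w m :: int
  assumes "coprime w m" "m > 0"
  obtains t :: nat where "m dvd (c + int t * w - c')"
proof -
  obtain v where "cong (w * v) 1 m" using cong_solve_coprime_int[OF assms(1)] by blast
  then have v: "m dvd (w * v - 1)" by (simp add: cong_iff_dvd_diff)
  define t where "t = nat (((c' - c) * v) mod m)"
  have t: "int t = ((c' - c) * v) mod m" using assms(2) by (simp add: t_def)
  have "m dvd (int t - (c' - c) * v)" unfolding t by (metis mod_eq_dvd_iff mod_mod_trivial)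
  then have "m dvd (int t - (c' - c) * v) * w + (c' - c) * (w * v - 1)"
    using v by (intro dvd_add) (auto intro: dvd_mult dvd_mult2)
  also have "(int t - (c' - c) * v) * w + (c' - c) * (w * v - 1) = c + int t * w - c'"
    by (simp add: algebra_simps)
  finally show ?thesis using that by blast
qed

lemma periodic_dvd:
  fixes r :: "int \<Rightarrow> 'a"
  assumes "\<And>c. r (c + m) = r c" "m dvd (c - c')"
  shows "r c = r c'"
proof -
  have nat: "r (c + int k * m) = r c" for k c
  proof (induct k)
    case (Suc k)
    have "r (c + int (Suc k) * m) = r ((c + int k * m) + m)" by (simp add: algebra_simps)
    with Suc show ?case using assms(1) by metis
  qed simp
  from assms(2) obtain k where k: "c - c' = m * k" by blast
  show ?thesis
  proof (cases "k \<ge> 0")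
    case True
    then obtain n where "k = int n" by (rule nonneg_int_cases)
    then have "c = c' + int n * m" using k by (simp add: algebra_simps)
    then show ?thesis by (simp only: nat)
  next
    case False
    then have "k \<le> 0" by simp
    then obtain n where "k = - int n" by (rule nonpos_int_cases)
    then have "c' = c + int n * m" using k by (simp add: algebra_simps)
    then show ?thesis by (simp only: nat)
  qed
qed

text \<open>Repeated steps by \<open>w\<close> reach every residue, since \<open>w\<close> is a unit
  modulo \<open>m\<close>. So any two values bound each other.\<close>

lemma cyclic_mono_const:
  fixes r :: "int \<Rightarrow> 'a :: order"
  assumes "coprime w m" "m > 0" "\<And>c. r (c + m) = r c" "\<And>c. r c \<le> r (c + w)"
  shows "r c = r c'"
proof -
  have step: "r c \<le> r (c + int t * w)" for t c
  proof (induct t)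
    case (Suc t)
    have "r (c + int t * w) \<le> r (c + int t * w + w)" by (rule assms(4))
    with Suc show ?case by (simp add: algebra_simps)
  qed simp
  have "r c \<le> r c'" for c c'
  proof -
    obtain t where "m dvd (c + int t * w - c')" by (rule int_residue_generator[OF assms(1,2)])
    then have "r (c + int t * w) = r c'" by (rule periodic_dvd[rotated]) (rule assms(3))
    with step[of c t] show ?thesis by simp
  qed
  then show ?thesis by (intro order_antisym)
qed

lemma nat_seq_stabilises:
  fixes r :: "nat \<Rightarrow> nat"
  assumes "\<And>n. r (Suc n) \<le> r n"
  obtains K where "\<And>n. n \<ge> K \<Longrightarrow> r n = r K"
proof -
  obtain K where K: "\<And>n. r K \<le> r n" using ex_has_least_nat[of "\<lambda>_. True" 0 r] by auto
  have "r n = r K" if "n \<ge> K" for n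
    using K[of n] lift_Suc_antimono_le[of r K n] assms that by (simp add: le_antisym)
  then show ?thesis using that by blast
qed

text \<open>On the stable image of \<open>X\<close> multiplication by \<open>X\<close> permutes the weight spaces cyclically, so
  these all have the same dimension.\<close>

lemma graded_kernel_dim:
  fixes E :: "int \<Rightarrow> 'n mpoly set" and m w :: int
  assumes m: "m > 0" and w: "coprime w m"
    and per: "\<And>c. E (c + m) = E c"
    and sub: "\<And>c. mp.subspace (E c)" and fin: "\<And>c. E c \<subseteq> mp.span S" "finite S"
    and X: "\<And>x y. X (x + y) = X x + X y" "\<And>c x. X (cst c * x) = cst c * X x"
    and XE: "\<And>c. X ` E c \<subseteq> E (c + w)"
  obtains K where "\<And>K'. K' \<ge> K \<Longrightarrow> \<exists>k. \<forall>c. mp.dim (E c) = k + mp.dim {x\<in>E c. (X ^^ K') x = 0}"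
proof -
  have Xk: "(X ^^ k) (x + y) = (X ^^ k) x + (X ^^ k) y" "(X ^^ k) (cst c * x) = cst c * (X ^^ k) x" for k x y c
    by (induct k) (auto simp: X)
  have XkE: "(X ^^ k) ` E c \<subseteq> E (c + int k * w)" for k c
  proof (induct k)
    case (Suc k)
    have "(X ^^ Suc k) ` E c \<subseteq> E (c + int k * w + w)" using XE[of "c + int k * w"] Suc by auto
    then show ?case by (simp add: algebra_simps)
  qed simp
  have subk: "mp.subspace ((X ^^ k) ` E c)" for k c
    unfolding mp.subspace_def
  proof (intro conjI ballI allI)
    have "(X ^^ k) 0 = 0" using Xk(2)[of k 0 0] by simp
    then show "0 \<in> (X ^^ k) ` E c" using mp.subspace_0[OF sub[of c]] by force
  next
    fix a b assume "a \<in> (X ^^ k) ` E c" "b \<in> (X ^^ k) ` E c"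
    then show "a + b \<in> (X ^^ k) ` E c"
      using mp.subspace_add[OF sub[of c]] Xk(1)[of k] by (smt (verit) imageE imageI)
  next
    fix a d assume "a \<in> (X ^^ k) ` E c"
    then show "cst d * a \<in> (X ^^ k) ` E c"
      using mp.subspace_scale[OF sub[of c]] Xk(2)[of k] by (smt (verit) imageE imageI)
  qed
  define r where "r k c = mp.dim ((X ^^ k) ` E c)" for k c
  have rper: "r k (c + m) = r k c" for k c by (simp add: r_def per)
  have dec: "r (Suc k) c \<le> r k c" for k c
  proof -
    have "(X ^^ Suc k) ` E c = X ` (X ^^ k) ` E c" by (simp add: image_comp)
    then show ?thesis
      using mp.rank_nullity_on[OF subk[of k c] order_trans[OF XkE fin(1)] fin(2) X] by (simp add: r_def)
  qed
  have "\<exists>K. \<forall>n\<ge>K. r n c = r K c" for c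
    using nat_seq_stabilises[of "\<lambda>k. r k c"] dec by metis
  then obtain K where K: "\<And>c n. n \<ge> K c \<Longrightarrow> r n c = r (K c) c" by metis
  \<comment> \<open>By periodicity only the residues 0, ..., m - 1 matter, so one bound serves all
    weights.\<close>
  define K0 where "K0 = Max (K ` {0..<m})"
  have stab: "r n c = r K0 c" if "n \<ge> K0" for n c
  proof -
    have c: "c mod m \<in> {0..<m}" using m by simp
    have "K (c mod m) \<le> K0" unfolding K0_def using c by (intro Max_ge) auto
    then have "r n (c mod m) = r K0 (c mod m)" using K that by (metis order_trans)
    moreover have "r k (c mod m) = r k c" for k
      by (rule periodic_dvd[where m = m]) (use rper in \<open>auto simp: mod_eq_dvd_iff[symmetric]\<close>)
    ultimately show ?thesis by simp
  qed
  \<comment> \<open>X^(n+1) maps E_c into X^n E_(c+w), and by stability its image is as large as X^n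
    E_c.\<close>
  have mono: "r n c \<le> r n (c + w)" if "n \<ge> K0" for n c
  proof -
    have "r n c = r (Suc n) c" using stab that by (metis le_SucI)
    also have "(X ^^ Suc n) ` E c = (X ^^ n) ` X ` E c" by (simp only: funpow_Suc_right image_comp)
    then have "r (Suc n) c \<le> r n (c + w)"
      unfolding r_def using XE[of c] order_trans[OF XkE fin(1)] fin(2)
      by (intro mp.dim_mono_finite) auto
    finally show ?thesis .
  qed
  show ?thesis
  proof (rule that)
    fix K' assume K': "K' \<ge> K0"
    have const: "r K' c = r K' 0" for c
      by (rule cyclic_mono_const[OF w m, where r = "r K'"]) (rule rper, rule mono[OF K'])
    have "mp.dim (E c) = r K' 0 + mp.dim {x\<in>E c. (X ^^ K') x = 0}" for c
      using mp.rank_nullity_on[OF sub[of c] fin, of "X ^^ K'"] Xk const[of c] by (simp add: r_def)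
    then show "\<exists>k. \<forall>c. mp.dim (E c) = k + mp.dim {x\<in>E c. (X ^^ K') x = 0}" by blast
  qed
qed

section \<open>Weights of the monomials in a box\<close>

definition wt :: "('n::finite \<Rightarrow> int) \<Rightarrow> ('n \<Rightarrow> nat) \<Rightarrow> int" where
  "wt w \<alpha> = (\<Sum>i\<in>UNIV. int (\<alpha> i) * w i)"

lemma wt_add [simp]: "wt w (\<alpha> + \<beta>) = wt w \<alpha> + wt w \<beta>"
  by (simp add: wt_def plus_fun_apply sum.distrib distrib_right)

lemma wt_zero [simp]: "wt w 0 = 0"
  by (simp add: wt_def zero_fun_apply)

lemma wt_expo [simp]: "wt w (expo j d) = int d * w j"
proof -
  have "wt w (expo j d) = (\<Sum>i\<in>UNIV. if i = j then int d * w j else 0)"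
    unfolding wt_def by (rule sum.cong) (auto simp: expo_def)
  then show ?thesis by simp
qed

definition mbox :: "'n set \<Rightarrow> nat \<Rightarrow> ('n \<Rightarrow> nat) set" where
  "mbox V M = {\<alpha>. supp_in V \<alpha> \<and> (\<forall>j\<in>V. \<alpha> j < M)}"

lemma finite_mbox: "finite (mbox (V :: 'n::finite set) M)"
proof (rule finite_subset)
  show "mbox V M \<subseteq> PiE UNIV (\<lambda>_. {..M})"
  proof
    fix \<alpha> assume "\<alpha> \<in> mbox V M"
    then have "\<alpha> i \<le> M" for i by (cases "i \<in> V") (auto simp: mbox_def supp_in_def intro: less_imp_le)
    then show "\<alpha> \<in> PiE UNIV (\<lambda>_. {..M})" by auto
  qed
qed (auto intro: finite_PiE)

lemma mbox_insert:
  assumes "j \<notin> V"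
  shows "mbox (insert j V) M = (\<Union>a<M. (\<lambda>\<alpha>. \<alpha> + expo j a) ` mbox V M)"
proof (intro equalityI subsetI)
  fix \<alpha> assume \<alpha>: "\<alpha> \<in> mbox (insert j V) M"
  let ?\<beta> = "\<lambda>i. if i = j then 0 else \<alpha> i"
  have "\<alpha> = ?\<beta> + expo j (\<alpha> j)" by (auto simp: fun_eq_iff plus_fun_apply expo_def)
  moreover have "?\<beta> \<in> mbox V M" using \<alpha> assms by (auto simp: mbox_def supp_in_def)
  moreover have "\<alpha> j < M" using \<alpha> by (simp add: mbox_def)
  ultimately show "\<alpha> \<in> (\<Union>a<M. (\<lambda>\<alpha>. \<alpha> + expo j a) ` mbox V M)" by blast
next
  fix \<alpha> assume "\<alpha> \<in> (\<Union>a<M. (\<lambda>\<alpha>. \<alpha> + expo j a) ` mbox V M)"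
  then obtain a \<beta> where \<beta>: "\<beta> \<in> mbox V M" "a < M" "\<alpha> = \<beta> + expo j a" by blast
  have "\<alpha> i = (if i = j then a else \<beta> i)" for i
    using assms \<beta>(1) by (simp add: \<beta>(3) plus_fun_apply expo_def mbox_def supp_in_def)
  then show "\<alpha> \<in> mbox (insert j V) M"
    using \<beta>(1,2) by (simp add: mbox_def supp_in_def)
qed

text \<open>In the group ring of the integers modulo m each variable contributes 1 + t^w + ... +
  t^((M-1)w). Since M is congruent to -1, this is a multiple of the sum of all residues minus
  t^(-w). In the product over \<open>V\<close> everything except (-1)^|V| t^(-sum w) is a multiple
  of that sum.\<close>

lemma mbox_weight_count:
  fixes w :: "'n::finite \<Rightarrow> int" and V :: "'n set"
  assumes "\<And>j. j \<in> V \<Longrightarrow> coprime (w j) (int m)" "m > 0" "int m dvd int M + 1"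
  shows "\<exists>k. \<forall>c. int (card {\<alpha>\<in>mbox V M. int m dvd (wt w \<alpha> - c)}) =
      k + (- 1) ^ card V * (if int m dvd (c + (\<Sum>j\<in>V. w j)) then 1 else 0)"
proof -
  have "finite V" by simp
  then show ?thesis using assms(1)
  proof (induct V)
    case empty
    have "mbox {} M = {0 :: 'n \<Rightarrow> nat}" by (auto simp: mbox_def supp_in_def fun_eq_iff zero_fun_apply)
    have "int (card {\<alpha>\<in>mbox {} M. int m dvd (wt w \<alpha> - c)}) = (if int m dvd c then 1 else 0)" for c
    proof (cases "int m dvd c")
      case True
      then have "{\<alpha>\<in>mbox {} M. int m dvd (wt w \<alpha> - c)} = {0}"
        unfolding \<open>mbox {} M = {0}\<close> by force
      with True show ?thesis by simp
    next
      case False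
      then have "{\<alpha>\<in>mbox {} M. int m dvd (wt w \<alpha> - c)} = {}"
        unfolding \<open>mbox {} M = {0}\<close> by force
      with False show ?thesis by (simp only: card.empty if_False of_nat_0)
    qed
    then show ?case by (intro exI[of _ 0] allI) simp
  next
    case (insert j V)
    define N where "N c = int (card {\<alpha>\<in>mbox V M. int m dvd (wt w \<alpha> - c)})" for c
    from insert obtain k where k: "\<And>c. N c = k + (- 1) ^ card V * (if int m dvd (c + (\<Sum>j\<in>V. w j)) then 1 else 0)"
      unfolding N_def by auto
    have Nper: "N c = N c'" if "int m dvd (c - c')" for c c'
    proof -
      have "int m dvd (wt w \<alpha> - c) \<longleftrightarrow> int m dvd (wt w \<alpha> - c')" for \<alpha>
        using dvd_add_left_iff[OF that, of "wt w \<alpha> - c"] by simp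
      then show ?thesis by (simp add: N_def)
    qed
    have cnt: "int (card {\<alpha>\<in>mbox (insert j V) M. int m dvd (wt w \<alpha> - c)}) = (\<Sum>a<M. N (c - int a * w j))" for c
    proof -
      let ?S = "\<lambda>a. (\<lambda>\<alpha>. \<alpha> + expo j a) ` {\<alpha>\<in>mbox V M. int m dvd (wt w \<alpha> - (c - int a * w j))}"
      have "{\<alpha>\<in>mbox (insert j V) M. int m dvd (wt w \<alpha> - c)} = (\<Union>a<M. ?S a)"
        unfolding mbox_insert[OF insert(2)] by (auto simp: algebra_simps)
      moreover have "card (\<Union>a<M. ?S a) = (\<Sum>a<M. card (?S a))"
      proof (rule card_UN_disjoint)
        show "\<forall>a\<in>{..<M}. \<forall>b\<in>{..<M}. a \<noteq> b \<longrightarrow> ?S a \<inter> ?S b = {}"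
        proof (intro ballI impI)
          fix a b :: nat assume "a \<noteq> b"
          have "(\<alpha> + expo j a) j = a" if "\<alpha> \<in> mbox V M" for \<alpha> a
            using that insert(2) by (auto simp: mbox_def supp_in_def plus_fun_apply)
          then have *: "x j = a" if "x \<in> ?S a" for x a using that by auto
          show "?S a \<inter> ?S b = {}"
          proof (rule equals0I)
            fix x assume "x \<in> ?S a \<inter> ?S b"
            then have "x j = a" "x j = b" by (auto intro!: *)
            with \<open>a \<noteq> b\<close> show False by simp
          qed
        qed
      qed (use finite_mbox[of V M] in auto)
      moreover have "card (?S a) = card {\<alpha>\<in>mbox V M. int m dvd (wt w \<alpha> - (c - int a * w j))}" for a
        by (rule card_image) (auto intro: inj_onI)
      ultimately show ?thesis by (simp add: N_def)
    qed
    have M: "int m dvd int (Suc M)" using assms(3) by (simp add: add.commute)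
    \<comment> \<open>With the missing exponent a = M added, the exponents run through whole periods
      modulo m, so that the sum no longer depends on \<open>c\<close>. The added term is later
      subtracted again and lies at c + w_j, because M is congruent to -1.\<close>
    define R where "R c = (\<Sum>a<Suc M. N (c - int a * w j))" for c
    have Rc: "R c = R 0" for c
    proof (rule cyclic_mono_const[where w = "w j" and m = "int m" and r = R])
      show "R (c + int m) = R c" for c
        unfolding R_def by (intro sum.cong refl Nper) simp
      show "R c \<le> R (c + w j)" for c
      proof -
        have "R (c + w j) = N (c + w j) + (\<Sum>a<M. N (c - int a * w j))"
          unfolding R_def sum.lessThan_Suc_shift by (simp add: algebra_simps)
        also have "N (c + w j) = N (c - int M * w j)"
        proof (rule Nper)
          have "c + w j - (c - int M * w j) = int (Suc M) * w j" by (simp add: algebra_simps)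
          then show "int m dvd (c + w j - (c - int M * w j))" using M by (simp only: dvd_mult2)
        qed
        finally show ?thesis by (simp add: R_def)
      qed
    qed (use insert(4) assms(2) in auto)
    have "(\<Sum>a<M. N (c - int a * w j)) = R 0 - N (c - int M * w j)" for c
      using Rc[of c] R_def[of c] by simp
    moreover have "N (c - int M * w j) = N (c + w j)" for c
    proof (rule Nper)
      have "c - int M * w j - (c + w j) = - (int (Suc M) * w j)" by (simp add: algebra_simps)
      then show "int m dvd (c - int M * w j - (c + w j))" using M by (simp only: dvd_mult2 dvd_minus_iff)
    qed
    ultimately have "int (card {\<alpha>\<in>mbox (insert j V) M. int m dvd (wt w \<alpha> - c)}) =
        (R 0 - k) + (- 1) ^ card (insert j V) * (if int m dvd (c + (\<Sum>j\<in>insert j V. w j)) then 1 else 0)" for c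
      unfolding cnt using insert(1,2) by (simp add: k ac_simps)
    then show ?case by blast
  qed
qed

lemma mpoly_span_mon:
  assumes "finite A"
  shows "mp.span (mon ` A) = {p. keys p \<subseteq> A}"
proof (intro equalityI subsetI)
  have "mp.subspace {p :: 'a mpoly. \<forall>\<alpha>\<in>keys p. \<alpha> \<in> A}" by (rule subspace_keys)
  then have "mp.subspace {p :: 'a mpoly. keys p \<subseteq> A}" by (simp only: subset_eq)
  then have "mp.span (mon ` A) \<subseteq> {p. keys p \<subseteq> A}" by (intro mp.span_minimal) auto
  then show "\<And>p. p \<in> mp.span (mon ` A) \<Longrightarrow> p \<in> {p. keys p \<subseteq> A}" by blast
next
  fix p :: "'a mpoly" assume "p \<in> {p. keys p \<subseteq> A}"
  then have "p = (\<Sum>\<alpha>\<in>A. cst (lookup p \<alpha>) * mon \<alpha>)"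
    using mpoly_sum_keys[OF assms, of p] unfolding single_as_mult[symmetric] by simp
  also have "\<dots> \<in> mp.span (mon ` A)" by (intro mp.span_sum mp.span_scale mp.span_base) auto
  finally show "p \<in> mp.span (mon ` A)" .
qed

lemma mpoly_dim_keys:
  assumes "finite A"
  shows "mp.dim {p :: 'n mpoly. keys p \<subseteq> A} = card A"
proof -
  have inj: "inj_on (mon :: ('n \<Rightarrow> nat) \<Rightarrow> 'n mpoly) A" by (rule inj_onI) (metis keys_single one_neq_zero singleton_inject)
  have "mp.independent (mon ` A :: 'n mpoly set)"
  proof (rule mp.independent_if_scalars_zero)
    fix f and x :: "'n mpoly" assume s: "(\<Sum>x\<in>mon ` A. cst (f x) * x) = 0" and "x \<in> mon ` A"
    then obtain \<alpha> where \<alpha>: "\<alpha> \<in> A" "x = mon \<alpha>" by auto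
    have "0 = lookup (\<Sum>\<beta>\<in>A. cst (f (mon \<beta>)) * mon \<beta>) \<alpha>"
      using s by (simp add: sum.reindex[OF inj])
    also have "\<dots> = (\<Sum>\<beta>\<in>A. if \<beta> = \<alpha> then f (mon \<alpha>) else 0)"
      unfolding lookup_sum by (rule sum.cong) (auto simp: lookup_single)
    also have "\<dots> = f x" using \<alpha> assms by simp
    finally show "f x = 0" by simp
  qed (use assms in auto)
  from mp.dim_span_eq_card_independent[OF this] show ?thesis
    by (simp add: mpoly_span_mon[OF assms] card_image[OF inj])
qed

section \<open>Weight spaces of the local algebra\<close>

lemma mon_power: "mon \<alpha> ^ k = mon (\<lambda>i. \<alpha> i * k :: nat)"
proof (induct k)
  case 0
  have "(\<lambda>i. \<alpha> i * 0) = 0" by (simp add: zero_fun_def)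
  then show ?case by (simp only: power_0 single_one)
next
  case (Suc k)
  have "\<alpha> + (\<lambda>i. \<alpha> i * k) = (\<lambda>i. \<alpha> i * Suc k)" by (simp add: fun_eq_iff plus_fun_apply)
  with Suc show ?case by (simp only: power_Suc mon_mult)
qed

lemma mon_expo_power: "mon (expo j a) ^ k = mon (expo j (a * k))"
  unfolding mon_power by (rule arg_cong[where f = mon]) (auto simp: expo_def)

lemma expo_add: "expo j a + expo j b = expo j (a + b)"
  by (auto simp: expo_def plus_fun_apply)

text \<open>The lowest nonzero coefficient is factored out, so that a relation among powers of x
  becomes x^k times something with nonzero constant part. That \<open>t\<close> is a combination of
  powers of \<open>x\<close> lets its weight be controlled.\<close>

lemma relation_lowest:
  fixes x :: "'n mpoly"
  assumes "(\<Sum>i<n. cst (c i) * x ^ i) \<in> J" "\<exists>i<n. c i \<noteq> 0"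
  obtains k d t where "k < n" "d \<noteq> 0" "t \<in> mp.span (range (\<lambda>i. x ^ i))" "x ^ k * (cst d + x * t) \<in> J"
proof -
  define k where "k = (LEAST i. c i \<noteq> 0)"
  obtain i0 where i0: "i0 < n" "c i0 \<noteq> 0" using assms(2) by blast
  have ck: "c k \<noteq> 0" unfolding k_def by (rule LeastI) (rule i0)
  have below: "c i = 0" if "i < k" for i using not_less_Least that by (auto simp: k_def)
  have "k \<le> i0" unfolding k_def by (rule Least_le) (rule i0)
  with i0 have kn: "k < n" by simp
  then obtain q where q: "n = k + Suc q" using less_iff_Suc_add by auto
  have split: "(\<Sum>i<k + p. f i) = (\<Sum>i<k. f i) + (\<Sum>i<p. f (k + i))" for p and f :: "nat \<Rightarrow> 'n mpoly"
    by (induct p) (simp_all add: ac_simps)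
  define t where "t = (\<Sum>i<q. cst (c (k + Suc i)) * x ^ i)"
  have "(\<Sum>i<n. cst (c i) * x ^ i) = (\<Sum>i<k. cst (c i) * x ^ i) + (\<Sum>i<Suc q. cst (c (k + i)) * x ^ (k + i))"
    unfolding q by (rule split)
  also have "(\<Sum>i<k. cst (c i) * x ^ i) = 0" by (rule sum.neutral) (simp add: below)
  also have "0 + (\<Sum>i<Suc q. cst (c (k + i)) * x ^ (k + i)) = x ^ k * (\<Sum>i<Suc q. cst (c (k + i)) * x ^ i)"
    unfolding sum_distrib_left add_0_left by (rule sum.cong) (simp_all add: power_add mult_ac)
  also have "(\<Sum>i<Suc q. cst (c (k + i)) * x ^ i) = cst (c k) + x * t"
    unfolding sum.lessThan_Suc_shift t_def sum_distrib_left by (simp add: mult_ac)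
  finally have "x ^ k * (cst (c k) + x * t) \<in> J" using assms(1) by simp
  moreover have "t \<in> mp.span (range (\<lambda>i. x ^ i))"
    unfolding t_def by (intro mp.span_sum mp.span_scale mp.span_base) auto
  ultimately show ?thesis using that kn ck by blast
qed

lemma ideal_one_minus_power:
  assumes J: "is_ideal J" and "y * (1 - z) \<in> J"
  shows "y * (1 - z ^ n) \<in> J"
  using is_idealD(4)[OF J assms(2), of "\<Sum>i<n. z ^ i"] unfolding mult.assoc one_diff_power_eq[symmetric] .

lemma normalise_unit:
  assumes "d \<noteq> 0"
  shows "cst (1 / d) * (y * (cst d + x * t)) = y * (1 - cst (- 1 / d) * (x * t) :: 'n mpoly)"
proof -
  have a: "cst (1 / d) * cst d = (1 :: 'n mpoly)" using assms by (simp add: cst_mult)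
  have b: "cst (- 1 / d) = - (cst (1 / d) :: 'n mpoly)" by (simp add: single_uminus[symmetric])
  have "cst (1 / d) * (y * (cst d + x * t)) = y * (cst (1 / d) * cst d + cst (1 / d) * (x * t))"
    by (simp only: distrib_left mult_ac)
  then show ?thesis unfolding a b by simp
qed

text \<open>Up to a scalar, d + x t is 1 - z with z in the maximal ideal; the geometric series
  inverts it up to z^N, which lies in \<open>J\<close>.\<close>

lemma ideal_unit_cancel:
  fixes x :: "'n::finite mpoly"
  assumes J: "is_ideal J" "mpw N \<subseteq> J" and x: "x \<in> mpw 1" and d: "d \<noteq> 0" and y: "y * (cst d + x * t) \<in> J"
  shows "y \<in> J"
proof -
  define z where "z = cst (- 1 / d) * (x * t)"
  have "cst (1 / d) * (y * (cst d + x * t)) = y * (1 - z)"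
    unfolding z_def by (rule normalise_unit[OF d])
  then have "y * (1 - z) \<in> J" using is_idealD(3)[OF J(1) y, of "cst (1 / d)"] by simp
  then have "y * (1 - z ^ N) \<in> J" by (rule ideal_one_minus_power[OF J(1)])
  moreover have "z ^ n \<in> mpw n" for n
  proof (induct n)
    case (Suc n)
    have "z \<in> mpw 1" unfolding z_def using x by (intro is_idealD(3,4)[OF is_ideal_mpw])
    from mpw_mult[OF this Suc] show ?case by simp
  qed (simp add: mpw_def)
  then have "y * z ^ N \<in> J" using J(2) is_idealD(3)[OF J(1)] by blast
  ultimately show ?thesis using is_idealD(2)[OF J(1)] by (fastforce simp: algebra_simps)
qed

text \<open>Dependence is meant for families: a repeated member is already a relation, which
  explains the split on injectivity.\<close>

lemma finite_dependent:
  fixes h :: "nat \<Rightarrow> 'n mpoly"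
  assumes "finite S" "card S < n" "\<And>i. i < n \<Longrightarrow> h i \<in> mp.span S"
  obtains c where "\<exists>i<n. c i \<noteq> 0" "(\<Sum>i<n. cst (c i) * h i) = 0"
proof (cases "inj_on h {..<n}")
  case True
  have "mp.dependent (h ` {..<n})"
  proof (rule ccontr)
    assume "mp.independent (h ` {..<n})"
    from mp.independent_span_bound[OF assms(1) this] assms(3)
    show False using assms(2) card_image[OF True] by fastforce
  qed
  then obtain u where u: "\<exists>v\<in>h ` {..<n}. u v \<noteq> 0" "(\<Sum>v\<in>h ` {..<n}. cst (u v) * v) = 0"
    unfolding mp.dependent_finite[OF finite_imageI[OF finite_lessThan]] by blast
  from u(2) have "(\<Sum>i<n. cst (u (h i)) * h i) = 0" unfolding sum.reindex[OF True] by (simp add: o_def)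
  with u(1) that[of "\<lambda>i. u (h i)"] show ?thesis by blast
next
  case False
  then obtain i j where ij: "i < n" "j < n" "i \<noteq> j" "h i = h j" by (auto simp: inj_on_def)
  let ?c = "\<lambda>k. if k = i then 1 else if k = j then - 1 else 0 :: complex"
  have "(\<Sum>k<n. cst (?c k) * h k) = (\<Sum>k\<in>{i, j}. cst (?c k) * h k)"
    by (rule sum.mono_neutral_right) (use ij in auto)
  also have "\<dots> = 0" using ij by (simp add: single_uminus)
  finally show ?thesis using that[of ?c] ij(1) by (metis zero_neq_one)
qed

text \<open>\<open>V\<close> is a block of variables on which the group acts through a cyclic group
  of order \<open>m\<close>, with weights \<open>w\<close>. By \<open>wtF\<close> the polynomial
  \<open>F j\<close> has weight -w_j, like a partial derivative of an invariant, and M congruent to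
  -1 gives x_j^M the same weight. The Milnor number enters through \<open>dep\<close> alone. The
  bound on \<open>N\<close> is the pigeonhole bound of \<open>raise_degree\<close>.\<close>

locale counting =
  fixes V :: "'n::finite set" and F :: "'n \<Rightarrow> 'n mpoly" and w :: "'n \<Rightarrow> int" and m N M l :: nat
  assumes V: "V \<noteq> {}" and m: "m \<ge> 2" and l: "l \<ge> 1" "l \<le> m" and N: "N > card V * l"
    and cop: "\<And>j. j \<in> V \<Longrightarrow> coprime (w j) (int m)"
    and FV: "\<And>j. j \<in> V \<Longrightarrow> F j \<in> pvars V"
    and wtF: "\<And>j \<beta>. j \<in> V \<Longrightarrow> \<beta> \<in> keys (F j) \<Longrightarrow> int m dvd (wt w \<beta> + w j)"
    and M: "int m dvd int M + 1" "N \<le> M"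
    and degF: "\<And>j \<beta>. j \<in> V \<Longrightarrow> \<beta> \<in> keys (F j) \<Longrightarrow> mdeg \<beta> < M"
    and dep: "\<And>h. (\<And>i. i < l \<Longrightarrow> h i \<in> pvars V) \<Longrightarrow>
      \<exists>c. (\<exists>i<l. c i \<noteq> 0) \<and> (\<Sum>i<l. cst (c i) * h i) \<in> gen_ideal F V N"
begin

sublocale rewriting V "\<lambda>_. M" F "\<lambda>_. False" mdeg
  by unfold_locales (auto simp: degF)

lemma l_less_N: "l < N"
proof -
  have "card V \<ge> 1" using V by (simp add: Suc_leI card_gt_0_iff)
  then have "1 * l \<le> card V * l" by (rule mult_le_mono1)
  with N show ?thesis by (metis le_less_trans mult_1)
qed

abbreviation NF :: "'n mpoly \<Rightarrow> 'n mpoly" where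
  "NF \<equiv> lin nf"

definition G :: "'n \<Rightarrow> 'n mpoly" where
  "G j = mon (expo j M) + F j"

text \<open>As the kernel of the normal form, membership is a linear condition; \<open>I_iff\<close>
  identifies this with the ideal generated by the \<open>G j\<close>.\<close>

definition I :: "'n mpoly set" where
  "I = {p. NF p = 0}"

lemma I_iff: "p \<in> I \<longleftrightarrow> (\<exists>b. p = (\<Sum>j\<in>V. b j * G j))"
proof
  assume "p \<in> I"
  let ?J = "{p. \<exists>b. p = (\<Sum>j\<in>V. b j * G j)}"
  have "is_ideal ?J"
    unfolding is_ideal_def
  proof (safe, goal_cases)
    case 1 show ?case by (rule exI[of _ "\<lambda>_. 0"]) simp
  next
    case (2 a b f g) show ?case
      by (rule exI[of _ "\<lambda>j. f j + g j"]) (simp add: distrib_right sum.distrib)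
  next
    case (3 a f r) show ?case
      by (rule exI[of _ "\<lambda>j. r * f j"]) (simp add: sum_distrib_left mult.assoc)
  qed
  moreover have "G j \<in> ?J" if "j \<in> V" for j
  proof -
    have "(\<Sum>i\<in>V. (if i = j then 1 else 0) * G i) = (\<Sum>i\<in>V. if i = j then G j else 0)"
      by (rule sum.cong) auto
    also have "\<dots> = G j" using that by simp
    finally show ?thesis by (intro CollectI exI) (rule sym)
  qed
  ultimately have "p - NF p \<in> ?J"
    by (intro diff_lin_nf_ideal) (auto simp: G_def)
  then show "\<exists>b. p = (\<Sum>j\<in>V. b j * G j)" using \<open>p \<in> I\<close> by (simp add: I_def)
next
  assume "\<exists>b. p = (\<Sum>j\<in>V. b j * G j)"
  then obtain b where "p = (\<Sum>j\<in>V. b j * G j)" by blast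
  then have "NF p = (\<Sum>j\<in>V. NF (b j * G j))" by (simp only: lin_sum)
  also have "\<dots> = 0" by (rule sum.neutral) (simp add: G_def lin_nf_gen)
  finally show "p \<in> I" by (simp add: I_def)
qed

lemma ideal_I: "is_ideal I"
  unfolding is_ideal_def
proof (intro conjI ballI allI)
  fix a r assume "a \<in> I"
  then obtain b where "a = (\<Sum>j\<in>V. b j * G j)" unfolding I_iff by blast
  then have "r * a = (\<Sum>j\<in>V. (r * b j) * G j)" by (simp add: sum_distrib_left mult.assoc)
  then show "r * a \<in> I" unfolding I_iff by (rule exI[of _ "\<lambda>j. r * b j"])
qed (auto simp: I_def lin_add)

lemma G_in_I: "j \<in> V \<Longrightarrow> G j \<in> I"
  using lin_nf_gen[of j 1] by (simp add: I_def G_def)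

lemma NF_cong: "p - q \<in> I \<Longrightarrow> NF p = NF q"
  by (simp add: I_def lin_diff)

lemma NF_diff: "p - NF p \<in> I"
  by (rule diff_lin_nf_ideal[OF ideal_I]) (use G_in_I in \<open>auto simp: G_def\<close>)

lemma NF_mult_NF: "NF (a * NF b) = NF (a * b)"
proof (rule NF_cong)
  have "a * NF b - a * b = - (a * (b - NF b))" by (simp add: algebra_simps)
  then show "a * NF b - a * b \<in> I"
    using is_idealD(5)[OF ideal_I is_idealD(3)[OF ideal_I NF_diff[of b], of a]] by (simp only:)
qed

definition H :: "int \<Rightarrow> 'n mpoly set" where
  "H c = {p. \<forall>\<alpha>\<in>keys p. supp_in V \<alpha> \<and> int m dvd (wt w \<alpha> - c)}"

text \<open>Normal forms of weight c: representatives of the weight c part of the quotient by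
  \<open>I\<close>.\<close>

definition A :: "int \<Rightarrow> 'n mpoly set" where
  "A c = {p. keys p \<subseteq> {\<alpha>\<in>mbox V M. int m dvd (wt w \<alpha> - c)}}"

lemma subspace_H: "mp.subspace (H c)"
  unfolding H_def by (rule subspace_keys)

lemma subspace_A: "mp.subspace (A c)"
  unfolding A_def subset_eq by (rule subspace_keys)

lemma H_mult: "p \<in> H c \<Longrightarrow> q \<in> H d \<Longrightarrow> p * q \<in> H (c + d)"
proof -
  assume p: "p \<in> H c" and q: "q \<in> H d"
  show ?thesis unfolding H_def
  proof (intro CollectI ballI)
    fix \<gamma> assume "\<gamma> \<in> keys (p * q)"
    from keys_mult_mdeg[OF this] obtain \<alpha> \<beta> where *: "\<alpha> \<in> keys p" "\<beta> \<in> keys q" "\<gamma> = \<alpha> + \<beta>" by blast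
    have "int m dvd (wt w \<alpha> - c) + (wt w \<beta> - d)"
      using p q * unfolding H_def by (intro dvd_add) auto
    then show "supp_in V \<gamma> \<and> int m dvd (wt w \<gamma> - (c + d))"
      using p q * unfolding H_def by (simp add: algebra_simps)
  qed
qed

lemma H_power: "p \<in> H 0 \<Longrightarrow> p ^ k \<in> H 0"
proof (induct k)
  case (Suc k)
  with H_mult[of p 0 "p ^ k" 0] show ?case by simp
qed (simp add: H_def)

lemma H_pvars: "H c \<subseteq> pvars V"
  by (auto simp: H_def pvars_def)

lemma A_subset_H: "A c \<subseteq> H c"
  by (auto simp: A_def H_def mbox_def)

lemma A_periodic: "A (c + int m) = A c"
proof -
  have "int m dvd (wt w \<alpha> - (c + int m)) \<longleftrightarrow> int m dvd (wt w \<alpha> - c)" for \<alpha>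
    using dvd_add_left_iff[of "int m" "- int m" "wt w \<alpha> - c"] by (simp add: algebra_simps)
  then show ?thesis by (simp add: A_def)
qed

lemma A_finite: "A c \<subseteq> mp.span (mon ` mbox V M)" "finite (mon ` mbox V M)"
  using finite_mbox[of V M] by (auto simp: mpoly_span_mon[OF finite_mbox] A_def)

text \<open>Both sides of the rule x_j^M -> - F_j have weight -w_j modulo m and involve only
  variables of \<open>V\<close>, so rewriting respects weight and support.\<close>

lemma nf_in_A:
  assumes "supp_in V \<alpha>" "int m dvd (wt w \<alpha> - c)"
  shows "nf \<alpha> \<in> A c"
  unfolding A_def
proof (rule CollectI, rule subsetI)
  fix \<delta> assume "\<delta> \<in> keys (nf \<alpha>)"
  have "red \<delta> \<and> ((supp_in V \<alpha> \<longrightarrow> supp_in V \<delta>) \<and> int m dvd (wt w \<alpha> - wt w \<delta>))"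
  proof (rule nf_keys[OF _ _ \<open>\<delta> \<in> keys (nf \<alpha>)\<close>])
    fix j \<gamma> \<beta> \<delta>' assume j: "j \<in> V" and \<beta>: "\<beta> \<in> keys (F j)"
      and Q: "(supp_in V (\<gamma> + \<beta>) \<longrightarrow> supp_in V \<delta>') \<and> int m dvd (wt w (\<gamma> + \<beta>) - wt w \<delta>')"
    have "supp_in V \<beta>" using FV[OF j] \<beta> by (auto simp: pvars_def)
    moreover have "int m dvd (wt w (\<gamma> + expo j M) - wt w \<delta>')"
    proof -
      have "wt w (\<gamma> + expo j M) - wt w \<delta>' = (wt w (\<gamma> + \<beta>) - wt w \<delta>') + ((int M + 1) * w j - (wt w \<beta> + w j))"
        by (simp add: algebra_simps)
      moreover have "int m dvd (int M + 1) * w j" using M(1) by (rule dvd_mult2)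
      ultimately show ?thesis using Q wtF[OF j \<beta>] by (metis dvd_add dvd_diff)
    qed
    ultimately show "(supp_in V (\<gamma> + expo j M) \<longrightarrow> supp_in V \<delta>') \<and> int m dvd (wt w (\<gamma> + expo j M) - wt w \<delta>')"
      using Q by simp
  qed auto
  then have \<delta>: "\<forall>j\<in>V. \<delta> j < M" "supp_in V \<delta>" "int m dvd (wt w \<alpha> - wt w \<delta>)"
    using assms by (auto simp: red_def)
  have "wt w \<delta> - c = (wt w \<alpha> - c) - (wt w \<alpha> - wt w \<delta>)" by simp
  then have "int m dvd (wt w \<delta> - c)" using assms(2) \<delta>(3) by (metis dvd_diff)
  with \<delta> show "\<delta> \<in> {\<alpha> \<in> mbox V M. int m dvd (wt w \<alpha> - c)}" by (simp add: mbox_def)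
qed

lemma NF_H: "p \<in> H c \<Longrightarrow> NF p \<in> A c"
  by (rule lin_in_subspace[OF subspace_A]) (auto simp: H_def intro: nf_in_A)

lemma NF_A: "v \<in> A c \<Longrightarrow> NF v = v"
  by (rule lin_nf_red) (auto simp: A_def red_def mbox_def)

text \<open>Multiplication by x_j in the quotient by \<open>I\<close>, acting on normal
  forms.\<close>

definition X :: "'n \<Rightarrow> 'n mpoly \<Rightarrow> 'n mpoly" where
  "X j v = NF (mon (expo j 1) * v)"

lemma X_linear: "X j (x + y) = X j x + X j y" "X j (cst c * x) = cst c * X j x"
  by (simp_all add: X_def distrib_left lin_add mult.left_commute[of _ "cst c"] lin_cst_mult)

lemma mon_expo_H: "j \<in> V \<Longrightarrow> mon (expo j k) \<in> H (int k * w j)"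
  by (simp add: H_def)

lemma X_pow: "NF v = v \<Longrightarrow> (X j ^^ k) v = NF (mon (expo j k) * v)"
proof (induct k)
  case 0
  have "mon (expo j 0) = 1" by (simp add: expo_def zero_fun_def[symmetric])
  with 0 show ?case by simp
next
  case (Suc k)
  have "(X j ^^ Suc k) v = X j (NF (mon (expo j k) * v))" using Suc by simp
  also have "\<dots> = NF (mon (expo j 1) * (mon (expo j k) * v))" unfolding X_def by (rule NF_mult_NF)
  also have "mon (expo j 1) * (mon (expo j k) * v) = mon (expo j (Suc k)) * v"
    unfolding mult.assoc[symmetric] mon_mult expo_add by simp
  finally show ?case .
qed

text \<open>For \<open>T = V\<close> and large exponents this is the weight c part of the local
  algebra at the origin, realised inside the finite-dimensional quotient by
  \<open>I\<close>.\<close>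

definition E :: "('n \<Rightarrow> nat) \<Rightarrow> 'n set \<Rightarrow> int \<Rightarrow> 'n mpoly set" where
  "E \<kappa> T c = {v\<in>A c. \<forall>j\<in>T. mon (expo j (\<kappa> j)) * v \<in> I}"

lemma subspace_E: "mp.subspace (E \<kappa> T c)"
  unfolding mp.subspace_def E_def
proof (intro conjI ballI allI, goal_cases)
  case 1 then show ?case using mp.subspace_0[OF subspace_A] is_idealD(1)[OF ideal_I] by simp
next
  case (2 a b) then show ?case
    using mp.subspace_add[OF subspace_A] is_idealD(2)[OF ideal_I] by (simp add: distrib_left)
next
  case (3 d a)
  have "mon (expo j (\<kappa> j)) * (cst d * a) \<in> I" if "j \<in> T" for j
    using 3 that is_idealD(3)[OF ideal_I] by (simp add: mult.left_commute)
  with 3 show ?case using mp.subspace_scale[OF subspace_A] by simp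
qed

text \<open>The variables are handled one at a time: multiplication by x_j commutes with the
  conditions already imposed, so \<open>graded_kernel_dim\<close> applies to what is left, and each
  variable costs an amount independent of the weight. The lower bound \<open>L\<close> leaves room
  for later demands on the exponents.\<close>

lemma E_dim:
  assumes "T \<subseteq> V"
  shows "\<exists>\<kappa>. (\<forall>j. \<kappa> j \<ge> L) \<and> (\<exists>k. \<forall>c. mp.dim (A c) = k + mp.dim (E \<kappa> T c))"
proof -
  have "finite T" by simp
  then show ?thesis using assms
  proof (induct T)
    case empty
    show ?case by (rule exI[of _ "\<lambda>_. L"]) (auto simp: E_def)
  next
    case (insert j T)
    from insert have "T \<subseteq> V" by simp
    from insert.hyps(3)[OF this] obtain \<kappa> k
      where \<kappa>: "\<forall>j. \<kappa> j \<ge> L" "\<And>c. mp.dim (A c) = k + mp.dim (E \<kappa> T c)" by blast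
    have j: "j \<in> V" using insert by auto
    have EA: "E \<kappa> T c \<subseteq> A c" for c by (auto simp: E_def)
    obtain K where K: "\<And>K'. K' \<ge> K \<Longrightarrow>
        \<exists>k. \<forall>c. mp.dim (E \<kappa> T c) = k + mp.dim {x\<in>E \<kappa> T c. (X j ^^ K') x = 0}"
    proof (rule graded_kernel_dim[where E = "E \<kappa> T" and m = "int m" and w = "w j" and X = "X j"])
      show "E \<kappa> T (c + int m) = E \<kappa> T c" for c by (simp add: E_def A_periodic)
      show "E \<kappa> T c \<subseteq> mp.span (mon ` mbox V M)" for c using EA A_finite(1) by blast
      show "X j ` E \<kappa> T c \<subseteq> E \<kappa> T (c + w j)" for c
      proof
        fix y assume "y \<in> X j ` E \<kappa> T c"
        then obtain v where v: "v \<in> E \<kappa> T c" "y = X j v" by blast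
        have "mon (expo j 1) * v \<in> H (c + w j)"
          using H_mult[OF mon_expo_H[OF j, of 1]] EA A_subset_H v(1) by (fastforce simp: add.commute)
        then have "y \<in> A (c + w j)" unfolding v(2) X_def by (rule NF_H)
        moreover have "mon (expo i (\<kappa> i)) * y \<in> I" if "i \<in> T" for i
        proof -
          have "mon (expo j 1) * (mon (expo i (\<kappa> i)) * v) \<in> I"
            by (rule is_idealD(3)[OF ideal_I]) (use v(1) that in \<open>auto simp: E_def\<close>)
          then show ?thesis
            unfolding I_def mem_Collect_eq v(2) X_def NF_mult_NF by (simp add: mult.left_commute)
        qed
        ultimately show "y \<in> E \<kappa> T (c + w j)" by (simp add: E_def)
      qed
    qed (use m cop[OF j] subspace_E A_finite X_linear in auto)
    define K' where "K' = max K L"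
    let ?\<kappa> = "\<kappa>(j := K')"
    have eq: "{x\<in>E \<kappa> T c. (X j ^^ K') x = 0} = E ?\<kappa> (insert j T) c" for c
    proof -
      have "(X j ^^ K') x = 0 \<longleftrightarrow> mon (expo j K') * x \<in> I" if "x \<in> A c" for x
        by (simp add: X_pow[OF NF_A[OF that]] I_def)
      moreover have "?\<kappa> i = \<kappa> i" if "i \<in> T" for i using insert(2) that by auto
      ultimately show ?thesis by (auto simp: E_def)
    qed
    have "K \<le> K'" by (simp add: K'_def)
    from K[OF this] obtain k' where "\<And>c. mp.dim (E \<kappa> T c) = k' + mp.dim {x\<in>E \<kappa> T c. (X j ^^ K') x = 0}"
      by blast
    note this[unfolded eq]
    then have "mp.dim (A c) = (k + k') + mp.dim (E ?\<kappa> (insert j T) c)" for c using \<kappa>(2)[of c] by simp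
    moreover have "\<forall>i. ?\<kappa> i \<ge> L" using \<kappa>(1) by (simp add: K'_def)
    ultimately show ?case by blast
  qed
qed

text \<open>The power u = x_j^m has weight 0 and satisfies a relation in the finite-dimensional
  quotient. Its lowest term gives u^k (1 - z) in \<open>I\<close> with z a weight 0 multiple of u,
  so a high power of z is, modulo \<open>I\<close>, the idempotent belonging to the part where x_j
  is invertible.\<close>

lemma ex_eta_factor:
  assumes j: "j \<in> V"
  shows "\<exists>L. \<forall>\<kappa>\<ge>L. \<exists>e\<in>H 0. (1 - e) * mon (expo j \<kappa>) \<in> I \<and> (\<exists>b. e = b * mon (expo j \<kappa>))"
proof -
  define u where "u = mon (expo j m)"
  have uH: "u \<in> H 0" using j by (simp add: u_def H_def)
  have span: "NF (u ^ i) \<in> mp.span (mon ` mbox V M)" for i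
    using NF_H[OF H_power[OF uH]] A_finite(1) by blast
  define n where "n = Suc (card (mon ` mbox V M :: 'n mpoly set))"
  obtain c where c: "\<exists>i<n. c i \<noteq> 0" "(\<Sum>i<n. cst (c i) * NF (u ^ i)) = 0"
    by (rule finite_dependent[OF A_finite(2), of n "\<lambda>i. NF (u ^ i)"]) (simp add: n_def, rule span)
  then have "(\<Sum>i<n. cst (c i) * u ^ i) \<in> I" by (simp add: I_def lin_sum lin_cst_mult)
  then obtain k d t where "k < n"
    and k: "d \<noteq> 0" "t \<in> mp.span (range (\<lambda>i. u ^ i))" "u ^ k * (cst d + u * t) \<in> I"
    by (rule relation_lowest[OF _ c(1)])
  have "mp.span (range (\<lambda>i. u ^ i)) \<subseteq> H 0"
    by (rule mp.span_minimal[OF _ subspace_H]) (use H_power[OF uH] in auto)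
  with k(2) have tH: "t \<in> H 0" by blast
  define t' where "t' = cst (- 1 / d) * t"
  have t'H: "t' \<in> H 0" unfolding t'_def by (rule mp.subspace_scale[OF subspace_H tH])
  define z where "z = u * t'"
  have zH: "z \<in> H 0" using H_mult[OF uH t'H] by (simp add: z_def)
  have "u ^ k * (1 - z) = cst (1 / d) * (u ^ k * (cst d + u * t))"
    unfolding normalise_unit[OF k(1)] z_def t'_def by (simp only: mult.left_commute)
  then have z: "u ^ k * (1 - z) \<in> I" using is_idealD(3)[OF ideal_I k(3)] by simp
  have "\<exists>e\<in>H 0. (1 - e) * mon (expo j \<kappa>) \<in> I \<and> (\<exists>b. e = b * mon (expo j \<kappa>))" if \<kappa>: "\<kappa> \<ge> m * k" for \<kappa>
  proof (intro bexI conjI)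
    show "z ^ \<kappa> \<in> H 0" by (rule H_power[OF zH])
    have "mon (expo j \<kappa>) = mon (expo j (\<kappa> - m * k)) * u ^ k"
      using \<kappa> by (simp add: u_def mon_expo_power mon_mult expo_add)
    then have "(1 - z ^ \<kappa>) * mon (expo j \<kappa>) = mon (expo j (\<kappa> - m * k)) * (u ^ k * (1 - z ^ \<kappa>))"
      by (simp only: mult_ac)
    then show "(1 - z ^ \<kappa>) * mon (expo j \<kappa>) \<in> I"
      using is_idealD(3)[OF ideal_I ideal_one_minus_power[OF ideal_I z]] by simp
    have "\<kappa> \<le> m * \<kappa>" using m by simp
    then have "u ^ \<kappa> = mon (expo j (m * \<kappa> - \<kappa>)) * mon (expo j \<kappa>)"
      by (simp add: u_def mon_expo_power mon_mult expo_add)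
    then have "z ^ \<kappa> = (mon (expo j (m * \<kappa> - \<kappa>)) * t' ^ \<kappa>) * mon (expo j \<kappa>)"
      by (simp add: z_def power_mult_distrib mult_ac)
    then show "\<exists>b. z ^ \<kappa> = b * mon (expo j \<kappa>)" by blast
  qed
  then show ?thesis by blast
qed

text \<open>The product of the complementary idempotents \<open>1 - e j\<close> projects onto the
  local algebra at the origin and has weight 0. Two properties suffice later: it kills the powers
  x_j^(\<open>\<kappa> j\<close>) modulo \<open>I\<close>, and it differs from 1 by a combination of
  them.\<close>

lemma ex_eta:
  obtains \<kappa> k \<eta> where "\<And>j. \<kappa> j \<ge> N" "\<And>c. mp.dim (A c) = k + mp.dim (E \<kappa> V c)"
    "\<eta> \<in> H 0" "\<And>j. j \<in> V \<Longrightarrow> \<eta> * mon (expo j (\<kappa> j)) \<in> I"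
    "\<exists>b. 1 - \<eta> = (\<Sum>j\<in>V. b j * mon (expo j (\<kappa> j)))"
proof -
  obtain L where L: "\<And>j \<kappa>. j \<in> V \<Longrightarrow> \<kappa> \<ge> L j \<Longrightarrow>
      \<exists>e\<in>H 0. (1 - e) * mon (expo j \<kappa>) \<in> I \<and> (\<exists>b. e = b * mon (expo j \<kappa>))"
    using ex_eta_factor by metis
  \<comment> \<open>The sum dominates every \<open>L j\<close>, and adding \<open>N\<close> puts the
    powers x_j^(\<open>\<kappa> j\<close>) into \<open>mpw N\<close>.\<close>
  obtain \<kappa> k where \<kappa>: "\<And>j. \<kappa> j \<ge> N + (\<Sum>i\<in>V. L i)" "\<And>c. mp.dim (A c) = k + mp.dim (E \<kappa> V c)"
    using E_dim[OF order_refl, of "N + (\<Sum>i\<in>V. L i)"] by blast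
  have "\<kappa> j \<ge> L j" if "j \<in> V" for j
    using member_le_sum[of j V L] that \<kappa>(1)[of j] by simp
  then have "\<forall>j\<in>V. \<exists>e\<in>H 0. (1 - e) * mon (expo j (\<kappa> j)) \<in> I \<and> (\<exists>b. e = b * mon (expo j (\<kappa> j)))"
    using L by blast
  then obtain e b where e: "\<And>j. j \<in> V \<Longrightarrow> e j \<in> H 0" "\<And>j. j \<in> V \<Longrightarrow> (1 - e j) * mon (expo j (\<kappa> j)) \<in> I"
    "\<And>j. j \<in> V \<Longrightarrow> e j = b j * mon (expo j (\<kappa> j))" by metis
  define \<eta> where "\<eta> T = (\<Prod>j\<in>T. 1 - e j)" for T
  have one: "1 \<in> H 0" by (simp add: H_def)
  have \<eta>: "\<eta> T \<in> H 0 \<and> (\<forall>j\<in>T. \<eta> T * mon (expo j (\<kappa> j)) \<in> I) \<and>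
      (\<exists>b. 1 - \<eta> T = (\<Sum>j\<in>T. b j * mon (expo j (\<kappa> j))))" if "T \<subseteq> V" for T
    using finite_subset[OF that finite] that
  proof (induct T)
    case empty
    then show ?case by (simp add: \<eta>_def one)
  next
    case (insert i T)
    then have i: "i \<in> V" by simp
    have \<eta>i: "\<eta> (insert i T) = (1 - e i) * \<eta> T" using insert by (simp add: \<eta>_def)
    have "1 - e i \<in> H 0" by (rule mp.subspace_diff[OF subspace_H one e(1)[OF i]])
    then have 1: "\<eta> (insert i T) \<in> H 0" using H_mult[of "1 - e i" 0 "\<eta> T" 0] insert by (simp add: \<eta>i)
    have 2: "\<eta> (insert i T) * mon (expo j (\<kappa> j)) \<in> I" if "j \<in> insert i T" for j
    proof (cases "j = i")
      case True
      then show ?thesis using is_idealD(4)[OF ideal_I e(2)[OF i], of "\<eta> T"] by (simp add: \<eta>i mult_ac)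
    next
      case False
      then have "\<eta> T * mon (expo j (\<kappa> j)) \<in> I" using insert that by auto
      then show ?thesis using is_idealD(3)[OF ideal_I, of _ "1 - e i"] by (simp add: \<eta>i mult.assoc)
    qed
    obtain f where f: "1 - \<eta> T = (\<Sum>j\<in>T. f j * mon (expo j (\<kappa> j)))" using insert by auto
    have "1 - \<eta> (insert i T) = (1 - \<eta> T) + (\<eta> T * b i) * mon (expo i (\<kappa> i))"
      unfolding \<eta>i using e(3)[OF i] by (simp add: algebra_simps)
    also have "\<dots> = (\<Sum>j\<in>insert i T. (f(i := \<eta> T * b i)) j * mon (expo j (\<kappa> j)))"
      using insert(1,2) unfolding f by (simp add: add.commute) (auto intro!: sum.cong)
    finally show ?case using 1 2 by blast
  qed
  show ?thesis
  proof (rule that[of \<kappa> k "\<eta> V"])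
    show "\<kappa> j \<ge> N" for j using \<kappa>(1)[of j] by simp
  qed (use \<kappa>(2) \<eta>[OF order_refl] in auto)
qed

end

section \<open>The local algebra at the origin inside the deformed algebra\<close>

lemma pick_supp_mult: "pick (supp_in V) (p * q) = pick (supp_in V) p * pick (supp_in V) q"
  by (rule pick_mult) simp

lemma pick_pvars: "p \<in> pvars V \<Longrightarrow> pick (supp_in V) p = p"
  by (rule pick_id) (simp add: pvars_def)

lemma pick_in_pvars: "pick (supp_in V) p \<in> pvars V"
  by (simp add: pvars_def)

lemma subspace_pvars: "mp.subspace (pvars V)"
  unfolding pvars_def by (rule subspace_keys)

lemma gen_ideal_const_coeff:
  assumes "p \<in> gen_ideal F S N" "N \<ge> 1" "\<And>j. j \<in> S \<Longrightarrow> lookup (F j) 0 = 0"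
  shows "lookup p 0 = 0"
proof -
  have const: "lookup q 0 = 0 \<longleftrightarrow> q \<in> mpw 1" for q :: "'a mpoly"
    by (auto simp: mpw_iff)
  have "gen_ideal F S N \<subseteq> mpw 1"
    using assms(2,3) mpw_mono[of 1 N] const by (intro gen_ideal_subset is_ideal_mpw) auto
  then show ?thesis using assms(1) const by blast
qed

locale counting_eta = counting +
  fixes \<kappa> :: "'a \<Rightarrow> nat" and k :: nat and \<eta> :: "'a mpoly"
  assumes \<kappa>: "\<And>j. \<kappa> j \<ge> N" and dimA: "\<And>c. mp.dim (A c) = k + mp.dim (E \<kappa> V c)"
    and \<eta>: "\<eta> \<in> H 0" "\<And>j. j \<in> V \<Longrightarrow> \<eta> * mon (expo j (\<kappa> j)) \<in> I"
    "\<exists>b. 1 - \<eta> = (\<Sum>j\<in>V. b j * mon (expo j (\<kappa> j)))"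
begin

text \<open>The polynomials that vanish in the local algebra. Variables outside \<open>V\<close> are
  set to zero beforehand, since \<open>mpw\<close> and \<open>gen_ideal\<close> refer to polynomials
  in all variables.\<close>

definition I0 :: "'a mpoly set" where
  "I0 = {p. \<eta> * pick (supp_in V) p \<in> I}"

lemma ideal_I0: "is_ideal I0"
  unfolding is_ideal_def I0_def
proof (intro conjI ballI allI, goal_cases)
  case 1 then show ?case by (simp add: is_idealD(1)[OF ideal_I])
next
  case (2 a b) then show ?case
    using is_idealD(2)[OF ideal_I] by (simp add: pick_add distrib_left)
next
  case (3 a r)
  then have "pick (supp_in V) r * (\<eta> * pick (supp_in V) a) \<in> I"
    using is_idealD(3)[OF ideal_I] by simp
  then show ?case by (simp add: pick_supp_mult mult.left_commute)
qed

lemma not_supp_I0: "\<not> supp_in V \<alpha> \<Longrightarrow> mon \<alpha> \<in> I0"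
  by (simp add: I0_def pick_single is_idealD(1)[OF ideal_I])

lemma I_pvars_I0: "p \<in> I \<Longrightarrow> p \<in> pvars V \<Longrightarrow> p \<in> I0"
  by (simp add: I0_def pick_pvars is_idealD(3)[OF ideal_I])

lemma G_I0: "j \<in> V \<Longrightarrow> G j \<in> I0"
proof (rule I_pvars_I0)
  assume j: "j \<in> V"
  then show "G j \<in> I" by (rule G_in_I)
  have "mon (expo j M) \<in> pvars V" using j by (simp add: pvars_def)
  then show "G j \<in> pvars V" unfolding G_def using FV[OF j] mp.subspace_add[OF subspace_pvars] by blast
qed

lemma power_kappa_I0: "j \<in> V \<Longrightarrow> mon (expo j (\<kappa> j)) \<in> I0"
  using \<eta>(2) by (simp add: I0_def pick_single)

text \<open>By \<open>dep\<close> the powers 1, x, ..., x^(l-1) are dependent modulo the ideal. The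
  relation is x^k times a unit with k < l, and the unit cancels.\<close>

lemma var_power_gen: "j \<in> V \<Longrightarrow> mon (expo j (l - 1)) \<in> gen_ideal F V N"
proof -
  assume j: "j \<in> V"
  let ?x = "mon (expo j 1) :: 'a mpoly"
  have "?x ^ i \<in> pvars V" for i using j unfolding mon_expo_power by (simp add: pvars_def)
  then obtain c where c: "\<exists>i<l. c i \<noteq> 0" "(\<Sum>i<l. cst (c i) * ?x ^ i) \<in> gen_ideal F V N"
    using dep[of "\<lambda>i. ?x ^ i"] by blast
  obtain k d t where k: "k < l" "d \<noteq> 0" "t \<in> mp.span (range (\<lambda>i. ?x ^ i))"
    "?x ^ k * (cst d + ?x * t) \<in> gen_ideal F V N"
    by (rule relation_lowest[OF c(2,1)])
  have "?x ^ k \<in> gen_ideal F V N"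
    by (rule ideal_unit_cancel[OF is_ideal_gen_ideal mpw_subset_gen_ideal _ k(2,4)]) (simp add: mpw_def)
  then have "?x ^ (l - 1 - k) * ?x ^ k \<in> gen_ideal F V N"
    by (rule is_idealD(3)[OF is_ideal_gen_ideal])
  moreover have "?x ^ (l - 1 - k) * ?x ^ k = mon (expo j (l - 1))"
    using k(1) by (simp add: mon_expo_power mon_mult expo_add)
  ultimately show ?thesis by simp
qed

text \<open>By pigeonhole some exponent is at least l - 1. There x_j^(l-1) is a combination of the
  F_i up to degree N, and modulo \<open>I0\<close> each F_i equals -x_i^M with M >= N. As l < N, the
  degree goes up.\<close>

lemma raise_degree:
  assumes "mdeg \<alpha> \<ge> card V * l"
  shows "\<exists>s\<in>mpw (mdeg \<alpha> + 1). mon \<alpha> - s \<in> I0"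
proof (cases "supp_in V \<alpha>")
  case False
  then have "mon \<alpha> - 0 \<in> I0" using not_supp_I0 by simp
  then show ?thesis using is_idealD(1)[OF is_ideal_mpw] by blast
next
  case True
  have "\<exists>j\<in>V. l - 1 \<le> \<alpha> j"
  proof (rule ccontr)
    assume "\<not> ?thesis"
    then have "\<alpha> j < l" if "j \<in> V" for j using that by fastforce
    then have "(\<Sum>j\<in>V. \<alpha> j) < (\<Sum>j\<in>V. l)" using V by (intro sum_strict_mono) auto
    moreover have "mdeg \<alpha> = (\<Sum>j\<in>V. \<alpha> j)"
      unfolding mdeg_def by (rule sum.mono_neutral_right) (use True in \<open>auto simp: supp_in_def\<close>)
    ultimately show False using assms by simp
  qed
  then obtain j where j: "j \<in> V" "l - 1 \<le> \<alpha> j" by blast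
  from mindex_split[of "l - 1" \<alpha> j, OF this(2)] obtain \<gamma> where \<gamma>: "\<alpha> = \<gamma> + expo j (l - 1)" by blast
  from var_power_gen[OF j(1)] obtain b where b: "mon (expo j (l - 1)) - (\<Sum>i\<in>V. b i * F i) \<in> mpw N"
    by (auto simp: gen_ideal_def)
  define q where "q = mon (expo j (l - 1)) - (\<Sum>i\<in>V. b i * F i)"
  define s where "s = mon \<gamma> * (q - (\<Sum>i\<in>V. b i * mon (expo i M)))"
  have "(\<Sum>i\<in>V. b i * mon (expo i M)) \<in> mpw N"
    using M(2) by (intro is_ideal_sum[OF is_ideal_mpw] is_idealD(3)[OF is_ideal_mpw]) (simp add: mpw_def)
  from is_idealD(6)[OF is_ideal_mpw b this]
  have "q - (\<Sum>i\<in>V. b i * mon (expo i M)) \<in> mpw N" by (simp only: q_def)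
  then have "s \<in> mpw (mdeg \<gamma> + N)" unfolding s_def by (intro mpw_mult) (simp add: mpw_def)
  moreover have "mdeg \<alpha> + 1 \<le> mdeg \<gamma> + N" using l_less_N by (simp add: \<gamma>)
  ultimately have "s \<in> mpw (mdeg \<alpha> + 1)" using mpw_mono by blast
  moreover have "mon \<alpha> - s \<in> I0"
  proof -
    have "mon \<alpha> = mon \<gamma> * mon (expo j (l - 1))" by (simp add: \<gamma> mon_mult)
    then have "mon \<alpha> - s = mon \<gamma> * (\<Sum>i\<in>V. b i * G i)"
      by (simp add: s_def q_def G_def algebra_simps sum.distrib)
    also have "\<dots> \<in> I0"
      by (intro is_idealD(3)[OF ideal_I0] is_ideal_sum[OF ideal_I0]) (rule G_I0)
    finally show ?thesis .
  qed
  ultimately show ?thesis by blast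
qed

lemma high_degree_I0:
  assumes "mdeg \<alpha> > (\<Sum>j\<in>V. \<kappa> j)"
  shows "mon \<alpha> \<in> I0"
proof (cases "supp_in V \<alpha>")
  case True
  have "\<exists>j\<in>V. \<kappa> j \<le> \<alpha> j"
  proof (rule ccontr)
    assume "\<not> ?thesis"
    then have "(\<Sum>j\<in>V. \<alpha> j) \<le> (\<Sum>j\<in>V. \<kappa> j)" by (intro sum_mono) (auto simp: not_le less_imp_le)
    moreover have "mdeg \<alpha> = (\<Sum>j\<in>V. \<alpha> j)"
      unfolding mdeg_def by (rule sum.mono_neutral_right) (use True in \<open>auto simp: supp_in_def\<close>)
    ultimately show False using assms by simp
  qed
  then obtain j where j: "j \<in> V" "\<kappa> j \<le> \<alpha> j" by blast
  from mindex_split[of "\<kappa> j" \<alpha> j, OF this(2)] obtain \<gamma> where \<gamma>: "\<alpha> = \<gamma> + expo j (\<kappa> j)" by blast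
  have "mon \<gamma> * mon (expo j (\<kappa> j)) \<in> I0" by (rule is_idealD(3)[OF ideal_I0 power_kappa_I0[OF j(1)]])
  then show ?thesis by (simp add: \<gamma> mon_mult)
qed (rule not_supp_I0)

text \<open>Degrees are raised again and again until they exceed the sum of the
  \<open>\<kappa> j\<close>; from there on each monomial contains some
  x_j^(\<open>\<kappa> j\<close>) or a variable outside \<open>V\<close>. This plays the part of
  Nakayama's lemma and shows that truncation at N loses nothing.\<close>

lemma mon_I0: "mdeg \<alpha> \<ge> N \<Longrightarrow> mon \<alpha> \<in> I0"
proof (induct "Suc (\<Sum>j\<in>V. \<kappa> j) - mdeg \<alpha>" arbitrary: \<alpha> rule: less_induct)
  case less
  show ?case
  proof (cases "mdeg \<alpha> > (\<Sum>j\<in>V. \<kappa> j)")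
    case False
    obtain s where s: "s \<in> mpw (mdeg \<alpha> + 1)" "mon \<alpha> - s \<in> I0"
      using raise_degree[of \<alpha>] less.prems N by auto
    have "mon \<beta> \<in> I0" if "\<beta> \<in> keys s" for \<beta>
    proof (rule less.hyps)
      have "mdeg \<beta> \<ge> mdeg \<alpha> + 1" using s(1) that by (auto simp: mpw_def)
      then show "Suc (\<Sum>j\<in>V. \<kappa> j) - mdeg \<beta> < Suc (\<Sum>j\<in>V. \<kappa> j) - mdeg \<alpha>" "N \<le> mdeg \<beta>"
        using False less.prems by auto
    qed
    then have "lin mon s \<in> I0" by (intro lin_in_subspace is_ideal_subspace ideal_I0)
    then have "s \<in> I0" by (simp add: lin_mon)
    with is_idealD(2)[OF ideal_I0 s(2)] show ?thesis by fastforce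
  qed (rule high_degree_I0)
qed

text \<open>The deformation terms x_j^M have degree at least N and therefore vanish in the local
  algebra: deforming did not change it.\<close>

lemma gen_ideal_I0: "gen_ideal F V N \<subseteq> I0"
proof (rule gen_ideal_subset[OF ideal_I0])
  show mpw: "mpw N \<subseteq> I0"
  proof
    fix p :: "'a mpoly" assume "p \<in> mpw N"
    then have "lin mon p \<in> I0"
      by (intro lin_in_subspace is_ideal_subspace ideal_I0 mon_I0) (simp add: mpw_def)
    then show "p \<in> I0" by (simp add: lin_mon)
  qed
  fix j assume j: "j \<in> V"
  have "mon (expo j M) \<in> I0" using M(2) by (intro mon_I0) simp
  from is_idealD(6)[OF ideal_I0 G_I0[OF j] this] show "F j \<in> I0" by (simp add: G_def)
qed

lemma I_subset_gen: "I \<subseteq> gen_ideal F V N"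
proof
  fix p assume "p \<in> I"
  then obtain b where b: "p = (\<Sum>j\<in>V. b j * G j)" unfolding I_iff by blast
  have "mon (expo j M) \<in> gen_ideal F V N" for j
    using M(2) mpw_subset_gen_ideal[of N F V] by (auto simp: mpw_def)
  then have "G j \<in> gen_ideal F V N" if "j \<in> V" for j
    unfolding G_def using gen_in_gen_ideal[OF that] is_idealD(2)[OF is_ideal_gen_ideal] by blast
  then show "p \<in> gen_ideal F V N"
    unfolding b by (intro is_ideal_sum[OF is_ideal_gen_ideal] is_idealD(3)[OF is_ideal_gen_ideal])
qed

lemma one_minus_eta: "(1 - \<eta>) * p \<in> gen_ideal F V N"
proof -
  obtain b where b: "1 - \<eta> = (\<Sum>j\<in>V. b j * mon (expo j (\<kappa> j)))" using \<eta>(3) by blast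
  have "mon (expo j (\<kappa> j)) \<in> gen_ideal F V N" for j
    using \<kappa> mpw_subset_gen_ideal[of N F V] by (auto simp: mpw_def)
  then have "1 - \<eta> \<in> gen_ideal F V N"
    unfolding b by (intro is_ideal_sum[OF is_ideal_gen_ideal] is_idealD(3)[OF is_ideal_gen_ideal])
  then show ?thesis by (rule is_idealD(4)[OF is_ideal_gen_ideal])
qed

definition proj :: "'a mpoly \<Rightarrow> 'a mpoly" where
  "proj p = NF (\<eta> * p)"

lemma proj_cst: "proj (cst c * p) = cst c * proj p"
  by (simp add: proj_def mult.left_commute[of _ "cst c"] lin_cst_mult)

lemma proj_diff: "proj (p - q) = proj p - proj q"
  by (simp add: proj_def right_diff_distrib lin_diff)

lemma proj_sum: "proj (sum f B) = (\<Sum>b\<in>B. proj (f b))"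
  by (simp add: proj_def sum_distrib_left lin_sum)

text \<open>Both directions of the comparison meet here: the projected algebra is that of
  polynomials modulo the truncated ideal, so dimensions in the deformed algebra become statements
  about \<open>gen_ideal\<close>.\<close>

lemma proj_0_iff:
  assumes "p \<in> pvars V"
  shows "proj p = 0 \<longleftrightarrow> p \<in> gen_ideal F V N"
proof
  assume "proj p = 0"
  then have "\<eta> * p \<in> I" by (simp add: proj_def I_def)
  then have "\<eta> * p + (1 - \<eta>) * p \<in> gen_ideal F V N"
    using I_subset_gen one_minus_eta is_idealD(2)[OF is_ideal_gen_ideal] by blast
  then show "p \<in> gen_ideal F V N" by (simp add: algebra_simps)
next
  assume "p \<in> gen_ideal F V N"
  then have "p \<in> I0" using gen_ideal_I0 by blast
  then show "proj p = 0" using assms by (simp add: I0_def pick_pvars proj_def I_def)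
qed

lemma proj_H: "p \<in> H c \<Longrightarrow> proj p \<in> E \<kappa> V c"
proof -
  assume p: "p \<in> H c"
  have "\<eta> * p \<in> H c" using H_mult[OF \<eta>(1) p] by simp
  then have "proj p \<in> A c" unfolding proj_def by (rule NF_H)
  moreover have "mon (expo j (\<kappa> j)) * proj p \<in> I" if "j \<in> V" for j
  proof -
    have "mon (expo j (\<kappa> j)) * (\<eta> * p) = (\<eta> * mon (expo j (\<kappa> j))) * p" by (simp only: mult_ac)
    also have "\<dots> \<in> I" by (rule is_idealD(4)[OF ideal_I \<eta>(2)[OF that]])
    finally show ?thesis unfolding I_def mem_Collect_eq proj_def NF_mult_NF .
  qed
  ultimately show ?thesis by (simp add: E_def)
qed

lemma proj_E: "v \<in> E \<kappa> V c \<Longrightarrow> proj v = v"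
proof -
  assume v: "v \<in> E \<kappa> V c"
  obtain b where b: "1 - \<eta> = (\<Sum>j\<in>V. b j * mon (expo j (\<kappa> j)))" using \<eta>(3) by blast
  have "(1 - \<eta>) * v = (\<Sum>j\<in>V. b j * (mon (expo j (\<kappa> j)) * v))"
    unfolding b sum_distrib_right mult.assoc ..
  also have "\<dots> \<in> I"
    by (rule is_ideal_sum[OF ideal_I], rule is_idealD(3)[OF ideal_I]) (use v in \<open>simp add: E_def\<close>)
  finally have "v - \<eta> * v \<in> I" by (simp add: algebra_simps)
  from NF_cong[OF this] show ?thesis using NF_A[of v c] v by (simp add: proj_def E_def)
qed

lemma E_H: "E \<kappa> V c \<subseteq> H c"
  using A_subset_H by (auto simp: E_def)

definition D :: "int \<Rightarrow> nat" where
  "D c = mp.dim (E \<kappa> V c)"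

lemma D_formula: "\<exists>a. \<forall>c. int (D c) = a + (- 1) ^ card V * (if int m dvd (c + (\<Sum>j\<in>V. w j)) then 1 else 0)"
proof -
  have "m > 0" using m by simp
  note ex = mbox_weight_count[of V w m M, OF cop this M(1)]
  obtain k' where k': "\<forall>c. int (card {\<alpha>\<in>mbox V M. int m dvd (wt w \<alpha> - c)}) =
      k' + (- 1) ^ card V * (if int m dvd (c + (\<Sum>j\<in>V. w j)) then 1 else 0)"
    by (rule exE[OF ex])
  have "mp.dim (A c) = card {\<alpha>\<in>mbox V M. int m dvd (wt w \<alpha> - c)}" for c
    unfolding A_def by (rule mpoly_dim_keys) (simp add: finite_mbox)
  then have "int (D c) = (k' - int k) + (- 1) ^ card V * (if int m dvd (c + (\<Sum>j\<in>V. w j)) then 1 else 0)" for c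
    using dimA[of c] spec[OF k', of c] by (simp add: D_def)
  then show ?thesis by blast
qed

text \<open>Bases of the weight spaces are joined. A combination that lies in the ideal is killed by
  \<open>proj\<close>, but \<open>proj\<close> is the identity on these spaces, so the combination
  is zero; selecting one weight then reduces to independence within that weight space.\<close>

lemma ex_basis:
  obtains e :: "nat \<Rightarrow> 'a mpoly" where "\<And>i. i < (\<Sum>c\<in>{0..<int m}. D c) \<Longrightarrow> e i \<in> pvars V"
    "\<And>u. (\<Sum>i<(\<Sum>c\<in>{0..<int m}. D c). cst (u i) * e i) \<in> gen_ideal F V N \<Longrightarrow>
      \<forall>i<(\<Sum>c\<in>{0..<int m}. D c). u i = 0"
proof -
  let ?C = "{0..<int m}" and ?n = "\<Sum>c\<in>{0..<int m}. D c"
  have "\<exists>B. finite B \<and> B \<subseteq> E \<kappa> V c \<and> mp.independent B \<and> card B = D c" for c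
  proof -
    have "E \<kappa> V c \<subseteq> mp.span (mon ` mbox V M)" using A_finite(1) by (auto simp: E_def)
    then obtain B where "finite B" "B \<subseteq> E \<kappa> V c" "mp.independent B" "E \<kappa> V c \<subseteq> mp.span B"
      "card B = mp.dim (E \<kappa> V c)"
      by (rule mp.finite_basis_of_subspace[OF _ A_finite(2)])
    then show ?thesis unfolding D_def by blast
  qed
  then obtain B where B: "\<And>c. finite (B c)" "\<And>c. B c \<subseteq> E \<kappa> V c" "\<And>c. mp.independent (B c)" "\<And>c. card (B c) = D c"
    by metis
  have BH: "b \<in> H c" if "b \<in> B c" for b c using B(2) E_H that by blast
  let ?Q = "\<lambda>c \<alpha>. int m dvd (wt w \<alpha> - c)"
  have same: "pick (?Q c) b = b" if "b \<in> B c" for b c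
    using BH[OF that] by (intro pick_id) (simp add: H_def)
  have diff: "pick (?Q c) b = 0" if "b \<in> B c'" "c \<in> ?C" "c' \<in> ?C" "c \<noteq> c'" for b c c'
  proof (rule poly_mapping_eqI)
    fix \<alpha>
    show "lookup (pick (?Q c) b) \<alpha> = lookup 0 \<alpha>"
    proof (cases "\<alpha> \<in> keys b \<and> ?Q c \<alpha>")
      case True
      have "int m dvd (wt w \<alpha> - c') - (wt w \<alpha> - c)" by (rule dvd_diff) (use True BH[OF that(1)] in \<open>auto simp: H_def\<close>)
      then have "int m dvd c - c'" by simp
      with that(2-4) have False by (auto dest!: zdvd_imp_le[rotated] simp: mod_eq_dvd_iff[symmetric])
      then show ?thesis ..
    qed (auto simp: in_keys_iff)
  qed
  have nz: "0 \<notin> B c" for c using B(3) mp.dependent_zero by blast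
  have disj: "B c \<inter> B c' = {}" if "c \<in> ?C" "c' \<in> ?C" "c \<noteq> c'" for c c'
    using same diff that nz by (metis disjoint_iff)
  have "card (\<Union>c\<in>?C. B c) = ?n"
    by (subst card_UN_disjoint) (use B disj in auto)
  moreover have finB: "finite (\<Union>c\<in>?C. B c)" using B(1) by auto
  ultimately have "\<exists>e. bij_betw e {..<?n} (\<Union>c\<in>?C. B c)"
    using ex_bij_betw_nat_finite[OF finB] unfolding lessThan_atLeast0 by metis
  then obtain e where e: "bij_betw e {..<?n} (\<Union>c\<in>?C. B c)" ..
  have eE: "\<exists>c\<in>?C. e i \<in> B c" if "i < ?n" for i
    using bij_betwE[OF e] that by blast
  show ?thesis
  proof (rule that[of e])
    fix i assume "i < ?n"
    then show "e i \<in> pvars V" using eE BH H_pvars by blast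
  next
    fix u assume gen: "(\<Sum>i<?n. cst (u i) * e i) \<in> gen_ideal F V N"
    define v where "v = (\<Sum>i<?n. cst (u i) * e i)"
    have "e i \<in> pvars V" if "i < ?n" for i using eE BH H_pvars that by blast
    then have "v \<in> pvars V" unfolding v_def
      by (intro mp.subspace_sum[OF subspace_pvars] mp.subspace_scale[OF subspace_pvars]) auto
    then have "proj v = 0" using proj_0_iff gen by (simp add: v_def)
    moreover have "proj v = v"
    proof -
      have "proj (e i) = e i" if "i < ?n" for i using eE[OF that] B(2) proj_E by blast
      then show ?thesis unfolding v_def proj_sum proj_cst by (intro sum.cong) auto
    qed
    ultimately have v0: "v = 0" by simp
    show "\<forall>i<?n. u i = 0"
    proof (intro allI impI)
      fix i assume i: "i < ?n"
      obtain c where c: "c \<in> ?C" "e i \<in> B c" using eE[OF i] by blast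
      let ?S = "{i. i < ?n \<and> e i \<in> B c}"
      have inj: "inj_on e ?S" by (rule inj_on_subset[OF bij_betw_imp_inj_on[OF e]]) auto
      have img: "e ` ?S = B c"
      proof (intro equalityI subsetI)
        fix b assume b: "b \<in> B c"
        then have "b \<in> e ` {..<?n}" using bij_betw_imp_surj_on[OF e] c(1) by blast
        with b show "b \<in> e ` ?S" by auto
      qed auto
      have "0 = pick (?Q c) v" using v0 by simp
      also have "\<dots> = (\<Sum>i<?n. cst (u i) * pick (?Q c) (e i))"
        unfolding v_def pick_sum pick_cst_mult ..
      also have "\<dots> = (\<Sum>i\<in>?S. cst (u i) * pick (?Q c) (e i))"
      proof (rule sum.mono_neutral_right)
        show "\<forall>i\<in>{..<?n} - ?S. cst (u i) * pick (?Q c) (e i) = 0"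
        proof
          fix i assume i: "i \<in> {..<?n} - ?S"
          then obtain c' where "c' \<in> ?C" "e i \<in> B c'" using eE by blast
          with i diff[of "e i" c' c] c(1) show "cst (u i) * pick (?Q c) (e i) = 0" by auto
        qed
      qed auto
      also have "\<dots> = (\<Sum>i\<in>?S. cst (u i) * e i)" using same by (intro sum.cong) auto
      also have "\<dots> = (\<Sum>b\<in>e ` ?S. cst (u (the_inv_into ?S e b)) * b)"
        unfolding sum.reindex[OF inj] by (intro sum.cong) (auto simp: the_inv_into_f_f[OF inj])
      also have "\<dots> = (\<Sum>b\<in>B c. cst (u (the_inv_into ?S e b)) * b)"
        by (simp only: img)
      finally have "u (the_inv_into ?S e (e i)) = 0"
        using mp.independentD[OF B(3) B(1) order_refl, of "\<lambda>b. u (the_inv_into ?S e b)"] c(2) by simp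
      then show "u i = 0" using the_inv_into_f_f[OF inj, of i] i c(2) by simp
    qed
  qed
qed

lemma total_less: "(\<Sum>c\<in>{0..<int m}. D c) < l"
proof (rule ccontr)
  let ?n = "\<Sum>c\<in>{0..<int m}. D c"
  assume "\<not> ?n < l"
  then have ln: "l \<le> ?n" by simp
  obtain e where e: "\<And>i. i < ?n \<Longrightarrow> e i \<in> pvars V"
    "\<And>u. (\<Sum>i<?n. cst (u i) * e i) \<in> gen_ideal F V N \<Longrightarrow> \<forall>i<?n. u i = 0"
    by (rule ex_basis) blast
  obtain c where c: "\<exists>i<l. c i \<noteq> 0" "(\<Sum>i<l. cst (c i) * e i) \<in> gen_ideal F V N"
    using dep[of e] e(1) ln by (meson order_less_le_trans)
  let ?u = "\<lambda>i. if i < l then c i else 0"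
  have "(\<Sum>i<?n. cst (?u i) * e i) = (\<Sum>i<l. cst (?u i) * e i)"
    by (rule sum.mono_neutral_right) (use ln in auto)
  also have "\<dots> = (\<Sum>i<l. cst (c i) * e i)" by (rule sum.cong) auto
  finally have "\<forall>i<?n. ?u i = 0" using e(2)[of ?u] c(2) by simp
  then show False using c(1) ln by (metis order_less_le_trans)
qed

lemma not_dvd_weight: "j \<in> V \<Longrightarrow> \<not> int m dvd w j"
proof
  assume j: "j \<in> V" and d: "int m dvd w j"
  have "is_unit (int m)" using coprime_common_divisor[OF cop[OF j] d dvd_refl] .
  then show False using m by simp
qed

lemma const_F: "j \<in> V \<Longrightarrow> lookup (F j) 0 = 0"
proof (rule ccontr)
  assume j: "j \<in> V" and "lookup (F j) 0 \<noteq> 0"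
  then have "int m dvd w j" using wtF[OF j, of 0] by (simp add: in_keys_iff)
  then show False using not_dvd_weight[OF j] by blast
qed

lemma one_not_gen: "p \<in> gen_ideal F V N \<Longrightarrow> lookup p 0 = 0"
  using gen_ideal_const_coeff[of p F V N] const_F l_less_N by simp

lemma D_basis:
  obtains B where "finite B" "B \<subseteq> E \<kappa> V c" "E \<kappa> V c \<subseteq> mp.span B" "card B = D c"
proof -
  have "E \<kappa> V c \<subseteq> mp.span (mon ` mbox V M)" using A_finite(1) by (auto simp: E_def)
  then obtain B where "finite B" "B \<subseteq> E \<kappa> V c" "mp.independent B" "E \<kappa> V c \<subseteq> mp.span B"
    "card B = mp.dim (E \<kappa> V c)"
    by (rule mp.finite_basis_of_subspace[OF _ A_finite(2)])
  then show ?thesis using that unfolding D_def by blast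
qed

lemma D_zero:
  assumes "D c = 0" "v \<in> E \<kappa> V c"
  shows "v = 0"
proof -
  obtain B where "finite B" "E \<kappa> V c \<subseteq> mp.span B" "card B = D c" by (rule D_basis)
  then show ?thesis using assms by auto
qed

lemma D_one:
  assumes "D c = 1" "v \<in> E \<kappa> V c" "u \<in> E \<kappa> V c" "u \<noteq> 0"
  shows "\<exists>a. v = cst a * u"
proof -
  obtain B where B: "finite B" "E \<kappa> V c \<subseteq> mp.span B" "card B = D c" by (rule D_basis)
  then obtain b where "B = {b}" using assms(1) card_1_singletonE by metis
  then have "\<And>z. z \<in> E \<kappa> V c \<Longrightarrow> \<exists>x. z = cst x * b"
    using B(2) by (auto simp: mp.span_singleton)
  then obtain x y where xy: "v = cst x * b" "u = cst y * b" using assms by metis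
  with assms(4) have "y \<noteq> 0" by auto
  then have "v = cst (x / y) * u" unfolding xy mult.assoc[symmetric] cst_mult by simp
  then show ?thesis by blast
qed

text \<open>No F_j has a constant term, because -w_j is not 0 modulo m. So 1 stays nonzero in the
  local algebra.\<close>

lemma D0_pos: "D 0 \<ge> 1"
proof (rule ccontr)
  assume "\<not> D 0 \<ge> 1"
  then have "D 0 = 0" by simp
  have one: "1 \<in> H 0" by (simp add: H_def)
  have "proj 1 = 0" using D_zero[OF \<open>D 0 = 0\<close>] proj_H[OF one] by blast
  then have "1 \<in> gen_ideal F V N" using proj_0_iff[of 1] by (simp add: pvars_def)
  from one_not_gen[OF this] show False by simp
qed

lemma sum_residue: "(\<Sum>c\<in>{0..<int m}. if int m dvd (c + \<sigma>) then x else 0) = (x :: int)"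
proof -
  define c0 where "c0 = (- \<sigma>) mod int m"
  have m0: "int m > 0" using m by simp
  have "int m dvd (c + \<sigma>) \<longleftrightarrow> c = c0" if "c \<in> {0..<int m}" for c
  proof -
    have "int m dvd (c + \<sigma>) \<longleftrightarrow> c mod int m = (- \<sigma>) mod int m" by (simp add: mod_eq_dvd_iff)
    then show ?thesis using that by (simp add: c0_def)
  qed
  then have "(\<Sum>c\<in>{0..<int m}. if int m dvd (c + \<sigma>) then x else 0) = (\<Sum>c\<in>{0..<int m}. if c = c0 then x else 0)"
    by (intro sum.cong) auto
  also have "\<dots> = x" using m0 by (simp add: c0_def)
  finally show ?thesis .
qed

text \<open>The dimensions of the weight spaces of the local algebra are \<open>a\<close> plus a correction
  \<open>\<plusminus>1\<close> in one weight. As their sum is less than \<open>l \<le> m\<close>, there is hardly any freedom.\<close>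

lemma dichotomy:
  "(\<forall>j\<in>V. mon (expo j 1) \<in> gen_ideal F V N) \<or>
   ((\<forall>h\<in>H 0. lookup h 0 = 0 \<longrightarrow> h \<in> gen_ideal F V N) \<and>
    (\<exists>e. (\<forall>i<l - 1. e i \<in> pvars V) \<and>
      (\<forall>u. (\<Sum>i<l - 1. cst (u i) * e i) \<in> gen_ideal F V N \<longrightarrow> (\<forall>i<l - 1. u i = 0))))"
proof -
  define \<sigma> where "\<sigma> = (\<Sum>j\<in>V. w j)"
  obtain a where a: "\<And>c. int (D c) = a + (- 1) ^ card V * (if int m dvd (c + \<sigma>) then 1 else 0)"
    using D_formula unfolding \<sigma>_def by blast
  have "(\<Sum>c\<in>{0..<int m}. int (D c)) =
      (\<Sum>c\<in>{0..<int m}. a) + (\<Sum>c\<in>{0..<int m}. if int m dvd (c + \<sigma>) then (- 1) ^ card V else 0)"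
    unfolding sum.distrib[symmetric] by (rule sum.cong) (auto simp: a)
  then have total: "int (\<Sum>c\<in>{0..<int m}. D c) = int m * a + (- 1) ^ card V"
    by (simp add: sum_residue)
  with total_less have less: "int m * a + (- 1) ^ card V < int l" by linarith
  \<comment> \<open>As m >= 2, some weight avoids the exceptional one. Its space has dimension
    exactly \<open>a\<close>, which is thus nonnegative.\<close>
  have "\<not> int m dvd 1" using m by simp
  then have "\<not> (int m dvd (1 + \<sigma>) \<and> int m dvd (0 + \<sigma>))"
    using dvd_diff[of "int m" "1 + \<sigma>" "0 + \<sigma>"] by auto
  then obtain c where c: "\<not> int m dvd (c + \<sigma>)" by blast
  then have a0: "a \<ge> 0" using a[of c] by simp
  show ?thesis
  proof (cases "even (card V)")
    case True
    have "a = 0"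
    proof (rule ccontr)
      assume "a \<noteq> 0"
      then have "int m * 1 \<le> int m * a" using a0 by (intro mult_left_mono) auto
      with less l(2) True show False by simp
    qed
    then have D: "int (D c) = (if int m dvd (c + \<sigma>) then 1 else 0)" for c using a[of c] True by simp
    \<comment> \<open>The algebra is one-dimensional and contains 1, so its only weight is 0; each
      x_j has nonzero weight and must vanish in it.\<close>
    have \<sigma>: "int m dvd \<sigma>" using D0_pos D[of 0] by (auto split: if_splits)
    have "mon (expo j 1) \<in> gen_ideal F V N" if j: "j \<in> V" for j
    proof -
      have "\<not> int m dvd (w j + \<sigma>)" using not_dvd_weight[OF j] \<sigma> by (simp add: dvd_add_left_iff)
      then have "D (w j) = 0" using D[of "w j"] by simp
      moreover have x: "mon (expo j 1) \<in> H (w j)" using mon_expo_H[OF j, of 1] by simp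
      ultimately have "proj (mon (expo j 1)) = 0" using D_zero proj_H by blast
      then show ?thesis using proj_0_iff x H_pvars by blast
    qed
    then show ?thesis by blast
  next
    case False
    have "a \<ge> 1" using D0_pos a[of 0] False by (auto split: if_splits)
    have "a \<le> 1"
    proof (rule ccontr)
      assume "\<not> a \<le> 1"
      then have "int m * 2 \<le> int m * a" by (intro mult_left_mono) auto
      with less l(2) m False show False by simp
    qed
    with \<open>a \<ge> 1\<close> have a1: "a = 1" by simp
    \<comment> \<open>Here m - 1 < l <= m. The local algebra thus has the full dimension l - 1, and
      its weight 0 part consists of the multiples of 1.\<close>
    then have "m = l" using less l(2) False by simp
    then have "int (\<Sum>c\<in>{0..<int m}. D c) = int (l - 1)"
      unfolding total using a1 False l(1) by (simp add: of_nat_diff)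
    then have n: "(\<Sum>c\<in>{0..<int m}. D c) = l - 1" by (simp only: of_nat_eq_iff)
    have D0: "D 0 = 1" using D0_pos a[of 0] a1 False by (auto split: if_splits)
    have one: "1 \<in> H 0" by (simp add: H_def)
    have p1: "proj 1 \<noteq> 0"
      using proj_0_iff[of 1] one_not_gen[of 1] by (auto simp: pvars_def)
    have "h \<in> gen_ideal F V N" if h: "h \<in> H 0" "lookup h 0 = 0" for h
    proof -
      obtain b where b: "proj h = cst b * proj 1"
        using D_one[OF D0 proj_H[OF h(1)] proj_H[OF one] p1] by blast
      have "proj (h - cst b) = 0" using b proj_cst[of b 1] by (simp add: proj_diff)
      moreover have "h - cst b \<in> pvars V"
      proof (rule mp.subspace_diff[OF subspace_pvars])
        show "h \<in> pvars V" using h(1) H_pvars by blast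
      qed (simp add: pvars_def)
      ultimately have gen: "h - cst b \<in> gen_ideal F V N" using proj_0_iff by blast
      from one_not_gen[OF this] h(2) have "b = 0" by (simp add: lookup_minus)
      with gen show ?thesis by simp
    qed
    moreover obtain e where "\<And>i. i < l - 1 \<Longrightarrow> e i \<in> pvars V"
      "\<And>u. (\<Sum>i<l - 1. cst (u i) * e i) \<in> gen_ideal F V N \<Longrightarrow> \<forall>i<l - 1. u i = 0"
      by (rule ex_basis[unfolded n]) (rule that)
    ultimately show ?thesis by blast
  qed
qed

end

context counting
begin

theorem local_algebra_dichotomy:
  "(\<forall>j\<in>V. mon (expo j 1) \<in> gen_ideal F V N) \<or>
   ((\<forall>h\<in>H 0. lookup h 0 = 0 \<longrightarrow> h \<in> gen_ideal F V N) \<and>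
    (\<exists>e. (\<forall>i<l - 1. e i \<in> pvars V) \<and>
      (\<forall>u. (\<Sum>i<l - 1. cst (u i) * e i) \<in> gen_ideal F V N \<longrightarrow> (\<forall>i<l - 1. u i = 0))))"
proof -
  obtain \<kappa> k \<eta> where *: "\<And>j. \<kappa> j \<ge> N" "\<And>c. mp.dim (A c) = k + mp.dim (E \<kappa> V c)"
    "\<eta> \<in> H 0" "\<And>j. j \<in> V \<Longrightarrow> \<eta> * mon (expo j (\<kappa> j)) \<in> I"
    "\<exists>b. 1 - \<eta> = (\<Sum>j\<in>V. b j * mon (expo j (\<kappa> j)))"
    by (rule ex_eta) (rule that)
  interpret counting_eta V F w m N M l \<kappa> k \<eta>
    by unfold_locales (use * in auto)
  show ?thesis by (rule dichotomy)
qed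

end

section \<open>Diagonal actions and the Jacobian ideal\<close>

definition mchar :: "('n::finite \<Rightarrow> 'g \<Rightarrow> complex) \<Rightarrow> ('n \<Rightarrow> nat) \<Rightarrow> 'g \<Rightarrow> complex" where
  "mchar \<xi> \<alpha> g = (\<Prod>i\<in>UNIV. \<xi> i g ^ \<alpha> i)"

lemma mchar_add: "mchar \<xi> (\<alpha> + \<beta>) g = mchar \<xi> \<alpha> g * mchar \<xi> \<beta> g"
  by (simp add: mchar_def plus_fun_apply power_add prod.distrib)

lemma mchar_zero [simp]: "mchar \<xi> 0 g = 1"
  by (simp add: mchar_def zero_fun_apply)

lemma mchar_expo [simp]: "mchar \<xi> (expo j d) g = \<xi> j g ^ d"
proof -
  have "mchar \<xi> (expo j d) g = (\<Prod>i\<in>UNIV. if i = j then \<xi> j g ^ d else 1)"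
    unfolding mchar_def by (rule prod.cong) (auto simp: expo_def)
  then show ?thesis by simp
qed

lemma mchar_eq_1: "supp_in V \<alpha> \<Longrightarrow> (\<And>k. k \<in> V \<Longrightarrow> \<xi> k g = 1) \<Longrightarrow> mchar \<xi> \<alpha> g = 1"
  unfolding mchar_def
proof (rule prod.neutral, rule ballI)
  fix k assume "supp_in V \<alpha>" "\<And>k. k \<in> V \<Longrightarrow> \<xi> k g = 1"
  then show "\<xi> k g ^ \<alpha> k = 1" by (cases "k \<in> V") (simp_all add: supp_in_def)
qed

lemma pick_mpw: "p \<in> mpw N \<Longrightarrow> pick Q p \<in> mpw N"
  by (simp add: mpw_def)

text \<open>Setting the variables outside \<open>V\<close> to zero is a ring homomorphism that does
  not lower degrees, and it kills the generators indexed outside \<open>V\<close>.\<close>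

lemma gen_ideal_pick:
  assumes "p \<in> gen_ideal F S N" "V \<subseteq> S" "\<And>j. j \<in> S - V \<Longrightarrow> pick (supp_in V) (F j) = 0"
  shows "pick (supp_in V) p \<in> gen_ideal (\<lambda>j. pick (supp_in V) (F j)) V N"
proof -
  obtain b where b: "p - (\<Sum>j\<in>S. b j * F j) \<in> mpw N" using assms(1) by (auto simp: gen_ideal_def)
  have "pick (supp_in V) (p - (\<Sum>j\<in>S. b j * F j)) =
      pick (supp_in V) p - (\<Sum>j\<in>S. pick (supp_in V) (b j) * pick (supp_in V) (F j))"
    by (simp only: pick_diff pick_sum pick_supp_mult)
  also have "(\<Sum>j\<in>S. pick (supp_in V) (b j) * pick (supp_in V) (F j)) =
      (\<Sum>j\<in>V. pick (supp_in V) (b j) * pick (supp_in V) (F j))"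
    by (rule sum.mono_neutral_right) (use assms in auto)
  finally show ?thesis
    using pick_mpw[OF b, of "supp_in V"] unfolding gen_ideal_def by auto
qed

lemma lookup_linear_mult:
  fixes b F :: "'n::finite mpoly"
  assumes "lookup F 0 = 0"
  shows "lookup (b * F) (expo s 1) = lookup b 0 * lookup F (expo s 1)"
proof -
  define b' where "b' = b - cst (lookup b 0)"
  have "b' \<in> mpw 1" by (auto simp: mpw_iff b'_def lookup_minus)
  moreover have "F \<in> mpw 1" using assms by (auto simp: mpw_iff)
  ultimately have "b' * F \<in> mpw (1 + 1)" by (rule mpw_mult)
  then have "lookup (b' * F) (expo s 1) = 0" by (simp add: mpw_iff)
  moreover have "b * F = cst (lookup b 0) * F + b' * F" by (simp add: b'_def algebra_simps)
  ultimately show ?thesis by (simp add: lookup_add)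
qed

lemma square_inverse_on:
  fixes c L :: "'n::finite \<Rightarrow> 'n \<Rightarrow> complex" and V :: "'n set"
  assumes "\<And>j s. j \<in> V \<Longrightarrow> s \<in> V \<Longrightarrow> (\<Sum>k\<in>V. c j k * L k s) = (if j = s then 1 else 0)"
    and "k \<in> V" "s \<in> V"
  shows "(\<Sum>j\<in>V. L k j * c j s) = (if k = s then 1 else 0)"
proof -
  \<comment> \<open>Padding by the identity outside \<open>V\<close> turns matrices indexed by
    \<open>V\<close> into square matrices over the whole index type, where left inverses are right
    inverses.\<close>
  define ext where "ext f = (\<chi> a b. if a \<in> V \<and> b \<in> V then f a b else if a = b then 1 else 0)" for f :: "'n \<Rightarrow> 'n \<Rightarrow> complex"
  have mul: "(ext f ** ext h) $ a $ b = (if a \<in> V \<and> b \<in> V then (\<Sum>k\<in>V. f a k * h k b) else if a = b then 1 else 0)"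
    for f h a b
  proof -
    have "(ext f ** ext h) $ a $ b = (\<Sum>k\<in>UNIV. ext f $ a $ k * ext h $ k $ b)"
      by (simp add: matrix_matrix_mult_def)
    also have "\<dots> = (\<Sum>k\<in>(if a \<in> V then V else {a}). ext f $ a $ k * ext h $ k $ b)"
      by (rule sum.mono_neutral_right) (auto simp: ext_def)
    also have "\<dots> = (if a \<in> V \<and> b \<in> V then (\<Sum>k\<in>V. f a k * h k b) else if a = b then 1 else 0)"
      by (auto simp: ext_def intro!: sum.neutral)
    finally show ?thesis .
  qed
  have "ext c ** ext L = mat 1"
    unfolding vec_eq_iff mul mat_def using assms(1) by auto
  then have "ext L ** ext c = mat 1" by (rule matrix_left_right_inverse1)
  then have "(ext L ** ext c) $ k $ s = mat 1 $ k $ s" by simp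
  then show ?thesis unfolding mul using assms(2,3) by (simp add: mat_def)
qed

section \<open>Characters of the group and their orders\<close>

locale diagonal_action =
  fixes G :: "('g, 'b) monoid_scheme" and \<xi> :: "'n::finite \<Rightarrow> 'g \<Rightarrow> complex"
  assumes G: "comm_group G" "finite (carrier G)" and \<xi>: "\<And>i. \<xi> i \<in> hom G complex_units"
begin

sublocale comm_group G by (rule G)

lemma \<xi>_nonzero: "g \<in> carrier G \<Longrightarrow> \<xi> i g \<noteq> 0"
  using \<xi>[of i] by (auto simp: hom_def complex_units_def)

lemma \<xi>_mult: "g \<in> carrier G \<Longrightarrow> h \<in> carrier G \<Longrightarrow> \<xi> i (g \<otimes>\<^bsub>G\<^esub> h) = \<xi> i g * \<xi> i h"
  using \<xi>[of i] by (auto simp: hom_def complex_units_def)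

lemma \<xi>_one: "\<xi> i \<one>\<^bsub>G\<^esub> = 1"
  using \<xi>_mult[of "\<one>\<^bsub>G\<^esub>" "\<one>\<^bsub>G\<^esub>" i] \<xi>_nonzero[of "\<one>\<^bsub>G\<^esub>" i] by simp

lemma \<xi>_inv: "g \<in> carrier G \<Longrightarrow> \<xi> i (inv\<^bsub>G\<^esub> g) = inverse (\<xi> i g)"
  using \<xi>_mult[of "inv\<^bsub>G\<^esub> g" g i] \<xi>_one[of i] \<xi>_nonzero[of g i] by (simp add: field_simps)

lemma \<xi>_pow: "g \<in> carrier G \<Longrightarrow> \<xi> i (g [^]\<^bsub>G\<^esub> (n::nat)) = \<xi> i g ^ n"
  by (induct n) (simp_all add: \<xi>_one \<xi>_mult)

text \<open>The order of the character: its image is a finite subgroup of the nonzero complex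
  numbers, hence a full group of roots of unity (\<open>image_roots_of_unity\<close>).\<close>

definition chord :: "'n \<Rightarrow> nat" where
  "chord i = card (\<xi> i ` carrier G)"

lemma chord_pos: "chord i > 0"
  unfolding chord_def using G(2) one_closed by (auto simp: card_gt_0_iff)

text \<open>Multiplication by an element z of the image permutes the image. Comparing the product of
  all elements before and after gives z^card = 1, and there are no more roots of unity than
  elements.\<close>

lemma image_roots_of_unity: "\<xi> i ` carrier G = {z. z ^ chord i = 1}"
proof -
  let ?S = "\<xi> i ` carrier G"
  have fin: "finite ?S" using G(2) by simp
  have "z ^ chord i = 1" if z: "z \<in> ?S" for z
  proof -
    from z obtain g where g: "g \<in> carrier G" "z = \<xi> i g" by blast
    have nz: "z \<noteq> 0" using g \<xi>_nonzero by simp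
    have "(*) z ` ?S \<subseteq> ?S"
    proof
      fix y assume "y \<in> (*) z ` ?S"
      then obtain h where "h \<in> carrier G" "y = z * \<xi> i h" by auto
      then have "y = \<xi> i (g \<otimes>\<^bsub>G\<^esub> h)" "g \<otimes>\<^bsub>G\<^esub> h \<in> carrier G" using g by (simp_all add: \<xi>_mult)
      then show "y \<in> ?S" by blast
    qed
    moreover have inj: "inj_on ((*) z) ?S" using nz by (auto intro: inj_onI)
    ultimately have "(*) z ` ?S = ?S" using endo_inj_surj[OF fin] by blast
    then have "(\<Prod>y\<in>?S. y) = (\<Prod>y\<in>?S. z * y)" using prod.reindex[OF inj, of "\<lambda>y. y"] by simp
    then have "(\<Prod>y\<in>?S. y) = z ^ card ?S * (\<Prod>y\<in>?S. y)" by (simp add: prod.distrib)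
    moreover have "(\<Prod>y\<in>?S. y) \<noteq> 0" using fin \<xi>_nonzero by auto
    ultimately show ?thesis by (simp add: chord_def)
  qed
  then have "?S \<subseteq> {z. z ^ chord i = 1}" by blast
  moreover have "card {z::complex. z ^ chord i = 1} = chord i"
    using chord_pos[of i] by (intro card_complex_roots_unity) simp
  moreover have "finite {z::complex. z ^ chord i = 1}" using chord_pos[of i] by (intro finite_roots_unity) simp
  ultimately show ?thesis by (intro card_subset_eq) (auto simp: chord_def)
qed

definition zeta :: "'n \<Rightarrow> complex" where
  "zeta i = exp (2 * of_real pi * \<i> / of_nat (chord i))"

lemma zeta_power: "zeta i ^ k = exp (2 * of_real pi * \<i> * of_nat k / of_nat (chord i))"
  unfolding zeta_def exp_of_nat_mult[symmetric] by (rule arg_cong[where f = exp]) simp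

lemma zeta_power_eq_1_iff: "zeta i ^ k = 1 \<longleftrightarrow> chord i dvd k"
  unfolding zeta_power using chord_pos[of i] by (intro complex_root_unity_eq_1) simp

lemma root_is_zeta_power: "z ^ chord i = 1 \<Longrightarrow> \<exists>k. z = zeta i ^ k"
  using complex_roots_unity[of "chord i"] chord_pos[of i] unfolding zeta_power by auto

lemma ex_generator: "\<exists>g\<in>carrier G. \<xi> i g = zeta i"
proof -
  have "zeta i \<in> \<xi> i ` carrier G"
    unfolding image_roots_of_unity using zeta_power_eq_1_iff[of i "chord i"] by simp
  then show ?thesis by (metis imageE)
qed

text \<open>On these coordinates the action factors through a cyclic group.\<close>

definition block :: "'n \<Rightarrow> 'n set" where
  "block i = {j. \<forall>g\<in>carrier G. \<xi> i g = 1 \<longrightarrow> \<xi> j g = 1}"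

text \<open>\<open>g\<close> and the a-th power of \<open>g0\<close> differ by an element of the
  kernel of \<open>\<xi> i\<close>, which acts trivially on the block.\<close>

lemma block_power:
  assumes "j \<in> block i" "g \<in> carrier G" "g0 \<in> carrier G" "\<xi> i g0 = zeta i" "\<xi> i g = zeta i ^ a"
  shows "\<xi> j g = \<xi> j g0 ^ a"
proof -
  let ?h = "g \<otimes>\<^bsub>G\<^esub> inv\<^bsub>G\<^esub> (g0 [^]\<^bsub>G\<^esub> a)"
  have "\<xi> i ?h = 1" using assms \<xi>_nonzero[of "g0" i] by (simp add: \<xi>_mult \<xi>_inv \<xi>_pow)
  then have "\<xi> j ?h = 1" using assms unfolding block_def by auto
  then show ?thesis using assms \<xi>_nonzero[of "g0" j] by (simp add: \<xi>_mult \<xi>_inv \<xi>_pow field_simps)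
qed

lemma block_weights:
  obtains g0 w where "g0 \<in> carrier G" "\<xi> i g0 = zeta i" "\<And>j. j \<in> block i \<Longrightarrow> \<xi> j g0 = zeta i ^ w j"
proof -
  obtain g0 where g0: "g0 \<in> carrier G" "\<xi> i g0 = zeta i" using ex_generator by blast
  have "\<exists>k. \<xi> j g0 = zeta i ^ k" if "j \<in> block i" for j
  proof (rule root_is_zeta_power)
    have "zeta i ^ chord i = 1" using zeta_power_eq_1_iff by simp
    then have "\<xi> i (g0 [^]\<^bsub>G\<^esub> chord i) = 1" using g0 by (simp add: \<xi>_pow)
    then have "\<xi> j (g0 [^]\<^bsub>G\<^esub> chord i) = 1" using that g0 unfolding block_def by auto
    then show "\<xi> j g0 ^ chord i = 1" using g0 by (simp add: \<xi>_pow)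
  qed
  then obtain w where "\<And>j. j \<in> block i \<Longrightarrow> \<xi> j g0 = zeta i ^ w j" by metis
  with g0 that show ?thesis by blast
qed

text \<open>A common divisor d > 1 of the weight and m would make all values of
  \<open>\<xi> j\<close> roots of unity of order dividing m/d, contradicting that
  \<open>\<xi> j\<close> has order at least m.\<close>

lemma block_coprime:
  assumes "j \<in> block i" "g0 \<in> carrier G" "\<xi> i g0 = zeta i" "\<xi> j g0 = zeta i ^ w" "chord i \<le> chord j"
  shows "coprime w (chord i)"
proof (rule ccontr)
  let ?m = "chord i" and ?d = "gcd w (chord i)"
  assume nc: "\<not> coprime w ?m"
  have d: "?d > 1" using nc chord_pos[of i] by (metis coprime_iff_gcd_eq_1 gcd_pos_nat less_numeral_extra(3) nat_neq_iff less_one)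
  obtain q where q: "?m = ?d * q" by (metis dvdE gcd_dvd2)
  obtain v where v: "w = ?d * v" by (metis dvdE gcd_dvd1)
  have qpos: "q \<ge> 1" using q chord_pos[of i] by (cases q) auto
  have "\<xi> j ` carrier G \<subseteq> {z. z ^ q = 1}"
  proof
    fix z assume "z \<in> \<xi> j ` carrier G"
    then obtain g where g: "g \<in> carrier G" "z = \<xi> j g" by blast
    have "\<xi> i g ^ ?m = 1" using image_roots_of_unity[of i] g(1) by blast
    then obtain a where a: "\<xi> i g = zeta i ^ a" using root_is_zeta_power by blast
    have "z = zeta i ^ (w * a)" using block_power[OF assms(1) g(1) assms(2,3) a] g(2) assms(4) by (simp add: power_mult)
    then have "z ^ q = zeta i ^ (w * a * q)" by (simp add: power_mult)
    also have "w * a * q = ?m * (v * a)" by (metis q v mult.assoc mult.commute)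
    also have "zeta i ^ (?m * (v * a)) = 1" unfolding zeta_power_eq_1_iff by simp
    finally show "z \<in> {z. z ^ q = 1}" by simp
  qed
  then have "chord j \<le> card {z::complex. z ^ q = 1}"
    unfolding chord_def using qpos by (intro card_mono finite_roots_unity) auto
  also have "\<dots> = q" by (rule card_complex_roots_unity[OF qpos])
  also have "q < ?m" using d qpos q by (metis mult.commute mult_less_cancel1 nat_mult_1_right less_le_trans zero_less_one)
  finally show False using assms(5) by simp
qed

lemma mchar_block:
  assumes "\<And>j. j \<in> V \<Longrightarrow> \<xi> j g0 = zeta i ^ w j" "supp_in V \<alpha>"
  shows "mchar \<xi> \<alpha> g0 = 1 \<longleftrightarrow> int (chord i) dvd wt (\<lambda>j. int (w j)) \<alpha>"
proof -
  have "\<xi> j g0 ^ \<alpha> j = zeta i ^ (\<alpha> j * w j)" for j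
    using assms by (cases "j \<in> V") (auto simp: supp_in_def power_mult[symmetric] mult.commute)
  then have "mchar \<xi> \<alpha> g0 = zeta i ^ (\<Sum>j\<in>UNIV. \<alpha> j * w j)"
    by (simp add: mchar_def power_sum)
  moreover have "wt (\<lambda>j. int (w j)) \<alpha> = int (\<Sum>j\<in>UNIV. \<alpha> j * w j)" by (simp add: wt_def)
  ultimately show ?thesis unfolding zeta_power_eq_1_iff by (simp only: of_nat_dvd_iff zeta_power_eq_1_iff)
qed

section \<open>Invariants, partial derivatives of invariants, and elimination of a block\<close>

definition inv_poly :: "'n mpoly \<Rightarrow> bool" where
  "inv_poly h \<longleftrightarrow> (\<forall>\<alpha>\<in>keys h. \<forall>g\<in>carrier G. mchar \<xi> \<alpha> g = 1)"

text \<open>Every monomial has the character inverse to \<open>\<xi> j\<close>, as for the j-th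
  partial derivative of an invariant.\<close>

definition covariant :: "'n \<Rightarrow> 'n mpoly \<Rightarrow> bool" where
  "covariant j F \<longleftrightarrow> (\<forall>\<beta>\<in>keys F. \<forall>g\<in>carrier G. mchar \<xi> \<beta> g * \<xi> j g = 1)"

lemma chord_ge_2_nontrivial: "chord j \<ge> 2 \<Longrightarrow> \<exists>g\<in>carrier G. \<xi> j g \<noteq> 1"
proof (rule ccontr)
  assume "chord j \<ge> 2" "\<not> ?thesis"
  then have "\<xi> j ` carrier G \<subseteq> {1}" by auto
  then have "chord j \<le> card {1 :: complex}" unfolding chord_def by (intro card_mono) auto
  with \<open>chord j \<ge> 2\<close> show False by simp
qed

lemma covariant_const: "covariant j F \<Longrightarrow> chord j \<ge> 2 \<Longrightarrow> lookup F 0 = 0"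
proof (rule ccontr)
  assume c: "covariant j F" "chord j \<ge> 2" and "lookup F 0 \<noteq> 0"
  then have 0: "0 \<in> keys F" by (simp only: in_keys_iff not_False_eq_True)
  have "\<xi> j g = 1" if "g \<in> carrier G" for g
  proof -
    have "mchar \<xi> 0 g * \<xi> j g = 1" using c(1) 0 that unfolding covariant_def by blast
    then show ?thesis by simp
  qed
  then show False using chord_ge_2_nontrivial[OF c(2)] by blast
qed

lemma covariant_linear:
  "covariant k F \<Longrightarrow> lookup F (expo s 1) \<noteq> 0 \<Longrightarrow> g \<in> carrier G \<Longrightarrow> \<xi> s g * \<xi> k g = 1"
proof -
  assume c: "covariant k F" "lookup F (expo s 1) \<noteq> 0" "g \<in> carrier G"
  then have "expo s 1 \<in> keys F" by (simp only: in_keys_iff not_False_eq_True)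
  with c have "mchar \<xi> (expo s 1) g * \<xi> k g = 1" unfolding covariant_def by blast
  then show ?thesis by simp
qed

text \<open>By hypothesis \<open>lin\<close> the linear parts of the F_k restricted to
  \<open>V\<close> generate all x_j there, so their coefficient matrix is invertible. Constant
  combinations E_j of the F_k then have linear part exactly x_j. Hypothesis \<open>closed\<close>
  keeps linear terms in variables outside \<open>V\<close> from appearing.\<close>

lemma elimination:
  fixes F :: "'n \<Rightarrow> 'n mpoly"
  assumes VS: "V \<subseteq> S" and N: "N \<ge> 2" and chS: "\<And>j. j \<in> S \<Longrightarrow> chord j \<ge> 2"
    and F: "\<And>j. j \<in> S \<Longrightarrow> F j \<in> pvars S" "\<And>j. j \<in> S \<Longrightarrow> covariant j (F j)"
    and closed: "\<And>k s. k \<in> V \<Longrightarrow> s \<in> S \<Longrightarrow> (\<And>g. g \<in> carrier G \<Longrightarrow> \<xi> s g * \<xi> k g = 1) \<Longrightarrow> s \<in> V"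
    and lin: "\<And>j. j \<in> V \<Longrightarrow> mon (expo j 1) \<in> gen_ideal (\<lambda>j. pick (supp_in V) (F j)) V N"
  obtains E where "\<And>j. j \<in> V \<Longrightarrow> E j \<in> pvars S" "\<And>j. j \<in> V \<Longrightarrow> E j - mon (expo j 1) \<in> mpw 2"
    "\<And>j \<beta> g. j \<in> V \<Longrightarrow> \<beta> \<in> keys (E j) \<Longrightarrow> g \<in> carrier G \<Longrightarrow> mchar \<xi> \<beta> g = \<xi> j g"
    "\<And>j. j \<in> V \<Longrightarrow> E j \<in> gen_ideal F S N"
    "\<And>k. k \<in> V \<Longrightarrow> F k \<in> gen_ideal E V N"
proof -
  let ?FV = "\<lambda>j. pick (supp_in V) (F j)"
  have F0: "lookup (F k) 0 = 0" if "k \<in> S" for k using covariant_const F(2) chS that by blast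
  obtain b where b: "\<And>j. j \<in> V \<Longrightarrow> mon (expo j 1) - (\<Sum>k\<in>V. b j k * ?FV k) \<in> mpw N"
    using lin unfolding gen_ideal_def mem_Collect_eq by metis
  define opp where "opp j k \<longleftrightarrow> (\<forall>g\<in>carrier G. \<xi> j g * \<xi> k g = 1)" for j k
  \<comment> \<open>Only those F_k are combined whose weight equals that of x_j; this makes E_j
    homogeneous of the character \<open>\<xi> j\<close>.\<close>
  define c where "c j k = (if opp j k then lookup (b j k) 0 else 0)" for j k
  define L where "L k s = lookup (F k) (expo s 1)" for k s
  have L_opp: "opp s k" if "k \<in> S" "L k s \<noteq> 0" for k s
    using covariant_linear[OF F(2)[OF that(1)]] that(2) unfolding L_def opp_def by blast
  \<comment> \<open>The index \<open>s\<close> runs over all variables, also outside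
    \<open>V\<close>: the linear part of E_j must be x_j and nothing else.\<close>
  have cL: "(\<Sum>k\<in>V. c j k * L k s) = (if j = s then 1 else 0)" if j: "j \<in> V" for j s
  proof (cases "\<forall>g\<in>carrier G. \<xi> s g = \<xi> j g")
    case True
    then have opp: "opp s k \<longleftrightarrow> opp j k" for k by (simp add: opp_def)
    show ?thesis
    proof (cases "s \<in> V")
      case sV: True
      have "lookup (mon (expo j 1) - (\<Sum>k\<in>V. b j k * ?FV k)) (expo s 1) = 0"
        using b[OF j] N by (simp add: mpw_iff)
      then have "lookup (mon (expo j 1)) (expo s 1) = (\<Sum>k\<in>V. lookup (b j k * ?FV k) (expo s 1))"
        by (simp add: lookup_minus lookup_sum)
      also have "\<dots> = (\<Sum>k\<in>V. c j k * L k s)"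
      proof (rule sum.cong[OF refl])
        fix k assume k: "k \<in> V"
        then have kS: "k \<in> S" using VS by blast
        have "lookup (b j k * ?FV k) (expo s 1) = lookup (b j k) 0 * L k s"
          by (subst lookup_linear_mult) (use F0[OF kS] sV in \<open>simp_all add: L_def\<close>)
        then show "lookup (b j k * ?FV k) (expo s 1) = c j k * L k s"
          using L_opp[OF kS, of s] opp[of k] by (auto simp: c_def)
      qed
      also have "lookup (mon (expo j 1)) (expo s 1) = (if j = s then 1 else 0 :: complex)"
        by (auto simp: lookup_single when_def expo_def fun_eq_iff)
      finally show ?thesis by simp
    next
      case False
      have "L k s = 0" if "k \<in> V" for k
      proof (rule ccontr)
        assume nz: "L k s \<noteq> 0"
        then have opp: "opp s k" using L_opp that VS by blast
        have "expo s 1 \<in> keys (F k)" using nz by (simp add: L_def in_keys_iff)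
        moreover have kS: "k \<in> S" using that VS by blast
        ultimately have "supp_in S (expo s 1)" using F(1)[OF kS] unfolding pvars_def by blast
        then have "s \<in> S" by simp
        then show False using closed[OF that] opp False unfolding opp_def by blast
      qed
      then show ?thesis using False j by auto
    qed
  next
    case False
    have "c j k * L k s = 0" if "k \<in> V" for k
    proof (rule ccontr)
      assume "c j k * L k s \<noteq> 0"
      then have "opp j k" "opp s k" using L_opp[of k s] that VS by (auto simp: c_def split: if_splits)
      then have "\<xi> s g = \<xi> j g" if "g \<in> carrier G" for g
        using that unfolding opp_def by (metis mult_right_cancel mult_zero_right zero_neq_one)
      with False show False by blast
    qed
    then have "(\<Sum>k\<in>V. c j k * L k s) = 0" by (rule sum.neutral[OF ballI])
    moreover have "j \<noteq> s" using False by auto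
    ultimately show ?thesis by simp
  qed
  define E where "E j = (\<Sum>k\<in>V. cst (c j k) * F k)" for j
  show ?thesis
  proof (rule that[of E])
    fix j assume j: "j \<in> V"
    show "E j \<in> pvars S"
      unfolding E_def using F(1) VS
      by (intro mp.subspace_sum[OF subspace_pvars] mp.subspace_scale[OF subspace_pvars]) blast
    show "E j - mon (expo j 1) \<in> mpw 2"
      unfolding mpw_iff
    proof (intro allI impI)
      fix \<alpha> :: "'n \<Rightarrow> nat" assume "mdeg \<alpha> < 2"
      then consider "\<alpha> = 0" | "mdeg \<alpha> = 1" by (metis less_2_cases mdeg_eq_0_iff One_nat_def)
      then show "lookup (E j - mon (expo j 1)) \<alpha> = 0"
      proof cases
        case 1
        have "lookup (F k) 0 = 0" if "k \<in> V" for k using F0 VS that by blast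
        moreover have "expo j 1 \<noteq> (0 :: 'n \<Rightarrow> nat)" by (metis mdeg_expo mdeg_zero zero_neq_one)
        ultimately show ?thesis using 1
          by (simp add: lookup_minus E_def lookup_sum lookup_single when_def)
      next
        case 2
        then have "\<alpha> \<noteq> 0" by auto
        then obtain s where "\<alpha> s \<noteq> 0" by (auto simp: fun_eq_iff zero_fun_apply)
        then have "1 \<le> \<alpha> s" by simp
        from mindex_split[of 1 \<alpha> s, OF this] obtain \<gamma> where \<gamma>: "\<alpha> = \<gamma> + expo s 1" by blast
        with 2 have "\<gamma> = 0" by simp
        with \<gamma> have \<alpha>: "\<alpha> = expo s 1" by simp
        have "lookup (mon (expo j 1)) (expo s 1) = (if j = s then 1 else 0 :: complex)"
          by (auto simp: lookup_single when_def expo_def fun_eq_iff)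
        then show ?thesis using cL[OF j, of s]
          by (simp add: \<alpha> lookup_minus E_def lookup_sum L_def)
      qed
    qed
    show "E j \<in> gen_ideal F S N"
      unfolding E_def
      by (rule is_ideal_sum[OF is_ideal_gen_ideal], rule is_idealD(3)[OF is_ideal_gen_ideal])
         (use gen_in_gen_ideal VS in blast)
  next
    fix j \<beta> g assume j: "j \<in> V" and "\<beta> \<in> keys (E j)" and g: "g \<in> carrier G"
    then have "lookup (E j) \<beta> \<noteq> 0" by (simp only: in_keys_iff not_False_eq_True)
    then have "(\<Sum>k\<in>V. c j k * lookup (F k) \<beta>) \<noteq> 0" by (simp add: E_def lookup_sum)
    then obtain k where "k \<in> V" "c j k * lookup (F k) \<beta> \<noteq> 0"
      by (rule sum.not_neutral_contains_not_neutral)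
    then have k: "k \<in> V" "c j k \<noteq> 0" "lookup (F k) \<beta> \<noteq> 0" by simp_all
    then have "opp j k" by (auto simp: c_def split: if_splits)
    then have "\<xi> j g * \<xi> k g = 1" using g by (simp add: opp_def)
    moreover have "mchar \<xi> \<beta> g * \<xi> k g = 1"
    proof -
      have "k \<in> S" "\<beta> \<in> keys (F k)" using k(1,3) VS by (auto simp: in_keys_iff simp del: lookup_not_eq_zero_eq_in_keys)
      then show ?thesis using F(2) g unfolding covariant_def by blast
    qed
    ultimately have "mchar \<xi> \<beta> g * \<xi> k g = \<xi> j g * \<xi> k g" "\<xi> k g \<noteq> 0" by auto
    then show "mchar \<xi> \<beta> g = \<xi> j g" by simp
  next
    \<comment> \<open>The inverse combination recovers F_k from the E_j, so the E_j can replace the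
      F_k with k in \<open>V\<close> as generators.\<close>
    fix k assume k: "k \<in> V"
    have "(\<Sum>j\<in>V. cst (L k j) * E j) = (\<Sum>s\<in>V. cst (\<Sum>j\<in>V. L k j * c j s) * F s)"
    proof -
      have "(\<Sum>j\<in>V. cst (L k j) * E j) = (\<Sum>j\<in>V. \<Sum>s\<in>V. cst (L k j * c j s) * F s)"
        unfolding E_def sum_distrib_left cst_mult[symmetric] by (simp only: mult.assoc)
      also have "\<dots> = (\<Sum>s\<in>V. \<Sum>j\<in>V. cst (L k j * c j s) * F s)" by (rule sum.swap)
      also have "\<dots> = (\<Sum>s\<in>V. cst (\<Sum>j\<in>V. L k j * c j s) * F s)"
      proof (rule sum.cong[OF refl])
        fix s
        have cs: "(\<Sum>j\<in>T. cst (L k j * c j s)) = cst (\<Sum>j\<in>T. L k j * c j s)" for T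
          by (induct T rule: infinite_finite_induct) (simp_all add: single_add)
        show "(\<Sum>j\<in>V. cst (L k j * c j s) * F s) = cst (\<Sum>j\<in>V. L k j * c j s) * F s"
          by (simp only: sum_distrib_right[symmetric] cs)
      qed
      finally show ?thesis .
    qed
    also have "\<dots> = (\<Sum>s\<in>V. if k = s then F s else 0)"
      by (rule sum.cong) (use square_inverse_on[of V c L k] cL k in auto)
    also have "\<dots> = F k" using k by simp
    finally have "F k = (\<Sum>j\<in>V. cst (L k j) * E j)" by simp
    also have "\<dots> \<in> gen_ideal E V N"
      by (rule is_ideal_sum[OF is_ideal_gen_ideal], rule is_idealD(3)[OF is_ideal_gen_ideal])
         (rule gen_in_gen_ideal)
    finally show "F k \<in> gen_ideal E V N" .
  qed
qed

text \<open>The rules x_j -> -(E_j - x_j) replace a variable of \<open>V\<close> by terms of degree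
  at least 2. Degrees rise until N is reached, when the monomial counts as zero. The map
  \<open>\<rho>\<close> is the resulting normal form; it lands in the remaining variables and
  preserves characters, since each E_j is homogeneous.\<close>

lemma reduction_map:
  fixes E :: "'n \<Rightarrow> 'n mpoly"
  assumes VS: "V \<subseteq> S"
    and E: "\<And>j. j \<in> V \<Longrightarrow> E j \<in> pvars S" "\<And>j. j \<in> V \<Longrightarrow> E j - mon (expo j 1) \<in> mpw 2"
    "\<And>j \<beta> g. j \<in> V \<Longrightarrow> \<beta> \<in> keys (E j) \<Longrightarrow> g \<in> carrier G \<Longrightarrow> mchar \<xi> \<beta> g = \<xi> j g"
  obtains \<rho> where "\<And>p q. \<rho> (p + q) = \<rho> p + \<rho> q" "\<And>c p. \<rho> (cst c * p) = cst c * \<rho> p"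
    "\<And>p. p \<in> gen_ideal E V N \<Longrightarrow> \<rho> p = 0" "\<And>p. p - \<rho> p \<in> gen_ideal E V N"
    "\<And>p. p \<in> pvars S \<Longrightarrow> \<rho> p \<in> pvars (S - V)" "\<And>p. p \<in> pvars (S - V) \<Longrightarrow> p - \<rho> p \<in> mpw N"
    "\<And>p \<delta>. \<delta> \<in> keys (\<rho> p) \<Longrightarrow> \<exists>\<alpha>\<in>keys p. \<forall>g\<in>carrier G. mchar \<xi> \<alpha> g = mchar \<xi> \<delta> g"
proof -
  define tail where "tail j = E j - mon (expo j 1)" for j
  have tail: "2 \<le> mdeg \<beta>" if "j \<in> V" "\<beta> \<in> keys (tail j)" for j \<beta>
    using E(2)[OF that(1)] that(2) by (simp add: tail_def mpw_def)
  interpret R: rewriting V "\<lambda>_. 1" tail "\<lambda>\<alpha>. N \<le> mdeg \<alpha>" "\<lambda>\<alpha>. N - mdeg \<alpha>"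
  proof unfold_locales
    fix j \<gamma> \<beta> assume j: "j \<in> V" "\<beta> \<in> keys (tail j)"
    show "N \<le> mdeg (\<gamma> + expo j 1) \<Longrightarrow> N \<le> mdeg (\<gamma> + \<beta>)" using tail[OF j] by simp
    show "\<not> N \<le> mdeg (\<gamma> + expo j 1) \<Longrightarrow> \<not> N \<le> mdeg (\<gamma> + \<beta>) \<Longrightarrow>
        N - mdeg (\<gamma> + \<beta>) < N - mdeg (\<gamma> + expo j 1)" using tail[OF j] by simp
  qed
  have gen: "mon (expo j 1) + tail j = E j" for j by (simp add: tail_def)
  have keysE: "supp_in S \<beta> \<and> (\<forall>g\<in>carrier G. mchar \<xi> \<beta> g = \<xi> j g)" if j: "j \<in> V" "\<beta> \<in> keys (tail j)" for j \<beta>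
  proof (cases "\<beta> \<in> keys (E j)")
    case True
    then show ?thesis using E(1,3) j by (auto simp: pvars_def)
  next
    case False
    then have "\<beta> = expo j 1" using j(2) by (auto simp: tail_def in_keys_iff lookup_minus lookup_single when_def split: if_splits)
    then show ?thesis using j VS by auto
  qed
  let ?Q = "\<lambda>\<alpha> \<delta>. (supp_in S \<alpha> \<longrightarrow> supp_in S \<delta>) \<and> (\<forall>g\<in>carrier G. mchar \<xi> \<alpha> g = mchar \<xi> \<delta> g)"
  have nfk: "R.red \<delta> \<and> ?Q \<alpha> \<delta>" if "\<delta> \<in> keys (R.nf \<alpha>)" for \<alpha> \<delta>
  proof (rule R.nf_keys[OF _ _ that])
    fix j \<gamma> \<beta> \<delta>' assume j: "j \<in> V" "\<beta> \<in> keys (tail j)" and Q: "?Q (\<gamma> + \<beta>) \<delta>'"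
    from keysE[OF j] have "supp_in S \<beta>" "\<And>g. g \<in> carrier G \<Longrightarrow> mchar \<xi> \<beta> g = \<xi> j g" by auto
    with Q show "?Q (\<gamma> + expo j 1) \<delta>'" by (simp add: mchar_add)
  qed auto
  have nfS: "R.nf \<alpha> \<in> {p. \<forall>\<delta>\<in>keys p. R.red \<delta> \<and> ?Q \<alpha> \<delta>}" for \<alpha> using nfk by blast
  have redW: "supp_in (S - V) \<delta>" if "R.red \<delta>" "supp_in S \<delta>" for \<delta>
    using that unfolding R.red_def supp_in_def by auto
  show ?thesis
  proof (rule that[of "lin R.nf"])
    show "lin R.nf (p + q) = lin R.nf p + lin R.nf q" "lin R.nf (cst c * p) = cst c * lin R.nf p" for p q c
      by (rule lin_add, rule lin_cst_mult)
    show "lin R.nf p = 0" if p: "p \<in> gen_ideal E V N" for p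
    proof -
      from p obtain b where b: "p - (\<Sum>j\<in>V. b j * E j) \<in> mpw N" by (auto simp: gen_ideal_def)
      have "lin R.nf (p - (\<Sum>j\<in>V. b j * E j)) = 0"
        by (rule R.lin_nf_Z) (use b in \<open>simp add: mpw_def\<close>)
      moreover have "lin R.nf (b j * E j) = 0" if "j \<in> V" for j
        using R.lin_nf_gen[OF that, of "b j"] by (simp only: gen)
      ultimately show ?thesis by (simp add: lin_diff lin_sum)
    qed
    show "p - lin R.nf p \<in> gen_ideal E V N" for p
    proof (rule R.diff_lin_nf_ideal[OF is_ideal_gen_ideal])
      show "j \<in> V \<Longrightarrow> mon (expo j 1) + tail j \<in> gen_ideal E V N" for j
        unfolding gen by (rule gen_in_gen_ideal)
      show "N \<le> mdeg \<alpha> \<Longrightarrow> mon \<alpha> \<in> gen_ideal E V N" for \<alpha>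
        using mpw_subset_gen_ideal[of N E V] by (auto simp: mpw_def)
    qed
    show "lin R.nf p \<in> pvars (S - V)" if "p \<in> pvars S" for p
      unfolding pvars_def
    proof (rule lin_in_subspace[OF subspace_keys])
      fix \<alpha> assume "\<alpha> \<in> keys p"
      then have "supp_in S \<alpha>" using that by (simp add: pvars_def)
      then show "R.nf \<alpha> \<in> {p. \<forall>\<alpha>\<in>keys p. supp_in (S - V) \<alpha>}" using nfS[of \<alpha>] redW by blast
    qed
    show "p - lin R.nf p \<in> mpw N" if p: "p \<in> pvars (S - V)" for p
    proof -
      let ?lo = "pick (\<lambda>\<alpha>. mdeg \<alpha> < N) p"
      have hi: "p - ?lo \<in> mpw N" by (simp add: mpw_iff lookup_minus)
      have "lin R.nf (p - ?lo) = 0" by (rule R.lin_nf_Z) (use hi in \<open>simp add: mpw_def\<close>)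
      moreover have "lin R.nf ?lo = ?lo"
        by (rule R.lin_nf_red, unfold R.red_def) (use p in \<open>auto simp: pvars_def supp_in_def\<close>)
      ultimately have "lin R.nf p = ?lo" by (simp add: lin_diff)
      with hi show ?thesis by simp
    qed
    show "\<exists>\<alpha>\<in>keys p. \<forall>g\<in>carrier G. mchar \<xi> \<alpha> g = mchar \<xi> \<delta> g" if "\<delta> \<in> keys (lin R.nf p)" for p \<delta>
    proof -
      have "lookup (lin R.nf p) \<delta> \<noteq> 0" using that by (simp only: in_keys_iff not_False_eq_True)
      then have "(\<Sum>\<alpha>\<in>keys p. lookup p \<alpha> * lookup (R.nf \<alpha>) \<delta>) \<noteq> 0" by (simp add: lin_def lookup_sum)
      then obtain \<alpha> where "\<alpha> \<in> keys p" "lookup p \<alpha> * lookup (R.nf \<alpha>) \<delta> \<noteq> 0"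
        by (rule sum.not_neutral_contains_not_neutral)
      then have "\<delta> \<in> keys (R.nf \<alpha>)" by (simp add: in_keys_iff del: lookup_not_eq_zero_eq_in_keys)
      with nfk \<open>\<alpha> \<in> keys p\<close> show ?thesis by blast
    qed
  qed
qed

lemma ex_degree_bound:
  fixes F :: "'n \<Rightarrow> 'n mpoly"
  obtains D where "\<And>j \<beta>. \<beta> \<in> keys (F j) \<Longrightarrow> mdeg \<beta> < D"
proof -
  have fin: "finite (\<Union>j. mdeg ` keys (F j))" by simp
  show ?thesis
  proof (rule that)
    fix j \<beta> assume "\<beta> \<in> keys (F j)"
    then have "mdeg \<beta> \<le> Max (\<Union>j. mdeg ` keys (F j))" by (intro Max_ge fin) blast
    then show "mdeg \<beta> < Suc (Max (\<Union>j. mdeg ` keys (F j)))" by simp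
  qed
qed

text \<open>Induction on the number of variables. A block whose local algebra has dimension l - 1
  leaves no room for more, which settles the claim at once; a block with trivial local algebra is
  eliminated. The bound on \<open>N\<close> uses all variables, so it holds at every stage of the
  induction.\<close>

theorem invariants_in_ideal:
  fixes F :: "'n \<Rightarrow> 'n mpoly" and l N :: nat
  assumes "l \<ge> 2" "N > CARD('n) * l" and "\<And>j. j \<in> S \<Longrightarrow> l \<le> chord j"
    and "\<And>j. j \<in> S \<Longrightarrow> F j \<in> pvars S" "\<And>j. j \<in> S \<Longrightarrow> covariant j (F j)"
    and "\<And>h. (\<And>i. i < l \<Longrightarrow> h i \<in> pvars S) \<Longrightarrow>
      \<exists>c. (\<exists>i<l. c i \<noteq> 0) \<and> (\<Sum>i<l. cst (c i) * h i) \<in> gen_ideal F S N"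
    and "h \<in> pvars S" "inv_poly h" "lookup h 0 = 0"
  shows "h \<in> gen_ideal F S N"
  using assms(3-)
proof (induct "card S" arbitrary: S F h rule: less_induct)
  case less
  note lS = less(2) and FS = less(3) and cov = less(4) and dep = less(5) and hS = less(6) and hinv = less(7) and h0 = less(8)
  show ?case
  proof (cases "S = {}")
    case True
    have "h = 0"
    proof (rule poly_mapping_eqI)
      fix \<alpha>
      show "lookup h \<alpha> = lookup 0 \<alpha>"
      proof (cases "\<alpha> \<in> keys h")
        case \<alpha>: True
        then have "\<alpha> = 0" using hS True by (auto simp: pvars_def supp_in_def fun_eq_iff zero_fun_apply)
        with h0 show ?thesis by simp
      qed (simp add: in_keys_iff)
    qed
    then show ?thesis using is_idealD(1)[OF is_ideal_gen_ideal] by simp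
  next
    case False
    \<comment> \<open>Minimality of the order of \<open>\<xi> i\<close> makes the weights in its
      block units modulo m.\<close>
    then obtain i where i: "i \<in> S" "\<And>j. j \<in> S \<Longrightarrow> chord i \<le> chord j"
      using ex_min_if_finite[of "chord ` S"] by (auto simp: not_less)
    define m where "m = chord i"
    define V where "V = block i \<inter> S"
    have VS: "V \<subseteq> S" and iV: "i \<in> V" using i by (auto simp: V_def block_def)
    obtain g0 w where g0: "g0 \<in> carrier G" "\<xi> i g0 = zeta i" "\<And>j. j \<in> block i \<Longrightarrow> \<xi> j g0 = zeta i ^ w j"
      by (rule block_weights) (rule that)
    define FV where "FV j = pick (supp_in V) (F j)" for j
    \<comment> \<open>Some g fixes all variables of \<open>V\<close> but not x_j. A monomial of F_j
      has the inverse of a nontrivial value at g, so it involves a variable outside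
      \<open>V\<close>.\<close>
    have vanish: "pick (supp_in V) (F j) = 0" if j: "j \<in> S - V" for j
    proof -
      obtain g where g: "g \<in> carrier G" "\<xi> i g = 1" "\<xi> j g \<noteq> 1" using j by (auto simp: V_def block_def)
      have "\<not> supp_in V \<beta>" if "\<beta> \<in> keys (F j)" for \<beta>
      proof
        assume "supp_in V \<beta>"
        then have "mchar \<xi> \<beta> g = 1" by (rule mchar_eq_1) (use g in \<open>auto simp: V_def block_def\<close>)
        moreover have "mchar \<xi> \<beta> g * \<xi> j g = 1" using cov j that g(1) unfolding covariant_def by blast
        ultimately show False using g(3) by simp
      qed
      then show ?thesis by (intro poly_mapping_eqI) (auto simp: in_keys_iff)
    qed
    have restrict: "pick (supp_in V) p \<in> gen_ideal FV V N" if "p \<in> gen_ideal F S N" for p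
      unfolding FV_def using that VS vanish by (rule gen_ideal_pick)
    have pVS: "pvars V \<subseteq> pvars S" using VS by (auto simp: pvars_def supp_in_def)
    obtain D where D: "\<And>j \<beta>. \<beta> \<in> keys (FV j) \<Longrightarrow> mdeg \<beta> < D" using ex_degree_bound by blast
    have m2: "m \<ge> 2" using lS[OF i(1)] assms(1) by (simp add: m_def)
    \<comment> \<open>Congruent to -1 modulo m, and above both N and all degrees of the restricted
      generators.\<close>
    define M where "M = m * (N + D + 1) - 1"
    have Suc_M: "Suc M = m * (N + D + 1)" using m2 by (simp add: M_def)
    have M: "int m dvd int M + 1" "N \<le> M" "D \<le> M"
    proof -
      have "int M + 1 = int (Suc M)" by simp
      then show "int m dvd int M + 1" unfolding Suc_M by simp
      have "2 * (N + D + 1) \<le> m * (N + D + 1)" using m2 by (rule mult_le_mono1)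
      then show "N \<le> M" "D \<le> M" using Suc_M by simp_all
    qed
    interpret C: counting V FV "\<lambda>j. int (w j)" m N M l
    proof unfold_locales
      show "V \<noteq> {}" using iV by blast
      show "2 \<le> m" by (rule m2)
      show "1 \<le> l" using assms(1) by simp
      show "l \<le> m" using lS[OF i(1)] by (simp add: m_def)
      have "card V \<le> CARD('n)" by (intro card_mono) auto
      then have "card V * l \<le> CARD('n) * l" by (rule mult_le_mono1)
      then show "card V * l < N" using assms(2) by (rule le_less_trans)
      show "int m dvd int M + 1" "N \<le> M" by (fact M)+
    next
      fix j assume j: "j \<in> V"
      have "coprime (w j) (chord i)"
        using block_coprime[OF _ g0(1,2) g0(3)] i(2) j by (auto simp: V_def)
      then show "coprime (int (w j)) (int m)" by (simp add: m_def)
      show "FV j \<in> pvars V" unfolding FV_def by (rule pick_in_pvars)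
      fix \<beta> assume \<beta>: "\<beta> \<in> keys (FV j)"
      show "mdeg \<beta> < M" using D[OF \<beta>] M(3) by simp
      have "mchar \<xi> (\<beta> + expo j 1) g0 = 1"
        using cov[of j] j VS \<beta> g0(1) unfolding covariant_def FV_def by (auto simp: mchar_add)
      moreover have "supp_in V (\<beta> + expo j 1)" using j \<beta> by (simp add: FV_def)
      moreover have "\<And>j. j \<in> V \<Longrightarrow> \<xi> j g0 = zeta i ^ w j" using g0(3) by (simp add: V_def)
      ultimately have "int (chord i) dvd wt (\<lambda>j. int (w j)) (\<beta> + expo j 1)" using mchar_block by blast
      then show "int m dvd wt (\<lambda>j. int (w j)) \<beta> + int (w j)" by (simp add: m_def)
    next
      fix h :: "nat \<Rightarrow> 'n mpoly" assume h: "\<And>i. i < l \<Longrightarrow> h i \<in> pvars V"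
      then obtain c where c: "\<exists>i<l. c i \<noteq> 0" "(\<Sum>i<l. cst (c i) * h i) \<in> gen_ideal F S N"
        using dep[of h] pVS by blast
      have "pick (supp_in V) (\<Sum>i<l. cst (c i) * h i) = (\<Sum>i<l. cst (c i) * h i)"
        by (rule pick_pvars) (use h in \<open>auto intro!: mp.subspace_sum[OF subspace_pvars] mp.subspace_scale[OF subspace_pvars]\<close>)
      then show "\<exists>c. (\<exists>i<l. c i \<noteq> 0) \<and> (\<Sum>i<l. cst (c i) * h i) \<in> gen_ideal FV V N"
        using restrict[OF c(2)] c(1) by auto
    qed
    from C.local_algebra_dichotomy show ?thesis
    proof (elim disjE conjE exE)
      assume inv: "\<forall>h\<in>C.H 0. lookup h 0 = 0 \<longrightarrow> h \<in> gen_ideal FV V N"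
      fix e assume e: "\<forall>i<l - 1. e i \<in> pvars V"
        "\<forall>u. (\<Sum>i<l - 1. cst (u i) * e i) \<in> gen_ideal FV V N \<longrightarrow> (\<forall>i<l - 1. u i = 0)"
      \<comment> \<open>The l - 1 independent elements of the block together with \<open>h\<close>
        make l polynomials, hence there is a relation in the full algebra. Restricted to the block,
        \<open>h\<close> vanishes, so the coefficients of the \<open>e i\<close> are zero and the
        relation says that a nonzero multiple of \<open>h\<close> lies in the ideal.\<close>
      define h' where "h' i = (if i < l - 1 then e i else h)" for i
      have "h' i \<in> pvars S" for i using e(1) pVS hS by (auto simp: h'_def)
      then obtain c where c: "\<exists>i<l. c i \<noteq> 0" "(\<Sum>i<l. cst (c i) * h' i) \<in> gen_ideal F S N"
        using dep[of h'] by blast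
      have l: "l = Suc (l - 1)" using assms(1) by simp
      have sum: "(\<Sum>i<l. cst (c i) * h' i) = (\<Sum>i<l - 1. cst (c i) * e i) + cst (c (l - 1)) * h"
        by (subst l, subst sum.lessThan_Suc) (simp add: h'_def)
      have hV: "pick (supp_in V) h \<in> gen_ideal FV V N"
      proof -
        have "pick (supp_in V) h \<in> C.H 0"
          unfolding C.H_def
        proof (intro CollectI ballI conjI)
          fix \<alpha> assume \<alpha>: "\<alpha> \<in> keys (pick (supp_in V) h)"
          then show "supp_in V \<alpha>" by simp
          moreover have "mchar \<xi> \<alpha> g0 = 1" using hinv \<alpha> g0(1) by (simp add: inv_poly_def)
          moreover have "\<And>j. j \<in> V \<Longrightarrow> \<xi> j g0 = zeta i ^ w j" using g0(3) by (simp add: V_def)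
          ultimately show "int m dvd wt (\<lambda>j. int (w j)) \<alpha> - 0" using mchar_block[of V g0 i w \<alpha>] by (simp add: m_def)
        qed
        with inv h0 show ?thesis by simp
      qed
      have "pick (supp_in V) (e i) = e i" if "i < l - 1" for i using e(1) that by (simp add: pick_pvars)
      then have "(\<Sum>i<l - 1. cst (c i) * e i) = (\<Sum>i<l - 1. cst (c i) * pick (supp_in V) (e i))"
        by (intro sum.cong) auto
      also have "\<dots> = pick (supp_in V) (\<Sum>i<l. cst (c i) * h' i) - cst (c (l - 1)) * pick (supp_in V) h"
        unfolding sum by (simp add: pick_add pick_sum pick_cst_mult)
      also have "\<dots> \<in> gen_ideal FV V N"
        by (rule is_idealD(6)[OF is_ideal_gen_ideal restrict[OF c(2)] is_idealD(3)[OF is_ideal_gen_ideal hV]])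
      finally have z: "\<forall>i<l - 1. c i = 0" using e(2) by blast
      have "c (l - 1) \<noteq> 0"
      proof
        assume "c (l - 1) = 0"
        with z have "c i = 0" if "i < l" for i using that l by (metis less_antisym)
        with c(1) show False by blast
      qed
      then have "h = cst (1 / c (l - 1)) * (cst (c (l - 1)) * h)"
        unfolding mult.assoc[symmetric] cst_mult by simp
      moreover have "(\<Sum>i<l. cst (c i) * h' i) = cst (c (l - 1)) * h" unfolding sum using z by simp
      ultimately show ?thesis using is_idealD(3)[OF is_ideal_gen_ideal c(2)] by metis
    next
      assume lin: "\<forall>j\<in>V. mon (expo j 1) \<in> gen_ideal FV V N"
      have N2: "N \<ge> 2"
      proof -
        have "1 * l \<le> CARD('n) * l" by (rule mult_le_mono1) (simp add: Suc_leI)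
        then show ?thesis using assms(1,2) by linarith
      qed
      have ch2: "chord j \<ge> 2" if "j \<in> S" for j using lS[OF that] assms(1) by simp
      \<comment> \<open>Inverse characters have the same kernel, so a variable with character
        inverse to one in the block belongs to it.\<close>
      have closed: "s \<in> V" if "k \<in> V" "s \<in> S" "\<And>g. g \<in> carrier G \<Longrightarrow> \<xi> s g * \<xi> k g = 1" for k s
        using that unfolding V_def block_def by (auto dest!: bspec) (metis mult.right_neutral)
      obtain E where E: "\<And>j. j \<in> V \<Longrightarrow> E j \<in> pvars S" "\<And>j. j \<in> V \<Longrightarrow> E j - mon (expo j 1) \<in> mpw 2"
        "\<And>j \<beta> g. j \<in> V \<Longrightarrow> \<beta> \<in> keys (E j) \<Longrightarrow> g \<in> carrier G \<Longrightarrow> mchar \<xi> \<beta> g = \<xi> j g"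
        "\<And>j. j \<in> V \<Longrightarrow> E j \<in> gen_ideal F S N" "\<And>k. k \<in> V \<Longrightarrow> F k \<in> gen_ideal E V N"
      proof (rule elimination[OF VS N2 ch2 FS cov closed])
        show "\<And>j. j \<in> V \<Longrightarrow> mon (expo j 1) \<in> gen_ideal (\<lambda>j. pick (supp_in V) (F j)) V N"
          using lin unfolding FV_def by blast
      qed (assumption | rule that)+
      obtain \<rho> where \<rho>: "\<And>p q. \<rho> (p + q) = \<rho> p + \<rho> q" "\<And>c p. \<rho> (cst c * p) = cst c * \<rho> p"
        "\<And>p. p \<in> gen_ideal E V N \<Longrightarrow> \<rho> p = 0" "\<And>p. p - \<rho> p \<in> gen_ideal E V N"
        "\<And>p. p \<in> pvars S \<Longrightarrow> \<rho> p \<in> pvars (S - V)" "\<And>p. p \<in> pvars (S - V) \<Longrightarrow> p - \<rho> p \<in> mpw N"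
        "\<And>p \<delta>. \<delta> \<in> keys (\<rho> p) \<Longrightarrow> \<exists>\<alpha>\<in>keys p. \<forall>g\<in>carrier G. mchar \<xi> \<alpha> g = mchar \<xi> \<delta> g"
        by (rule reduction_map[OF VS E(1-3)]) (assumption | rule that)+
      have \<rho>_diff: "\<rho> (p - q) = \<rho> p - \<rho> q" for p q
        using \<rho>(1)[of "p - q" q] by simp
      have \<rho>_cong: "\<rho> p = \<rho> q" if "p - q \<in> gen_ideal E V N" for p q
        using \<rho>(3)[OF that] by (simp add: \<rho>_diff)
      have \<rho>0: "\<rho> 0 = 0" using \<rho>(1)[of 0 0] by simp
      have \<rho>_sum: "\<rho> (sum f A) = (\<Sum>a\<in>A. \<rho> (f a))" for f A
        by (induct A rule: infinite_finite_induct) (simp_all add: \<rho>0 \<rho>(1))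
      let ?W = "S - V"
      define F' where "F' j = \<rho> (F j)" for j
      note giI = is_ideal_gen_ideal
      have E_sub: "gen_ideal E V N \<subseteq> gen_ideal F S N"
        by (rule gen_ideal_subset[OF giI _ mpw_subset_gen_ideal]) (rule E(4))
      have F'_sub: "gen_ideal F' ?W N \<subseteq> gen_ideal F S N"
      proof (rule gen_ideal_subset[OF giI _ mpw_subset_gen_ideal])
        fix j assume j: "j \<in> ?W"
        have "F j - \<rho> (F j) \<in> gen_ideal F S N" using \<rho>(4) E_sub by blast
        moreover have "F j \<in> gen_ideal F S N" by (rule gen_in_gen_ideal) (use j in blast)
        ultimately have "F j - (F j - \<rho> (F j)) \<in> gen_ideal F S N" by (metis is_idealD(6)[OF giI])
        then show "F' j \<in> gen_ideal F S N"
          by (simp add: F'_def)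
      qed
      have trans: "\<rho> v \<in> gen_ideal F' ?W N" if v: "v \<in> gen_ideal F S N" and vS: "v \<in> pvars S" for v
      proof -
        from v obtain b' where b': "v - (\<Sum>j\<in>S. b' j * F j) \<in> mpw N" by (auto simp: gen_ideal_def)
        \<comment> \<open>The coefficients may be taken in the variables of \<open>S\<close>; then
          their images under \<open>\<rho>\<close> involve only the remaining variables, where
          \<open>\<rho>\<close> is the identity up to degree N.\<close>
        define b where "b = (\<lambda>j. pick (supp_in S) (b' j))"
        from pick_mpw[OF b', of "supp_in S"]
        have "pick (supp_in S) v - (\<Sum>j\<in>S. pick (supp_in S) (b' j) * pick (supp_in S) (F j)) \<in> mpw N"
          by (simp only: pick_diff pick_sum pick_supp_mult)
        also have "(\<Sum>j\<in>S. pick (supp_in S) (b' j) * pick (supp_in S) (F j)) = (\<Sum>j\<in>S. pick (supp_in S) (b' j) * F j)"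
          by (rule sum.cong) (simp_all add: pick_pvars[OF FS])
        finally have b: "v - (\<Sum>j\<in>S. b j * F j) \<in> mpw N" by (simp only: pick_pvars[OF vS] b_def)
        have bS: "b j \<in> pvars S" for j by (simp add: b_def pick_in_pvars)
        from b have "\<rho> v = \<rho> (\<Sum>j\<in>S. b j * F j)" using mpw_subset_gen_ideal[of N E V] by (intro \<rho>_cong) blast
        also have "\<dots> = (\<Sum>j\<in>S. \<rho> (b j * F j))" by (rule \<rho>_sum)
        also have "\<dots> \<in> gen_ideal F' ?W N"
        proof (rule is_ideal_sum[OF giI])
          fix j assume j: "j \<in> S"
          show "\<rho> (b j * F j) \<in> gen_ideal F' ?W N"
          proof (cases "j \<in> V")
            case True
            then have "\<rho> (b j * F j) = 0" by (intro \<rho>(3) is_idealD(3)[OF giI E(5)])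
            then show ?thesis using is_idealD(1)[OF giI] by simp
          next
            case jV: False
            have "\<rho> (b j) * F' j \<in> pvars ?W" unfolding F'_def by (intro pvars_mult \<rho>(5) FS[OF j] bS)
            then have d: "\<rho> (b j) * F' j - \<rho> (\<rho> (b j) * F' j) \<in> gen_ideal F' ?W N"
              using \<rho>(6) mpw_subset_gen_ideal by blast
            \<comment> \<open>\<open>\<rho>\<close> is not multiplicative, but it is constant on
              classes modulo the E_j, so a product may be replaced by the product of images before
              it is applied.\<close>
            have "\<rho> (b j * F j) = \<rho> (\<rho> (b j) * F' j)"
            proof (rule \<rho>_cong)
              have "b j * F j - \<rho> (b j) * F' j = b j * (F j - F' j) + F' j * (b j - \<rho> (b j))"
                by (simp add: algebra_simps)
              also have "\<dots> \<in> gen_ideal E V N"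
                unfolding F'_def by (rule is_idealD(2)[OF giI is_idealD(3)[OF giI \<rho>(4)] is_idealD(3)[OF giI \<rho>(4)]])
              finally show "b j * F j - \<rho> (b j) * F' j \<in> gen_ideal E V N" .
            qed
            moreover have "\<rho> (b j) * F' j \<in> gen_ideal F' ?W N"
              using j jV by (intro is_idealD(3)[OF giI] gen_in_gen_ideal) blast
            ultimately show ?thesis using is_idealD(6)[OF giI _ d] by force
          qed
        qed
        finally show ?thesis .
      qed
      \<comment> \<open>A relation modulo the old ideal between polynomials in the remaining
        variables is carried by \<open>\<rho>\<close> to one modulo the new ideal, so the dependence
        hypothesis survives elimination.\<close>
      have dep': "\<exists>c. (\<exists>i<l. c i \<noteq> 0) \<and> (\<Sum>i<l. cst (c i) * h i) \<in> gen_ideal F' ?W N"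
        if h: "\<And>i. i < l \<Longrightarrow> h i \<in> pvars ?W" for h
      proof -
        have "pvars ?W \<subseteq> pvars S" by (auto simp: pvars_def supp_in_def)
        with h obtain c where c: "\<exists>i<l. c i \<noteq> 0" "(\<Sum>i<l. cst (c i) * h i) \<in> gen_ideal F S N"
          using dep[of h] by blast
        let ?v = "\<Sum>i<l. cst (c i) * h i"
        have vW: "?v \<in> pvars ?W"
          by (rule mp.subspace_sum[OF subspace_pvars], rule mp.subspace_scale[OF subspace_pvars]) (use h in auto)
        then have "?v - \<rho> ?v \<in> gen_ideal F' ?W N" using \<rho>(6) mpw_subset_gen_ideal by blast
        moreover have "?v \<in> pvars S" using vW \<open>pvars ?W \<subseteq> pvars S\<close> by blast
        ultimately have "?v - \<rho> ?v + \<rho> ?v \<in> gen_ideal F' ?W N"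
          using is_idealD(2)[OF giI] trans[OF c(2)] by blast
        then have "?v \<in> gen_ideal F' ?W N" by simp
        with c(1) show ?thesis by blast
      qed
      have "card ?W < card S"
        by (rule psubset_card_mono) (use iV i(1) in auto)
      then have "\<rho> h \<in> gen_ideal F' ?W N"
      proof (rule less.hyps)
        show "j \<in> ?W \<Longrightarrow> l \<le> chord j" for j using lS by blast
        show "j \<in> ?W \<Longrightarrow> F' j \<in> pvars ?W" for j unfolding F'_def using \<rho>(5) FS by blast
        show "covariant j (F' j)" if j: "j \<in> ?W" for j
          unfolding covariant_def F'_def
        proof (intro ballI)
          fix \<beta> g assume "\<beta> \<in> keys (\<rho> (F j))" and g: "g \<in> carrier G"
          then obtain \<alpha> where "\<alpha> \<in> keys (F j)" "mchar \<xi> \<alpha> g = mchar \<xi> \<beta> g" using \<rho>(7) by blast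
          then show "mchar \<xi> \<beta> g * \<xi> j g = 1" using cov j g unfolding covariant_def by fastforce
        qed
        show "\<rho> h \<in> pvars ?W" by (rule \<rho>(5)[OF hS])
        show "inv_poly (\<rho> h)"
          unfolding inv_poly_def
        proof (intro ballI)
          fix \<beta> g assume "\<beta> \<in> keys (\<rho> h)" and g: "g \<in> carrier G"
          then obtain \<alpha> where "\<alpha> \<in> keys h" "mchar \<xi> \<alpha> g = mchar \<xi> \<beta> g" using \<rho>(7) by blast
          then show "mchar \<xi> \<beta> g = 1" using hinv g unfolding inv_poly_def by fastforce
        qed
        have "lookup (h - \<rho> h) 0 = 0"
        proof (rule gen_ideal_const_coeff[OF \<rho>(4)])
          fix j assume j: "j \<in> V"
          have "lookup (E j - mon (expo j 1)) 0 = 0" using E(2)[OF j] by (simp add: mpw_iff)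
          moreover have "expo j 1 \<noteq> (0 :: 'n \<Rightarrow> nat)" by (metis mdeg_expo mdeg_zero zero_neq_one)
          ultimately show "lookup (E j) 0 = 0" by (simp add: lookup_minus lookup_single when_def)
        qed (use N2 in simp)
        then show "lookup (\<rho> h) 0 = 0" using h0 by (simp add: lookup_minus)
      qed (rule dep')
      then have "\<rho> h \<in> gen_ideal F S N" using F'_sub by blast
      moreover have "h - \<rho> h \<in> gen_ideal F S N" using \<rho>(4) E_sub by blast
      ultimately have "(h - \<rho> h) + \<rho> h \<in> gen_ideal F S N" using is_idealD(2)[OF giI] by blast
      then show ?thesis by simp
    qed
  qed
qed

end

section \<open>Convergent power series\<close>

lemma mpow_add: "mpow x (\<alpha> + \<beta>) = mpow x \<alpha> * mpow x \<beta>"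
  by (simp add: mpow_def plus_fun_apply power_add prod.distrib)

lemma mpow_zero [simp]: "mpow x 0 = 1"
  by (simp add: mpow_def zero_fun_apply)

lemma mpow_expo [simp]: "mpow x (expo j d) = (x $ j) ^ d"
proof -
  have "mpow x (expo j d) = (\<Prod>i\<in>UNIV. if i = j then (x $ j) ^ d else 1)"
    unfolding mpow_def by (rule prod.cong) (auto simp: expo_def)
  then show ?thesis by simp
qed

lemma norm_mpow: "norm (mpow x \<alpha>) = (\<Prod>i\<in>UNIV. norm (x $ i) ^ \<alpha> i)"
  by (simp add: mpow_def norm_power prod_norm[symmetric])

lemma norm_mpow_le: "(\<And>i. norm (x $ i) \<le> \<rho>) \<Longrightarrow> norm (mpow x \<alpha>) \<le> \<rho> ^ mdeg \<alpha>"
  unfolding norm_mpow mdeg_def power_sum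
  by (rule prod_mono) (auto intro: power_mono)

lemma mpow_const_vec: "mpow (\<chi> i. c) \<alpha> = c ^ mdeg \<alpha>"
  by (simp add: mpow_def mdeg_def power_sum)

lemma mpow_at_0: "mpow 0 \<alpha> = (if \<alpha> = 0 then 1 else 0)"
proof (cases "\<alpha> = 0")
  case False
  then obtain i where "\<alpha> i \<noteq> 0" by (auto simp: fun_eq_iff zero_fun_apply)
  then have "mpow 0 \<alpha> = 0" unfolding mpow_def by (intro prod_zero) auto
  with False show ?thesis by simp
qed simp

lemma eventually_nhds_0_polydisc:
  "(\<forall>\<^sub>F x in nhds (0 :: complex ^ 'n::finite). P x) \<longleftrightarrow> (\<exists>\<rho>>0. \<forall>x. (\<forall>i. norm (x $ i) \<le> \<rho>) \<longrightarrow> P x)"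
proof
  assume "\<forall>\<^sub>F x in nhds (0 :: complex ^ 'n). P x"
  then obtain e where e: "e > 0" "\<And>x. dist x 0 < e \<Longrightarrow> P x" unfolding eventually_nhds_metric by blast
  let ?\<rho> = "e / (2 * CARD('n))"
  show "\<exists>\<rho>>0. \<forall>x. (\<forall>i. norm (x $ i) \<le> \<rho>) \<longrightarrow> P x"
  proof (intro exI conjI allI impI)
    show "?\<rho> > 0" using e by simp
    fix x :: "complex ^ 'n" assume x: "\<forall>i. norm (x $ i) \<le> ?\<rho>"
    have "norm x \<le> (\<Sum>i\<in>UNIV. norm (x $ i))" unfolding norm_vec_def by (rule L2_set_le_sum) simp
    also have "\<dots> \<le> (\<Sum>i\<in>(UNIV :: 'n set). ?\<rho>)" using x by (intro sum_mono) auto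
    also have "\<dots> < e" using e by simp
    finally show "P x" using e by simp
  qed
next
  assume "\<exists>\<rho>>0. \<forall>x. (\<forall>i. norm (x $ i) \<le> \<rho>) \<longrightarrow> P x"
  then obtain \<rho> where \<rho>: "\<rho> > 0" "\<And>x. (\<forall>i. norm (x $ i) \<le> \<rho>) \<Longrightarrow> P x" by blast
  show "\<forall>\<^sub>F x in nhds (0 :: complex ^ 'n). P x"
    unfolding eventually_nhds_metric
  proof (intro exI conjI allI impI)
    fix x :: "complex ^ 'n" assume "dist x 0 < \<rho>"
    then have "norm (x $ i) \<le> \<rho>" for i using Finite_Cartesian_Product.norm_nth_le[of x i] by simp
    then show "P x" using \<rho> by blast
  qed (rule \<rho>)
qed

definition abs_conv :: "'n::finite series \<Rightarrow> real \<Rightarrow> bool" where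
  "abs_conv a \<rho> \<longleftrightarrow> \<rho> > 0 \<and> (\<lambda>\<alpha>. norm (a \<alpha>) * \<rho> ^ mdeg \<alpha>) summable_on UNIV"

lemma abs_conv_summable:
  assumes "abs_conv a \<rho>" "\<And>i. norm (x $ i) \<le> \<rho>"
  shows "(\<lambda>\<alpha>. norm (a \<alpha> * mpow x \<alpha>)) summable_on UNIV" "(\<lambda>\<alpha>. a \<alpha> * mpow x \<alpha>) summable_on UNIV"
proof -
  show *: "(\<lambda>\<alpha>. norm (a \<alpha> * mpow x \<alpha>)) summable_on UNIV"
    by (rule summable_on_comparison_test[where f = "\<lambda>\<alpha>. norm (a \<alpha>) * \<rho> ^ mdeg \<alpha>"])
       (use assms norm_mpow_le[of x \<rho>] in \<open>auto simp: abs_conv_def norm_mult intro!: mult_left_mono\<close>)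
  then show "(\<lambda>\<alpha>. a \<alpha> * mpow x \<alpha>) summable_on UNIV" by (rule abs_summable_summable)
qed

text \<open>Unconditional summability of complex numbers is absolute, so the single point
  (\<open>\<rho>\<close>, ..., \<open>\<rho>\<close>) controls the whole polydisc.\<close>

lemma abs_convI:
  assumes "\<rho> > 0" "(\<lambda>\<alpha>. a \<alpha> * mpow (\<chi> i. of_real \<rho>) \<alpha>) summable_on UNIV"
  shows "abs_conv a \<rho>"
proof -
  have "(\<lambda>\<alpha>. norm (a \<alpha> * mpow (\<chi> i. of_real \<rho>) \<alpha>)) summable_on UNIV"
    using assms(2) by (simp only: summable_on_iff_abs_summable_on_complex[symmetric])
  with assms(1) show ?thesis by (simp add: abs_conv_def norm_mult mpow_const_vec norm_power)
qed

lemma summable_nhds_iff: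
  "(\<forall>\<^sub>F x in nhds (0 :: complex ^ 'n::finite). (\<lambda>\<alpha>. a \<alpha> * mpow x \<alpha>) summable_on UNIV) \<longleftrightarrow> (\<exists>\<rho>. abs_conv a \<rho>)"
  unfolding eventually_nhds_0_polydisc
proof
  assume "\<exists>\<rho>>0. \<forall>x :: complex ^ 'n. (\<forall>i. norm (x $ i) \<le> \<rho>) \<longrightarrow> (\<lambda>\<alpha>. a \<alpha> * mpow x \<alpha>) summable_on UNIV"
  then obtain \<rho> where "\<rho> > 0" "\<And>x :: complex ^ 'n. (\<forall>i. norm (x $ i) \<le> \<rho>) \<Longrightarrow> (\<lambda>\<alpha>. a \<alpha> * mpow x \<alpha>) summable_on UNIV"
    by blast
  then show "\<exists>\<rho>. abs_conv a \<rho>" by (intro exI[of _ \<rho>] abs_convI) simp_all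
next
  assume "\<exists>\<rho>. abs_conv a \<rho>"
  then obtain \<rho> where \<rho>: "abs_conv a \<rho>" by blast
  then have "\<rho> > 0" by (simp add: abs_conv_def)
  with abs_conv_summable(2)[OF \<rho>]
  show "\<exists>\<rho>>0. \<forall>x :: complex ^ 'n. (\<forall>i. norm (x $ i) \<le> \<rho>) \<longrightarrow> (\<lambda>\<alpha>. a \<alpha> * mpow x \<alpha>) summable_on UNIV"
    by blast
qed

definition sval :: "'n::finite series \<Rightarrow> complex ^ 'n \<Rightarrow> complex" where
  "sval a x = (\<Sum>\<^sub>\<infinity>\<alpha>. a \<alpha> * mpow x \<alpha>)"

lemma has_series_iff:
  "has_series f a \<longleftrightarrow> (\<exists>\<rho>. abs_conv a \<rho>) \<and> (\<forall>\<^sub>F x in nhds 0. f x = sval a x)"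
  unfolding has_series_def has_sum_iff eventually_conj_iff summable_nhds_iff sval_def
  by (rule conj_cong[OF refl]) (rule eventually_subst, simp add: eq_commute)

lemma has_seriesE:
  assumes "has_series f a"
  obtains \<rho> where "abs_conv a \<rho>" "\<forall>x. (\<forall>i. norm (x $ i) \<le> \<rho>) \<longrightarrow> ((\<lambda>\<alpha>. a \<alpha> * mpow x \<alpha>) has_sum f x) UNIV"
proof -
  obtain \<rho> where \<rho>: "\<rho> > 0" "\<And>x. (\<forall>i. norm (x $ i) \<le> \<rho>) \<Longrightarrow> ((\<lambda>\<alpha>. a \<alpha> * mpow x \<alpha>) has_sum f x) UNIV"
    using assms unfolding has_series_def eventually_nhds_0_polydisc by blast
  have "abs_conv a \<rho>" using \<rho>(1) \<rho>(2)[of "\<chi> i. of_real \<rho>"] by (intro abs_convI) (auto dest: has_sum_imp_summable)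
  with \<rho>(2) show ?thesis using that by blast
qed

lemma has_seriesI:
  assumes "\<rho> > 0" "\<And>x. (\<And>i. norm (x $ i) \<le> \<rho>) \<Longrightarrow> ((\<lambda>\<alpha>. a \<alpha> * mpow x \<alpha>) has_sum f x) UNIV"
  shows "has_series f a"
  unfolding has_series_def eventually_nhds_0_polydisc using assms by blast

lemma has_series_sval: "\<exists>\<rho>. abs_conv a \<rho> \<Longrightarrow> has_series (sval a) a"
  by (simp add: has_series_iff)

lemma has_series_cong: "has_series f a \<Longrightarrow> \<forall>\<^sub>F x in nhds 0. f x = g x \<Longrightarrow> has_series g a"
proof -
  assume "has_series f a" and eq: "\<forall>\<^sub>F x in nhds 0. f x = g x"
  then have "\<forall>\<^sub>F x in nhds 0. ((\<lambda>\<alpha>. a \<alpha> * mpow x \<alpha>) has_sum f x) UNIV" by (simp only: has_series_def)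
  then show "has_series g a" unfolding has_series_def by (rule eventually_elim2[OF _ eq]) simp
qed

lemma has_series_add:
  assumes "has_series f a" "has_series g b"
  shows "has_series (\<lambda>x. f x + g x) (\<lambda>\<alpha>. a \<alpha> + b \<alpha>)"
  unfolding has_series_def
  by (rule eventually_elim2[OF assms[unfolded has_series_def]]) (simp add: distrib_right has_sum_add)

lemma has_series_cmult: "has_series f a \<Longrightarrow> has_series (\<lambda>x. c * f x) (\<lambda>\<alpha>. c * a \<alpha>)"
  unfolding has_series_def by (elim eventually_mono) (simp add: mult.assoc has_sum_cmult_right)

lemma has_series_diff:
  assumes "has_series f a" "has_series g b"
  shows "has_series (\<lambda>x. f x - g x) (\<lambda>\<alpha>. a \<alpha> - b \<alpha>)"
  using has_series_add[OF assms(1) has_series_cmult[OF assms(2), of "-1"]] by simp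

lemma has_series_zero: "has_series (\<lambda>_. 0) (\<lambda>_. 0)"
  unfolding has_series_def by simp

lemma has_series_0: "has_series f a \<Longrightarrow> f 0 = a 0"
proof -
  assume f: "has_series f a"
  obtain \<rho> where \<rho>': "abs_conv a \<rho>" "\<forall>x. (\<forall>i. norm (x $ i) \<le> \<rho>) \<longrightarrow> ((\<lambda>\<alpha>. a \<alpha> * mpow x \<alpha>) has_sum f x) UNIV"
    by (rule has_seriesE[OF f]) (rule that)
  note \<rho> = \<rho>'(1) \<rho>'(2)[THEN spec, THEN mp, OF allI]
  have "((\<lambda>\<alpha>. a \<alpha> * mpow 0 \<alpha>) has_sum f 0) UNIV" using \<rho> by (intro \<rho>(2)) (simp add: abs_conv_def)
  moreover have "((\<lambda>\<alpha>. a \<alpha> * mpow 0 \<alpha>) has_sum a 0) UNIV"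
    by (rule has_sum_finite_neutralI[where B = "{0}"]) (auto simp: mpow_at_0)
  ultimately show ?thesis by (rule has_sum_unique)
qed

section \<open>Uniqueness of power series expansions\<close>

lemma has_sum_finite_sum:
  fixes f :: "'k \<Rightarrow> 'a \<Rightarrow> complex"
  assumes "\<And>k. k \<in> K \<Longrightarrow> (f k has_sum s k) A"
  shows "((\<lambda>x. \<Sum>k\<in>K. f k x) has_sum (\<Sum>k\<in>K. s k)) A"
  using assms by (induct K rule: infinite_finite_induct) (simp_all add: has_sum_add)

text \<open>Averaging over \<open>L\<close>-th roots of unity in every coordinate isolates the exponents congruent to
  a given one modulo \<open>L\<close>; as \<open>L\<close> grows, all other exponents disappear.\<close>

lemma root_sum:
  fixes L k :: nat
  assumes "L > 0"
  shows "(\<Sum>r<L. (exp (2 * of_real pi * \<i> / of_nat L) ^ r) ^ k :: complex) = (if L dvd k then of_nat L else 0)"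
proof -
  let ?z = "exp (2 * of_real pi * \<i> / of_nat L) :: complex"
  have zk: "?z ^ k = exp (2 * of_real pi * \<i> * of_nat k / of_nat L)" for k
    unfolding exp_of_nat_mult[symmetric] by (rule arg_cong[where f = exp]) simp
  have eq1: "?z ^ k = 1 \<longleftrightarrow> L dvd k" for k
    unfolding zk using assms by (intro complex_root_unity_eq_1) simp
  have *: "(?z ^ r) ^ k = (?z ^ k) ^ r" for r by (simp add: power_mult[symmetric] mult.commute)
  show ?thesis
  proof (cases "L dvd k")
    case True
    then have "?z ^ k = 1" using eq1 by blast
    then show ?thesis unfolding * using True by simp
  next
    case False
    then have "?z ^ k \<noteq> 1" using eq1 by blast
    then have "(\<Sum>r<L. (?z ^ k) ^ r) = ((?z ^ k) ^ L - 1) / (?z ^ k - 1)" by (rule geometric_sum)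
    also have "(?z ^ k) ^ L = 1" using eq1[of "k * L"] by (simp add: power_mult)
    finally show ?thesis unfolding * using False by simp
  qed
qed

text \<open>After averaging, the terms with exponents congruent to \<open>\<alpha>0\<close> modulo L
  sum to zero. So the term at \<open>\<alpha>0\<close> is balanced by terms outside a finite set
  that carries all but less than that amount of the absolute sum, which is impossible.\<close>

lemma series_zero_unique:
  fixes c :: "'n::finite series"
  assumes "has_series (\<lambda>_. 0) c"
  shows "c \<alpha>0 = 0"
proof (rule ccontr)
  assume nz: "c \<alpha>0 \<noteq> 0"
  obtain \<rho> where \<rho>': "abs_conv c \<rho>" "\<forall>x. (\<forall>i. norm (x $ i) \<le> \<rho>) \<longrightarrow> ((\<lambda>\<alpha>. c \<alpha> * mpow x \<alpha>) has_sum 0) UNIV"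
    by (rule has_seriesE[OF assms]) (rule that)
  note \<rho> = \<rho>'(1) \<rho>'(2)[THEN spec, THEN mp, OF allI]
  have \<rho>0: "\<rho> > 0" using \<rho>(1) by (simp add: abs_conv_def)
  let ?s = "\<lambda>\<alpha>. norm (c \<alpha>) * \<rho> ^ mdeg \<alpha>"
  have s: "?s summable_on UNIV" using \<rho>(1) by (simp add: abs_conv_def)
  \<comment> \<open>The absolute value of the supposedly nonzero term; the tail of the series is
    made smaller than it.\<close>
  define \<epsilon> where "\<epsilon> = ?s \<alpha>0"
  have \<epsilon>: "\<epsilon> > 0" using nz \<rho>0 by (simp add: \<epsilon>_def)
  obtain Fs where Fs: "finite Fs" "dist (sum ?s Fs) (infsum ?s UNIV) < \<epsilon>"
    using has_sum_finite_approximation[OF has_sum_infsum[OF s], of "\<epsilon> / 2"] \<epsilon>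
    by (metis (no_types, lifting) half_gt_zero_iff field_sum_of_halves le_less_trans less_add_same_cancel1)
  \<comment> \<open>Above every degree in \<open>Fs\<close> and that of \<open>\<alpha>0\<close>, so
    that among these exponents congruence modulo L is equality.\<close>
  define L where "L = Suc (Max (mdeg ` insert \<alpha>0 Fs))"
  have deg_L: "mdeg \<alpha> < L" if "\<alpha> \<in> insert \<alpha>0 Fs" for \<alpha>
    unfolding L_def using that Fs(1) by (intro le_imp_less_Suc Max_ge) auto
  have L0: "L > 0" by (simp add: L_def)
  have le_mdeg: "\<alpha> i \<le> mdeg \<alpha>" for \<alpha> :: "'n \<Rightarrow> nat" and i
    unfolding mdeg_def by (rule member_le_sum) auto
  define z :: complex where "z = exp (2 * of_real pi * \<i> / of_nat L)"
  have nz1: "norm z = 1" unfolding z_def by (simp add: norm_exp_eq_Re)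
  let ?K = "PiE (UNIV :: 'n set) (\<lambda>_. {..<L})"
  define pt where "pt k = (\<chi> i. of_real \<rho> * z ^ k i)" for k :: "'n \<Rightarrow> nat"
  \<comment> \<open>Multiplication by the conjugate of the monomial \<open>\<alpha>0\<close> at
    roots of unity, written with the exponent (L - 1) \<open>\<alpha>0\<close>, which is congruent
    to - \<open>\<alpha>0\<close> modulo L.\<close>
  define u where "u k = (\<Prod>i\<in>UNIV. (z ^ k i) ^ ((L - 1) * \<alpha>0 i))" for k :: "'n \<Rightarrow> nat"
  let ?cong = "\<lambda>\<alpha>. \<forall>i. L dvd ((L - 1) * \<alpha>0 i + \<alpha> i)"
  have avg: "(\<Sum>k\<in>?K. u k * (c \<alpha> * mpow (pt k) \<alpha>)) =
      (if ?cong \<alpha> then of_nat L ^ CARD('n) * (c \<alpha> * of_real \<rho> ^ mdeg \<alpha>) else 0)" for \<alpha>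
  proof -
    have *: "u k * (c \<alpha> * mpow (pt k) \<alpha>) =
        c \<alpha> * of_real \<rho> ^ mdeg \<alpha> * (\<Prod>i\<in>UNIV. (z ^ k i) ^ ((L - 1) * \<alpha>0 i + \<alpha> i))" for k
      by (simp add: u_def pt_def mpow_def mdeg_def power_sum power_mult_distrib power_add prod.distrib)
    have "(\<Sum>k\<in>?K. u k * (c \<alpha> * mpow (pt k) \<alpha>)) =
        c \<alpha> * of_real \<rho> ^ mdeg \<alpha> * (\<Sum>k\<in>?K. \<Prod>i\<in>UNIV. (z ^ k i) ^ ((L - 1) * \<alpha>0 i + \<alpha> i))"
      unfolding * sum_distrib_left by (rule refl)
    also have "(\<Sum>k\<in>?K. \<Prod>i\<in>UNIV. (z ^ k i) ^ ((L - 1) * \<alpha>0 i + \<alpha> i)) =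
        (\<Prod>i\<in>UNIV. \<Sum>r<L. (z ^ r) ^ ((L - 1) * \<alpha>0 i + \<alpha> i))"
      by (rule prod_sum_PiE[symmetric]) auto
    also have "\<dots> = (\<Prod>i\<in>UNIV. if L dvd ((L - 1) * \<alpha>0 i + \<alpha> i) then of_nat L else 0)"
      unfolding z_def by (simp only: root_sum[OF L0])
    also have "\<dots> = (if ?cong \<alpha> then of_nat L ^ CARD('n) else 0)"
      by (auto intro: prod_zero)
    finally show ?thesis by simp
  qed
  have "((\<lambda>\<alpha>. \<Sum>k\<in>?K. u k * (c \<alpha> * mpow (pt k) \<alpha>)) has_sum (\<Sum>k\<in>?K. u k * 0)) UNIV"
  proof (rule has_sum_finite_sum)
    fix k assume "k \<in> ?K"
    have "norm (pt k $ i) \<le> \<rho>" for i using \<rho>0 by (simp add: pt_def norm_mult norm_power nz1)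
    then show "((\<lambda>\<alpha>. u k * (c \<alpha> * mpow (pt k) \<alpha>)) has_sum (u k * 0)) UNIV"
      by (intro has_sum_cmult_right \<rho>(2))
  qed
  then have "((\<lambda>\<alpha>. if ?cong \<alpha> then of_nat L ^ CARD('n) * (c \<alpha> * of_real \<rho> ^ mdeg \<alpha>) else 0) has_sum 0) UNIV"
    unfolding avg by simp
  then have "((\<lambda>\<alpha>. of_nat L ^ CARD('n) * (c \<alpha> * of_real \<rho> ^ mdeg \<alpha>)) has_sum 0) {\<alpha>. ?cong \<alpha>}"
    by (subst (asm) has_sum_cong_neutral[where T = "{\<alpha>. ?cong \<alpha>}" and g = "\<lambda>\<alpha>. of_nat L ^ CARD('n) * (c \<alpha> * of_real \<rho> ^ mdeg \<alpha>)"]) auto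
  from has_sum_cmult_right[OF this, of "1 / of_nat L ^ CARD('n)"] L0
  have sum0: "((\<lambda>\<alpha>. c \<alpha> * of_real \<rho> ^ mdeg \<alpha>) has_sum 0) {\<alpha>. ?cong \<alpha>}"
    by simp
  have cong0: "?cong \<alpha>0"
  proof
    fix i
    have "(L - 1) * \<alpha>0 i + \<alpha>0 i = L * \<alpha>0 i" using L0 by (cases L) auto
    then show "L dvd ((L - 1) * \<alpha>0 i + \<alpha>0 i)" by simp
  qed
  let ?R = "{\<alpha>. ?cong \<alpha>} - {\<alpha>0}"
  have R: "((\<lambda>\<alpha>. c \<alpha> * of_real \<rho> ^ mdeg \<alpha>) has_sum (0 - c \<alpha>0 * of_real \<rho> ^ mdeg \<alpha>0)) ?R"
    by (rule has_sum_Diff[OF sum0]) (use cong0 in \<open>auto intro!: has_sum_finiteI\<close>)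
  have disj: "?R \<inter> Fs = {}"
  proof -
    have "\<alpha> \<notin> Fs" if \<alpha>: "\<alpha> \<in> ?R" for \<alpha>
    proof
      assume "\<alpha> \<in> Fs"
      have "\<alpha> i = \<alpha>0 i" for i
      proof -
        have a: "\<alpha> i < L" using le_less_trans[OF le_mdeg deg_L[of \<alpha>]] \<open>\<alpha> \<in> Fs\<close> by simp
        have a0: "\<alpha>0 i < L" using le_less_trans[OF le_mdeg deg_L[of \<alpha>0]] by simp
        have "L dvd ((L - 1) * \<alpha>0 i + \<alpha> i)" using \<alpha> by simp
        then have "int L dvd int ((L - 1) * \<alpha>0 i + \<alpha> i)" by (simp only: of_nat_dvd_iff)
        also have "int ((L - 1) * \<alpha>0 i + \<alpha> i) = int L * int (\<alpha>0 i) + (int (\<alpha> i) - int (\<alpha>0 i))"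
          using L0 by (cases L) (simp_all add: algebra_simps)
        finally have "int L dvd int (\<alpha> i) - int (\<alpha>0 i)" by (simp add: dvd_add_right_iff)
        with a a0 show ?thesis by (metis mod_eq_dvd_iff mod_pos_pos_trivial of_nat_0_le_iff of_nat_eq_iff of_nat_less_iff)
      qed
      then have "\<alpha> = \<alpha>0" by blast
      with \<alpha> show False by simp
    qed
    then show ?thesis by blast
  qed
  have sR: "?s summable_on ?R" using s by (rule summable_on_subset_banach) auto
  have "\<epsilon> = norm (0 - c \<alpha>0 * of_real \<rho> ^ mdeg \<alpha>0)"
    using \<rho>0 by (simp add: \<epsilon>_def norm_mult norm_power)
  also have "\<dots> = norm (\<Sum>\<^sub>\<infinity>\<alpha>\<in>?R. c \<alpha> * of_real \<rho> ^ mdeg \<alpha>)" using infsumI[OF R] by simp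
  also have "\<dots> \<le> (\<Sum>\<^sub>\<infinity>\<alpha>\<in>?R. norm (c \<alpha> * of_real \<rho> ^ mdeg \<alpha>))"
    by (rule norm_infsum_bound) (use sR \<rho>0 in \<open>simp add: norm_mult norm_power\<close>)
  also have "\<dots> = infsum ?s ?R" using \<rho>0 by (simp add: norm_mult norm_power)
  also have "\<dots> < \<epsilon>"
  proof -
    have "infsum ?s (Fs \<union> ?R) = infsum ?s Fs + infsum ?s ?R"
      by (rule infsum_Un_disjoint) (use Fs(1) sR disj in auto)
    moreover have "infsum ?s (Fs \<union> ?R) \<le> infsum ?s UNIV"
      by (rule infsum_mono_neutral) (use s \<rho>0 in \<open>auto intro: summable_on_subset_banach\<close>)
    ultimately show ?thesis using Fs by (simp add: dist_real_def abs_if split: if_splits)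
  qed
  finally show False by simp
qed

lemma has_series_unique: "has_series f a \<Longrightarrow> has_series f b \<Longrightarrow> a = b"
  using series_zero_unique[of "\<lambda>\<alpha>. a \<alpha> - b \<alpha>"] has_series_diff[of f a f b] by (auto simp: fun_eq_iff)

lemma series_of_eq: "has_series f a \<Longrightarrow> series_of f = a"
  unfolding series_of_def using has_series_unique by blast

lemma has_series_series_of: "analytic_germ f \<Longrightarrow> has_series f (series_of f)"
  unfolding analytic_germ_def using series_of_eq by metis

section \<open>Products, derivatives and polynomials\<close>

abbreviation cauchy :: "'n::finite series \<Rightarrow> 'n series \<Rightarrow> 'n series" where
  "cauchy a b \<equiv> (\<lambda>\<gamma>. \<Sum>(\<alpha>, \<beta>)\<in>{(\<alpha>, \<beta>). \<forall>i. \<alpha> i + \<beta> i = \<gamma> i}. a \<alpha> * b \<beta>)"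

lemma finite_splits: "finite {(\<alpha>, \<beta>). \<forall>i. \<alpha> i + \<beta> i = (\<gamma> i :: nat)}" for \<gamma> :: "'n::finite \<Rightarrow> nat"
proof (rule finite_subset)
  show "{(\<alpha>, \<beta>). \<forall>i. \<alpha> i + \<beta> i = \<gamma> i} \<subseteq> {\<alpha>. mdeg \<alpha> \<le> mdeg \<gamma>} \<times> {\<alpha>. mdeg \<alpha> \<le> mdeg \<gamma>}"
    unfolding mdeg_def by (auto intro!: sum_mono) (metis le_add1, metis le_add2)
qed (simp add: finite_mdeg_le)

lemma splits_iff: "(\<forall>i. \<alpha> i + \<beta> i = \<gamma> i) \<longleftrightarrow> \<gamma> = \<alpha> + \<beta>" for \<alpha> \<beta> \<gamma> :: "'n \<Rightarrow> nat"
  by (auto simp: fun_eq_iff plus_fun_apply)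

text \<open>The double family is absolutely summable, hence may be regrouped by the sum of the two
  exponents.\<close>

lemma has_series_mult:
  assumes "has_series f a" "has_series g b"
  shows "has_series (\<lambda>x. f x * g x) (cauchy a b)"
proof -
  obtain \<rho>1 where q1': "abs_conv a \<rho>1" "\<forall>x. (\<forall>i. norm (x $ i) \<le> \<rho>1) \<longrightarrow> ((\<lambda>\<alpha>. a \<alpha> * mpow x \<alpha>) has_sum f x) UNIV"
    by (rule has_seriesE[OF assms(1)]) (rule that)
  note 1 = q1'(1) q1'(2)[THEN spec, THEN mp, OF allI]
  obtain \<rho>2 where q2': "abs_conv b \<rho>2" "\<forall>x. (\<forall>i. norm (x $ i) \<le> \<rho>2) \<longrightarrow> ((\<lambda>\<alpha>. b \<alpha> * mpow x \<alpha>) has_sum g x) UNIV"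
    by (rule has_seriesE[OF assms(2)]) (rule that)
  note 2 = q2'(1) q2'(2)[THEN spec, THEN mp, OF allI]
  show ?thesis
  proof (rule has_seriesI[of "min \<rho>1 \<rho>2"])
    show "min \<rho>1 \<rho>2 > 0" using 1(1) 2(1) by (simp add: abs_conv_def)
    fix x :: "complex ^ 'a" assume "\<And>i. norm (x $ i) \<le> min \<rho>1 \<rho>2"
    then have x1: "\<And>i. norm (x $ i) \<le> \<rho>1" and x2: "\<And>i. norm (x $ i) \<le> \<rho>2" by simp_all
    let ?p = "\<lambda>\<alpha>. a \<alpha> * mpow x \<alpha>" and ?q = "\<lambda>\<beta>. b \<beta> * mpow x \<beta>"
    have "(\<lambda>(\<alpha>, \<beta>). norm (?p \<alpha> * ?q \<beta>)) summable_on Sigma UNIV (\<lambda>_. UNIV)"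
    proof (rule summable_on_SigmaI)
      fix \<alpha>
      show "((\<lambda>\<beta>. case (\<alpha>, \<beta>) of (\<alpha>, \<beta>) \<Rightarrow> norm (?p \<alpha> * ?q \<beta>)) has_sum
          (norm (?p \<alpha>) * infsum (\<lambda>\<beta>. norm (?q \<beta>)) UNIV)) UNIV"
        using has_sum_cmult_right[OF has_sum_infsum[OF abs_conv_summable(1)[OF 2(1) x2]], of "norm (?p \<alpha>)"]
        by (simp only: prod.case norm_mult)
      show "(\<lambda>\<alpha>. norm (?p \<alpha>) * infsum (\<lambda>\<beta>. norm (?q \<beta>)) UNIV) summable_on UNIV"
        by (rule summable_on_cmult_left) (rule abs_conv_summable(1)[OF 1(1) x1])
    qed auto
    then have "(\<lambda>z. norm ((\<lambda>(\<alpha>, \<beta>). ?p \<alpha> * ?q \<beta>) z)) summable_on UNIV"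
      by (simp add: case_prod_unfold)
    then have S: "(\<lambda>(\<alpha>, \<beta>). ?p \<alpha> * ?q \<beta>) summable_on Sigma UNIV (\<lambda>_. UNIV)"
      using abs_summable_summable by (simp add: case_prod_unfold)
    have "((\<lambda>(\<alpha>, \<beta>). ?p \<alpha> * ?q \<beta>) has_sum (f x * g x)) (Sigma UNIV (\<lambda>_. UNIV))"
    proof (rule has_sum_SigmaI)
      show "((\<lambda>\<beta>. case (\<alpha>, \<beta>) of (\<alpha>, \<beta>) \<Rightarrow> ?p \<alpha> * ?q \<beta>) has_sum (?p \<alpha> * g x)) UNIV" for \<alpha>
        using has_sum_cmult_right[OF 2(2)[OF x2], of "?p \<alpha>"] by simp
      show "((\<lambda>\<alpha>. ?p \<alpha> * g x) has_sum (f x * g x)) UNIV"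
        by (rule has_sum_cmult_left) (rule 1(2)[OF x1])
    qed (rule S)
    then have "((\<lambda>(\<alpha>, \<beta>). ?p \<alpha> * ?q \<beta>) has_sum (f x * g x)) UNIV" by simp
    then have "((\<lambda>(\<gamma>, \<alpha>, \<beta>). ?p \<alpha> * ?q \<beta>) has_sum (f x * g x))
        (Sigma UNIV (\<lambda>\<gamma>. {(\<alpha>, \<beta>). \<forall>i. \<alpha> i + \<beta> i = \<gamma> i}))"
      by (subst (asm) has_sum_reindex_bij_witness[where
          i = "\<lambda>(\<gamma>, \<alpha>, \<beta>). (\<alpha>, \<beta>)" and j = "\<lambda>(\<alpha>, \<beta>). (\<alpha> + \<beta>, \<alpha>, \<beta>)" and s' = "f x * g x" and
          T = "Sigma UNIV (\<lambda>\<gamma>. {(\<alpha>, \<beta>). \<forall>i. \<alpha> i + \<beta> i = \<gamma> i})" and h = "\<lambda>(\<gamma>, \<alpha>, \<beta>). ?p \<alpha> * ?q \<beta>"])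
         (auto simp: splits_iff)
    then show "((\<lambda>\<gamma>. cauchy a b \<gamma> * mpow x \<gamma>) has_sum (f x * g x)) UNIV"
    proof (rule has_sum_Sigma')
      fix \<gamma> :: "'a \<Rightarrow> nat"
      let ?S = "{(\<alpha>, \<beta>). \<forall>i. \<alpha> i + \<beta> i = \<gamma> i}"
      have "cauchy a b \<gamma> * mpow x \<gamma> = (\<Sum>(\<alpha>, \<beta>)\<in>?S. ?p \<alpha> * ?q \<beta>)"
        unfolding sum_distrib_right by (rule sum.cong) (auto simp: splits_iff mpow_add)
      then show "((\<lambda>y. case (\<gamma>, y) of (\<gamma>, \<alpha>, \<beta>) \<Rightarrow> ?p \<alpha> * ?q \<beta>) has_sum (cauchy a b \<gamma> * mpow x \<gamma>)) ?S"
        by (intro has_sum_finiteI finite_splits) (simp add: case_prod_unfold)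
    qed
  qed
qed

lemma mpow_axis:
  "mpow (x + axis i t) \<alpha> = (x $ i + t) ^ \<alpha> i * (\<Prod>k\<in>UNIV - {i}. (x $ k) ^ \<alpha> k)"
proof -
  have "mpow (x + axis i t) \<alpha> = ((x + axis i t) $ i) ^ \<alpha> i * (\<Prod>k\<in>UNIV - {i}. ((x + axis i t) $ k) ^ \<alpha> k)"
    unfolding mpow_def by (rule prod.remove) auto
  also have "(\<Prod>k\<in>UNIV - {i}. ((x + axis i t) $ k) ^ \<alpha> k) = (\<Prod>k\<in>UNIV - {i}. (x $ k) ^ \<alpha> k)"
    by (rule prod.cong) (auto simp: axis_def)
  finally show ?thesis by (simp add: axis_def)
qed

text \<open>Along the i-th axis the finite partial sums are holomorphic and converge uniformly by
  the Weierstrass test, so their derivatives converge to that of the limit; this yields the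
  unordered sum of termwise derivatives.\<close>

lemma has_series_partial:
  assumes "has_series f a"
  shows "has_series (partial_deriv f i) (\<lambda>\<alpha>. of_nat (\<alpha> i + 1) * a (\<alpha> + expo i 1))"
proof -
  obtain \<rho> where \<rho>': "abs_conv a \<rho>" "\<forall>x. (\<forall>i. norm (x $ i) \<le> \<rho>) \<longrightarrow> ((\<lambda>\<alpha>. a \<alpha> * mpow x \<alpha>) has_sum f x) UNIV"
    by (rule has_seriesE[OF assms]) (rule that)
  note \<rho> = \<rho>'(1) \<rho>'(2)[THEN spec, THEN mp, OF allI]
  have \<rho>0: "\<rho> > 0" using \<rho>(1) by (simp add: abs_conv_def)
  show ?thesis
  proof (rule has_seriesI[of "\<rho> / 2"])
    show "\<rho> / 2 > 0" using \<rho>0 by simp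
    fix x :: "complex ^ 'a" assume x: "\<And>i. norm (x $ i) \<le> \<rho> / 2"
    let ?F = "finite_subsets_at_top (UNIV :: ('a \<Rightarrow> nat) set)"
    let ?f = "\<lambda>A t. \<Sum>\<alpha>\<in>A. a \<alpha> * mpow (x + axis i t) \<alpha>"
    define d where "d \<alpha> = (\<lambda>k. if k = i then \<alpha> i - 1 else \<alpha> k)" for \<alpha> :: "'a \<Rightarrow> nat"
    let ?f' = "\<lambda>A t. \<Sum>\<alpha>\<in>A. a \<alpha> * (of_nat (\<alpha> i) * mpow (x + axis i t) (d \<alpha>))"
    have near: "norm ((x + axis i t) $ k) \<le> \<rho>" if "t \<in> cball 0 (\<rho> / 2)" for t k
      using x[of k] that \<rho>0 norm_triangle_ineq[of "x $ k" "axis i t $ k"] by (auto simp: axis_def)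
    have der: "((\<lambda>t. mpow (x + axis i t) \<alpha>) has_field_derivative (of_nat (\<alpha> i) * mpow (x + axis i t) (d \<alpha>))) (at t)" for \<alpha> t
    proof -
      have "mpow (x + axis i t) (d \<alpha>) = (x $ i + t) ^ (\<alpha> i - 1) * (\<Prod>k\<in>UNIV - {i}. (x $ k) ^ \<alpha> k)"
        unfolding mpow_axis by (intro arg_cong2[where f = times] prod.cong) (auto simp: d_def)
      then show ?thesis unfolding mpow_axis by (auto intro!: derivative_eq_intros)
    qed
    have derA: "(?f A has_field_derivative ?f' A t) (at t)" for A t
      by (intro DERIV_sum DERIV_cmult der)
    have cont: "\<forall>\<^sub>F A in ?F. continuous_on (cball 0 (\<rho> / 2)) (?f A) \<and>
        (\<forall>w\<in>ball 0 (\<rho> / 2). (?f A has_field_derivative ?f' A w) (at w))"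
      using derA by (intro always_eventually allI conjI ballI)
        (auto intro!: continuous_at_imp_continuous_on DERIV_isCont[OF derA])
    have ulim: "uniform_limit (cball 0 (\<rho> / 2)) ?f (\<lambda>t. f (x + axis i t)) ?F"
    proof (rule Weierstrass_m_test_general'[where M = "\<lambda>\<alpha>. norm (a \<alpha>) * \<rho> ^ mdeg \<alpha>"])
      show "norm (a \<alpha> * mpow (x + axis i t) \<alpha>) \<le> norm (a \<alpha>) * \<rho> ^ mdeg \<alpha>" if "t \<in> cball 0 (\<rho> / 2)" for \<alpha> t
        unfolding norm_mult using norm_mpow_le[OF near[OF that]] by (intro mult_left_mono) auto
      show "((\<lambda>\<alpha>. a \<alpha> * mpow (x + axis i t) \<alpha>) has_sum f (x + axis i t)) UNIV" if "t \<in> cball 0 (\<rho> / 2)" for t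
        by (rule \<rho>(2)) (rule near[OF that])
      show "(\<lambda>\<alpha>. norm (a \<alpha>) * \<rho> ^ mdeg \<alpha>) summable_on UNIV" using \<rho>(1) by (simp add: abs_conv_def)
    qed
    have "\<exists>g'. \<forall>w\<in>ball 0 (\<rho> / 2).
        ((\<lambda>t. f (x + axis i t)) has_field_derivative g' w) (at w) \<and> ((\<lambda>A. ?f' A w) \<longlongrightarrow> g' w) ?F"
    proof (rule has_complex_derivative_uniform_limit[OF cont ulim])
      show "\<not> trivial_limit ?F" by simp
      show "0 < \<rho> / 2" using \<rho>0 by simp
    qed blast
    then obtain g' where g': "\<And>w. w \<in> ball 0 (\<rho> / 2) \<Longrightarrow>
        ((\<lambda>t. f (x + axis i t)) has_field_derivative g' w) (at w) \<and> ((\<lambda>A. ?f' A w) \<longlongrightarrow> g' w) ?F"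
      by blast
    have w0: "(0::complex) \<in> ball 0 (\<rho> / 2)" using \<rho>0 by simp
    have "partial_deriv f i x = g' 0"
      unfolding partial_deriv_def using g'[OF w0] by (intro DERIV_imp_deriv) simp
    then have "((\<lambda>\<alpha>. a \<alpha> * (of_nat (\<alpha> i) * mpow (x + axis i 0) (d \<alpha>))) has_sum partial_deriv f i x) UNIV"
      using g'[OF w0] unfolding has_sum_def by simp
    moreover have "x + axis i 0 = x" by (simp add: vec_eq_iff axis_def)
    ultimately have "((\<lambda>\<alpha>. a \<alpha> * (of_nat (\<alpha> i) * mpow x (d \<alpha>))) has_sum partial_deriv f i x) UNIV"
      by simp
    then have "((\<lambda>\<alpha>. a \<alpha> * (of_nat (\<alpha> i) * mpow x (d \<alpha>))) has_sum partial_deriv f i x) {\<alpha>. \<alpha> i \<noteq> 0}"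
      by (subst has_sum_cong_neutral[where T = UNIV and g = "\<lambda>\<alpha>. a \<alpha> * (of_nat (\<alpha> i) * mpow x (d \<alpha>))"]) auto
    then show "((\<lambda>\<alpha>. of_nat (\<alpha> i + 1) * a (\<alpha> + expo i 1) * mpow x \<alpha>) has_sum partial_deriv f i x) UNIV"
    proof (subst has_sum_reindex_bij_witness[where i = d and j = "\<lambda>\<beta>. \<beta> + expo i 1" and T = "{\<alpha>. \<alpha> i \<noteq> 0}"
          and h = "\<lambda>\<alpha>. a \<alpha> * (of_nat (\<alpha> i) * mpow x (d \<alpha>))" and s' = "partial_deriv f i x"])
      show dd: "d (\<beta> + expo i 1) = \<beta>" for \<beta> by (auto simp: d_def fun_eq_iff plus_fun_apply expo_def)
      show "\<beta> + expo i 1 \<in> {\<alpha>. \<alpha> i \<noteq> 0}" for \<beta> :: "'a \<Rightarrow> nat" by (simp add: plus_fun_apply)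
      show "d \<alpha> + expo i 1 = \<alpha>" if "\<alpha> \<in> {\<alpha>. \<alpha> i \<noteq> 0}" for \<alpha>
        using that by (auto simp: d_def fun_eq_iff plus_fun_apply expo_def)
      show "a (\<beta> + expo i 1) * (of_nat ((\<beta> + expo i 1) i) * mpow x (d (\<beta> + expo i 1))) =
          of_nat (\<beta> i + 1) * a (\<beta> + expo i 1) * mpow x \<beta>" for \<beta>
        unfolding dd by (simp add: plus_fun_apply)
    qed auto
  qed
qed

definition peval :: "'n::finite mpoly \<Rightarrow> complex ^ 'n \<Rightarrow> complex" where
  "peval p x = (\<Sum>\<alpha>\<in>keys p. lookup p \<alpha> * mpow x \<alpha>)"

lemma peval_superset: "finite A \<Longrightarrow> keys p \<subseteq> A \<Longrightarrow> peval p x = (\<Sum>\<alpha>\<in>A. lookup p \<alpha> * mpow x \<alpha>)"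
  unfolding peval_def by (rule sum.mono_neutral_left) (auto simp: in_keys_iff)

lemma peval_single [simp]: "peval (Poly_Mapping.single \<alpha> c) x = c * mpow x \<alpha>"
proof -
  have "peval (Poly_Mapping.single \<alpha> c) x = (\<Sum>\<beta>\<in>{\<alpha>}. lookup (Poly_Mapping.single \<alpha> c) \<beta> * mpow x \<beta>)"
    by (rule peval_superset) simp_all
  then show ?thesis by simp
qed

lemma peval_zero [simp]: "peval 0 x = 0"
  by (simp add: peval_def)

lemma peval_one [simp]: "peval 1 x = 1"
  using peval_single[of 0 1 x] by simp

lemma peval_add: "peval (p + q) x = peval p x + peval q x"
  using keys_add[of p q]
  by (simp add: peval_superset[of "keys p \<union> keys q"] lookup_add distrib_right sum.distrib)

lemma peval_mult: "peval (p * q) x = peval p x * peval q x"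
proof (rule mpoly_induct[of _ p])
  fix \<alpha> c
  show "peval (Poly_Mapping.single \<alpha> c * q) x = peval (Poly_Mapping.single \<alpha> c) x * peval q x"
    by (rule mpoly_induct[of _ q]) (simp_all add: mult_single mpow_add peval_add distrib_left)
qed (simp add: peval_add distrib_right)

lemma peval_power: "peval (p ^ k) x = peval p x ^ k"
  by (induct k) (simp_all add: peval_mult)

lemma has_series_peval: "has_series (peval p) (lookup p)"
proof -
  have "((\<lambda>\<alpha>. lookup p \<alpha> * mpow x \<alpha>) has_sum peval p x) UNIV" for x
    by (rule has_sum_finite_neutralI[where B = "keys p"]) (auto simp: peval_def in_keys_iff)
  then show ?thesis unfolding has_series_def by simp
qed

text \<open>Both sides are expansions of the same function, and expansions are unique.\<close>

lemma lookup_mult_cauchy: "lookup (p * q) = cauchy (lookup p) (lookup (q :: 'n::finite mpoly))"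
proof (rule has_series_unique)
  show "has_series (peval (p * q)) (lookup (p * q))" by (rule has_series_peval)
  have "peval (p * q) = (\<lambda>x. peval p x * peval q x)" by (simp add: fun_eq_iff peval_mult)
  then show "has_series (peval (p * q)) (cauchy (lookup p) (lookup q))"
    using has_series_mult[OF has_series_peval has_series_peval] by simp
qed

section \<open>Truncation, and the action of the group on expansions\<close>

definition trunc :: "nat \<Rightarrow> 'n::finite series \<Rightarrow> 'n mpoly" where
  "trunc N a = Abs_poly_mapping (\<lambda>\<alpha>. if mdeg \<alpha> < N then a \<alpha> else 0)"

lemma lookup_trunc [simp]: "lookup (trunc N a) \<alpha> = (if mdeg \<alpha> < N then a \<alpha> else 0)"
proof -
  have "finite {\<alpha>. (if mdeg \<alpha> < N then a \<alpha> else 0) \<noteq> 0}"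
    by (rule finite_subset[OF _ finite_mdeg_le[of N]]) (auto split: if_splits)
  then show ?thesis by (simp add: trunc_def)
qed

lemma trunc_add: "trunc N (\<lambda>\<alpha>. a \<alpha> + b \<alpha>) = trunc N a + trunc N b"
  by (rule poly_mapping_eqI) (simp add: lookup_add)

lemma trunc_lookup: "p - trunc N (lookup p) \<in> mpw N"
  by (simp add: mpw_iff lookup_minus)

lemma trunc_cauchy: "trunc N (cauchy a b) - trunc N a * trunc N b \<in> mpw N"
  unfolding mpw_iff
proof (intro allI impI)
  fix \<gamma> :: "'a \<Rightarrow> nat" assume \<gamma>: "mdeg \<gamma> < N"
  have "cauchy (lookup (trunc N a)) (lookup (trunc N b)) \<gamma> = cauchy a b \<gamma>"
  proof (rule sum.cong[OF refl])
    fix z assume "z \<in> {(\<alpha>, \<beta>). \<forall>i. \<alpha> i + \<beta> i = \<gamma> i}"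
    then obtain \<alpha> \<beta> where z: "z = (\<alpha>, \<beta>)" "\<gamma> = \<alpha> + \<beta>" by (auto simp: splits_iff)
    then show "(case z of (\<alpha>, \<beta>) \<Rightarrow> lookup (trunc N a) \<alpha> * lookup (trunc N b) \<beta>) = (case z of (\<alpha>, \<beta>) \<Rightarrow> a \<alpha> * b \<beta>)"
      using \<gamma> by simp
  qed
  then show "lookup (trunc N (cauchy a b) - trunc N a * trunc N b) \<gamma> = 0"
    unfolding lookup_minus lookup_mult_cauchy using \<gamma> by simp
qed

lemma mpow_diag_act: "mpow (diag_act \<xi> g x) \<alpha> = mchar \<xi> \<alpha> g * mpow x \<alpha>"
  by (simp add: mpow_def diag_act_def mchar_def power_mult_distrib prod.distrib)

lemma has_series_diag:
  assumes "has_series f a"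
  shows "has_series (\<lambda>x. f (diag_act \<xi> g x)) (\<lambda>\<alpha>. mchar \<xi> \<alpha> g * a \<alpha>)"
proof -
  obtain \<rho> where \<rho>': "abs_conv a \<rho>" "\<forall>x. (\<forall>i. norm (x $ i) \<le> \<rho>) \<longrightarrow> ((\<lambda>\<alpha>. a \<alpha> * mpow x \<alpha>) has_sum f x) UNIV"
    by (rule has_seriesE[OF assms]) (rule that)
  have \<rho>0: "\<rho> > 0" using \<rho>'(1) by (simp add: abs_conv_def)
  define B where "B = 1 + (\<Sum>i\<in>UNIV. norm (\<xi> i g))"
  have B: "B > 0" "norm (\<xi> i g) \<le> B" for i
    using member_le_sum[of i UNIV "\<lambda>i. norm (\<xi> i g)"] sum_nonneg[of UNIV "\<lambda>i. norm (\<xi> i g)"]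
    by (simp_all add: B_def)
  show ?thesis
  proof (rule has_seriesI[of "\<rho> / B"])
    show "\<rho> / B > 0" using \<rho>0 B(1) by simp
    fix x :: "complex ^ 'a" assume x: "\<And>i. norm (x $ i) \<le> \<rho> / B"
    have "norm (diag_act \<xi> g x $ i) \<le> \<rho>" for i
    proof -
      have "norm (\<xi> i g) * norm (x $ i) \<le> B * (\<rho> / B)"
        by (rule mult_mono) (use B x[of i] in auto)
      then have "norm (diag_act \<xi> g x $ i) \<le> B * (\<rho> / B)" by (simp add: diag_act_def norm_mult)
      then show ?thesis using B(1) by simp
    qed
    with \<rho>'(2) have "((\<lambda>\<alpha>. a \<alpha> * mpow (diag_act \<xi> g x) \<alpha>) has_sum f (diag_act \<xi> g x)) UNIV" by blast
    then show "((\<lambda>\<alpha>. mchar \<xi> \<alpha> g * a \<alpha> * mpow x \<alpha>) has_sum f (diag_act \<xi> g x)) UNIV"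
      by (simp add: mpow_diag_act mult_ac)
  qed
qed

lemma invariant_coeffs:
  assumes "has_series f a" "invariant_germ G \<xi> f" "g \<in> carrier G" "a \<alpha> \<noteq> 0"
  shows "mchar \<xi> \<alpha> g = 1"
proof -
  have "\<forall>\<^sub>F x in nhds 0. f (diag_act \<xi> g x) = f x" using assms(2,3) by (simp add: invariant_germ_def)
  from has_series_cong[OF has_series_diag[OF assms(1)] this]
  have "(\<lambda>\<alpha>. mchar \<xi> \<alpha> g * a \<alpha>) = a" using assms(1) by (rule has_series_unique)
  then have "mchar \<xi> \<alpha> g * a \<alpha> = a \<alpha>" by (rule fun_cong)
  with assms(4) show ?thesis by simp
qed

section \<open>The Milnor number\<close>

lemma conv_carrier_iff: "a \<in> carrier conv_series_ring \<longleftrightarrow> (\<exists>f. has_series f a)"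
proof
  assume "a \<in> carrier conv_series_ring"
  then have "\<exists>\<rho>. abs_conv a \<rho>" by (simp add: conv_series_ring_def summable_nhds_iff)
  then show "\<exists>f. has_series f a" using has_series_sval by blast
next
  assume "\<exists>f. has_series f a"
  then show "a \<in> carrier conv_series_ring" by (auto simp: has_series_iff conv_series_ring_def summable_nhds_iff)
qed

lemma conv_ring_simps:
  "a \<otimes>\<^bsub>conv_series_ring\<^esub> b = cauchy a b"
  "\<one>\<^bsub>conv_series_ring\<^esub> = lookup 1"
  "\<zero>\<^bsub>conv_series_ring\<^esub> = (\<lambda>_. 0)"
  "a \<oplus>\<^bsub>conv_series_ring\<^esub> b = (\<lambda>\<alpha>. a \<alpha> + b \<alpha>)"
  by (simp_all add: conv_series_ring_def fun_eq_iff lookup_one zero_fun_def when_def)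

lemma cring_conv: "cring (conv_series_ring :: 'n::finite series ring)"
proof (rule cringI)
  let ?R = "conv_series_ring :: 'n series ring"
  show "abelian_group ?R"
  proof (rule abelian_groupI)
    fix x y assume "x \<in> carrier ?R" "y \<in> carrier ?R"
    then show "x \<oplus>\<^bsub>?R\<^esub> y \<in> carrier ?R"
      unfolding conv_carrier_iff conv_ring_simps using has_series_add by blast
  next
    fix x assume "x \<in> carrier ?R"
    then obtain f where "has_series f x" by (auto simp: conv_carrier_iff)
    from has_series_cmult[OF this, of "-1"] have "(\<lambda>\<alpha>. - x \<alpha>) \<in> carrier ?R"
      by (auto simp: conv_carrier_iff)
    then show "\<exists>y\<in>carrier ?R. y \<oplus>\<^bsub>?R\<^esub> x = \<zero>\<^bsub>?R\<^esub>"
      by (intro bexI[of _ "\<lambda>\<alpha>. - x \<alpha>"]) (simp_all add: conv_ring_simps)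
  next
    show "\<zero>\<^bsub>?R\<^esub> \<in> carrier ?R" unfolding conv_carrier_iff conv_ring_simps using has_series_zero by blast
  qed (auto simp: conv_ring_simps algebra_simps)
  show "comm_monoid ?R"
  proof (rule comm_monoidI)
    fix x y assume "x \<in> carrier ?R" "y \<in> carrier ?R"
    then obtain f g where fg: "has_series f x" "has_series g y" by (auto simp: conv_carrier_iff)
    from has_series_mult[OF this] show "x \<otimes>\<^bsub>?R\<^esub> y \<in> carrier ?R" by (auto simp: conv_carrier_iff conv_ring_simps)
    from has_series_mult[OF fg] has_series_mult[OF fg(2,1)] show "x \<otimes>\<^bsub>?R\<^esub> y = y \<otimes>\<^bsub>?R\<^esub> x"
      unfolding conv_ring_simps by (simp add: mult.commute has_series_unique)
  next
    fix x y z assume "x \<in> carrier ?R" "y \<in> carrier ?R" "z \<in> carrier ?R"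
    then obtain f g h where *: "has_series f x" "has_series g y" "has_series h z" by (auto simp: conv_carrier_iff)
    from has_series_mult[OF has_series_mult[OF *(1,2)] *(3)] has_series_mult[OF *(1) has_series_mult[OF *(2,3)]]
    show "x \<otimes>\<^bsub>?R\<^esub> y \<otimes>\<^bsub>?R\<^esub> z = x \<otimes>\<^bsub>?R\<^esub> (y \<otimes>\<^bsub>?R\<^esub> z)"
      unfolding conv_ring_simps by (simp add: mult.assoc has_series_unique)
  next
    show "\<one>\<^bsub>?R\<^esub> \<in> carrier ?R" unfolding conv_carrier_iff conv_ring_simps using has_series_peval by blast
    fix x assume "x \<in> carrier ?R"
    then obtain f where f: "has_series f x" by (auto simp: conv_carrier_iff)
    from has_series_mult[OF has_series_peval[of 1] f] f show "\<one>\<^bsub>?R\<^esub> \<otimes>\<^bsub>?R\<^esub> x = x"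
      unfolding conv_ring_simps by (simp add: has_series_unique)
  qed
  fix x y z assume "x \<in> carrier ?R" "y \<in> carrier ?R" "z \<in> carrier ?R"
  then obtain f g h where *: "has_series f x" "has_series g y" "has_series h z" by (auto simp: conv_carrier_iff)
  from has_series_mult[OF has_series_add[OF *(1,2)] *(3)] has_series_add[OF has_series_mult[OF *(1,3)] has_series_mult[OF *(2,3)]]
  show "(x \<oplus>\<^bsub>?R\<^esub> y) \<otimes>\<^bsub>?R\<^esub> z = x \<otimes>\<^bsub>?R\<^esub> z \<oplus>\<^bsub>?R\<^esub> y \<otimes>\<^bsub>?R\<^esub> z"
    unfolding conv_ring_simps by (simp add: distrib_right has_series_unique)
qed

text \<open>Truncation is multiplicative up to degree N, which lies in \<open>J\<close>. The
  Jacobian ideal will be bounded by such a preimage, so no structure theory of convergent power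
  series is involved.\<close>

lemma ideal_truncations:
  fixes J :: "'n::finite mpoly set"
  assumes J: "is_ideal J" "mpw N \<subseteq> J"
  shows "ideal {h \<in> carrier conv_series_ring. trunc N h \<in> J} (conv_series_ring :: 'n series ring)"
proof (rule idealI)
  let ?R = "conv_series_ring :: 'n series ring"
  interpret R: cring ?R by (rule cring_conv)
  show "ring ?R" by (rule R.ring_axioms)
  show "subgroup {h \<in> carrier ?R. trunc N h \<in> J} (add_monoid ?R)"
  proof (rule R.add.subgroupI)
    have "trunc N (\<lambda>_. 0) = (0 :: 'n mpoly)" by (rule poly_mapping_eqI) simp
    then have "\<zero>\<^bsub>?R\<^esub> \<in> {h \<in> carrier ?R. trunc N h \<in> J}"
      using R.zero_closed is_idealD(1)[OF J(1)] by (simp add: conv_ring_simps)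
    then show "{h \<in> carrier ?R. trunc N h \<in> J} \<noteq> {}" by blast
  next
    fix a assume a: "a \<in> {h \<in> carrier ?R. trunc N h \<in> J}"
    then have "a \<oplus>\<^bsub>?R\<^esub> (\<ominus>\<^bsub>?R\<^esub> a) = \<zero>\<^bsub>?R\<^esub>" using R.r_neg by blast
    then have "\<forall>\<alpha>. a \<alpha> + (\<ominus>\<^bsub>?R\<^esub> a) \<alpha> = 0" unfolding conv_ring_simps by (simp add: fun_eq_iff)
    then have "(\<ominus>\<^bsub>?R\<^esub> a) = (\<lambda>\<alpha>. - a \<alpha>)" by (simp add: fun_eq_iff eq_neg_iff_add_eq_0 add.commute)
    then have "trunc N (\<ominus>\<^bsub>?R\<^esub> a) = - trunc N a" by (intro poly_mapping_eqI) simp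
    then show "\<ominus>\<^bsub>?R\<^esub> a \<in> {h \<in> carrier ?R. trunc N h \<in> J}" using a is_idealD(5)[OF J(1)] by simp
  next
    fix a b assume "a \<in> {h \<in> carrier ?R. trunc N h \<in> J}" "b \<in> {h \<in> carrier ?R. trunc N h \<in> J}"
    then show "a \<oplus>\<^bsub>?R\<^esub> b \<in> {h \<in> carrier ?R. trunc N h \<in> J}"
      using is_idealD(2)[OF J(1)] R.a_closed[of a b] by (simp add: conv_ring_simps trunc_add)
  qed auto
  have mult: "x \<otimes>\<^bsub>?R\<^esub> a \<in> {h \<in> carrier ?R. trunc N h \<in> J}"
    if "a \<in> {h \<in> carrier ?R. trunc N h \<in> J}" "x \<in> carrier ?R" for a x
  proof -
    have "trunc N (cauchy x a) - trunc N x * trunc N a \<in> J" using trunc_cauchy J(2) by blast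
    moreover have "trunc N x * trunc N a \<in> J" using that is_idealD(3)[OF J(1)] by simp
    ultimately have "trunc N (cauchy x a) - trunc N x * trunc N a + trunc N x * trunc N a \<in> J"
      by (rule is_idealD(2)[OF J(1)])
    then show ?thesis using that R.m_closed[of x a] by (simp add: conv_ring_simps)
  qed
  then show "x \<otimes>\<^bsub>?R\<^esub> a \<in> {h \<in> carrier ?R. trunc N h \<in> J}"
    if "a \<in> {h \<in> carrier ?R. trunc N h \<in> J}" "x \<in> carrier ?R" for a x using that by blast
  from mult show "a \<otimes>\<^bsub>?R\<^esub> x \<in> {h \<in> carrier ?R. trunc N h \<in> J}"
    if "a \<in> {h \<in> carrier ?R. trunc N h \<in> J}" "x \<in> carrier ?R" for a x
    using that R.m_comm[of a x] by simp
qed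

text \<open>The scalars in \<open>milnor_number\<close> are the image of this field in the quotient,
  and therefore form a subfield as soon as the quotient is nonzero.\<close>

definition complex_field :: "complex ring" where
  "complex_field = \<lparr>carrier = UNIV, mult = (*), one = 1, zero = 0, add = (+)\<rparr>"

lemma field_complex: "field complex_field"
proof (rule cring.cring_fieldI)
  show "cring complex_field"
  proof (rule cringI)
    show "abelian_group complex_field"
    proof (rule abelian_groupI)
      fix x assume "x \<in> carrier complex_field"
      show "\<exists>y\<in>carrier complex_field. y \<oplus>\<^bsub>complex_field\<^esub> x = \<zero>\<^bsub>complex_field\<^esub>"
        by (rule bexI[of _ "- x"]) (simp_all add: complex_field_def)
    qed (simp_all add: complex_field_def)
    show "comm_monoid complex_field"
      by (rule comm_monoidI) (simp_all add: complex_field_def)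
    show "(x \<oplus>\<^bsub>complex_field\<^esub> y) \<otimes>\<^bsub>complex_field\<^esub> z =
        x \<otimes>\<^bsub>complex_field\<^esub> z \<oplus>\<^bsub>complex_field\<^esub> y \<otimes>\<^bsub>complex_field\<^esub> z" for x y z
      by (simp add: complex_field_def distrib_right)
  qed
  have "\<exists>y. y * x = 1 \<and> x * y = 1" if "x \<noteq> 0" for x :: complex
    using that by (intro exI[of _ "inverse x"]) simp
  then show "Units complex_field = carrier complex_field - {\<zero>\<^bsub>complex_field\<^esub>}"
    by (auto simp: Units_def complex_field_def)
qed

lemma const_series_lookup: "const_series c = lookup (cst c)"
  by (auto simp: const_series_def lookup_single when_def zero_fun_def intro!: ext)

lemma ring_hom_const: "const_series \<in> ring_hom complex_field (conv_series_ring :: 'n::finite series ring)"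
proof (rule ring_hom_memI)
  fix x y :: complex
  show "const_series x \<in> carrier (conv_series_ring :: 'n series ring)"
    unfolding conv_carrier_iff const_series_lookup using has_series_peval by blast
  show "const_series (x \<otimes>\<^bsub>complex_field\<^esub> y) = const_series x \<otimes>\<^bsub>(conv_series_ring :: 'n series ring)\<^esub> const_series y"
    unfolding conv_ring_simps const_series_lookup lookup_mult_cauchy[symmetric] cst_mult
    by (simp add: complex_field_def)
  show "const_series (x \<oplus>\<^bsub>complex_field\<^esub> y) = const_series x \<oplus>\<^bsub>(conv_series_ring :: 'n series ring)\<^esub> const_series y"
    unfolding conv_ring_simps const_series_lookup by (simp add: complex_field_def single_add lookup_add fun_eq_iff)
  show "const_series \<one>\<^bsub>complex_field\<^esub> = \<one>\<^bsub>(conv_series_ring :: 'n series ring)\<^esub>"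
    unfolding conv_ring_simps const_series_lookup by (simp add: complex_field_def)
qed

lemma lookup_in_carrier: "lookup p \<in> carrier conv_series_ring"
  unfolding conv_carrier_iff using has_series_peval by blast

lemma conv_combine:
  assumes "length cs = length ps"
  shows "ring.combine conv_series_ring (map const_series cs) (map lookup ps) =
    lookup (\<Sum>i<length ps. cst (cs ! i) * (ps ! i :: 'n::finite mpoly))"
  using assms
proof (induct cs ps rule: list_induct2)
  interpret R: cring "conv_series_ring :: 'n series ring" by (rule cring_conv)
  case Nil
  then show ?case by (simp add: conv_ring_simps fun_eq_iff)
next
  interpret R: cring "conv_series_ring :: 'n series ring" by (rule cring_conv)
  case (Cons c cs p ps)
  have "(\<Sum>i<length (p # ps). cst ((c # cs) ! i) * ((p # ps) ! i)) = cst c * p + (\<Sum>i<length ps. cst (cs ! i) * (ps ! i))"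
    unfolding length_Cons sum.lessThan_Suc_shift by (simp del: sum.lessThan_Suc)
  moreover have "const_series c \<otimes>\<^bsub>conv_series_ring\<^esub> lookup p = lookup (cst c * p)"
    unfolding conv_ring_simps const_series_lookup lookup_mult_cauchy[symmetric] ..
  ultimately show ?case using Cons by (simp add: conv_ring_simps(4) lookup_add fun_eq_iff)
qed

text \<open>A finite value \<open>enat d\<close> means finite dimension d, so the classes of d + 1
  polynomials satisfy a nontrivial relation. It says that a convergent series lies in the Jacobian
  ideal, and truncation carries this to the truncated polynomial ideal.\<close>

theorem milnor_dependent:
  fixes f :: "complex ^ 'n::finite \<Rightarrow> complex" and h :: "nat \<Rightarrow> 'n mpoly"
  assumes "analytic_germ f" and crit: "\<And>i. partial_deriv f i 0 = 0" and \<mu>: "milnor_number f = enat d" and N: "N \<ge> 1"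
  shows "\<exists>c. (\<exists>i<Suc d. c i \<noteq> 0) \<and>
    (\<Sum>i<Suc d. cst (c i) * h i) \<in> gen_ideal (\<lambda>i. trunc N (series_of (partial_deriv f i))) UNIV N"
proof -
  let ?R = "conv_series_ring :: 'n series ring" and ?f = "\<lambda>i. series_of (partial_deriv f i)"
  interpret R: cring ?R by (rule cring_conv)
  define J where "J = jacobian_ideal f"
  define gI where "gI = gen_ideal (\<lambda>i. trunc N (?f i)) UNIV N"
  have has: "has_series (partial_deriv f i) (?f i)" for i
    using has_series_partial[OF has_series_series_of[OF assms(1)], of i]
    by (intro has_series_series_of) (auto simp: analytic_germ_def)
  have fi: "?f i \<in> carrier ?R" for i unfolding conv_carrier_iff using has by blast
  have "ideal {h \<in> carrier ?R. trunc N h \<in> gI} ?R"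
    unfolding gI_def by (rule ideal_truncations[OF is_ideal_gen_ideal mpw_subset_gen_ideal])
  moreover have "range ?f \<subseteq> {h \<in> carrier ?R. trunc N h \<in> gI}"
  proof
    fix a assume "a \<in> range ?f"
    then obtain i where "a = ?f i" by blast
    then show "a \<in> {h \<in> carrier ?R. trunc N h \<in> gI}"
      using fi gen_in_gen_ideal[of i UNIV "\<lambda>i. trunc N (?f i)" N] by (simp add: gI_def)
  qed
  ultimately have J_sub: "J \<subseteq> {h \<in> carrier ?R. trunc N h \<in> gI}"
    unfolding J_def jacobian_ideal_def by (rule R.genideal_minimal)
  have J_ideal: "ideal J ?R"
    unfolding J_def jacobian_ideal_def by (rule R.genideal_ideal) (use fi in blast)
  interpret J: ideal J ?R by (rule J_ideal)
  define Q where "Q = ?R Quot J"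
  interpret pr: ring_hom_ring ?R Q "(+>\<^bsub>?R\<^esub>) J" unfolding Q_def by (rule J.rcos_ring_hom_ring)
  have ringQ: "ring Q" unfolding Q_def by (rule J.quotient_is_ring)
  define \<kappa> where "\<kappa> c = J +>\<^bsub>?R\<^esub> const_series c" for c
  have "ring_hom_ring complex_field Q \<kappa>"
  proof (rule ring_hom_ringI2)
    show "ring complex_field" using field_complex by (simp add: field_def domain_def cring_def)
    show "ring Q" by (rule ringQ)
    have "(\<lambda>c. J +>\<^bsub>?R\<^esub> const_series c) \<in> ring_hom complex_field Q"
      using ring_hom_trans[OF ring_hom_const pr.homh] by (simp add: o_def)
    also have "(\<lambda>c. J +>\<^bsub>?R\<^esub> const_series c) = \<kappa>" by (simp add: \<kappa>_def fun_eq_iff)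
    finally show "\<kappa> \<in> ring_hom complex_field Q" .
  qed
  then interpret \<kappa>: ring_hom_ring complex_field Q \<kappa> .
  have zero_iff: "J +>\<^bsub>?R\<^esub> a = \<zero>\<^bsub>Q\<^esub> \<Longrightarrow> a \<in> J" if "a \<in> carrier ?R" for a
  proof -
    assume "J +>\<^bsub>?R\<^esub> a = \<zero>\<^bsub>Q\<^esub>"
    then have "J +>\<^bsub>?R\<^esub> a = J +>\<^bsub>?R\<^esub> \<zero>\<^bsub>?R\<^esub>" using pr.hom_zero by simp
    then have "a \<ominus>\<^bsub>?R\<^esub> \<zero>\<^bsub>?R\<^esub> \<in> J" using R.quotient_eq_iff_same_a_r_cos[OF J_ideal that R.zero_closed] by simp
    then show "a \<in> J" using that by (simp add: R.minus_eq)
  qed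
  have f0: "lookup (trunc N (?f i)) 0 = 0" for i
    using has_series_0[OF has[of i]] crit[of i] N by simp
  \<comment> \<open>At a critical point the generators have no constant term, so 1 is not in the
    ideal; hence the scalars embed as a field.\<close>
  have "\<one>\<^bsub>Q\<^esub> \<noteq> \<zero>\<^bsub>Q\<^esub>"
  proof
    assume "\<one>\<^bsub>Q\<^esub> = \<zero>\<^bsub>Q\<^esub>"
    then have "J +>\<^bsub>?R\<^esub> \<one>\<^bsub>?R\<^esub> = \<zero>\<^bsub>Q\<^esub>" using pr.hom_one by simp
    then have "\<one>\<^bsub>?R\<^esub> \<in> J" by (rule zero_iff[OF R.one_closed])
    then have "trunc N (lookup 1) \<in> gI" using J_sub by (auto simp: conv_ring_simps)
    then have "lookup (trunc N (lookup (1 :: 'n mpoly))) 0 = 0"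
      unfolding gI_def by (rule gen_ideal_const_coeff[OF _ N f0])
    then show False using N by simp
  qed
  then have sub: "subfield (\<kappa> ` carrier complex_field) Q"
    using \<kappa>.img_is_subfield(2) field.carrier_is_subfield[OF field_complex] by blast
  define K where "K = range \<kappa>"
  have K: "subfield K Q" using sub by (simp add: K_def complex_field_def)
  have fin: "ring.finite_dimension Q K (carrier Q)" and dim: "ring.dim Q K (carrier Q) = d"
    using \<mu> unfolding milnor_number_def Let_def J_def[symmetric] Q_def[symmetric] \<kappa>_def[symmetric] K_def[symmetric]
    by (auto split: if_splits)
  have dimension: "ring.dimension Q d K (carrier Q)"
    using ring.finite_dimensionE[OF ringQ K fin] dim by (simp add: over_def)
  define ps where "ps = map h [0..<Suc d]"
  define Us where "Us = map (\<lambda>p. J +>\<^bsub>?R\<^esub> lookup p) ps"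
  have len: "length ps = Suc d" "length Us = Suc d" by (simp_all add: ps_def Us_def)
  have Us: "set Us \<subseteq> carrier Q"
    unfolding Us_def using pr.hom_closed[OF lookup_in_carrier] by auto
  have "\<not> ring.independent Q K Us"
  proof
    assume "ring.independent Q K Us"
    from ring.independent_length_le_dimension[OF ringQ K dimension this Us] len show False by simp
  qed
  from ring.dependent_imp_non_trivial_combine[OF ringQ K Us this]
  obtain Ks where Ks: "length Ks = length Us" "ring.combine Q Ks Us = \<zero>\<^bsub>Q\<^esub>" "set Ks \<subseteq> K" "set Ks \<noteq> {\<zero>\<^bsub>Q\<^esub>}"
    by blast
  have "\<exists>cs. Ks = map \<kappa> cs" using Ks(3) unfolding K_def ex_map_conv by auto
  then obtain cs where cs: "Ks = map \<kappa> cs" ..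
  then have lcs: "length cs = length ps" using Ks(1) len by simp
  have nz: "\<exists>i<Suc d. cs ! i \<noteq> 0"
  proof (rule ccontr)
    assume "\<not> ?thesis"
    then have "\<forall>c\<in>set cs. c = 0" using lcs len by (metis in_set_conv_nth)
    moreover have "\<kappa> 0 = \<zero>\<^bsub>Q\<^esub>" using \<kappa>.hom_zero by (simp add: complex_field_def)
    ultimately have "set Ks \<subseteq> {\<zero>\<^bsub>Q\<^esub>}" by (auto simp: cs)
    moreover have "set Ks \<noteq> {}" using Ks(1) len by auto
    ultimately show False using Ks(4) by (metis subset_singletonD)
  qed
  let ?v = "\<Sum>i<Suc d. cst (cs ! i) * h i"
  have "?v = (\<Sum>i<length ps. cst (cs ! i) * (ps ! i))"
    unfolding len by (rule sum.cong) (simp_all add: ps_def del: upt_Suc)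
  then have "J +>\<^bsub>?R\<^esub> lookup ?v = J +>\<^bsub>?R\<^esub> ring.combine ?R (map const_series cs) (map lookup ps)"
    by (simp only: conv_combine[OF lcs])
  also have "\<dots> = ring.combine Q (map ((+>\<^bsub>?R\<^esub>) J) (map const_series cs)) (map ((+>\<^bsub>?R\<^esub>) J) (map lookup ps))"
    by (rule pr.combine_hom[symmetric]) (auto simp: lookup_in_carrier const_series_lookup)
  also have "map ((+>\<^bsub>?R\<^esub>) J) (map const_series cs) = Ks" by (simp add: cs \<kappa>_def)
  also have "map ((+>\<^bsub>?R\<^esub>) J) (map lookup ps) = Us" by (simp add: Us_def)
  finally have "J +>\<^bsub>?R\<^esub> lookup ?v = \<zero>\<^bsub>Q\<^esub>" using Ks(2) by simp
  then have "lookup ?v \<in> J" by (rule zero_iff[OF lookup_in_carrier])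
  then have "trunc N (lookup ?v) \<in> gI" using J_sub by blast
  moreover have "?v - trunc N (lookup ?v) \<in> gI"
    unfolding gI_def using trunc_lookup mpw_subset_gen_ideal by blast
  ultimately have "?v - trunc N (lookup ?v) + trunc N (lookup ?v) \<in> gI"
    unfolding gI_def using is_idealD(2)[OF is_ideal_gen_ideal] by blast
  then have "?v \<in> gI" by simp
  with nz show ?thesis unfolding gI_def by blast
qed

section \<open>Substitution and strict differentiability\<close>

text \<open>Substitution along a map of scalars. The identity gives values at complex points and
  \<open>cst\<close> gives substitution of polynomials, so differentiability needs proof only
  once.\<close>

definition meval :: "(complex \<Rightarrow> 'a::comm_ring_1) \<Rightarrow> ('n::finite \<Rightarrow> 'a) \<Rightarrow> 'n mpoly \<Rightarrow> 'a" where
  "meval \<iota> Q h = (\<Sum>\<alpha>\<in>keys h. \<iota> (lookup h \<alpha>) * (\<Prod>i\<in>UNIV. Q i ^ \<alpha> i))"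

locale scalar_hom =
  fixes \<iota> :: "complex \<Rightarrow> 'a::comm_ring_1"
  assumes \<iota>_one: "\<iota> 1 = 1" and \<iota>_add: "\<iota> (a + b) = \<iota> a + \<iota> b" and \<iota>_mult: "\<iota> (a * b) = \<iota> a * \<iota> b"
begin

lemma \<iota>_zero: "\<iota> 0 = 0"
  using \<iota>_add[of 0 0] by simp

lemma meval_superset:
  "finite A \<Longrightarrow> keys h \<subseteq> A \<Longrightarrow> meval \<iota> Q h = (\<Sum>\<alpha>\<in>A. \<iota> (lookup h \<alpha>) * (\<Prod>i\<in>UNIV. Q i ^ \<alpha> i))"
  unfolding meval_def by (rule sum.mono_neutral_left) (auto simp: in_keys_iff \<iota>_zero)

lemma meval_single: "meval \<iota> Q (Poly_Mapping.single \<alpha> c) = \<iota> c * (\<Prod>i\<in>UNIV. Q i ^ \<alpha> i)"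
proof -
  have "meval \<iota> Q (Poly_Mapping.single \<alpha> c) =
      (\<Sum>\<beta>\<in>{\<alpha>}. \<iota> (lookup (Poly_Mapping.single \<alpha> c) \<beta>) * (\<Prod>i\<in>UNIV. Q i ^ \<beta> i))"
    by (rule meval_superset) simp_all
  then show ?thesis by simp
qed

lemma meval_cst [simp]: "meval \<iota> Q (cst c) = \<iota> c"
  by (simp add: meval_single zero_fun_apply)

lemma meval_zero [simp]: "meval \<iota> Q 0 = 0"
  by (simp add: meval_def)

lemma meval_one [simp]: "meval \<iota> Q 1 = 1"
  using meval_cst[of Q 1] by (simp add: \<iota>_one)

lemma meval_var [simp]: "meval \<iota> Q (mon (expo j 1)) = Q j"
proof -
  have "(\<Prod>i\<in>UNIV. Q i ^ expo j 1 i) = (\<Prod>i\<in>UNIV. if i = j then Q j else 1)"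
    by (rule prod.cong) (auto simp: expo_def)
  then show ?thesis unfolding meval_single by (simp add: \<iota>_one)
qed

lemma meval_add: "meval \<iota> Q (p + q) = meval \<iota> Q p + meval \<iota> Q q"
  using keys_add[of p q]
  by (simp add: meval_superset[of "keys p \<union> keys q"] lookup_add \<iota>_add distrib_right sum.distrib)

lemma meval_diff: "meval \<iota> Q (p - q) = meval \<iota> Q p - meval \<iota> Q q"
  using meval_add[of Q "p - q" q] by simp

lemma meval_sum: "meval \<iota> Q (sum f A) = (\<Sum>a\<in>A. meval \<iota> Q (f a))"
  by (induct A rule: infinite_finite_induct) (simp_all add: meval_add)

lemma meval_mult: "meval \<iota> Q (p * q) = meval \<iota> Q p * meval \<iota> Q q"
proof (rule mpoly_induct[of _ p])
  fix \<alpha> c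
  show "meval \<iota> Q (Poly_Mapping.single \<alpha> c * q) = meval \<iota> Q (Poly_Mapping.single \<alpha> c) * meval \<iota> Q q"
  proof (rule mpoly_induct[of _ q])
    show "meval \<iota> Q (Poly_Mapping.single \<alpha> c * Poly_Mapping.single \<beta> d) =
        meval \<iota> Q (Poly_Mapping.single \<alpha> c) * meval \<iota> Q (Poly_Mapping.single \<beta> d)" for \<beta> d
      by (simp add: mult_single meval_single plus_fun_apply power_add prod.distrib \<iota>_mult mult_ac)
  qed (simp add: meval_add distrib_left)
qed (simp add: meval_add distrib_right)

end

interpretation id_hom: scalar_hom "\<lambda>c :: complex. c"
  by standard simp_all

interpretation cst_hom: scalar_hom "cst :: complex \<Rightarrow> 'n mpoly"
  by standard (simp_all add: single_add cst_mult)

lemma peval_meval: "peval p x = meval (\<lambda>c. c) (($) x) p"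
  by (simp add: peval_def meval_def mpow_def)

abbreviation subst :: "('n::finite \<Rightarrow> 'm mpoly) \<Rightarrow> 'n mpoly \<Rightarrow> 'm mpoly" where
  "subst \<equiv> meval cst"

lemma peval_prod: "peval (prod f A) x = (\<Prod>a\<in>A. peval (f a) x)"
  by (induct A rule: infinite_finite_induct) (simp_all add: peval_mult)

lemma peval_subst: "peval (subst Q h) x = peval h (\<chi> i. peval (Q i) x)"
  by (rule mpoly_induct[of _ h])
     (simp_all add: cst_hom.meval_single cst_hom.meval_add peval_mult peval_prod peval_power peval_add
        mpow_def[of "\<chi> i. peval (Q i) x"])

lemma subst_power: "subst P (p ^ k) = subst P p ^ k"
  by (induct k) (simp_all add: cst_hom.meval_mult)

lemma subst_prod: "subst P (prod f A) = (\<Prod>a\<in>A. subst P (f a))"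
  by (induct A rule: infinite_finite_induct) (simp_all add: cst_hom.meval_mult)

lemma subst_subst: "subst P (subst Q h) = subst (\<lambda>i. subst P (Q i)) h"
  by (rule mpoly_induct[of _ h])
     (simp_all add: cst_hom.meval_single[of Q] cst_hom.meval_single[of "\<lambda>i. subst P (Q i)"] cst_hom.meval_add
        cst_hom.meval_mult subst_prod subst_power)

lemma prod_expo: "(\<Prod>i\<in>UNIV. mon (expo i 1) ^ \<alpha> i) = mon (\<alpha> :: 'n::finite \<Rightarrow> nat)"
proof -
  have pw: "mon \<beta> ^ k = mon (\<lambda>i. k * \<beta> i)" for \<beta> :: "'n \<Rightarrow> nat" and k
    by (induct k) (auto simp: mon_mult zero_fun_def[symmetric] plus_fun_def)
  have "(\<Prod>i\<in>A. mon (expo i 1) ^ \<alpha> i) = mon (\<lambda>j. if j \<in> A then \<alpha> j else 0)" for A :: "'n set"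
    by (induct A rule: infinite_finite_induct)
       (auto simp: pw mon_mult zero_fun_def[symmetric] plus_fun_def expo_def intro!: arg_cong[where f = mon])
  from this[of UNIV] show ?thesis by simp
qed

lemma subst_id: "subst (\<lambda>i. mon (expo i 1)) h = h"
proof (rule mpoly_induct[of _ h])
  fix \<alpha> c
  show "subst (\<lambda>i. mon (expo i 1)) (Poly_Mapping.single \<alpha> c) = Poly_Mapping.single \<alpha> c"
    unfolding cst_hom.meval_single prod_expo by (simp add: mult_single)
qed (simp add: cst_hom.meval_add)

text \<open>The formal partial derivative. The truncated subtraction is harmless: the coefficient
  vanishes when \<open>\<alpha> i = 0\<close>.\<close>

definition pd :: "'n \<Rightarrow> 'n::finite mpoly \<Rightarrow> 'n mpoly" where
  "pd i = lin (\<lambda>\<alpha>. Poly_Mapping.single (\<alpha> - expo i 1) (of_nat (\<alpha> i)))"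

lemma minus_expo: "\<alpha> i \<noteq> 0 \<Longrightarrow> expo i 1 + (\<alpha> - expo i 1) = \<alpha>"
  by (auto simp: fun_eq_iff plus_fun_apply fun_diff_def expo_def)

lemma minus_expo2: "(\<alpha> + expo i 1) - expo i 1 = (\<alpha> :: 'n \<Rightarrow> nat)"
  by (auto simp: fun_eq_iff plus_fun_apply fun_diff_def expo_def)

lemma pd_single: "pd i (Poly_Mapping.single \<alpha> c) = Poly_Mapping.single (\<alpha> - expo i 1) (c * of_nat (\<alpha> i))"
  by (simp add: pd_def mult_single)

lemma pd_add: "pd i (p + q) = pd i p + pd i q"
  by (simp add: pd_def lin_add)

lemma lookup_pd: "lookup (pd i p) \<beta> = of_nat (\<beta> i + 1) * lookup p (\<beta> + expo i 1)"
proof (rule mpoly_induct[of _ p])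
  fix \<alpha> c
  show "lookup (pd i (Poly_Mapping.single \<alpha> c)) \<beta> = of_nat (\<beta> i + 1) * lookup (Poly_Mapping.single \<alpha> c) (\<beta> + expo i 1)"
  proof (cases "\<alpha> = \<beta> + expo i 1")
    case True
    have "\<alpha> i = \<beta> i + 1" unfolding True by (simp add: plus_fun_apply)
    with True show ?thesis by (simp add: pd_single minus_expo2[unfolded One_nat_def])
  next
    case False
    have "\<alpha> i = 0 \<or> \<alpha> - expo i 1 \<noteq> \<beta>" using False minus_expo[of \<alpha> i] by (metis add.commute)
    with False show ?thesis by (auto simp: pd_single lookup_single when_def)
  qed
qed (simp add: pd_add lookup_add distrib_left)

lemma pd_mon_expo: "pd i (mon (\<alpha> + expo j 1)) = (if i = j then mon \<alpha> else 0) + mon (expo j 1) * pd i (mon \<alpha>)"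
proof (cases "i = j")
  case True
  have "mon (expo i 1) * pd i (mon \<alpha>) = Poly_Mapping.single \<alpha> (of_nat (\<alpha> i))"
    unfolding pd_single mult_single by (cases "\<alpha> i = 0") (simp_all add: minus_expo[unfolded One_nat_def])
  moreover have "pd i (mon (\<alpha> + expo i 1)) = Poly_Mapping.single \<alpha> (1 + of_nat (\<alpha> i))"
    unfolding pd_single minus_expo2 by (simp add: plus_fun_apply)
  ultimately show ?thesis using True by (simp add: single_add)
next
  case False
  have "mon (expo j 1) * pd i (mon \<alpha>) = Poly_Mapping.single (expo j 1 + (\<alpha> - expo i 1)) (of_nat (\<alpha> i))"
    by (simp add: pd_single mult_single)
  moreover have "pd i (mon (\<alpha> + expo j 1)) = Poly_Mapping.single (\<alpha> + expo j 1 - expo i 1) (of_nat (\<alpha> i))"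
    using False by (simp add: pd_single plus_fun_apply)
  moreover have "\<alpha> i \<noteq> 0 \<Longrightarrow> expo j 1 + (\<alpha> - expo i 1) = \<alpha> + expo j 1 - expo i 1"
    using False by (auto simp: fun_eq_iff plus_fun_apply fun_diff_def expo_def)
  ultimately show ?thesis using False by (cases "\<alpha> i = 0") simp_all
qed

section \<open>Strict differentiability of substitution\<close>

locale seminorm_hom = scalar_hom \<iota> for \<iota> :: "complex \<Rightarrow> 'a::comm_ring_1" +
  fixes nm :: "'a \<Rightarrow> real"
  assumes nm_zero [simp]: "nm 0 = 0" and nm_add: "nm (a + b) \<le> nm a + nm b"
    and nm_mult: "nm (a * b) \<le> nm a * nm b" and nm_minus [simp]: "nm (- a) = nm a"
begin

lemma nm_nonneg [simp]: "0 \<le> nm a"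
  using nm_add[of a "- a"] by simp

lemma nm_diff: "nm (a - b) \<le> nm a + nm b"
  using nm_add[of a "- b"] by simp

lemma nm_sum: "nm (sum f A) \<le> (\<Sum>a\<in>A. nm (f a))"
proof (induct A rule: infinite_finite_induct)
  case (insert x F) then show ?case using nm_add[of "f x" "sum f F"] by simp
qed simp_all

definition near :: "('n::finite \<Rightarrow> 'a) \<Rightarrow> real \<Rightarrow> ('n \<Rightarrow> 'a) \<Rightarrow> bool" where
  "near P \<delta> Q \<longleftrightarrow> (\<forall>i. nm (Q i - P i) \<le> \<delta>)"

definition gap :: "('n::finite \<Rightarrow> 'a) \<Rightarrow> ('n \<Rightarrow> 'a) \<Rightarrow> real" where
  "gap Q Q' = (\<Sum>i\<in>UNIV. nm (Q i - Q' i))"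

text \<open>Strict differentiability: the error is small against the distance of the two arguments
  from each other, not from the base point. Local injectivity and Newton's iteration with a frozen
  derivative both depend on this.\<close>

definition strict_deriv :: "('n::finite \<Rightarrow> 'a) \<Rightarrow> (('n \<Rightarrow> 'a) \<Rightarrow> 'a) \<Rightarrow> ('n \<Rightarrow> 'a) \<Rightarrow> bool" where
  "strict_deriv P g D \<longleftrightarrow> (\<forall>\<epsilon>>0. \<exists>\<delta>>0. \<forall>Q Q'. near P \<delta> Q \<longrightarrow> near P \<delta> Q' \<longrightarrow>
     nm (g Q - g Q' - (\<Sum>i\<in>UNIV. D i * (Q i - Q' i))) \<le> \<epsilon> * gap Q Q')"

lemma near_mono: "near P \<delta> Q \<Longrightarrow> \<delta> \<le> \<delta>' \<Longrightarrow> near P \<delta>' Q"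
  unfolding near_def by (meson order_trans)

lemma near_self: "0 \<le> \<delta> \<Longrightarrow> near P \<delta> P"
  by (simp add: near_def)

lemma gap_nonneg [simp]: "0 \<le> gap Q Q'"
  by (simp add: gap_def sum_nonneg)

lemma gap_near: "near P \<delta> (Q :: 'n::finite \<Rightarrow> 'a) \<Longrightarrow> gap Q P \<le> real CARD('n) * \<delta>"
  unfolding gap_def near_def using sum_bounded_above[of UNIV "\<lambda>i. nm (Q i - P i)" \<delta>] by simp

lemma nm_linear: "nm (\<Sum>i\<in>UNIV. D i * (Q i - Q' i)) \<le> (\<Sum>i\<in>UNIV. nm (D i)) * gap Q Q'"
proof -
  have "nm (\<Sum>i\<in>UNIV. D i * (Q i - Q' i)) \<le> (\<Sum>i\<in>UNIV. nm (D i * (Q i - Q' i)))" by (rule nm_sum)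
  also have "\<dots> \<le> (\<Sum>i\<in>UNIV. (\<Sum>i\<in>UNIV. nm (D i)) * nm (Q i - Q' i))"
  proof (rule sum_mono)
    fix i
    have "nm (D i) \<le> (\<Sum>i\<in>UNIV. nm (D i))" by (rule member_le_sum) auto
    then have "nm (D i) * nm (Q i - Q' i) \<le> (\<Sum>i\<in>UNIV. nm (D i)) * nm (Q i - Q' i)"
      by (rule mult_right_mono) simp
    with nm_mult[of "D i" "Q i - Q' i"] show "nm (D i * (Q i - Q' i)) \<le> (\<Sum>i\<in>UNIV. nm (D i)) * nm (Q i - Q' i)" by linarith
  qed
  finally show ?thesis by (simp add: gap_def sum_distrib_left)
qed

lemma strict_deriv_lipschitz:
  assumes "strict_deriv P g D"
  obtains L \<delta> where "L > 0" "\<delta> > 0" "\<forall>Q Q'. near P \<delta> Q \<longrightarrow> near P \<delta> Q' \<longrightarrow> nm (g Q - g Q') \<le> L * gap Q Q'"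
proof -
  obtain \<delta> where \<delta>: "\<delta> > 0" "\<And>Q Q'. near P \<delta> Q \<Longrightarrow> near P \<delta> Q' \<Longrightarrow>
     nm (g Q - g Q' - (\<Sum>i\<in>UNIV. D i * (Q i - Q' i))) \<le> 1 * gap Q Q'"
    using assms unfolding strict_deriv_def by (meson zero_less_one)
  have "nm (g Q - g Q') \<le> (1 + (\<Sum>i\<in>UNIV. nm (D i))) * gap Q Q'" if "near P \<delta> Q" "near P \<delta> Q'" for Q Q'
    using \<delta>(2)[OF that] nm_linear[of D Q Q']
      nm_add[of "g Q - g Q' - (\<Sum>i\<in>UNIV. D i * (Q i - Q' i))" "\<Sum>i\<in>UNIV. D i * (Q i - Q' i)"]
    by (simp add: algebra_simps)
  moreover have "1 + (\<Sum>i\<in>UNIV. nm (D i)) > 0" using sum_nonneg[of UNIV "\<lambda>i. nm (D i)"] by simp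
  ultimately show ?thesis using that \<delta>(1) by blast
qed

lemma strict_deriv_const: "strict_deriv P (\<lambda>Q. a) (\<lambda>i. 0)"
  unfolding strict_deriv_def by (auto intro!: exI[of _ 1])

lemma strict_deriv_var: "strict_deriv P (\<lambda>Q. Q j) (\<lambda>i. if i = j then 1 else 0)"
  unfolding strict_deriv_def by (auto intro!: exI[of _ 1] simp: if_distrib[where f = "\<lambda>x. x * _"] cong: if_cong)

lemma strict_deriv_add:
  assumes "strict_deriv P g D" "strict_deriv P h E"
  shows "strict_deriv P (\<lambda>Q. g Q + h Q) (\<lambda>i. D i + E i)"
  unfolding strict_deriv_def
proof (intro allI impI)
  fix \<epsilon> :: real assume "\<epsilon> > 0"
  then have e2: "\<epsilon> / 2 > 0" by simp
  obtain \<delta>1 where \<delta>1: "\<delta>1 > 0" "\<And>Q Q'. near P \<delta>1 Q \<Longrightarrow> near P \<delta>1 Q' \<Longrightarrow>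
     nm (g Q - g Q' - (\<Sum>i\<in>UNIV. D i * (Q i - Q' i))) \<le> \<epsilon> / 2 * gap Q Q'"
    using assms(1) e2 unfolding strict_deriv_def by meson
  obtain \<delta>2 where \<delta>2: "\<delta>2 > 0" "\<And>Q Q'. near P \<delta>2 Q \<Longrightarrow> near P \<delta>2 Q' \<Longrightarrow>
     nm (h Q - h Q' - (\<Sum>i\<in>UNIV. E i * (Q i - Q' i))) \<le> \<epsilon> / 2 * gap Q Q'"
    using assms(2) e2 unfolding strict_deriv_def by meson
  show "\<exists>\<delta>>0. \<forall>Q Q'. near P \<delta> Q \<longrightarrow> near P \<delta> Q' \<longrightarrow>
     nm (g Q + h Q - (g Q' + h Q') - (\<Sum>i\<in>UNIV. (D i + E i) * (Q i - Q' i))) \<le> \<epsilon> * gap Q Q'"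
  proof (intro exI conjI allI impI)
    show "min \<delta>1 \<delta>2 > 0" using \<delta>1 \<delta>2 by simp
    fix Q Q' assume Q: "near P (min \<delta>1 \<delta>2) Q" "near P (min \<delta>1 \<delta>2) Q'"
    have *: "g Q + h Q - (g Q' + h Q') - (\<Sum>i\<in>UNIV. (D i + E i) * (Q i - Q' i)) =
      (g Q - g Q' - (\<Sum>i\<in>UNIV. D i * (Q i - Q' i))) + (h Q - h Q' - (\<Sum>i\<in>UNIV. E i * (Q i - Q' i)))"
      by (simp add: distrib_right sum.distrib)
    have "nm (g Q - g Q' - (\<Sum>i\<in>UNIV. D i * (Q i - Q' i))) \<le> \<epsilon> / 2 * gap Q Q'"
      by (rule \<delta>1(2)) (use Q near_mono in \<open>auto intro: near_mono\<close>)
    moreover have "nm (h Q - h Q' - (\<Sum>i\<in>UNIV. E i * (Q i - Q' i))) \<le> \<epsilon> / 2 * gap Q Q'"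
      by (rule \<delta>2(2)) (use Q near_mono in \<open>auto intro: near_mono\<close>)
    moreover have "\<epsilon> / 2 * gap Q Q' + \<epsilon> / 2 * gap Q Q' = \<epsilon> * gap Q Q'" by simp
    ultimately show "nm (g Q + h Q - (g Q' + h Q') - (\<Sum>i\<in>UNIV. (D i + E i) * (Q i - Q' i))) \<le> \<epsilon> * gap Q Q'"
      unfolding * by (smt (verit) nm_add)
  qed
qed

lemma strict_deriv_near:
  assumes "strict_deriv P g D" "\<eta> > 0"
  obtains \<delta> where "\<delta> > 0" "\<forall>Q. near P \<delta> Q \<longrightarrow> nm (g Q - g (P :: 'n::finite \<Rightarrow> 'a)) \<le> \<eta>"
proof -
  obtain L \<delta> where L: "L > 0" "\<delta> > 0" "\<forall>Q Q'. near P \<delta> Q \<longrightarrow> near P \<delta> Q' \<longrightarrow> nm (g Q - g Q') \<le> L * gap Q Q'"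
    by (rule strict_deriv_lipschitz[OF assms(1)]) (rule that)
  define \<delta>' where "\<delta>' = min \<delta> (\<eta> / (L * CARD('n)))"
  have \<delta>': "\<delta>' > 0" "\<delta>' \<le> \<delta>" "L * (CARD('n) * \<delta>') \<le> \<eta>"
  proof -
    show "\<delta>' > 0" "\<delta>' \<le> \<delta>" using L assms(2) by (simp_all add: \<delta>'_def)
    have "L * CARD('n) > 0" using L by simp
    moreover have "\<delta>' \<le> \<eta> / (L * CARD('n))" by (simp add: \<delta>'_def)
    ultimately show "L * (CARD('n) * \<delta>') \<le> \<eta>" by (simp add: pos_le_divide_eq mult_ac)
  qed
  have "nm (g Q - g P) \<le> \<eta>" if Q: "near P \<delta>' Q" for Q
  proof -
    have "nm (g Q - g P) \<le> L * gap Q P"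
      using L(3) near_mono[OF Q \<delta>'(2)] near_self[of \<delta> P] L(2) by simp
    also have "\<dots> \<le> L * (CARD('n) * \<delta>')" using gap_near[OF Q] L(1) by simp
    finally show ?thesis using \<delta>'(3) by simp
  qed
  with \<delta>'(1) that show ?thesis by blast
qed

text \<open>The product rule: errors of the factors are multiplied by bounded values, and replacing
  values near \<open>P\<close> by those at \<open>P\<close> costs a small factor times the
  derivative.\<close>

lemma strict_deriv_mult:
  assumes g: "strict_deriv P g D" and h: "strict_deriv P h E"
  shows "strict_deriv P (\<lambda>Q. g Q * h Q) (\<lambda>i. g P * E i + h P * D i)"
  unfolding strict_deriv_def
proof (intro allI impI)
  fix \<epsilon> :: real assume \<epsilon>: "\<epsilon> > 0"
  define KD where "KD = (\<Sum>i\<in>UNIV. nm (D i))"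
  define KE where "KE = (\<Sum>i\<in>UNIV. nm (E i))"
  have K: "KD \<ge> 0" "KE \<ge> 0" by (simp_all add: KD_def KE_def sum_nonneg)
  define M where "M = (nm (g P) + 1) + (nm (h P) + 1) + KD + KE"
  have M: "M > 0" unfolding M_def using K nm_nonneg[of "g P"] nm_nonneg[of "h P"] by linarith
  \<comment> \<open>\<open>M\<close> collects the factors by which the four error terms are
    multiplied, so \<open>\<eta>\<close> with M \<open>\<eta>\<close> <= \<open>\<epsilon>\<close>
    is the tolerance granted to each of them.\<close>
  define \<eta> where "\<eta> = min 1 (\<epsilon> / M)"
  have "\<eta> \<le> \<epsilon> / M" by (simp add: \<eta>_def)
  then have "M * \<eta> \<le> \<epsilon>" using M by (simp add: pos_le_divide_eq mult.commute)
  with M \<epsilon> have \<eta>: "\<eta> > 0" "\<eta> \<le> 1" "M * \<eta> \<le> \<epsilon>" by (simp_all add: \<eta>_def)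
  obtain \<delta>1 where \<delta>1: "\<delta>1 > 0" "\<And>Q Q'. near P \<delta>1 Q \<Longrightarrow> near P \<delta>1 Q' \<Longrightarrow>
     nm (g Q - g Q' - (\<Sum>i\<in>UNIV. D i * (Q i - Q' i))) \<le> \<eta> * gap Q Q'"
    using g \<eta>(1) unfolding strict_deriv_def by meson
  obtain \<delta>2 where \<delta>2: "\<delta>2 > 0" "\<And>Q Q'. near P \<delta>2 Q \<Longrightarrow> near P \<delta>2 Q' \<Longrightarrow>
     nm (h Q - h Q' - (\<Sum>i\<in>UNIV. E i * (Q i - Q' i))) \<le> \<eta> * gap Q Q'"
    using h \<eta>(1) unfolding strict_deriv_def by meson
  obtain \<delta>3 where \<delta>3: "\<delta>3 > 0" "\<forall>Q. near P \<delta>3 Q \<longrightarrow> nm (g Q - g P) \<le> \<eta>"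
    by (rule strict_deriv_near[OF g \<eta>(1)]) (rule that)
  obtain \<delta>4 where \<delta>4: "\<delta>4 > 0" "\<forall>Q. near P \<delta>4 Q \<longrightarrow> nm (h Q - h P) \<le> \<eta>"
    by (rule strict_deriv_near[OF h \<eta>(1)]) (rule that)
  define \<delta> where "\<delta> = min (min \<delta>1 \<delta>2) (min \<delta>3 \<delta>4)"
  show "\<exists>\<delta>>0. \<forall>Q Q'. near P \<delta> Q \<longrightarrow> near P \<delta> Q' \<longrightarrow>
     nm (g Q * h Q - g Q' * h Q' - (\<Sum>i\<in>UNIV. (g P * E i + h P * D i) * (Q i - Q' i))) \<le> \<epsilon> * gap Q Q'"
  proof (intro exI conjI allI impI)
    show "\<delta> > 0" using \<delta>1 \<delta>2 \<delta>3 \<delta>4 by (simp add: \<delta>_def)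
    fix Q Q' assume Q: "near P \<delta> Q" "near P \<delta> Q'"
    let ?S = "gap Q Q'" and ?dD = "\<Sum>i\<in>UNIV. D i * (Q i - Q' i)" and ?dE = "\<Sum>i\<in>UNIV. E i * (Q i - Q' i)"
    have nr: "near P \<delta>1 Q" "near P \<delta>1 Q'" "near P \<delta>2 Q" "near P \<delta>2 Q'" "near P \<delta>3 Q" "near P \<delta>4 Q'"
      by (auto intro: near_mono[OF Q(1)] near_mono[OF Q(2)] simp: \<delta>_def)
    \<comment> \<open>\<open>u\<close> and \<open>v\<close> carry the errors of the factors,
      \<open>w\<close> and \<open>z\<close> the change of the values of \<open>g\<close> and
      \<open>h\<close> between the moving points and \<open>P\<close>.\<close>
    define u v w z where "u = g Q * (h Q - h Q' - ?dE)" and "v = h Q' * (g Q - g Q' - ?dD)"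
      and "w = (g Q - g P) * ?dE" and "z = (h Q' - h P) * ?dD"
    have eq: "g Q * h Q - g Q' * h Q' - (\<Sum>i\<in>UNIV. (g P * E i + h P * D i) * (Q i - Q' i)) = u + v + w + z"
    proof -
      have "(\<Sum>i\<in>UNIV. (g P * E i + h P * D i) * (Q i - Q' i)) = g P * ?dE + h P * ?dD"
        by (simp add: distrib_right sum.distrib sum_distrib_left mult.assoc)
      then show ?thesis unfolding u_def v_def w_def z_def by (simp only:) (simp add: algebra_simps)
    qed
    have gQ: "nm (g Q) \<le> nm (g P) + 1"
      using \<delta>3(2) nr(5) \<eta>(2) nm_add[of "g Q - g P" "g P"] by fastforce
    have hQ: "nm (h Q') \<le> nm (h P) + 1"
      using \<delta>4(2) nr(6) \<eta>(2) nm_add[of "h Q' - h P" "h P"] by fastforce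
    have "nm u \<le> (nm (g P) + 1) * (\<eta> * ?S)"
      unfolding u_def by (rule order_trans[OF nm_mult mult_mono[OF gQ \<delta>2(2)[OF nr(3,4)]]]) auto
    moreover have "nm v \<le> (nm (h P) + 1) * (\<eta> * ?S)"
      unfolding v_def by (rule order_trans[OF nm_mult mult_mono[OF hQ \<delta>1(2)[OF nr(1,2)]]]) auto
    moreover have "nm w \<le> \<eta> * (KE * ?S)"
      unfolding w_def KE_def
      by (rule order_trans[OF nm_mult mult_mono[OF _ nm_linear]]) (use \<delta>3(2) nr(5) \<eta>(1) in auto)
    moreover have "nm z \<le> \<eta> * (KD * ?S)"
      unfolding z_def KD_def
      by (rule order_trans[OF nm_mult mult_mono[OF _ nm_linear]]) (use \<delta>4(2) nr(6) \<eta>(1) in auto)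
    moreover have "(nm (g P) + 1) * (\<eta> * ?S) + (nm (h P) + 1) * (\<eta> * ?S) + \<eta> * (KE * ?S) + \<eta> * (KD * ?S) = M * \<eta> * ?S"
      unfolding M_def by (simp add: algebra_simps)
    moreover have "M * \<eta> * ?S \<le> \<epsilon> * ?S" using \<eta>(3) by (intro mult_right_mono) auto
    moreover have "nm (u + v + w + z) \<le> nm u + nm v + nm w + nm z"
      using nm_add[of "u + v + w" z] nm_add[of "u + v" w] nm_add[of u v] by linarith
    ultimately show "nm (g Q * h Q - g Q' * h Q' - (\<Sum>i\<in>UNIV. (g P * E i + h P * D i) * (Q i - Q' i))) \<le> \<epsilon> * ?S"
      unfolding eq by linarith
  qed
qed

lemma strict_deriv_mon:
  "strict_deriv P (\<lambda>Q. meval \<iota> Q (mon (\<alpha> :: 'n::finite \<Rightarrow> nat))) (\<lambda>i. meval \<iota> P (pd i (mon \<alpha>)))"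
proof (induct "mdeg \<alpha>" arbitrary: \<alpha>)
  case 0
  then have "\<alpha> = 0" by simp
  have "pd i (mon 0) = 0" for i :: 'n unfolding pd_single by (simp add: zero_fun_apply)
  moreover have "meval \<iota> Q (mon 0) = \<iota> 1" for Q :: "'n \<Rightarrow> 'a" by (rule meval_cst)
  ultimately show ?case unfolding \<open>\<alpha> = 0\<close> using strict_deriv_const[of P "\<iota> 1"] by simp
next
  case (Suc d)
  then have "\<alpha> \<noteq> 0" by auto
  then obtain j where "\<alpha> j \<noteq> 0" unfolding fun_eq_iff zero_fun_apply by blast
  then have "1 \<le> \<alpha> j" by simp
  from mindex_split[of 1 \<alpha> j, OF this] obtain \<gamma> where \<alpha>: "\<alpha> = \<gamma> + expo j 1" ..
  have "d = mdeg \<gamma>" using Suc(2) \<alpha> by simp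
  from strict_deriv_mult[OF strict_deriv_var[of P j] Suc(1)[OF this]]
  have "strict_deriv P (\<lambda>Q. Q j * meval \<iota> Q (mon \<gamma>))
     (\<lambda>i. P j * meval \<iota> P (pd i (mon \<gamma>)) + meval \<iota> P (mon \<gamma>) * (if i = j then 1 else 0))" .
  also have "(\<lambda>Q. Q j * meval \<iota> Q (mon \<gamma>)) = (\<lambda>Q. meval \<iota> Q (mon \<alpha>))"
    unfolding \<alpha> mon_mult[symmetric] meval_mult meval_var by (simp only: mult.commute)
  also have "(\<lambda>i. P j * meval \<iota> P (pd i (mon \<gamma>)) + meval \<iota> P (mon \<gamma>) * (if i = j then 1 else 0)) =
     (\<lambda>i. meval \<iota> P (pd i (mon \<alpha>)))"
    unfolding \<alpha> pd_mon_expo meval_add meval_mult meval_var by (auto simp: fun_eq_iff)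
  finally show ?case .
qed

theorem strict_deriv_meval: "strict_deriv P (\<lambda>Q. meval \<iota> Q h) (\<lambda>i. meval \<iota> P (pd i h))"
proof (rule mpoly_induct[of _ h])
  fix \<alpha> c
  have "strict_deriv P (\<lambda>Q. \<iota> c * meval \<iota> Q (mon \<alpha>)) (\<lambda>i. \<iota> c * meval \<iota> P (pd i (mon \<alpha>)) + meval \<iota> P (mon \<alpha>) * 0)"
    by (rule strict_deriv_mult[OF strict_deriv_const strict_deriv_mon])
  then show "strict_deriv P (\<lambda>Q. meval \<iota> Q (Poly_Mapping.single \<alpha> c)) (\<lambda>i. meval \<iota> P (pd i (Poly_Mapping.single \<alpha> c)))"
    by (simp add: meval_single pd_single \<iota>_mult \<iota>_one mult_ac)
qed (auto simp: meval_add pd_add intro: strict_deriv_add)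

end

text \<open>The sum of the absolute values of the terms at the point (\<open>\<rho>\<close>, ...,
  \<open>\<rho>\<close>); it is submultiplicative and bounds coefficients, so it detects
  convergence.\<close>

definition wnorm :: "real \<Rightarrow> 'n::finite mpoly \<Rightarrow> real" where
  "wnorm \<rho> p = (\<Sum>\<alpha>\<in>keys p. norm (lookup p \<alpha>) * \<rho> ^ mdeg \<alpha>)"

lemma wnorm_superset: "finite A \<Longrightarrow> keys p \<subseteq> A \<Longrightarrow> wnorm \<rho> p = (\<Sum>\<alpha>\<in>A. norm (lookup p \<alpha>) * \<rho> ^ mdeg \<alpha>)"
  unfolding wnorm_def by (rule sum.mono_neutral_left) (auto simp: in_keys_iff)

lemma wnorm_single [simp]: "wnorm \<rho> (Poly_Mapping.single \<alpha> c) = norm c * \<rho> ^ mdeg \<alpha>"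
proof -
  have "wnorm \<rho> (Poly_Mapping.single \<alpha> c) = (\<Sum>\<beta>\<in>{\<alpha>}. norm (lookup (Poly_Mapping.single \<alpha> c) \<beta>) * \<rho> ^ mdeg \<beta>)"
    by (rule wnorm_superset) simp_all
  then show ?thesis by simp
qed

lemma wnorm_add:
  assumes "\<rho> \<ge> 0" shows "wnorm \<rho> (p + q) \<le> wnorm \<rho> p + wnorm \<rho> q"
proof -
  let ?A = "keys p \<union> keys q"
  have "wnorm \<rho> (p + q) = (\<Sum>\<alpha>\<in>?A. norm (lookup p \<alpha> + lookup q \<alpha>) * \<rho> ^ mdeg \<alpha>)"
    using keys_add[of p q] by (simp add: wnorm_superset[of ?A] lookup_add)
  also have "\<dots> \<le> (\<Sum>\<alpha>\<in>?A. (norm (lookup p \<alpha>) + norm (lookup q \<alpha>)) * \<rho> ^ mdeg \<alpha>)"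
    by (intro sum_mono mult_right_mono norm_triangle_ineq) (use assms in auto)
  finally show ?thesis
    by (simp add: wnorm_superset[of ?A] distrib_right sum.distrib)
qed

lemma wnorm_sum: "\<rho> \<ge> 0 \<Longrightarrow> wnorm \<rho> (sum f A) \<le> (\<Sum>a\<in>A. wnorm \<rho> (f a))"
proof (induct A rule: infinite_finite_induct)
  case (insert x F) then show ?case using wnorm_add[of \<rho> "f x" "sum f F"] by simp
qed (simp_all add: wnorm_def)

lemma wnorm_mult:
  assumes "\<rho> \<ge> 0" shows "wnorm \<rho> (p * q) \<le> wnorm \<rho> p * wnorm \<rho> q"
proof -
  have "p * q = (\<Sum>\<alpha>\<in>keys p. Poly_Mapping.single \<alpha> (lookup p \<alpha>)) * (\<Sum>\<beta>\<in>keys q. Poly_Mapping.single \<beta> (lookup q \<beta>))"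
    using mpoly_sum_keys[of "keys p" p] mpoly_sum_keys[of "keys q" q] by simp
  also have "\<dots> = (\<Sum>\<alpha>\<in>keys p. \<Sum>\<beta>\<in>keys q. Poly_Mapping.single (\<alpha> + \<beta>) (lookup p \<alpha> * lookup q \<beta>))"
    by (simp add: sum_product mult_single)
  finally have pq: "p * q = \<dots>" .
  have "wnorm \<rho> (p * q) \<le> (\<Sum>\<alpha>\<in>keys p. \<Sum>\<beta>\<in>keys q. wnorm \<rho> (Poly_Mapping.single (\<alpha> + \<beta>) (lookup p \<alpha> * lookup q \<beta>)))"
    unfolding pq by (intro order_trans[OF wnorm_sum[OF assms]] sum_mono wnorm_sum[OF assms])
  also have "\<dots> = wnorm \<rho> p * wnorm \<rho> q"
    by (simp add: wnorm_def[of \<rho> p] wnorm_def[of \<rho> q] sum_product norm_mult power_add mult_ac)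
  finally show ?thesis .
qed

lemma seminorm_hom_wnorm: "\<rho> \<ge> 0 \<Longrightarrow> seminorm_hom (cst :: complex \<Rightarrow> 'n::finite mpoly) (wnorm \<rho>)"
proof unfold_locales
  show "wnorm \<rho> (- a) = wnorm \<rho> a" for a :: "'n mpoly"
  proof -
    have "keys (- a) = keys a" by (auto simp: in_keys_iff)
    then show ?thesis by (simp add: wnorm_def)
  qed
qed (auto simp: wnorm_add wnorm_mult, simp add: wnorm_def)

interpretation complex_norm: seminorm_hom "\<lambda>c :: complex. c" norm
  by unfold_locales (auto simp: norm_triangle_ineq norm_mult)

lemma wnorm_subst_le:
  fixes Q :: "'a::finite \<Rightarrow> 'b::finite mpoly"
  assumes \<rho>: "\<rho> \<ge> 0" and Q: "\<And>i. wnorm \<rho> (Q i) \<le> R"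
  shows "wnorm \<rho> (subst Q h) \<le> wnorm R h"
proof -
  have R: "R \<ge> 0" by (rule order_trans[OF _ Q[of undefined]]) (simp add: wnorm_def sum_nonneg \<rho>)
  have wn1: "wnorm \<rho> (1 :: 'b mpoly) = 1" using wnorm_single[of \<rho> 0 1] by (simp del: wnorm_single add: wnorm_def)
  have pw: "wnorm \<rho> (q ^ k) \<le> wnorm \<rho> q ^ k" for q :: "'b mpoly" and k
  proof (induct k)
    case 0 show ?case using wn1 by simp
  next
    case (Suc k)
    have "wnorm \<rho> (q * q ^ k) \<le> wnorm \<rho> q * wnorm \<rho> (q ^ k)" by (rule wnorm_mult[OF \<rho>])
    also have "\<dots> \<le> wnorm \<rho> q * wnorm \<rho> q ^ k"
      using Suc \<rho> by (intro mult_left_mono) (auto simp: wnorm_def sum_nonneg)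
    finally show ?case by simp
  qed
  have pr: "wnorm \<rho> (\<Prod>i\<in>A. Q i ^ \<alpha> i) \<le> (\<Prod>i\<in>A. R ^ \<alpha> i)" for \<alpha> A
  proof (induct A rule: infinite_finite_induct)
    case (insert x F)
    have "wnorm \<rho> (Q x ^ \<alpha> x) \<le> R ^ \<alpha> x"
      by (rule order_trans[OF pw power_mono[OF Q]]) (use \<rho> in \<open>auto simp: wnorm_def sum_nonneg\<close>)
    then have "wnorm \<rho> (Q x ^ \<alpha> x) * wnorm \<rho> (\<Prod>i\<in>F. Q i ^ \<alpha> i) \<le> R ^ \<alpha> x * (\<Prod>i\<in>F. R ^ \<alpha> i)"
      using insert R by (intro mult_mono) (auto simp: wnorm_def sum_nonneg \<rho>)
    with insert wnorm_mult[OF \<rho>, of "Q x ^ \<alpha> x" "\<Prod>i\<in>F. Q i ^ \<alpha> i"] show ?case by simp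
  qed (simp_all add: wn1)
  have "wnorm \<rho> (subst Q h) \<le> (\<Sum>\<alpha>\<in>keys h. wnorm \<rho> (cst (lookup h \<alpha>) * (\<Prod>i\<in>UNIV. Q i ^ \<alpha> i)))"
    unfolding meval_def by (rule wnorm_sum[OF \<rho>])
  also have "\<dots> \<le> (\<Sum>\<alpha>\<in>keys h. norm (lookup h \<alpha>) * R ^ mdeg \<alpha>)"
  proof (rule sum_mono)
    fix \<alpha>
    have "wnorm \<rho> (cst (lookup h \<alpha>) * (\<Prod>i\<in>UNIV. Q i ^ \<alpha> i)) \<le> norm (lookup h \<alpha>) * wnorm \<rho> (\<Prod>i\<in>UNIV. Q i ^ \<alpha> i)"
      using wnorm_mult[OF \<rho>, of "cst (lookup h \<alpha>)"] by simp
    also have "\<dots> \<le> norm (lookup h \<alpha>) * (\<Prod>i\<in>UNIV. R ^ \<alpha> i)" by (intro mult_left_mono pr) simp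
    finally show "wnorm \<rho> (cst (lookup h \<alpha>) * (\<Prod>i\<in>UNIV. Q i ^ \<alpha> i)) \<le> norm (lookup h \<alpha>) * R ^ mdeg \<alpha>"
      by (simp add: mdeg_def power_sum)
  qed
  finally show ?thesis by (simp add: wnorm_def)
qed

section \<open>Composition and inversion of coordinate changes\<close>

lemma mpoly_ring_induct:
  fixes p :: "'n::finite mpoly"
  assumes cst: "\<And>c. P (cst c)" and var: "\<And>j. P (mon (expo j 1))"
    and add: "\<And>p q. P p \<Longrightarrow> P q \<Longrightarrow> P (p + q)" and mult: "\<And>p q. P p \<Longrightarrow> P q \<Longrightarrow> P (p * q)"
  shows "P p"
proof (rule mpoly_induct[of _ p])
  have one: "P 1" using cst[of 1] by simp
  have pw: "P (mon (expo j 1) ^ k)" for j k by (induct k) (use one mult[OF var] in auto)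
  have pr: "P (\<Prod>i\<in>A. mon (expo i 1) ^ \<alpha> i)" for A :: "'n set" and \<alpha> :: "'n \<Rightarrow> nat"
    by (induct A rule: infinite_finite_induct) (use one mult[OF pw] in auto)
  have "P (mon \<alpha>)" for \<alpha> :: "'n \<Rightarrow> nat" using pr[of \<alpha> UNIV] unfolding prod_expo .
  then show "P (Poly_Mapping.single \<alpha> c)" for \<alpha> c unfolding single_as_mult[of \<alpha> c] by (intro mult cst)
qed (rule add)

lemma subst_cong_ideal:
  assumes J: "is_ideal J" and Q: "\<And>i. Q i - Q' i \<in> J"
  shows "subst Q h - subst Q' h \<in> J"
proof (rule mpoly_ring_induct[of _ h])
  show "subst Q (cst c) - subst Q' (cst c) \<in> J" for c using is_idealD(1)[OF J] by simp
  show "subst Q (mon (expo j 1)) - subst Q' (mon (expo j 1)) \<in> J" for j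
    unfolding cst_hom.meval_var by (rule Q)
next
  fix p q assume p: "subst Q p - subst Q' p \<in> J" and q: "subst Q q - subst Q' q \<in> J"
  have "subst Q (p + q) - subst Q' (p + q) = (subst Q p - subst Q' p) + (subst Q q - subst Q' q)"
    by (simp add: cst_hom.meval_add)
  with is_idealD(2)[OF J p q] show "subst Q (p + q) - subst Q' (p + q) \<in> J" by simp
  have "subst Q (p * q) - subst Q' (p * q) = (subst Q p - subst Q' p) * subst Q q + subst Q' p * (subst Q q - subst Q' q)"
    by (simp add: cst_hom.meval_mult algebra_simps)
  with is_idealD(2)[OF J is_idealD(4)[OF J p] is_idealD(3)[OF J q]]
  show "subst Q (p * q) - subst Q' (p * q) \<in> J" by simp
qed

lemma prod_mpw:
  fixes Q :: "'n::finite \<Rightarrow> 'm::finite mpoly"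
  shows "(\<And>i. Q i \<in> mpw 1) \<Longrightarrow> (\<Prod>i\<in>UNIV. Q i ^ \<alpha> i) \<in> mpw (mdeg \<alpha>)"
proof -
  assume Q: "\<And>i. Q i \<in> mpw 1"
  have one: "1 \<in> mpw 0" by (simp add: mpw_iff)
  have "Q i ^ k \<in> mpw k" for i k
  proof (induct k)
    case (Suc k) with mpw_mult[OF Q[of i] Suc] show ?case by simp
  qed (simp add: one)
  then have "(\<Prod>i\<in>A. Q i ^ \<alpha> i) \<in> mpw (\<Sum>i\<in>A. \<alpha> i)" for A
    by (induct A rule: infinite_finite_induct) (auto simp: one intro: mpw_mult)
  then show ?thesis by (simp add: mdeg_def)
qed

lemma subst_mpw:
  fixes Q :: "'n::finite \<Rightarrow> 'm::finite mpoly"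
  assumes Q: "\<And>i. Q i \<in> mpw 1" and h: "h \<in> mpw m"
  shows "subst Q h \<in> mpw m"
  unfolding meval_def
proof (rule is_ideal_sum[OF is_ideal_mpw])
  fix \<alpha> assume "\<alpha> \<in> keys h"
  then have "m \<le> mdeg \<alpha>" using h by (simp add: mpw_def)
  then have "(\<Prod>i\<in>UNIV. Q i ^ \<alpha> i) \<in> mpw m" using prod_mpw[where Q = Q and \<alpha> = \<alpha>, OF Q] mpw_mono by blast
  then show "cst (lookup h \<alpha>) * (\<Prod>i\<in>UNIV. Q i ^ \<alpha> i) \<in> mpw m" by (rule is_idealD(3)[OF is_ideal_mpw])
qed

text \<open>Every monomial of \<open>h\<close> has degree at least 2, so besides the factor that
  changes there is always another one in the maximal ideal.\<close>

lemma subst_diff_mpw_Suc: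
  fixes Q :: "'n::finite \<Rightarrow> 'm::finite mpoly"
  assumes Q: "\<And>i. Q i \<in> mpw 1" "\<And>i. Q' i \<in> mpw 1" "\<And>i. Q i - Q' i \<in> mpw k" and h: "h \<in> mpw 2"
  shows "subst Q h - subst Q' h \<in> mpw (Suc k)"
proof (rule mpoly_induct_keys[of h])
  fix \<alpha> and c :: complex assume "\<alpha> \<in> keys h"
  then have d: "mdeg \<alpha> \<ge> 2" using h by (simp add: mpw_def)
  then have "\<alpha> \<noteq> 0" by auto
  then obtain j where "\<alpha> j \<noteq> 0" unfolding fun_eq_iff zero_fun_apply by blast
  then have "1 \<le> \<alpha> j" by simp
  from mindex_split[of 1 \<alpha> j, OF this] obtain \<gamma> where \<alpha>: "\<alpha> = \<gamma> + expo j 1" ..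
  let ?g = "Poly_Mapping.single \<gamma> c"
  have g: "?g \<in> mpw 1" using d by (auto simp: \<alpha> mpw_def)
  have eq: "Poly_Mapping.single \<alpha> c = mon (expo j 1) * ?g" by (simp add: \<alpha> mult_single add.commute)
  have "subst Q (Poly_Mapping.single \<alpha> c) - subst Q' (Poly_Mapping.single \<alpha> c) =
      (Q j - Q' j) * subst Q ?g + Q' j * (subst Q ?g - subst Q' ?g)"
    unfolding eq cst_hom.meval_mult cst_hom.meval_var by (simp add: algebra_simps)
  moreover have "(Q j - Q' j) * subst Q ?g \<in> mpw (k + 1)" by (rule mpw_mult[OF Q(3) subst_mpw[OF Q(1) g]])
  moreover have "Q' j * (subst Q ?g - subst Q' ?g) \<in> mpw (1 + k)"
    by (rule mpw_mult[OF Q(2) subst_cong_ideal[OF is_ideal_mpw Q(3)]])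
  ultimately show "subst Q (Poly_Mapping.single \<alpha> c) - subst Q' (Poly_Mapping.single \<alpha> c) \<in> mpw (Suc k)"
    using is_idealD(2)[OF is_ideal_mpw, of _ "Suc k"] by simp
next
  fix p q assume "subst Q p - subst Q' p \<in> mpw (Suc k)" "subst Q q - subst Q' q \<in> mpw (Suc k)"
  from is_idealD(2)[OF is_ideal_mpw this] show "subst Q (p + q) - subst Q' (p + q) \<in> mpw (Suc k)"
    by (simp add: cst_hom.meval_add algebra_simps)
qed (simp add: is_idealD(1)[OF is_ideal_mpw])

text \<open>The outer function is a polynomial, so induction over sums and products of variables
  suffices; the same induction shows that truncations compose.\<close>

theorem has_series_compose:
  assumes g: "\<And>i. has_series (g i) (c i)"
  shows "\<exists>s. has_series (\<lambda>x. peval h (\<chi> i. g i x)) s \<and> (\<forall>N. trunc N s - subst (\<lambda>i. trunc N (c i)) h \<in> mpw N)"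
proof (rule mpoly_ring_induct[of _ h])
  show "\<exists>s. has_series (\<lambda>x. peval (cst d) (\<chi> i. g i x)) s \<and> (\<forall>N. trunc N s - subst (\<lambda>i. trunc N (c i)) (cst d) \<in> mpw N)" for d
    by (intro exI[of _ "lookup (cst d)"] conjI allI)
       (use has_series_peval[of "cst d"] in \<open>auto simp: peval_def[abs_def] mpw_iff lookup_minus\<close>)
  show "\<exists>s. has_series (\<lambda>x. peval (mon (expo j 1)) (\<chi> i. g i x)) s \<and> (\<forall>N. trunc N s - subst (\<lambda>i. trunc N (c i)) (mon (expo j 1)) \<in> mpw N)" for j
    by (intro exI[of _ "c j"]) (use g[of j] in \<open>simp add: is_idealD(1)[OF is_ideal_mpw] del: One_nat_def\<close>)
next
  fix p q
  let ?S = "\<lambda>N. subst (\<lambda>i. trunc N (c i))"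
  assume "\<exists>s. has_series (\<lambda>x. peval p (\<chi> i. g i x)) s \<and> (\<forall>N. trunc N s - ?S N p \<in> mpw N)"
    and "\<exists>s. has_series (\<lambda>x. peval q (\<chi> i. g i x)) s \<and> (\<forall>N. trunc N s - ?S N q \<in> mpw N)"
  then obtain s t where s: "has_series (\<lambda>x. peval p (\<chi> i. g i x)) s" "\<And>N. trunc N s - ?S N p \<in> mpw N"
    and t: "has_series (\<lambda>x. peval q (\<chi> i. g i x)) t" "\<And>N. trunc N t - ?S N q \<in> mpw N" by blast
  show "\<exists>s. has_series (\<lambda>x. peval (p + q) (\<chi> i. g i x)) s \<and> (\<forall>N. trunc N s - ?S N (p + q) \<in> mpw N)"
  proof (intro exI conjI allI)
    show "has_series (\<lambda>x. peval (p + q) (\<chi> i. g i x)) (\<lambda>\<alpha>. s \<alpha> + t \<alpha>)"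
      unfolding peval_add by (rule has_series_add[OF s(1) t(1)])
    fix N
    have "trunc N (\<lambda>\<alpha>. s \<alpha> + t \<alpha>) - ?S N (p + q) = (trunc N s - ?S N p) + (trunc N t - ?S N q)"
      by (simp add: trunc_add cst_hom.meval_add)
    with is_idealD(2)[OF is_ideal_mpw s(2) t(2)] show "trunc N (\<lambda>\<alpha>. s \<alpha> + t \<alpha>) - ?S N (p + q) \<in> mpw N" by simp
  qed
  show "\<exists>s. has_series (\<lambda>x. peval (p * q) (\<chi> i. g i x)) s \<and> (\<forall>N. trunc N s - ?S N (p * q) \<in> mpw N)"
  proof (intro exI conjI allI)
    show "has_series (\<lambda>x. peval (p * q) (\<chi> i. g i x)) (cauchy s t)"
      unfolding peval_mult by (rule has_series_mult[OF s(1) t(1)])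
    fix N
    have "trunc N (cauchy s t) - ?S N (p * q) = (trunc N (cauchy s t) - trunc N s * trunc N t)
        + ((trunc N s - ?S N p) * trunc N t + ?S N p * (trunc N t - ?S N q))"
      by (simp add: cst_hom.meval_mult algebra_simps)
    moreover have "(trunc N s - ?S N p) * trunc N t + ?S N p * (trunc N t - ?S N q) \<in> mpw N"
      by (rule is_idealD(2)[OF is_ideal_mpw is_idealD(4)[OF is_ideal_mpw s(2)] is_idealD(3)[OF is_ideal_mpw t(2)]])
    ultimately show "trunc N (cauchy s t) - ?S N (p * q) \<in> mpw N"
      using is_idealD(2)[OF is_ideal_mpw trunc_cauchy] by (simp only:)
  qed
qed

section \<open>Order of vanishing and coefficients\<close>

lemma has_series_order:
  fixes g :: "complex ^ 'n::finite \<Rightarrow> complex"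
  assumes "has_series g a" "\<And>\<alpha>. mdeg \<alpha> < N \<Longrightarrow> a \<alpha> = 0"
  obtains C \<rho> where "C \<ge> 0" "\<rho> > 0" "\<forall>x M. (\<forall>i. norm (x $ i) \<le> M) \<longrightarrow> M \<le> \<rho> \<longrightarrow> norm (g x) \<le> C * M ^ N"
proof -
  obtain \<rho> where \<rho>: "abs_conv a \<rho>" "\<forall>x. (\<forall>i. norm (x $ i) \<le> \<rho>) \<longrightarrow> ((\<lambda>\<alpha>. a \<alpha> * mpow x \<alpha>) has_sum g x) UNIV"
    by (rule has_seriesE[OF assms(1)]) (rule that)
  have \<rho>0: "\<rho> > 0" using \<rho>(1) by (simp add: abs_conv_def)
  define C where "C = (\<Sum>\<^sub>\<infinity>\<alpha>. norm (a \<alpha>) * \<rho> ^ mdeg \<alpha>) / \<rho> ^ N"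
  have "C \<ge> 0" unfolding C_def using \<rho>0 by (intro divide_nonneg_nonneg infsum_nonneg) auto
  moreover have "norm (g x) \<le> C * M ^ N" if x: "\<forall>i. norm (x $ i) \<le> M" and M: "M \<le> \<rho>" for x M
  proof -
    have M0: "M \<ge> 0" using x norm_ge_zero order_trans by blast
    have x\<rho>: "\<forall>i. norm (x $ i) \<le> \<rho>" using x M order_trans by blast
    have sm: "(\<lambda>\<alpha>. norm (a \<alpha> * mpow x \<alpha>)) summable_on UNIV" by (rule abs_conv_summable(1)[OF \<rho>(1)]) (use x\<rho> in blast)
    have sr: "(\<lambda>\<alpha>. norm (a \<alpha>) * \<rho> ^ mdeg \<alpha>) summable_on UNIV" using \<rho>(1) by (simp add: abs_conv_def)
    have "g x = (\<Sum>\<^sub>\<infinity>\<alpha>. a \<alpha> * mpow x \<alpha>)" by (rule infsumI[symmetric]) (use \<rho>(2) x\<rho> in blast)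
    then have "norm (g x) \<le> (\<Sum>\<^sub>\<infinity>\<alpha>. norm (a \<alpha> * mpow x \<alpha>))" using norm_infsum_bound[OF sm] by simp
    also have "\<dots> \<le> (\<Sum>\<^sub>\<infinity>\<alpha>. (M / \<rho>) ^ N * (norm (a \<alpha>) * \<rho> ^ mdeg \<alpha>))"
    proof (rule infsum_mono[OF sm summable_on_cmult_right[OF sr]])
      fix \<alpha>
      show "norm (a \<alpha> * mpow x \<alpha>) \<le> (M / \<rho>) ^ N * (norm (a \<alpha>) * \<rho> ^ mdeg \<alpha>)"
      proof (cases "mdeg \<alpha> < N")
        case False
        have "norm (mpow x \<alpha>) \<le> M ^ mdeg \<alpha>" by (rule norm_mpow_le) (use x in blast)
        also have "M ^ mdeg \<alpha> = (M / \<rho>) ^ mdeg \<alpha> * \<rho> ^ mdeg \<alpha>" using \<rho>0 by (simp add: power_divide)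
        also have "\<dots> \<le> (M / \<rho>) ^ N * \<rho> ^ mdeg \<alpha>"
          by (rule mult_right_mono[OF power_decreasing]) (use False M M0 \<rho>0 in auto)
        finally have "norm (a \<alpha>) * norm (mpow x \<alpha>) \<le> norm (a \<alpha>) * ((M / \<rho>) ^ N * \<rho> ^ mdeg \<alpha>)"
          by (rule mult_left_mono) simp
        then show ?thesis by (simp add: norm_mult mult_ac)
      qed (simp add: assms(2))
    qed
    also have "\<dots> = (M / \<rho>) ^ N * (\<Sum>\<^sub>\<infinity>\<alpha>. norm (a \<alpha>) * \<rho> ^ mdeg \<alpha>)" by (rule infsum_cmult_right) (simp add: sr)
    also have "\<dots> = C * M ^ N" by (simp add: C_def power_divide)
    finally show ?thesis .
  qed
  ultimately show ?thesis using that \<rho>0 by blast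
qed

text \<open>By induction the lowest remaining part p is homogeneous of degree k =
  \<open>mdeg \<alpha>\<close> < N, and p is bounded by a multiple of M^(k+1). Scaling x by t gives
  t^k |p(x)| <= const t^(k+1) for all small t, hence p = 0.\<close>

lemma order_imp_coeffs_zero:
  fixes g :: "complex ^ 'n::finite \<Rightarrow> complex"
  assumes g: "has_series g a" and \<rho>: "\<rho> > 0"
    and bound: "\<And>x M. (\<And>i. norm (x $ i) \<le> M) \<Longrightarrow> M \<le> \<rho> \<Longrightarrow> norm (g x) \<le> C * M ^ N" and "mdeg \<alpha> < N"
  shows "a \<alpha> = 0"
  using assms(4)
proof (induct "mdeg \<alpha>" arbitrary: \<alpha> rule: less_induct)
  case less
  define k where "k = mdeg \<alpha>"
  define p where "p = trunc (Suc k) a"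
  have p_keys: "mdeg \<beta> = k" if "\<beta> \<in> keys p" for \<beta>
  proof -
    have "lookup p \<beta> \<noteq> 0" using that by (simp add: in_keys_iff)
    then have "mdeg \<beta> \<le> k" "a \<beta> \<noteq> 0" by (auto simp: p_def split: if_splits)
    moreover have "\<not> mdeg \<beta> < mdeg \<alpha>" using less(1)[of \<beta>] less(2) calculation(2) by auto
    ultimately show ?thesis by (simp add: k_def)
  qed
  have d1: "has_series (\<lambda>x. g x - peval p x) (\<lambda>\<beta>. a \<beta> - lookup p \<beta>)"
    by (rule has_series_diff[OF g has_series_peval])
  have d2: "a \<beta> - lookup p \<beta> = 0" if "mdeg \<beta> < Suc k" for \<beta> using that by (simp add: p_def)
  obtain C' \<rho>' where C': "C' \<ge> 0" "\<rho>' > 0"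
    "\<forall>x M. (\<forall>i. norm (x $ i) \<le> M) \<longrightarrow> M \<le> \<rho>' \<longrightarrow> norm (g x - peval p x) \<le> C' * M ^ Suc k"
    by (rule has_series_order[OF d1 d2]) (simp, rule that)
  \<comment> \<open>A radius at most 1 allows M^N to be bounded by M^(k+1).\<close>
  define \<sigma> where "\<sigma> = min 1 (min \<rho> \<rho>')"
  have \<sigma>: "\<sigma> > 0" "\<sigma> \<le> 1" "\<sigma> \<le> \<rho>" "\<sigma> \<le> \<rho>'" using \<rho> C'(2) by (simp_all add: \<sigma>_def)
  define K where "K = \<bar>C\<bar> + C'"
  have K: "K \<ge> 0" using C'(1) by (simp add: K_def)
  have p_bound: "norm (peval p x) \<le> K * M ^ Suc k" if x: "\<And>i. norm (x $ i) \<le> M" and M: "M \<le> \<sigma>" for x M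
  proof -
    have M0: "M \<ge> 0" using x norm_ge_zero order_trans by blast
    have "M ^ N \<le> M ^ Suc k" using M0 M \<sigma>(2) less(2) by (intro power_decreasing) (auto simp: k_def)
    have "norm (g x) \<le> C * M ^ N" using bound[of x M] x M \<sigma>(3) by simp
    also have "\<dots> \<le> \<bar>C\<bar> * M ^ Suc k" using M0 \<open>M ^ N \<le> M ^ Suc k\<close> by (intro mult_mono) auto
    finally have "norm (g x) \<le> \<bar>C\<bar> * M ^ Suc k" .
    moreover have "norm (g x - peval p x) \<le> C' * M ^ Suc k" using C'(3) x M \<sigma>(4) by simp
    ultimately have "norm (g x) + norm (g x - peval p x) \<le> K * M ^ Suc k" by (simp add: K_def distrib_right)
    moreover have "norm (peval p x) \<le> norm (g x) + norm (g x - peval p x)"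
      using norm_triangle_ineq4[of "g x" "g x - peval p x"] by simp
    ultimately show ?thesis by linarith
  qed
  have p_zero: "peval p x = 0" if x: "\<forall>i. norm (x $ i) \<le> \<sigma>" for x
  proof (rule ccontr)
    assume nz: "peval p x \<noteq> 0"
    define e where "e = norm (peval p x)"
    \<comment> \<open>Chosen so that K t < e, which contradicts the estimate obtained from
      scaling.\<close>
    define t where "t = min 1 (e / (2 * (K + 1)))"
    have e: "e > 0" using nz by (simp add: e_def)
    then have t: "t > 0" "t \<le> 1" using K by (simp_all add: t_def)
    have hom: "peval p (\<chi> i. of_real t * x $ i) = of_real (t ^ k) * peval p x"
    proof -
      have "mpow (\<chi> i. of_real t * x $ i) \<beta> = of_real (t ^ mdeg \<beta>) * mpow x \<beta>" for \<beta>
        using mpow_diag_act[of "\<lambda>i g. of_real t" undefined x \<beta>]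
        by (simp add: diag_act_def mchar_def mdeg_def power_sum)
      then show ?thesis unfolding peval_def sum_distrib_left
        by (intro sum.cong) (auto simp: p_keys)
    qed
    have "norm (peval p (\<chi> i. of_real t * x $ i)) \<le> K * (t * \<sigma>) ^ Suc k"
    proof (rule p_bound)
      show "norm ((\<chi> i. of_real t * x $ i) $ i) \<le> t * \<sigma>" for i using x t by (simp add: norm_mult)
      show "t * \<sigma> \<le> \<sigma>" using t \<sigma>(1) by (simp add: mult_le_cancel_right2)
    qed
    then have "t ^ k * e \<le> K * (t * \<sigma>) ^ Suc k" using t by (simp add: hom norm_mult e_def norm_power)
    also have "\<dots> = t ^ k * (K * t * \<sigma> ^ Suc k)" by (simp add: power_mult_distrib mult_ac)
    also have "\<dots> \<le> t ^ k * (K * t * 1)"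
      using \<sigma> t K by (intro mult_left_mono power_le_one) auto
    finally have "e \<le> K * t" using t by simp
    also have "\<dots> \<le> K * (e / (2 * (K + 1)))" using K by (intro mult_left_mono) (auto simp: t_def)
    also have "\<dots> < e" using K e by (simp add: divide_simps)
    finally show False by simp
  qed
  have "\<forall>\<^sub>F x in nhds 0. peval p x = 0"
    unfolding eventually_nhds_0_polydisc using p_zero \<sigma>(1) by blast
  from has_series_cong[OF has_series_peval this] have "lookup p = (\<lambda>_. 0)"
    using has_series_zero by (rule has_series_unique)
  then have "lookup p \<alpha> = 0" by simp
  then show "a \<alpha> = 0" by (simp add: p_def k_def)
qed

lemma analytic_map_bound:
  fixes \<phi> :: "complex ^ 'n::finite \<Rightarrow> complex ^ 'n"
  assumes "\<And>i. has_series (\<lambda>x. \<phi> x $ i) (c i)" "\<phi> 0 = 0"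
  obtains C \<rho> where "C \<ge> 0" "\<rho> > 0"
    "\<forall>x M. (\<forall>i. norm (x $ i) \<le> M) \<longrightarrow> M \<le> \<rho> \<longrightarrow> (\<forall>i. norm (\<phi> x $ i) \<le> C * M)"
proof -
  have "\<exists>C \<rho>. C \<ge> 0 \<and> \<rho> > 0 \<and> (\<forall>x M. (\<forall>i. norm (x $ i) \<le> M) \<longrightarrow> M \<le> \<rho> \<longrightarrow> norm (\<phi> x $ i) \<le> C * M)" for i
  proof -
    have z: "c i \<alpha> = 0" if "mdeg \<alpha> < 1" for \<alpha>
      using has_series_0[OF assms(1)[of i]] assms(2) that by simp
    obtain C \<rho> where "C \<ge> 0" "\<rho> > 0"
      "\<forall>x M. (\<forall>i. norm (x $ i) \<le> M) \<longrightarrow> M \<le> \<rho> \<longrightarrow> norm (\<phi> x $ i) \<le> C * M ^ 1"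
      by (rule has_series_order[where N = 1, OF assms(1)[of i] z]) (assumption, rule that)
    then show ?thesis by auto
  qed
  then obtain C \<rho> where C: "\<And>i. C i \<ge> 0" "\<And>i. \<rho> i > 0"
    "\<And>i x M. (\<forall>i. norm (x $ i) \<le> M) \<Longrightarrow> M \<le> \<rho> i \<Longrightarrow> norm (\<phi> x $ i) \<le> C i * M" by metis
  define C' where "C' = sum C UNIV"
  define \<rho>' where "\<rho>' = Min (range \<rho>)"
  have "\<rho>' > 0" using C(2) by (simp add: \<rho>'_def)
  moreover have "C' \<ge> 0" by (simp add: C'_def C(1) sum_nonneg)
  moreover have "norm (\<phi> x $ i) \<le> C' * M" if x: "\<forall>i. norm (x $ i) \<le> M" and M: "M \<le> \<rho>'" for x M i
  proof -
    have "\<rho>' \<le> \<rho> i" by (simp add: \<rho>'_def)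
    then have "norm (\<phi> x $ i) \<le> C i * M" using C(3)[OF x] M by simp
    also have "\<dots> \<le> C' * M"
    proof (rule mult_right_mono)
      show "C i \<le> C'" unfolding C'_def using C(1) by (intro member_le_sum) auto
      show "M \<ge> 0" using x norm_ge_zero order_trans by blast
    qed
    finally show ?thesis .
  qed
  ultimately show ?thesis using that by blast
qed

lemma eventually_compose:
  fixes \<phi> :: "complex ^ 'n::finite \<Rightarrow> complex ^ 'n"
  assumes "\<And>i. has_series (\<lambda>x. \<phi> x $ i) (c i)" "\<phi> 0 = 0" "\<forall>\<^sub>F x in nhds 0. P x"
  shows "\<forall>\<^sub>F x in nhds 0. P (\<phi> x)"
proof -
  obtain C \<rho> where C: "C \<ge> 0" "\<rho> > 0"
    "\<forall>x M. (\<forall>i. norm (x $ i) \<le> M) \<longrightarrow> M \<le> \<rho> \<longrightarrow> (\<forall>i. norm (\<phi> x $ i) \<le> C * M)"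
    by (rule analytic_map_bound[OF assms(1,2)]) (rule that)
  obtain \<sigma> where \<sigma>: "\<sigma> > 0" "\<And>x. (\<forall>i. norm (x $ i) \<le> \<sigma>) \<Longrightarrow> P x"
    using assms(3) unfolding eventually_nhds_0_polydisc by blast
  define M where "M = min \<rho> (\<sigma> / (C + 1))"
  have M: "M > 0" "M \<le> \<rho>" using C \<sigma> by (simp_all add: M_def)
  have "M \<le> \<sigma> / (C + 1)" by (simp add: M_def)
  then have "M * (C + 1) \<le> \<sigma>" using C(1) by (simp add: pos_le_divide_eq)
  then have "C * M \<le> \<sigma>" using M(1) by (simp add: algebra_simps)
  then have "\<forall>x. (\<forall>i. norm (x $ i) \<le> M) \<longrightarrow> P (\<phi> x)" using C(3) M(2) \<sigma>(2) order_trans by meson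
  then show ?thesis unfolding eventually_nhds_0_polydisc using M(1) by blast
qed

section \<open>Inversion of polynomial maps\<close>

definition linear_part :: "('n::finite \<Rightarrow> 'n series) \<Rightarrow> complex ^ 'n ^ 'n" where
  "linear_part \<Phi> = (\<chi> i j. \<Phi> i (expo j 1))"

lemma pd_at_0: "meval (\<lambda>c. c) (\<lambda>_. 0) (pd j p) = lookup p (expo j 1)"
proof -
  have "meval (\<lambda>c. c) (\<lambda>_. 0) q = lookup q 0" for q :: "'a mpoly"
  proof -
    have "($) (0 :: complex ^ 'a) = (\<lambda>_. 0)" by (simp add: fun_eq_iff)
    then have "meval (\<lambda>c. c) (\<lambda>_. 0) q = peval q 0" by (simp only: peval_meval)
    also have "\<dots> = lookup q 0" by (rule has_series_0[OF has_series_peval])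
    finally show ?thesis .
  qed
  then show ?thesis by (simp add: lookup_pd zero_fun_apply)
qed

text \<open>At the origin the strict derivative is the linear part. If two small points have the
  same image, the linear part maps their difference to something at most \<open>\<epsilon>\<close>
  times as large, and applying \<open>B\<close>, whose entries sum to \<open>K\<close> in absolute
  value, gives g <= K \<open>\<epsilon>\<close> g with K \<open>\<epsilon>\<close> < 1.\<close>

lemma poly_map_locally_injective:
  fixes \<Phi> :: "'n::finite \<Rightarrow> 'n mpoly"
  assumes B: "B ** linear_part (\<lambda>i. lookup (\<Phi> i)) = mat 1"
  obtains \<delta> where "\<delta> > 0" "\<forall>x y. (\<forall>i. norm (x $ i) \<le> \<delta>) \<longrightarrow> (\<forall>i. norm (y $ i) \<le> \<delta>) \<longrightarrow>
    (\<forall>i. peval (\<Phi> i) x = peval (\<Phi> i) y) \<longrightarrow> x = y"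
proof -
  define L where "L = linear_part (\<lambda>i. lookup (\<Phi> i))"
  define K where "K = (\<Sum>k\<in>UNIV. \<Sum>i\<in>UNIV. norm (B $ k $ i))"
  have K: "K \<ge> 0" by (simp add: K_def sum_nonneg)
  define \<epsilon> where "\<epsilon> = 1 / (K + 1)"
  have \<epsilon>: "\<epsilon> > 0" "K * \<epsilon> < 1" using K by (simp_all add: \<epsilon>_def)
  have "\<forall>i. \<exists>\<delta>>0. \<forall>Q Q'. complex_norm.near (\<lambda>_. 0) \<delta> Q \<longrightarrow> complex_norm.near (\<lambda>_. 0) \<delta> Q' \<longrightarrow>
     norm (meval (\<lambda>c. c) Q (\<Phi> i) - meval (\<lambda>c. c) Q' (\<Phi> i) - (\<Sum>j\<in>UNIV. L $ i $ j * (Q j - Q' j))) \<le> \<epsilon> * complex_norm.gap Q Q'"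
    (is "\<forall>i. ?P i")
  proof
    show "?P i" for i
      using complex_norm.strict_deriv_meval[of "\<lambda>_. 0" "\<Phi> i"] \<epsilon>(1)
      unfolding complex_norm.strict_deriv_def pd_at_0 by (simp add: L_def linear_part_def)
  qed
  from choice[OF this] obtain \<delta> where \<delta>: "\<And>i. \<delta> i > 0" "\<And>i Q Q'. complex_norm.near (\<lambda>_. 0) (\<delta> i) Q \<Longrightarrow> complex_norm.near (\<lambda>_. 0) (\<delta> i) Q' \<Longrightarrow>
     norm (meval (\<lambda>c. c) Q (\<Phi> i) - meval (\<lambda>c. c) Q' (\<Phi> i) - (\<Sum>j\<in>UNIV. L $ i $ j * (Q j - Q' j))) \<le> \<epsilon> * complex_norm.gap Q Q'"
    by blast
  define \<delta>' where "\<delta>' = Min (range \<delta>)"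
  have \<delta>': "\<delta>' > 0" "\<And>i. \<delta>' \<le> \<delta> i" using \<delta>(1) by (simp_all add: \<delta>'_def)
  have "x = y" if x: "\<forall>i. norm (x $ i) \<le> \<delta>'" and y: "\<forall>i. norm (y $ i) \<le> \<delta>'"
    and eq: "\<forall>i. peval (\<Phi> i) x = peval (\<Phi> i) y" for x y
  proof -
    define g where "g = complex_norm.gap (($) x) (($) y)"
    have g: "g \<ge> 0" by (simp add: g_def)
    have "norm ((L *v (x - y)) $ i) \<le> \<epsilon> * g" for i
    proof -
      have "complex_norm.near (\<lambda>_. 0) (\<delta> i) (($) x)" "complex_norm.near (\<lambda>_. 0) (\<delta> i) (($) y)"
        using x y \<delta>'(2)[of i] unfolding complex_norm.near_def by (auto intro: order_trans)
      from \<delta>(2)[OF this] eq show ?thesis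
        by (simp add: peval_meval[symmetric] g_def matrix_vector_mult_def)
    qed
    then have *: "norm (\<Sum>i\<in>UNIV. B $ k $ i * (L *v (x - y)) $ i) \<le> (\<Sum>i\<in>UNIV. norm (B $ k $ i)) * (\<epsilon> * g)" for k
      unfolding sum_distrib_right
      by (intro order_trans[OF norm_sum] sum_mono) (auto simp: norm_mult intro: mult_left_mono)
    have "x - y = B *v (L *v (x - y))" using B by (simp add: matrix_vector_mul_assoc L_def)
    then have "norm ((x - y) $ k) \<le> (\<Sum>i\<in>UNIV. norm (B $ k $ i)) * (\<epsilon> * g)" for k
      using *[of k] by (metis (no_types, lifting) matrix_vector_mult_def vec_lambda_beta sum.cong)
    then have "(\<Sum>k\<in>UNIV. norm (x $ k - y $ k)) \<le> (\<Sum>k\<in>UNIV. (\<Sum>i\<in>UNIV. norm (B $ k $ i)) * (\<epsilon> * g))"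
      by (intro sum_mono) simp
    moreover have "(\<Sum>k\<in>UNIV. norm (x $ k - y $ k)) = g" by (simp add: g_def complex_norm.gap_def)
    ultimately have "g \<le> K * \<epsilon> * g" unfolding K_def sum_distrib_right[symmetric] by (simp add: mult.assoc)
    then have "g = 0" using \<epsilon>(2) g by (metis dual_order.antisym less_le_not_le mult_le_cancel_right1 not_le)
    then have "x $ k = y $ k" for k
      by (auto simp: g_def complex_norm.gap_def sum_nonneg_eq_0_iff)
    then show ?thesis by (simp add: vec_eq_iff)
  qed
  with \<delta>'(1) that show ?thesis by blast
qed

text \<open>The inverse is the limit of the fixed-point iteration \<open>\<psi> \<mapsto> B (x - h \<circ> \<psi>)\<close>, where \<open>h\<close> is the nonlinear
  part: each step makes one more degree correct, and a weighted coefficient norm stays bounded.\<close>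

theorem polynomial_diffeo:
  fixes \<Phi> :: "'n::finite \<Rightarrow> 'n mpoly"
  assumes \<Phi>: "\<And>i. \<Phi> i \<in> mpw 1" and det: "det (linear_part (\<lambda>i. lookup (\<Phi> i))) \<noteq> 0"
  shows "diffeo_germ (\<lambda>x. \<chi> i. peval (\<Phi> i) x)"
proof -
  define A where "A = linear_part (\<lambda>i. lookup (\<Phi> i))"
  obtain B where B: "A ** B = mat 1" "B ** A = mat 1"
    using det unfolding A_def[symmetric] invertible_det_nz[symmetric] invertible_def by blast
  define h where "h i = \<Phi> i - (\<Sum>j\<in>UNIV. cst (A $ i $ j) * mon (expo j 1))" for i
  have h2: "h i \<in> mpw 2" for i
    unfolding mpw_iff
  proof (intro allI impI)
    fix \<alpha> :: "'n \<Rightarrow> nat" assume d: "mdeg \<alpha> < 2"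
    show "lookup (h i) \<alpha> = 0"
    proof (cases "\<alpha> = 0")
      case True
      have "expo j 1 \<noteq> (0 :: 'n \<Rightarrow> nat)" for j :: 'n by (metis mdeg_expo mdeg_zero zero_neq_one)
      then show ?thesis using \<Phi>[of i] True
        by (simp add: h_def lookup_minus lookup_sum lookup_single when_def mpw_iff del: One_nat_def)
    next
      case False
      then obtain k where "\<alpha> k \<noteq> 0" unfolding fun_eq_iff zero_fun_apply by blast
      then have "1 \<le> \<alpha> k" by simp
      from mindex_split[of 1 \<alpha> k, OF this] obtain \<gamma> where \<alpha>: "\<alpha> = \<gamma> + expo k 1" ..
      then have "\<gamma> = 0" using d by simp
      with \<alpha> have \<alpha>: "\<alpha> = expo k 1" by simp
      have "expo j 1 = expo k 1 \<longleftrightarrow> j = k" for j by (metis expo_simps zero_neq_one)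
      then show ?thesis
        by (simp add: \<alpha> h_def lookup_minus lookup_sum lookup_single when_def if_distrib A_def linear_part_def
            del: One_nat_def cong: if_cong)
    qed
  qed
  define it where "it q i = (\<Sum>j\<in>UNIV. cst (B $ i $ j) * (mon (expo j 1) - subst q (h j)))" for q :: "'n \<Rightarrow> 'n mpoly" and i
  define \<psi> where "\<psi> k = (it ^^ k) (\<lambda>_. 0)" for k
  have \<psi>_Suc: "\<psi> (Suc k) = it (\<psi> k)" for k by (simp add: \<psi>_def)
  have mpw_sum: "(\<Sum>j\<in>UNIV. cst (B $ i $ j) * q j) \<in> mpw N" if "\<And>j. q j \<in> mpw N" for q N i
    by (rule is_ideal_sum[OF is_ideal_mpw is_idealD(3)[OF is_ideal_mpw that]])
  have \<psi>1: "\<psi> k i \<in> mpw 1" for k i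
  proof (induct k arbitrary: i)
    case 0 show ?case by (simp add: \<psi>_def is_idealD(1)[OF is_ideal_mpw])
  next
    case (Suc k)
    have "mon (expo j 1) - subst (\<psi> k) (h j) \<in> mpw 1" for j
    proof (rule is_idealD(6)[OF is_ideal_mpw])
      show "mon (expo j 1) \<in> mpw 1" by (simp add: mpw_def)
      have "subst (\<psi> k) (h j) \<in> mpw 2" by (rule subst_mpw[OF Suc h2])
      then show "subst (\<psi> k) (h j) \<in> mpw 1" using mpw_mono[of 1 2] by auto
    qed
    then show ?case unfolding \<psi>_Suc it_def by (rule mpw_sum)
  qed
  have \<psi>_step: "\<psi> (Suc k) i - \<psi> k i \<in> mpw (Suc k)" for k i
  proof (induct k arbitrary: i)
    case 0 then show ?case using \<psi>1[of 1 i] by (simp add: \<psi>_def)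
  next
    case (Suc k)
    have "\<psi> (Suc (Suc k)) i - \<psi> (Suc k) i =
        (\<Sum>j\<in>UNIV. cst (B $ i $ j) * (- (subst (\<psi> (Suc k)) (h j) - subst (\<psi> k) (h j))))"
      unfolding \<psi>_Suc it_def by (simp add: sum_subtractf[symmetric] algebra_simps)
    also have "\<dots> \<in> mpw (Suc (Suc k))"
      by (rule mpw_sum[OF is_idealD(5)[OF is_ideal_mpw subst_diff_mpw_Suc[OF \<psi>1 \<psi>1 Suc h2]]])
    finally show ?case .
  qed
  have \<psi>_stable: "\<psi> (k + m) i - \<psi> k i \<in> mpw (Suc k)" for k m i
  proof (induct m)
    case 0 show ?case by (simp add: is_idealD(1)[OF is_ideal_mpw])
  next
    case (Suc m)
    have "\<psi> (Suc (k + m)) i - \<psi> (k + m) i \<in> mpw (Suc k)"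
      using \<psi>_step[of "k + m" i] mpw_mono[of "Suc k" "Suc (k + m)"] by auto
    from is_idealD(2)[OF is_ideal_mpw this Suc] show ?case by simp
  qed
  \<comment> \<open>From step k on the coefficients of degree at most k no longer change, so those
    of the limit can be read off after finitely many steps.\<close>
  define c where "c i \<alpha> = lookup (\<psi> (mdeg \<alpha>) i) \<alpha>" for i \<alpha>
  have c: "lookup (\<psi> k i) \<alpha> = c i \<alpha>" if "mdeg \<alpha> \<le> k" for k i \<alpha>
  proof -
    have "lookup (\<psi> (mdeg \<alpha> + (k - mdeg \<alpha>)) i - \<psi> (mdeg \<alpha>) i) \<alpha> = 0"
      using \<psi>_stable[of "mdeg \<alpha>" "k - mdeg \<alpha>" i] by (simp add: mpw_iff)
    with that show ?thesis by (simp add: lookup_minus c_def)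
  qed
  define b where "b = 1 + (\<Sum>i\<in>UNIV. \<Sum>j\<in>UNIV. norm (B $ i $ j))"
  define H where "H = 1 + (\<Sum>j\<in>UNIV. wnorm 1 (h j))"
  \<comment> \<open>\<open>b\<close> bounds the rows of \<open>B\<close> and \<open>H\<close> the
    coefficients of the nonlinear part. As that part starts in degree 2, one step maps the ball of
    radius R into the one of radius b (\<open>\<rho>\<close> + H R^2), and both summands contribute
    R/2.\<close>
  define R where "R = 1 / (2 * b * H)"
  define \<rho> where "\<rho> = R / (2 * b)"
  have b: "b \<ge> 1" "\<And>i. (\<Sum>j\<in>UNIV. norm (B $ i $ j)) \<le> b"
  proof -
    show "b \<ge> 1" by (simp add: b_def sum_nonneg)
    show "(\<Sum>j\<in>UNIV. norm (B $ i $ j)) \<le> b" for i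
      using member_le_sum[of i UNIV "\<lambda>i. \<Sum>j\<in>UNIV. norm (B $ i $ j)"] by (simp add: b_def sum_nonneg)
  qed
  have w0: "wnorm 1 p \<ge> 0" for p :: "'n mpoly" by (simp add: wnorm_def sum_nonneg)
  have H: "H \<ge> 1" "\<And>j. wnorm 1 (h j) \<le> H"
  proof -
    show "H \<ge> 1" by (simp add: H_def sum_nonneg w0)
    show "wnorm 1 (h j) \<le> H" for j
      using member_le_sum[of j UNIV "\<lambda>j. wnorm 1 (h j)"] by (simp add: H_def w0)
  qed
  have bH: "b * H \<ge> 1" using b(1) H(1) by (metis mult_mono mult_1 zero_le_one order_trans)
  have R: "0 < R" "R \<le> 1" "2 * (b * (H * R)) = 1"
    using bH b(1) H(1) by (simp_all add: R_def divide_le_eq mult.assoc)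
  have \<rho>: "\<rho> > 0" "2 * (b * \<rho>) = R" using R(1) b(1) by (simp_all add: \<rho>_def)
  interpret wn: seminorm_hom "cst :: complex \<Rightarrow> 'n mpoly" "wnorm \<rho>" by (rule seminorm_hom_wnorm) (use \<rho> in simp)
  have h_bound: "wnorm R (h j) \<le> H * R ^ 2" for j
  proof -
    have "wnorm R (h j) \<le> (\<Sum>\<alpha>\<in>keys (h j). norm (lookup (h j) \<alpha>) * 1 ^ mdeg \<alpha> * R ^ 2)"
      unfolding wnorm_def
    proof (rule sum_mono)
      fix \<alpha> assume "\<alpha> \<in> keys (h j)"
      then have "R ^ mdeg \<alpha> \<le> R ^ 2" using h2[of j] R by (intro power_decreasing) (auto simp: mpw_def)
      then show "norm (lookup (h j) \<alpha>) * R ^ mdeg \<alpha> \<le> norm (lookup (h j) \<alpha>) * 1 ^ mdeg \<alpha> * R ^ 2"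
        by (simp add: mult_left_mono)
    qed
    also have "\<dots> = wnorm 1 (h j) * R ^ 2" by (simp add: wnorm_def sum_distrib_right)
    also have "\<dots> \<le> H * R ^ 2" using H(2) by (rule mult_right_mono) simp
    finally show ?thesis .
  qed
  have \<psi>_bound: "wnorm \<rho> (\<psi> k i) \<le> R" for k i
  proof (induct k arbitrary: i)
    case 0 show ?case using R(1) by (simp add: \<psi>_def wn.nm_zero)
  next
    case (Suc k)
    have t: "wnorm \<rho> (mon (expo j 1) - subst (\<psi> k) (h j)) \<le> \<rho> + H * R ^ 2" for j
    proof -
      have "wnorm \<rho> (subst (\<psi> k) (h j)) \<le> wnorm R (h j)" by (rule wnorm_subst_le) (use \<rho>(1) Suc in auto)
      with h_bound[of j] wn.nm_diff[of "mon (expo j 1)" "subst (\<psi> k) (h j)"] show ?thesis by simp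
    qed
    have "wnorm \<rho> (\<psi> (Suc k) i) \<le> (\<Sum>j\<in>UNIV. wnorm \<rho> (cst (B $ i $ j) * (mon (expo j 1) - subst (\<psi> k) (h j))))"
      unfolding \<psi>_Suc it_def by (rule wn.nm_sum)
    also have "\<dots> \<le> (\<Sum>j\<in>UNIV. norm (B $ i $ j) * (\<rho> + H * R ^ 2))"
    proof (rule sum_mono)
      fix j
      show "wnorm \<rho> (cst (B $ i $ j) * (mon (expo j 1) - subst (\<psi> k) (h j))) \<le> norm (B $ i $ j) * (\<rho> + H * R ^ 2)"
        by (rule order_trans[OF wn.nm_mult mult_mono[OF _ t]]) simp_all
    qed
    also have "\<dots> = (\<Sum>j\<in>UNIV. norm (B $ i $ j)) * (\<rho> + H * R ^ 2)" by (rule sum_distrib_right[symmetric])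
    also have "\<dots> \<le> b * (\<rho> + H * R ^ 2)" using b(2) \<rho>(1) H(1) by (intro mult_right_mono) auto
    also have "\<dots> = (2 * (b * \<rho>) + 2 * (b * (H * R)) * R) / 2" by (simp add: algebra_simps power2_eq_square)
    also have "\<dots> = R" unfolding \<rho>(2) R(3) by simp
    finally show ?case .
  qed
  have conv: "abs_conv (c i) \<rho>" for i
    unfolding abs_conv_def
  proof
    show "(\<lambda>\<alpha>. norm (c i \<alpha>) * \<rho> ^ mdeg \<alpha>) summable_on UNIV"
    proof (rule nonneg_bdd_above_summable_on)
      show "bdd_above (sum (\<lambda>\<alpha>. norm (c i \<alpha>) * \<rho> ^ mdeg \<alpha>) ` {F. F \<subseteq> UNIV \<and> finite F})"
      proof (rule bdd_aboveI2)
        fix F :: "('n \<Rightarrow> nat) set" assume "F \<in> {F. F \<subseteq> UNIV \<and> finite F}"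
        then have F: "finite F" by simp
        define k where "k = (\<Sum>\<alpha>\<in>F. mdeg \<alpha>)"
        have "mdeg \<alpha> \<le> k" if "\<alpha> \<in> F" for \<alpha> unfolding k_def by (rule member_le_sum) (use that F in auto)
        then have "(\<Sum>\<alpha>\<in>F. norm (c i \<alpha>) * \<rho> ^ mdeg \<alpha>) = (\<Sum>\<alpha>\<in>F. norm (lookup (\<psi> k i) \<alpha>) * \<rho> ^ mdeg \<alpha>)"
          by (intro sum.cong) (auto simp: c)
        also have "\<dots> \<le> (\<Sum>\<alpha>\<in>F \<union> keys (\<psi> k i). norm (lookup (\<psi> k i) \<alpha>) * \<rho> ^ mdeg \<alpha>)"
          using F \<rho>(1) by (intro sum_mono2) auto
        also have "\<dots> = wnorm \<rho> (\<psi> k i)" by (rule wnorm_superset[symmetric]) (use F in auto)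
        also have "\<dots> \<le> R" by (rule \<psi>_bound)
        finally show "(\<Sum>\<alpha>\<in>F. norm (c i \<alpha>) * \<rho> ^ mdeg \<alpha>) \<le> R" .
      qed
    qed (use \<rho>(1) in simp)
  qed (rule \<rho>(1))
  define \<Psi> where "\<Psi> x = (\<chi> i. sval (c i) x)" for x
  have \<Psi>_series: "has_series (\<lambda>x. \<Psi> x $ i) (c i)" for i
    using has_series_sval[of "c i"] conv[of i] by (auto simp: \<Psi>_def)
  have \<Psi>0: "\<Psi> 0 = 0"
    unfolding vec_eq_iff using has_series_0[OF \<Psi>_series] by (simp add: c_def \<psi>_def zero_vec_def)
  have right: "\<forall>\<^sub>F x in nhds 0. peval (\<Phi> i) (\<Psi> x) = x $ i" for i
  proof -
    obtain s where s: "has_series (\<lambda>x. peval (\<Phi> i) (\<chi> i. \<Psi> x $ i)) s"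
      "\<And>N. trunc N s - subst (\<lambda>i. trunc N (c i)) (\<Phi> i) \<in> mpw N"
      using has_series_compose[of "\<lambda>i x. \<Psi> x $ i" c "\<Phi> i", OF \<Psi>_series] by blast
    have "s \<alpha> = lookup (mon (expo i 1)) \<alpha>" for \<alpha>
    proof -
      define N where "N = Suc (mdeg \<alpha>)"
      have c\<psi>: "trunc N (c j) - \<psi> N j \<in> mpw N" for j by (simp add: mpw_iff lookup_minus c)
      have "\<Phi> i = (\<Sum>j\<in>UNIV. cst (A $ i $ j) * mon (expo j 1)) + h i" by (simp add: h_def)
      then have "subst (\<psi> N) (\<Phi> i) = (\<Sum>j\<in>UNIV. cst (A $ i $ j) * \<psi> N j) + subst (\<psi> N) (h i)"
        by (simp only: cst_hom.meval_add cst_hom.meval_sum cst_hom.meval_mult cst_hom.meval_var cst_hom.meval_cst)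
      \<comment> \<open>Multiplied by \<open>A\<close>, the iteration reads A
        \<open>\<psi>\<close>(N+1) = x - h(\<open>\<psi>\<close> N). So
        \<open>\<Phi>\<close>(\<open>\<psi>\<close> N) - x is - A applied to the last increment,
        which has order above N.\<close>
      moreover have "(\<Sum>j\<in>UNIV. cst (A $ i $ j) * \<psi> (Suc N) j) = mon (expo i 1) - subst (\<psi> N) (h i)"
      proof -
        have "(\<Sum>j\<in>UNIV. cst (A $ i $ j) * \<psi> (Suc N) j) =
            (\<Sum>j\<in>UNIV. \<Sum>k\<in>UNIV. cst (A $ i $ j * B $ j $ k) * (mon (expo k 1) - subst (\<psi> N) (h k)))"
          unfolding \<psi>_Suc it_def sum_distrib_left by (simp only: mult.assoc[symmetric] cst_mult)
        also have "\<dots> = (\<Sum>k\<in>UNIV. (\<Sum>j\<in>UNIV. cst (A $ i $ j * B $ j $ k)) * (mon (expo k 1) - subst (\<psi> N) (h k)))"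
          by (subst sum.swap) (simp only: sum_distrib_right)
        also have "\<dots> = (\<Sum>k\<in>UNIV. cst (if i = k then 1 else 0) * (mon (expo k 1) - subst (\<psi> N) (h k)))"
        proof (rule sum.cong[OF refl])
          fix k
          have "(\<Sum>j\<in>UNIV. A $ i $ j * B $ j $ k) = (A ** B) $ i $ k" by (simp add: matrix_matrix_mult_def)
          also have "\<dots> = (if i = k then 1 else 0)" unfolding B(1) by (simp add: mat_def)
          finally have "(\<Sum>j\<in>UNIV. cst (A $ i $ j * B $ j $ k)) = (cst (if i = k then 1 else 0) :: 'n mpoly)"
            using sum_comp_morphism[of "cst :: complex \<Rightarrow> 'n mpoly" "\<lambda>j. A $ i $ j * B $ j $ k" UNIV]
            by (simp add: single_add o_def)
          then show "(\<Sum>j\<in>UNIV. cst (A $ i $ j * B $ j $ k)) * (mon (expo k 1) - subst (\<psi> N) (h k)) =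
              cst (if i = k then 1 else 0) * (mon (expo k 1) - subst (\<psi> N) (h k))" by (simp only:)
        qed
        also have "\<dots> =
            (\<Sum>k\<in>UNIV. if i = k then mon (expo k 1) - subst (\<psi> N) (h k) else 0)"
          by (rule sum.cong) auto
        finally show ?thesis by simp
      qed
      ultimately have "subst (\<psi> N) (\<Phi> i) - mon (expo i 1) = (\<Sum>j\<in>UNIV. cst (A $ i $ j) * (- (\<psi> (Suc N) j - \<psi> N j)))"
        by (simp add: right_diff_distrib sum_subtractf del: One_nat_def)
      also have "\<dots> \<in> mpw (Suc N)"
        by (rule is_ideal_sum[OF is_ideal_mpw is_idealD(3)[OF is_ideal_mpw is_idealD(5)[OF is_ideal_mpw \<psi>_step]]])
      finally have 1: "subst (\<psi> N) (\<Phi> i) - mon (expo i 1) \<in> mpw N" using mpw_mono[of N "Suc N"] by auto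
      have 2: "subst (\<lambda>i. trunc N (c i)) (\<Phi> i) - subst (\<psi> N) (\<Phi> i) \<in> mpw N"
        by (rule subst_cong_ideal[OF is_ideal_mpw c\<psi>])
      from is_idealD(2)[OF is_ideal_mpw s(2) is_idealD(2)[OF is_ideal_mpw 2 1]]
      have "trunc N s - mon (expo i 1) \<in> mpw N" by simp
      then have "lookup (trunc N s - mon (expo i 1)) \<alpha> = 0" unfolding mpw_iff N_def by blast
      then show ?thesis by (simp add: lookup_minus N_def)
    qed
    then have "s = lookup (mon (expo i 1))" by (simp add: fun_eq_iff)
    with s(1) have "has_series (\<lambda>x. peval (\<Phi> i) (\<Psi> x)) (lookup (mon (expo i 1)))" by simp
    from has_series_diff[OF this has_series_peval[of "mon (expo i 1)"]]
    have "has_series (\<lambda>x. peval (\<Phi> i) (\<Psi> x) - x $ i) (\<lambda>_. 0)" by simp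
    then show ?thesis unfolding has_series_def
    proof (rule eventually_mono)
      fix x assume "((\<lambda>\<alpha>. 0 * mpow x \<alpha>) has_sum (peval (\<Phi> i) (\<Psi> x) - x $ i)) UNIV"
      moreover have "((\<lambda>\<alpha>. 0 * mpow x \<alpha>) has_sum 0) UNIV" by (rule has_sum_0) simp
      ultimately have "peval (\<Phi> i) (\<Psi> x) - x $ i = 0" by (rule has_sum_unique)
      then show "peval (\<Phi> i) (\<Psi> x) = x $ i" by simp
    qed
  qed
  define \<phi> where "\<phi> x = (\<chi> i. peval (\<Phi> i) x)" for x
  have \<phi>_series: "has_series (\<lambda>x. \<phi> x $ i) (lookup (\<Phi> i))" for i by (simp add: \<phi>_def has_series_peval)
  have \<phi>0: "\<phi> 0 = 0"
    unfolding vec_eq_iff using has_series_0[OF \<phi>_series] \<Phi> by (auto simp: mpw_iff)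
  have right': "\<forall>\<^sub>F x in nhds 0. \<phi> (\<Psi> x) = x"
    using eventually_all_finite[of "\<lambda>x i. peval (\<Phi> i) (\<Psi> x) = x $ i", OF right]
    by (simp add: \<phi>_def vec_eq_iff)
  obtain \<delta> where \<delta>: "\<delta> > 0" "\<forall>x y. (\<forall>i. norm (x $ i) \<le> \<delta>) \<longrightarrow> (\<forall>i. norm (y $ i) \<le> \<delta>) \<longrightarrow>
    (\<forall>i. peval (\<Phi> i) x = peval (\<Phi> i) y) \<longrightarrow> x = y"
    by (rule poly_map_locally_injective[OF B(2)[unfolded A_def]]) (rule that)
  have small: "\<forall>\<^sub>F x in nhds (0 :: complex ^ 'n). \<forall>i. norm (x $ i) \<le> \<delta>"
    unfolding eventually_nhds_0_polydisc using \<delta>(1) by blast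
  have "\<forall>\<^sub>F x in nhds 0. \<forall>i. norm (\<Psi> (\<phi> x) $ i) \<le> \<delta>"
    by (rule eventually_compose[OF \<phi>_series \<phi>0 eventually_compose[OF \<Psi>_series \<Psi>0 small]])
  moreover have "\<forall>\<^sub>F x in nhds 0. \<phi> (\<Psi> (\<phi> x)) = \<phi> x"
    by (rule eventually_compose[OF \<phi>_series \<phi>0 right'])
  \<comment> \<open>\<open>\<Psi> (\<phi> x)\<close> and \<open>x\<close> are small and have the
    same image under \<open>\<phi>\<close>; local injectivity turns the right inverse into a
    two-sided one.\<close>
  ultimately have left: "\<forall>\<^sub>F x in nhds 0. \<Psi> (\<phi> x) = x" using small
  proof eventually_elim
    case (elim x)
    have "peval (\<Phi> i) (\<Psi> (\<phi> x)) = peval (\<Phi> i) x" for i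
      using arg_cong[OF elim(2), of "\<lambda>v. v $ i"] by (simp add: \<phi>_def)
    with \<delta>(2) elim(1,3) show ?case by blast
  qed
  have "diffeo_germ \<phi>"
    unfolding diffeo_germ_def analytic_map_germ_def analytic_germ_def
    using \<phi>_series \<phi>0 \<Psi>_series \<Psi>0 left right' by blast
  then show ?thesis by (simp add: \<phi>_def[abs_def])
qed

section \<open>Jets\<close>

lemma jet_poly_peval: "jet_poly r a x = peval (trunc (Suc r) a) x"
proof -
  have "keys (trunc (Suc r) a) \<subseteq> {\<alpha>. mdeg \<alpha> \<le> r}" by (auto simp: in_keys_iff split: if_splits)
  from peval_superset[OF finite_mdeg_le this] show ?thesis
    by (simp add: jet_poly_def less_Suc_eq_le)
qed

text \<open>The shift to \<open>Suc r\<close>: \<open>trunc N\<close> keeps degrees below N, an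
  r-jet keeps degrees up to r.\<close>

lemma jet_has_series: "has_series f a \<Longrightarrow> jet r f = lookup (trunc (Suc r) a)"
  by (auto simp: jet_def series_of_eq less_Suc_eq_le)

lemma jet_act_eq:
  "jet_act r \<Phi> a = lookup (trunc (Suc r) (lookup (subst (\<lambda>i. trunc (Suc r) (\<Phi> i)) (trunc (Suc r) a))))"
proof -
  have "(\<lambda>x. jet_poly r a (\<chi> i. jet_poly r (\<Phi> i) x)) = peval (subst (\<lambda>i. trunc (Suc r) (\<Phi> i)) (trunc (Suc r) a))"
    by (simp add: jet_poly_peval peval_subst fun_eq_iff)
  then show ?thesis unfolding jet_act_def using jet_has_series[OF has_series_peval] by simp
qed

lemma mpw_1_iff: "p \<in> mpw 1 \<longleftrightarrow> lookup p 0 = 0"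
  by (auto simp: mpw_iff)

lemma trunc_eq_0_iff: "trunc N (lookup p) = 0 \<longleftrightarrow> p \<in> mpw N"
  by (auto simp: mpw_iff poly_mapping_eq_iff fun_eq_iff)

lemma lookup_subst_linear:
  fixes P :: "'n::finite \<Rightarrow> 'n mpoly"
  assumes P: "\<And>j. P j \<in> mpw 1"
  shows "lookup (subst P q) (expo k 1) = (\<Sum>j\<in>UNIV. lookup q (expo j 1) * lookup (P j) (expo k 1))"
proof (rule mpoly_induct[of _ q])
  fix \<alpha> :: "'n \<Rightarrow> nat" and c :: complex
  consider "\<alpha> = 0" | j where "\<alpha> = expo j 1" | "mdeg \<alpha> \<ge> 2"
  proof (cases "mdeg \<alpha> \<ge> 2")
    case False
    show ?thesis
    proof (cases "\<alpha> = 0")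
      case nz: False
      then obtain j where "\<alpha> j \<noteq> 0" unfolding fun_eq_iff zero_fun_apply by blast
      then have "1 \<le> \<alpha> j" by simp
      from mindex_split[of 1 \<alpha> j, OF this] obtain \<gamma> where \<alpha>: "\<alpha> = \<gamma> + expo j 1" ..
      have "mdeg \<alpha> = mdeg \<gamma> + 1" unfolding \<alpha> by simp
      with False have "mdeg \<gamma> = 0" by linarith
      then have "\<gamma> = 0" by simp
      with \<alpha> that(2) show ?thesis by simp
    qed (rule that)
  qed (rule that)
  then show "lookup (subst P (Poly_Mapping.single \<alpha> c)) (expo k 1) =
      (\<Sum>j\<in>UNIV. lookup (Poly_Mapping.single \<alpha> c) (expo j 1) * lookup (P j) (expo k 1))"
  proof cases
    case 1
    have "expo j 1 \<noteq> (0 :: 'n \<Rightarrow> nat)" for j by (metis mdeg_expo mdeg_zero zero_neq_one)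
    then show ?thesis by (simp add: 1 lookup_single when_def del: One_nat_def)
  next
    case (2 j)
    have *: "expo j 1 = expo i 1 \<longleftrightarrow> i = j" for i by (metis expo_simps zero_neq_one)
    have "Poly_Mapping.single \<alpha> c = cst c * mon (expo j 1)" by (simp add: 2 mult_single)
    then have "subst P (Poly_Mapping.single \<alpha> c) = cst c * P j"
      by (simp only: cst_hom.meval_mult cst_hom.meval_var cst_hom.meval_cst)
    then show ?thesis
      by (simp add: 2 lookup_single when_def * if_distrib[where f = "\<lambda>x. x * _"] del: One_nat_def cong: if_cong)
  next
    case 3
    have "Poly_Mapping.single \<alpha> c \<in> mpw 2" using 3 by (auto simp: mpw_def)
    from subst_mpw[OF P this] have "lookup (subst P (Poly_Mapping.single \<alpha> c)) (expo k 1) = 0"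
      by (simp add: mpw_iff)
    moreover have "\<alpha> \<noteq> expo j 1" for j using 3 by auto
    ultimately show ?thesis by (simp add: lookup_single when_def)
  qed
qed (simp add: cst_hom.meval_add lookup_add distrib_right sum.distrib)

text \<open>The chain rule at the origin: linear terms of the composition are a product of matrices,
  and they are visible modulo degree N because N >= 2.\<close>

lemma linear_part_invertible:
  fixes P Q :: "'n::finite \<Rightarrow> 'n mpoly"
  assumes P: "\<And>j. P j \<in> mpw 1" and inv: "\<And>i. subst P (Q i) - mon (expo i 1) \<in> mpw N" and N: "N \<ge> 2"
  shows "det (linear_part (\<lambda>i. lookup (P i))) \<noteq> 0"
proof -
  have "linear_part (\<lambda>i. lookup (Q i)) ** linear_part (\<lambda>i. lookup (P i)) = mat 1"
    unfolding vec_eq_iff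
  proof (intro allI)
    fix i k
    have "lookup (subst P (Q i) - mon (expo i 1)) (expo k 1) = 0" using inv[of i] N by (simp add: mpw_iff)
    moreover have "expo i 1 = expo k 1 \<longleftrightarrow> i = k" by (metis expo_simps zero_neq_one)
    ultimately have "lookup (subst P (Q i)) (expo k 1) = (if i = k then 1 else 0)"
      by (simp add: lookup_minus lookup_single when_def del: One_nat_def split: if_splits)
    then show "(linear_part (\<lambda>i. lookup (Q i)) ** linear_part (\<lambda>i. lookup (P i))) $ i $ k = mat 1 $ i $ k"
      unfolding lookup_subst_linear[OF P] by (simp add: matrix_matrix_mult_def linear_part_def mat_def)
  qed
  then have "det (linear_part (\<lambda>i. lookup (Q i))) * det (linear_part (\<lambda>i. lookup (P i))) = 1"
    using det_mul by (metis det_I)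
  then show ?thesis by auto
qed

lemma det_nonzero_nearby:
  fixes L :: "complex ^ 'n::finite ^ 'n"
  assumes "det L \<noteq> 0"
  obtains \<delta> where "\<delta> > 0" "\<forall>L'. (\<forall>i j. norm (L' $ i $ j - L $ i $ j) \<le> \<delta>) \<longrightarrow> det L' \<noteq> 0"
proof -
  have "continuous_on UNIV (det :: complex ^ 'n ^ 'n \<Rightarrow> complex)"
    unfolding det_def by (intro continuous_intros)
  then have "open {L' :: complex ^ 'n ^ 'n. det L' \<noteq> 0}"
    using open_Collect_neq[of "det :: complex ^ 'n ^ 'n \<Rightarrow> complex" "\<lambda>_. 0"] by simp
  then obtain e where e: "e > 0" "\<And>L'. dist L' L < e \<Longrightarrow> det L' \<noteq> 0"
    using assms unfolding open_dist by blast
  define n where "n = real CARD('n)"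
  have n: "n > 0" by (simp add: n_def)
  define \<delta> where "\<delta> = e / (2 * n * n)"
  have "\<delta> > 0" using e(1) n by (simp add: \<delta>_def)
  moreover have "det L' \<noteq> 0" if L': "\<forall>i j. norm (L' $ i $ j - L $ i $ j) \<le> \<delta>" for L'
  proof (rule e(2))
    have row: "norm ((L' - L) $ i) \<le> n * \<delta>" for i
    proof -
      have "norm ((L' - L) $ i) \<le> (\<Sum>j\<in>UNIV. norm ((L' - L) $ i $ j))"
        unfolding norm_vec_def[of "(L' - L) $ i"] by (rule L2_set_le_sum) simp
      also have "\<dots> \<le> (\<Sum>j\<in>(UNIV :: 'n set). \<delta>)" using L' by (intro sum_mono) simp
      finally show ?thesis by (simp add: n_def)
    qed
    have "dist L' L \<le> (\<Sum>i\<in>UNIV. norm ((L' - L) $ i))"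
      unfolding dist_norm norm_vec_def[of "L' - L"] by (rule L2_set_le_sum) simp
    also have "\<dots> \<le> (\<Sum>i\<in>(UNIV :: 'n set). n * \<delta>)" using row by (intro sum_mono) simp
    also have "\<dots> = e / 2" using n by (simp add: n_def[symmetric] \<delta>_def)
    finally show "dist L' L < e" using e(1) by simp
  qed
  ultimately show ?thesis using that by blast
qed

section \<open>Equivariant jets\<close>

context diagonal_action
begin

definition homog :: "('g \<Rightarrow> complex) \<Rightarrow> 'n mpoly \<Rightarrow> bool" where
  "homog w p \<longleftrightarrow> (\<forall>\<beta>\<in>keys p. \<forall>g\<in>carrier G. mchar \<xi> \<beta> g = w g)"

lemma homog_inv_poly: "inv_poly h \<longleftrightarrow> homog (\<lambda>_. 1) h"
  by (simp add: inv_poly_def homog_def)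

lemma homog_zero [simp]: "homog w 0"
  by (simp add: homog_def)

lemma homog_add: "homog w p \<Longrightarrow> homog w q \<Longrightarrow> homog w (p + q)"
  unfolding homog_def using keys_add[of p q] by blast

lemma homog_keys: "homog w p \<Longrightarrow> keys q \<subseteq> keys p \<Longrightarrow> homog w q"
  by (auto simp: homog_def)

lemma homog_mult: "homog w p \<Longrightarrow> homog w' q \<Longrightarrow> homog (\<lambda>g. w g * w' g) (p * q)"
  unfolding homog_def by (auto dest!: keys_mult_mdeg simp: mchar_add)

lemma homog_cst_mult: "homog w p \<Longrightarrow> homog w (cst c * p)"
  by (rule homog_keys) (auto simp: in_keys_iff)

lemma homog_trunc: "homog w p \<Longrightarrow> homog w (trunc N (lookup p))"
  by (rule homog_keys) (auto simp: in_keys_iff split: if_splits)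

lemma homog_lookup: "homog w p \<Longrightarrow> lookup p \<beta> \<noteq> 0 \<Longrightarrow> g \<in> carrier G \<Longrightarrow> mchar \<xi> \<beta> g = w g"
  by (auto simp: homog_def in_keys_iff)

lemma homog_subst_single:
  assumes P: "\<And>j. homog (\<xi> j) (P j)"
  shows "homog (mchar \<xi> \<alpha>) (subst P (Poly_Mapping.single \<alpha> c))"
proof -
  have one: "homog (\<lambda>_. 1) 1" by (auto simp: homog_def)
  have pw: "homog (\<lambda>g. \<xi> j g ^ k) (P j ^ k)" for j k
  proof (induct k)
    case (Suc k) from homog_mult[OF P Suc] show ?case by simp
  qed (simp add: one)
  have "homog (\<lambda>g. \<Prod>j\<in>A. \<xi> j g ^ \<alpha> j) (\<Prod>j\<in>A. P j ^ \<alpha> j)" for A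
  proof (induct A rule: infinite_finite_induct)
    case (insert x F) from homog_mult[OF pw insert(3)] insert(1,2) show ?case by simp
  qed (simp_all add: one)
  from homog_cst_mult[OF this[of UNIV]] show ?thesis
    by (simp add: cst_hom.meval_single mchar_def[abs_def])
qed

lemma homog_subst:
  assumes P: "\<And>j. homog (\<xi> j) (P j)" and h: "homog w h"
  shows "homog w (subst P h)"
proof (rule mpoly_induct_keys[of h])
  fix \<alpha> c assume "\<alpha> \<in> keys h"
  then show "homog w (subst P (Poly_Mapping.single \<alpha> c))"
    using homog_subst_single[OF P, of \<alpha> c] h by (auto simp: homog_def)
qed (auto simp: cst_hom.meval_add intro: homog_add)

definition wt_index :: "'n \<Rightarrow> ('n \<Rightarrow> nat) \<Rightarrow> bool" where
  "wt_index i \<beta> \<longleftrightarrow> (\<forall>g\<in>carrier G. mchar \<xi> \<beta> g = \<xi> i g)"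

lemma homog_wt_index: "homog (\<xi> i) p \<longleftrightarrow> (\<forall>\<beta>\<in>keys p. wt_index i \<beta>)"
  by (simp add: homog_def wt_index_def)

lemma homog_pick: "homog (\<xi> i) (pick (wt_index i) p)"
  by (simp add: homog_wt_index)

text \<open>An equivariant substitution preserves characters, so it commutes with the projection to
  an isotypic part; this projection takes the place of averaging over the group.\<close>

lemma subst_pick:
  assumes P: "\<And>j. homog (\<xi> j) (P j)"
  shows "subst P (pick (wt_index i) p) = pick (wt_index i) (subst P p)"
proof (rule mpoly_induct[of _ p])
  fix \<alpha> c
  let ?q = "subst P (Poly_Mapping.single \<alpha> c)"
  have "wt_index i \<beta> \<longleftrightarrow> wt_index i \<alpha>" if "\<beta> \<in> keys ?q" for \<beta>
    using homog_subst_single[OF P, of \<alpha> c] that by (auto simp: homog_def wt_index_def)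
  then have "pick (wt_index i) ?q = (if wt_index i \<alpha> then ?q else 0)"
    by (intro poly_mapping_eqI) (auto simp: in_keys_iff)
  then show "subst P (pick (wt_index i) (Poly_Mapping.single \<alpha> c)) = pick (wt_index i) ?q"
    by (simp add: pick_single)
qed (simp add: pick_add cst_hom.meval_add)

lemma peval_diag_homog:
  assumes "homog w p" "g \<in> carrier G"
  shows "peval p (diag_act \<xi> g x) = w g * peval p x"
  unfolding peval_def sum_distrib_left
proof (rule sum.cong[OF refl])
  fix \<alpha> assume "\<alpha> \<in> keys p"
  then have "mchar \<xi> \<alpha> g = w g" using assms by (simp add: homog_def)
  then show "lookup p \<alpha> * mpow (diag_act \<xi> g x) \<alpha> = w g * (lookup p \<alpha> * mpow x \<alpha>)"
    by (simp add: mpow_diag_act)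
qed

definition inv_jet_polys :: "nat \<Rightarrow> 'n mpoly set" where
  "inv_jet_polys N = {p. homog (\<lambda>_. 1) p \<and> (\<forall>\<alpha>\<in>keys p. 1 \<le> mdeg \<alpha> \<and> mdeg \<alpha> < N)}"

text \<open>Invariance is a condition on each monomial separately, so the truncation of an invariant
  germ is an invariant polynomial, and such a polynomial is a germ with itself as jet.\<close>

lemma inv_jets_eq: "inv_jets G \<xi> r = lookup ` inv_jet_polys (Suc r)"
proof (intro equalityI subsetI)
  fix a assume "a \<in> inv_jets G \<xi> r"
  then obtain f where f: "analytic_germ f" "invariant_germ G \<xi> f" "f 0 = 0" "a = jet r f"
    by (auto simp: inv_jets_def inv_max_ideal_def)
  have s: "has_series f (series_of f)" by (rule has_series_series_of[OF f(1)])
  have a: "a = lookup (trunc (Suc r) (series_of f))" using jet_has_series[OF s] f(4) by simp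
  moreover have "trunc (Suc r) (series_of f) \<in> inv_jet_polys (Suc r)"
    unfolding inv_jet_polys_def
  proof (intro CollectI conjI ballI)
    show "homog (\<lambda>_. 1) (trunc (Suc r) (series_of f))"
      unfolding homog_def using invariant_coeffs[OF s f(2)] by (auto simp: in_keys_iff split: if_splits)
    fix \<alpha> assume "\<alpha> \<in> keys (trunc (Suc r) (series_of f))"
    then have "mdeg \<alpha> < Suc r" "series_of f \<alpha> \<noteq> 0" by (auto simp: in_keys_iff split: if_splits)
    moreover have "series_of f 0 = 0" using has_series_0[OF s] f(3) by simp
    ultimately have "\<alpha> \<noteq> 0" by auto
    then show "1 \<le> mdeg \<alpha>" using mdeg_eq_0_iff[of \<alpha>] by linarith
    show "mdeg \<alpha> < Suc r" by fact
  qed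
  ultimately show "a \<in> lookup ` inv_jet_polys (Suc r)" by blast
next
  fix a assume "a \<in> lookup ` inv_jet_polys (Suc r)"
  then obtain p where p: "a = lookup p" "homog (\<lambda>_. 1) p" "\<And>\<alpha>. \<alpha> \<in> keys p \<Longrightarrow> 1 \<le> mdeg \<alpha> \<and> mdeg \<alpha> < Suc r"
    by (auto simp: inv_jet_polys_def)
  have "trunc (Suc r) (lookup p) = p" using p(3) by (intro poly_mapping_eqI) (auto simp: in_keys_iff)
  then have "a = jet r (peval p)" unfolding jet_has_series[OF has_series_peval] p(1) by (simp only:)
  moreover have "lookup p 0 = 0" using p(3)[of 0] by (auto simp: in_keys_iff)
  then have "peval p 0 = 0" using has_series_0[OF has_series_peval] by metis
  then have "peval p \<in> inv_max_ideal G \<xi>"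
    using peval_diag_homog[OF p(2)] has_series_peval[of p]
    by (auto simp: inv_max_ideal_def analytic_germ_def invariant_germ_def)
  ultimately show "a \<in> inv_jets G \<xi> r" by (auto simp: inv_jets_def)
qed

lemma diffeo_jetsI:
  assumes P: "\<And>i. homog (\<xi> i) (P i)" "\<And>i. P i \<in> mpw 1" "\<And>i \<beta>. \<beta> \<in> keys (P i) \<Longrightarrow> mdeg \<beta> \<le> r"
    and det: "det (linear_part (\<lambda>i. lookup (P i))) \<noteq> 0"
  shows "(\<lambda>i. lookup (P i)) \<in> diffeo_jets G \<xi> r"
proof -
  define \<phi> where "\<phi> x = (\<chi> i. peval (P i) x)" for x
  have "diffeo_germ \<phi>" unfolding \<phi>_def[abs_def] by (rule polynomial_diffeo[OF P(2) det])
  moreover have "equivariant_germ G \<xi> \<phi>"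
    unfolding equivariant_germ_def vec_eq_iff
    by (auto simp: \<phi>_def peval_diag_homog[OF P(1)] diag_act_def[of \<xi> _ "\<chi> i. peval (P i) _"])
  moreover have "jet r (\<lambda>x. \<phi> x $ i) = lookup (P i)" for i
  proof -
    have "has_series (\<lambda>x. \<phi> x $ i) (lookup (P i))" by (simp add: \<phi>_def has_series_peval)
    from jet_has_series[OF this] have "jet r (\<lambda>x. \<phi> x $ i) = lookup (trunc (Suc r) (lookup (P i)))" .
    also have "trunc (Suc r) (lookup (P i)) = P i"
      using P(3)[of _ i] by (intro poly_mapping_eqI) (auto simp: in_keys_iff less_Suc_eq_le)
    finally show ?thesis .
  qed
  ultimately show ?thesis unfolding diffeo_jets_def by (intro image_eqI[of _ _ \<phi>]) auto
qed

text \<open>\<open>Q\<close> comes from the Taylor polynomial T of the inverse germ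
  \<open>\<psi>\<close>. As \<open>\<psi>\<close> - T vanishes to order r + 1, so does
  T(\<open>\<phi>\<close> x) - x, and an order estimate determines its coefficients. Keeping only
  the monomials with the character of the respective coordinate makes the result
  equivariant.\<close>

lemma diffeo_jetsE:
  assumes "\<Phi> \<in> diffeo_jets G \<xi> r"
  obtains P Q where "\<Phi> = (\<lambda>i. lookup (P i))" "\<forall>i. homog (\<xi> i) (P i)" "\<forall>i. P i \<in> mpw 1"
    "\<forall>i. \<forall>\<beta>\<in>keys (P i). mdeg \<beta> \<le> r"
    "\<forall>i. homog (\<xi> i) (Q i)" "\<forall>i. Q i \<in> mpw 1" "\<forall>i. subst P (Q i) - mon (expo i 1) \<in> mpw (Suc r)"
proof -
  let ?N = "Suc r"
  obtain \<phi> where \<phi>: "diffeo_germ \<phi>" "equivariant_germ G \<xi> \<phi>" "\<Phi> = (\<lambda>i. jet r (\<lambda>x. \<phi> x $ i))"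
    using assms by (auto simp: diffeo_jets_def)
  obtain \<psi> where \<psi>: "analytic_map_germ \<psi>" "\<psi> 0 = 0" "\<forall>\<^sub>F x in nhds 0. \<psi> (\<phi> x) = x"
    using \<phi>(1) unfolding diffeo_germ_def by blast
  have \<phi>0: "\<phi> 0 = 0" "analytic_map_germ \<phi>" using \<phi>(1) by (auto simp: diffeo_germ_def)
  define c where "c i = series_of (\<lambda>x. \<phi> x $ i)" for i
  define d where "d i = series_of (\<lambda>x. \<psi> x $ i)" for i
  have c: "has_series (\<lambda>x. \<phi> x $ i) (c i)" and d: "has_series (\<lambda>x. \<psi> x $ i) (d i)" for i
    using \<phi>0(2) \<psi>(1) has_series_series_of unfolding analytic_map_germ_def c_def d_def by blast+
  have c0: "c i 0 = 0" and d0: "d i 0 = 0" for i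
    using has_series_0[OF c[of i]] has_series_0[OF d[of i]] \<phi>0(1) \<psi>(2) by simp_all
  define P where "P i = trunc ?N (c i)" for i
  define T where "T i = trunc ?N (d i)" for i
  have \<Phi>: "\<Phi> = (\<lambda>i. lookup (P i))" unfolding \<phi>(3) P_def jet_has_series[OF c] ..
  have P1: "P i \<in> mpw 1" for i unfolding mpw_1_iff by (simp add: P_def c0)
  have wt: "mchar \<xi> \<beta> g = \<xi> i g" if g: "g \<in> carrier G" and nz: "c i \<beta> \<noteq> 0" for i \<beta> g
  proof -
    have "\<forall>\<^sub>F x in nhds 0. \<phi> (diag_act \<xi> g x) $ i = \<xi> i g * \<phi> x $ i"
      using \<phi>(2) g unfolding equivariant_germ_def
      by (auto elim!: eventually_mono dest!: bspec simp: diag_act_def[of \<xi> g "\<phi> _"])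
    from has_series_cong[OF has_series_diag[OF c] this]
    have "(\<lambda>\<beta>. mchar \<xi> \<beta> g * c i \<beta>) = (\<lambda>\<beta>. \<xi> i g * c i \<beta>)"
      using has_series_cmult[OF c] by (rule has_series_unique)
    then have "mchar \<xi> \<beta> g * c i \<beta> = \<xi> i g * c i \<beta>" by (rule fun_cong)
    with nz show ?thesis by simp
  qed
  have Ph: "homog (\<xi> i) (P i)" for i
    unfolding homog_def using wt by (auto simp: P_def in_keys_iff split: if_splits)
  have main: "subst P (T i) - mon (expo i 1) \<in> mpw ?N" for i
  proof -
    obtain s where s: "has_series (\<lambda>x. peval (T i) (\<chi> i. \<phi> x $ i)) s"
      "\<And>N. trunc N s - subst (\<lambda>i. trunc N (c i)) (T i) \<in> mpw N"
      using has_series_compose[of "\<lambda>i x. \<phi> x $ i" c "T i", OF c] by blast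
    have u1: "has_series (\<lambda>x. \<psi> x $ i - peval (T i) x) (\<lambda>\<alpha>. d i \<alpha> - lookup (T i) \<alpha>)"
      by (rule has_series_diff[OF d has_series_peval])
    have u2: "d i \<alpha> - lookup (T i) \<alpha> = 0" if "mdeg \<alpha> < ?N" for \<alpha> using that by (simp add: T_def)
    obtain C1 \<rho>1 where 1: "C1 \<ge> 0" "\<rho>1 > 0"
      "\<forall>x M. (\<forall>j. norm (x $ j) \<le> M) \<longrightarrow> M \<le> \<rho>1 \<longrightarrow> norm (\<psi> x $ i - peval (T i) x) \<le> C1 * M ^ ?N"
      by (rule has_series_order[where N = ?N, OF u1 u2]) (assumption, rule that)
    obtain C2 \<rho>2 where 2: "C2 \<ge> 0" "\<rho>2 > 0"
      "\<forall>x M. (\<forall>j. norm (x $ j) \<le> M) \<longrightarrow> M \<le> \<rho>2 \<longrightarrow> (\<forall>j. norm (\<phi> x $ j) \<le> C2 * M)"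
      by (rule analytic_map_bound[OF c \<phi>0(1)]) (rule that)
    obtain \<rho>3 where 3: "\<rho>3 > 0" "\<And>x. (\<forall>j. norm (x $ j) \<le> \<rho>3) \<Longrightarrow> \<psi> (\<phi> x) = x"
      using \<psi>(3) unfolding eventually_nhds_0_polydisc by blast
    \<comment> \<open>So small that \<open>\<phi>\<close> maps the polydisc into the one of radius
      \<open>\<rho>1\<close>, where \<open>\<psi>\<close> is compared with its Taylor
      polynomial.\<close>
    define \<rho> where "\<rho> = min (min \<rho>2 \<rho>3) (\<rho>1 / (C2 + 1))"
    have \<rho>: "\<rho> > 0" "\<rho> \<le> \<rho>2" "\<rho> \<le> \<rho>3" using 1 2 3 by (simp_all add: \<rho>_def)
    have "\<rho> \<le> \<rho>1 / (C2 + 1)" by (simp add: \<rho>_def)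
    then have "\<rho> * (C2 + 1) \<le> \<rho>1" using 2(1) by (simp add: pos_le_divide_eq)
    then have \<rho>4: "C2 * \<rho> \<le> \<rho>1" using \<rho>(1) by (simp add: algebra_simps)
    have v: "has_series (\<lambda>x. peval (T i) (\<phi> x) - peval (mon (expo i 1)) x) (\<lambda>\<alpha>. s \<alpha> - lookup (mon (expo i 1)) \<alpha>)"
      using has_series_diff[OF s(1) has_series_peval[of "mon (expo i 1)"]] by simp
    have bound: "norm (peval (T i) (\<phi> x) - peval (mon (expo i 1)) x) \<le> (C1 * C2 ^ ?N) * M ^ ?N"
      if x: "\<And>j. norm (x $ j) \<le> M" and M: "M \<le> \<rho>" for x M
    proof -
      have "\<forall>j. norm (x $ j) \<le> \<rho>3" using order_trans[OF x order_trans[OF M \<rho>(3)]] by simp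
      then have fix1: "\<psi> (\<phi> x) $ i = x $ i" using 3(2) by simp
      have "\<forall>j. norm (\<phi> x $ j) \<le> C2 * M" using 2(3) x M \<rho>(2) by auto
      moreover have "C2 * M \<le> \<rho>1" using \<rho>4 mult_left_mono[OF M 2(1)] by linarith
      ultimately have "norm (\<psi> (\<phi> x) $ i - peval (T i) (\<phi> x)) \<le> C1 * (C2 * M) ^ ?N" by (rule 1(3)[THEN spec, THEN spec, THEN mp, THEN mp])
      then have "norm (x $ i - peval (T i) (\<phi> x)) \<le> C1 * (C2 * M) ^ ?N" by (simp only: fix1)
      then show ?thesis by (simp add: norm_minus_commute power_mult_distrib mult_ac)
    qed
    have "s \<alpha> - lookup (mon (expo i 1)) \<alpha> = 0" if "mdeg \<alpha> < ?N" for \<alpha>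
      by (rule order_imp_coeffs_zero[OF v \<rho>(1) bound that])
    then have "trunc ?N s - mon (expo i 1) \<in> mpw ?N" by (simp add: mpw_iff lookup_minus)
    from is_idealD(6)[OF is_ideal_mpw this s(2)[of ?N]] show ?thesis by (simp add: P_def[abs_def])
  qed
  define Q where "Q i = pick (wt_index i) (T i)" for i
  have "subst P (Q i) - mon (expo i 1) \<in> mpw ?N" for i
  proof -
    have "pick (wt_index i) (subst P (T i) - mon (expo i 1)) \<in> mpw ?N" by (rule pick_mpw[OF main])
    moreover have "pick (wt_index i) (mon (expo i 1)) = mon (expo i 1)"
      unfolding pick_single by (simp add: wt_index_def del: One_nat_def)
    ultimately show ?thesis unfolding Q_def subst_pick[OF Ph] by (simp add: pick_diff del: One_nat_def)
  qed
  moreover have "Q i \<in> mpw 1" for i unfolding mpw_1_iff by (simp add: Q_def T_def d0)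
  moreover have "mdeg \<beta> \<le> r" if "\<beta> \<in> keys (P i)" for i \<beta>
    using that by (auto simp: P_def in_keys_iff split: if_splits)
  ultimately show ?thesis using that[of P Q] \<Phi> Ph P1 homog_pick by (simp add: Q_def)
qed

end

section \<open>Openness of the orbit\<close>

text \<open>Radius 1 gives the plain sum of the absolute values of the coefficients, the norm used
  on jets.\<close>

interpretation wn: seminorm_hom "cst :: complex \<Rightarrow> 'n::finite mpoly" "wnorm 1"
  by (rule seminorm_hom_wnorm) simp

lemma lookup_le_wnorm: "norm (lookup p \<alpha>) \<le> wnorm 1 p"
proof (cases "\<alpha> \<in> keys p")
  case True
  have "norm (lookup p \<alpha>) * 1 ^ mdeg \<alpha> \<le> wnorm 1 p"
    unfolding wnorm_def by (rule member_le_sum[OF True]) auto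
  then show ?thesis by simp
qed (simp add: in_keys_iff)

lemma wnorm_eq_0: "wnorm 1 p \<le> 0 \<Longrightarrow> p = 0"
  using lookup_le_wnorm[of p] by (intro poly_mapping_eqI) (metis lookup_zero norm_le_zero_iff order_trans)

abbreviation cut :: "nat \<Rightarrow> 'n::finite mpoly \<Rightarrow> 'n mpoly" where
  "cut N p \<equiv> trunc N (lookup p)"

lemma cut_diff: "cut N (p - q) = cut N p - cut N q"
  by (rule poly_mapping_eqI) (simp add: lookup_minus)

lemma cut_id: "(\<And>\<alpha>. \<alpha> \<in> keys p \<Longrightarrow> mdeg \<alpha> < N) \<Longrightarrow> cut N p = p"
  by (rule poly_mapping_eqI) (auto simp: in_keys_iff)

lemma cut_cong: "p - q \<in> mpw N \<Longrightarrow> cut N p = cut N q"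
  unfolding trunc_eq_0_iff[symmetric] cut_diff by simp

lemma wnorm_cut: "wnorm 1 (cut N p) \<le> wnorm 1 p"
proof -
  have "wnorm 1 (cut N p) = (\<Sum>\<alpha>\<in>keys p. norm (lookup (cut N p) \<alpha>) * 1 ^ mdeg \<alpha>)"
    by (rule wnorm_superset) (auto simp: in_keys_iff split: if_splits)
  also have "\<dots> \<le> wnorm 1 p" unfolding wnorm_def by (rule sum_mono) simp
  finally show ?thesis .
qed

section \<open>The derivative of the orbit map and Newton's iteration\<close>

context diagonal_action
begin

text \<open>The i-th components of jets of equivariant vector fields that vanish at the origin: the
  directions in which an equivariant change of coordinates can be varied.\<close>

definition equi_polys :: "nat \<Rightarrow> 'n \<Rightarrow> 'n mpoly set" where
  "equi_polys N i = {p. \<forall>\<beta>\<in>keys p. wt_index i \<beta> \<and> 1 \<le> mdeg \<beta> \<and> mdeg \<beta> < N}"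

lemma subspace_equi_polys: "mp.subspace (equi_polys N i)"
  unfolding equi_polys_def by (rule subspace_keys)

lemma equi_polysD:
  assumes "p \<in> equi_polys N i"
  shows "homog (\<xi> i) p" "p \<in> mpw 1" "\<beta> \<in> keys p \<Longrightarrow> mdeg \<beta> < N"
  using assms by (auto simp: equi_polys_def homog_wt_index mpw_def)

lemma inv_jet_polys_alt:
  "inv_jet_polys N = {p. \<forall>\<alpha>\<in>keys p. (\<forall>g\<in>carrier G. mchar \<xi> \<alpha> g = 1) \<and> 1 \<le> mdeg \<alpha> \<and> mdeg \<alpha> < N}"
  by (auto simp: inv_jet_polys_def homog_def)

lemma subspace_inv_jet_polys: "mp.subspace (inv_jet_polys N)"
  unfolding inv_jet_polys_alt by (rule subspace_keys)

lemma cut_subst_inv_jet: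
  assumes "\<And>j. homog (\<xi> j) (P j)" "\<And>j. P j \<in> mpw 1" "homog (\<lambda>_. 1) h" "h \<in> mpw 1"
  shows "cut N (subst P h) \<in> inv_jet_polys N"
  unfolding inv_jet_polys_def
proof (intro CollectI conjI ballI)
  show "homog (\<lambda>_. 1) (cut N (subst P h))" by (rule homog_trunc[OF homog_subst[OF assms(1,3)]])
  fix \<alpha> assume "\<alpha> \<in> keys (cut N (subst P h))"
  then have "mdeg \<alpha> < N" "\<alpha> \<in> keys (subst P h)" by (auto simp: in_keys_iff split: if_splits)
  then show "mdeg \<alpha> < N" "1 \<le> mdeg \<alpha>" using subst_mpw[OF assms(2,4)] by (auto simp: mpw_def)
qed

text \<open>Pull \<open>h\<close> back by the inverse \<open>Q\<close> of \<open>P\<close>, write the result in terms of the \<open>F j\<close> with equivariant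
  coefficients, and push it forward by \<open>P\<close>.\<close>

lemma derivative_surjective:
  assumes chord: "\<And>i. chord i \<ge> 2"
    and P: "\<And>j. homog (\<xi> j) (P j)"
    and Q: "\<And>j. homog (\<xi> j) (Q j)" "\<And>j. Q j \<in> mpw 1" "\<And>i. subst P (Q i) - mon (expo i 1) \<in> mpw N"
    and F: "\<And>j. covariant j (F j)"
    and ideal: "\<And>h. inv_poly h \<Longrightarrow> lookup h 0 = 0 \<Longrightarrow> h \<in> gen_ideal F UNIV N"
    and P1: "\<And>j. P j \<in> mpw 1"
    and h: "h \<in> inv_jet_polys N"
  shows "\<exists>v. (\<forall>i. v i \<in> equi_polys N i) \<and> h - (\<Sum>i\<in>UNIV. v i * subst P (F i)) \<in> mpw N"
proof -
  let ?p = "subst Q h"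
  have h1: "homog (\<lambda>_. 1) h" "h \<in> mpw 1" using h by (auto simp: inv_jet_polys_def mpw_def)
  have p: "homog (\<lambda>_. 1) ?p" by (rule homog_subst[OF Q(1) h1(1)])
  have "?p \<in> gen_ideal F UNIV N"
    using p subst_mpw[OF Q(2) h1(2), unfolded mpw_1_iff] by (intro ideal) (simp_all add: homog_inv_poly)
  then obtain b where b: "?p - (\<Sum>j\<in>UNIV. b j * F j) \<in> mpw N" by (auto simp: gen_ideal_def)
  \<comment> \<open>Since F_j has the character inverse to \<open>\<xi> j\<close>, the invariant
    part of b_j F_j comes from the part of b_j with character \<open>\<xi> j\<close>. The
    coefficients thus become equivariant.\<close>
  define w where "w j = pick (wt_index j) (b j)" for j
  let ?inv = "\<lambda>\<alpha>. \<forall>g\<in>carrier G. mchar \<xi> \<alpha> g = 1"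
  have pbF: "pick ?inv (b j * F j) = w j * F j" for j
  proof -
    have "pick ?inv (b j * F j) = pick (wt_index j) (b j) * pick (\<lambda>_. True) (F j)"
    proof (rule pick_mult)
      fix \<alpha> \<beta> assume "\<beta> \<in> keys (F j)"
      then have \<beta>: "mchar \<xi> \<beta> g * \<xi> j g = 1" if "g \<in> carrier G" for g
        using F[of j] that by (auto simp: covariant_def)
      have "mchar \<xi> (\<alpha> + \<beta>) g = 1 \<longleftrightarrow> mchar \<xi> \<alpha> g = \<xi> j g" if "g \<in> carrier G" for g
        using \<beta>[OF that] unfolding mchar_add
        by (metis mult.commute mult_cancel_right mult_zero_left zero_neq_one)
      then show "?inv (\<alpha> + \<beta>) \<longleftrightarrow> wt_index j \<alpha> \<and> True" by (simp add: wt_index_def)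
    qed
    also have "pick (\<lambda>_. True) (F j) = F j" by (rule pick_id) simp
    finally show ?thesis by (simp add: w_def)
  qed
  have "pick ?inv (?p - (\<Sum>j\<in>UNIV. b j * F j)) = ?p - (\<Sum>j\<in>UNIV. w j * F j)"
    unfolding pick_diff pick_sum pbF using p by (subst pick_id) (auto simp: homog_def)
  then have "?p - (\<Sum>j\<in>UNIV. w j * F j) \<in> mpw N" using pick_mpw[OF b, of ?inv] by simp
  from subst_mpw[OF P1 this] have 1: "subst P ?p - (\<Sum>j\<in>UNIV. subst P (w j) * subst P (F j)) \<in> mpw N"
    by (simp add: cst_hom.meval_diff cst_hom.meval_sum cst_hom.meval_mult)
  have 2: "subst P ?p - h \<in> mpw N"
    using subst_cong_ideal[where Q = "\<lambda>i. subst P (Q i)" and Q' = "\<lambda>i. mon (expo i 1)" and h = h, OF is_ideal_mpw Q(3)] unfolding subst_subst subst_id .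
  define v where "v j = cut N (subst P (w j))" for j
  have 3: "(\<Sum>j\<in>UNIV. (subst P (w j) - v j) * subst P (F j)) \<in> mpw N"
    unfolding v_def by (rule is_ideal_sum[OF is_ideal_mpw is_idealD(4)[OF is_ideal_mpw trunc_lookup]])
  have eq: "h - (\<Sum>j\<in>UNIV. v j * subst P (F j)) = (subst P ?p - (\<Sum>j\<in>UNIV. subst P (w j) * subst P (F j)))
      - (subst P ?p - h) + (\<Sum>j\<in>UNIV. (subst P (w j) - v j) * subst P (F j))"
    by (simp add: left_diff_distrib sum_subtractf)
  have "h - (\<Sum>j\<in>UNIV. v j * subst P (F j)) \<in> mpw N"
    unfolding eq by (rule is_idealD(2)[OF is_ideal_mpw is_idealD(6)[OF is_ideal_mpw 1 2] 3])
  moreover have "v j \<in> equi_polys N j" for j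
    unfolding equi_polys_def
  proof (intro CollectI ballI conjI)
    have hv: "homog (\<xi> j) (v j)" unfolding v_def w_def by (rule homog_trunc[OF homog_subst[OF P homog_pick]])
    fix \<beta> assume \<beta>: "\<beta> \<in> keys (v j)"
    with hv show wt: "wt_index j \<beta>" by (simp add: homog_wt_index)
    show "mdeg \<beta> < N" using \<beta> by (auto simp: v_def in_keys_iff split: if_splits)
    \<comment> \<open>A constant term has trivial character, while \<open>\<xi> j\<close> is
      nontrivial; so the vector field vanishes at the origin by itself.\<close>
    have "\<beta> \<noteq> 0"
    proof
      assume "\<beta> = 0"
      with wt have "\<forall>g\<in>carrier G. \<xi> j g = 1" by (simp add: wt_index_def)
      then show False using chord_ge_2_nontrivial[OF chord[of j]] by auto
    qed
    then show "1 \<le> mdeg \<beta>" using mdeg_eq_0_iff[of \<beta>] by linarith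
  qed
  ultimately show ?thesis by blast
qed

text \<open>Solutions are chosen for the finitely many invariant monomials and extended linearly,
  which makes the solution operator bounded.\<close>

lemma bounded_right_inverse:
  assumes ex: "\<And>h. h \<in> inv_jet_polys N \<Longrightarrow> \<exists>v. (\<forall>i. v i \<in> equi_polys N i) \<and> h - (\<Sum>i\<in>UNIV. v i * D i) \<in> mpw N"
  obtains R K where "K \<ge> 0" "\<forall>h i. R h i \<in> equi_polys N i"
    "\<forall>h\<in>inv_jet_polys N. h - (\<Sum>i\<in>UNIV. R h i * D i) \<in> mpw N"
    "\<forall>h. (\<Sum>i\<in>UNIV. wnorm 1 (R h i)) \<le> K * wnorm 1 h"
proof -
  define A where "A = {\<alpha>. (\<forall>g\<in>carrier G. mchar \<xi> \<alpha> g = 1) \<and> 1 \<le> mdeg \<alpha> \<and> mdeg \<alpha> < N}"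
  have fin: "finite A" by (rule finite_subset[OF _ finite_mdeg_le[of N]]) (auto simp: A_def)
  have "\<forall>\<alpha>\<in>A. \<exists>v. (\<forall>i. v i \<in> equi_polys N i) \<and> mon \<alpha> - (\<Sum>i\<in>UNIV. v i * D i) \<in> mpw N"
  proof
    fix \<alpha> assume "\<alpha> \<in> A"
    then have "mon \<alpha> \<in> inv_jet_polys N" by (simp add: inv_jet_polys_alt A_def)
    then show "\<exists>v. (\<forall>i. v i \<in> equi_polys N i) \<and> mon \<alpha> - (\<Sum>i\<in>UNIV. v i * D i) \<in> mpw N" by (rule ex)
  qed
  from bchoice[OF this] obtain va where va: "\<And>\<alpha> i. \<alpha> \<in> A \<Longrightarrow> va \<alpha> i \<in> equi_polys N i"
    "\<And>\<alpha>. \<alpha> \<in> A \<Longrightarrow> mon \<alpha> - (\<Sum>i\<in>UNIV. va \<alpha> i * D i) \<in> mpw N" by blast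
  define R where "R h i = (\<Sum>\<alpha>\<in>A. cst (lookup h \<alpha>) * va \<alpha> i)" for h i
  define K where "K = (\<Sum>i\<in>UNIV. \<Sum>\<alpha>\<in>A. wnorm 1 (va \<alpha> i))"
  have "K \<ge> 0" unfolding K_def by (intro sum_nonneg) simp
  moreover have "R h i \<in> equi_polys N i" for h i
    unfolding R_def
    by (rule mp.subspace_sum[OF subspace_equi_polys mp.subspace_scale[OF subspace_equi_polys va(1)]])
  moreover have "h - (\<Sum>i\<in>UNIV. R h i * D i) \<in> mpw N" if h: "h \<in> inv_jet_polys N" for h
  proof -
    have "keys h \<subseteq> A" using h by (auto simp: A_def inv_jet_polys_alt)
    from mpoly_sum_keys[OF fin this] have "h = (\<Sum>\<alpha>\<in>A. cst (lookup h \<alpha>) * mon \<alpha>)"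
      by (simp add: mult_single)
    moreover have "(\<Sum>i\<in>UNIV. R h i * D i) = (\<Sum>\<alpha>\<in>A. cst (lookup h \<alpha>) * (\<Sum>i\<in>UNIV. va \<alpha> i * D i))"
      unfolding R_def sum_distrib_right sum_distrib_left mult.assoc by (rule sum.swap)
    ultimately have "h - (\<Sum>i\<in>UNIV. R h i * D i) = (\<Sum>\<alpha>\<in>A. cst (lookup h \<alpha>) * (mon \<alpha> - (\<Sum>i\<in>UNIV. va \<alpha> i * D i)))"
      unfolding right_diff_distrib sum_subtractf by metis
    also have "\<dots> \<in> mpw N" by (rule is_ideal_sum[OF is_ideal_mpw is_idealD(3)[OF is_ideal_mpw va(2)]])
    finally show ?thesis .
  qed
  moreover have "(\<Sum>i\<in>UNIV. wnorm 1 (R h i)) \<le> K * wnorm 1 h" for h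
    unfolding K_def sum_distrib_right
  proof (rule sum_mono)
    fix i
    have "wnorm 1 (R h i) \<le> (\<Sum>\<alpha>\<in>A. wnorm 1 (cst (lookup h \<alpha>) * va \<alpha> i))" unfolding R_def by (rule wn.nm_sum)
    also have "\<dots> \<le> (\<Sum>\<alpha>\<in>A. wnorm 1 (va \<alpha> i) * wnorm 1 h)"
    proof (rule sum_mono)
      fix \<alpha>
      have "wnorm 1 (cst (lookup h \<alpha>) * va \<alpha> i) \<le> norm (lookup h \<alpha>) * wnorm 1 (va \<alpha> i)"
        using wn.nm_mult[of "cst (lookup h \<alpha>)" "va \<alpha> i"] by simp
      also have "\<dots> \<le> wnorm 1 h * wnorm 1 (va \<alpha> i)" by (rule mult_right_mono[OF lookup_le_wnorm]) simp
      finally show "wnorm 1 (cst (lookup h \<alpha>) * va \<alpha> i) \<le> wnorm 1 (va \<alpha> i) * wnorm 1 h" by (simp add: mult.commute)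
    qed
    finally show "wnorm 1 (R h i) \<le> (\<Sum>\<alpha>\<in>A. wnorm 1 (va \<alpha> i) * wnorm 1 h)" .
  qed
  ultimately show ?thesis using that[of K R] by blast
qed

text \<open>Newton's iteration with a fixed bounded right inverse of the derivative.\<close>

lemma locally_surjective:
  assumes P: "\<And>j. homog (\<xi> j) (P j)" "\<And>j. P j \<in> mpw 1"
    and f: "homog (\<lambda>_. 1) f" "f \<in> mpw 1"
    and surj: "\<And>h. h \<in> inv_jet_polys N \<Longrightarrow>
      \<exists>v. (\<forall>i. v i \<in> equi_polys N i) \<and> h - (\<Sum>i\<in>UNIV. v i * subst P (pd i f)) \<in> mpw N"
    and \<delta>0: "\<delta>0 > 0"
  obtains \<eta> where "\<eta> > 0" "\<forall>b\<in>inv_jet_polys N. wnorm 1 (b - cut N (subst P f)) < \<eta> \<longrightarrow>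
    (\<exists>v. (\<forall>i. v i \<in> equi_polys N i \<and> wnorm 1 (v i) \<le> \<delta>0) \<and> cut N (subst (\<lambda>i. P i + v i) f) = b)"
proof -
  define D where "D i = subst P (pd i f)" for i
  obtain R K where K: "K \<ge> 0" and R: "\<forall>h i. R h i \<in> equi_polys N i"
    "\<forall>h\<in>inv_jet_polys N. h - (\<Sum>i\<in>UNIV. R h i * D i) \<in> mpw N"
    "\<forall>h. (\<Sum>i\<in>UNIV. wnorm 1 (R h i)) \<le> K * wnorm 1 h"
    by (rule bounded_right_inverse[OF surj[folded D_def]]) (assumption, rule that)
  \<comment> \<open>With \<open>\<epsilon>\<close> K <= 1/2 each Newton step halves the
    error.\<close>
  define \<epsilon> where "\<epsilon> = 1 / (2 * (K + 1))"
  have \<epsilon>: "\<epsilon> > 0" "\<epsilon> * K \<le> 1 / 2" using K by (simp_all add: \<epsilon>_def divide_simps)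
  have sd: "wn.strict_deriv P (\<lambda>Q. subst Q f) D" unfolding D_def by (rule wn.strict_deriv_meval)
  obtain \<delta>1 where \<delta>1: "\<delta>1 > 0" "\<And>Q Q'. wn.near P \<delta>1 Q \<Longrightarrow> wn.near P \<delta>1 Q' \<Longrightarrow>
     wnorm 1 (subst Q f - subst Q' f - (\<Sum>i\<in>UNIV. D i * (Q i - Q' i))) \<le> \<epsilon> * wn.gap Q Q'"
    using sd \<epsilon>(1) unfolding wn.strict_deriv_def by meson
  obtain L \<delta>2 where L: "L > 0" "\<delta>2 > 0" "\<forall>Q Q'. wn.near P \<delta>2 Q \<longrightarrow> wn.near P \<delta>2 Q' \<longrightarrow>
      wnorm 1 (subst Q f - subst Q' f) \<le> L * wn.gap Q Q'"
    by (rule wn.strict_deriv_lipschitz[OF sd]) (rule that)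
  define r where "r = min (min \<delta>1 \<delta>2) \<delta>0"
  have r: "r > 0" "r \<le> \<delta>1" "r \<le> \<delta>2" "r \<le> \<delta>0" using \<delta>1(1) L(2) \<delta>0 by (simp_all add: r_def)
  \<comment> \<open>The corrections form a geometric series with total at most 2 K times the initial
    error, so all iterates stay within radius \<open>r\<close>.\<close>
  define \<eta> where "\<eta> = r / (2 * (K + 1))"
  have \<eta>: "\<eta> > 0" "2 * K * \<eta> \<le> r" using r K by (simp_all add: \<eta>_def divide_simps)
  have "\<exists>v. (\<forall>i. v i \<in> equi_polys N i \<and> wnorm 1 (v i) \<le> \<delta>0) \<and> cut N (subst (\<lambda>i. P i + v i) f) = b"
    if b: "b \<in> inv_jet_polys N" and close: "wnorm 1 (b - cut N (subst P f)) < \<eta>" for b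
  proof -
    define T where "T v = cut N (subst (\<lambda>i. P i + v i) f)" for v
    define v where "v k = ((\<lambda>v i. v i + R (b - T v) i) ^^ k) (\<lambda>_. 0)" for k
    define e where "e k = b - T (v k)" for k
    define \<Delta> where "\<Delta> k = R (e k)" for k
    have v0: "v 0 = (\<lambda>_. 0)" and v_Suc: "v (Suc k) = (\<lambda>i. v k i + \<Delta> k i)" for k
      by (simp_all add: v_def \<Delta>_def e_def)
    define s where "s = wnorm 1 (e 0)"
    have s: "s \<ge> 0" "2 * K * s \<le> r"
    proof -
      show "s \<ge> 0" by (simp add: s_def)
      have "s < \<eta>" using close by (simp add: s_def e_def T_def v0)
      then have "2 * K * s \<le> 2 * K * \<eta>" using K by (intro mult_left_mono) auto
      with \<eta>(2) show "2 * K * s \<le> r" by simp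
    qed
    have near: "wn.near P \<delta> (\<lambda>i. P i + u i)" if "\<And>i. wnorm 1 (u i) \<le> \<delta>" for u \<delta>
      unfolding wn.near_def using that by simp
    have v_equi: "v k i \<in> equi_polys N i" for k i
    proof (induct k)
      case 0 show ?case unfolding v0 by (rule mp.subspace_0[OF subspace_equi_polys])
    next
      case (Suc k) then show ?case
        unfolding v_Suc \<Delta>_def using R(1) by (intro mp.subspace_add[OF subspace_equi_polys]) auto
    qed
    have e_inv: "e k \<in> inv_jet_polys N" for k
      unfolding e_def T_def
    proof (rule mp.subspace_diff[OF subspace_inv_jet_polys b cut_subst_inv_jet[OF _ _ f]])
      show "homog (\<xi> j) (P j + v k j)" for j by (rule homog_add[OF P(1) equi_polysD(1)[OF v_equi]])
      show "P j + v k j \<in> mpw 1" for j by (rule is_idealD(2)[OF is_ideal_mpw P(2) equi_polysD(2)[OF v_equi]])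
    qed
    have \<Delta>_norm: "(\<Sum>i\<in>UNIV. wnorm 1 (\<Delta> k i)) \<le> K * wnorm 1 (e k)" for k
      using R(3) by (simp add: \<Delta>_def)
    \<comment> \<open>The factor 1 - 2^(-k) is the partial sum of the geometric series of
      corrections; it stays below 1, so the derivative estimate is available at every step.\<close>
    have inv: "(\<Sum>i\<in>UNIV. wnorm 1 (v k i)) \<le> 2 * K * s * (1 - (1/2) ^ k) \<and> wnorm 1 (e k) \<le> s * (1/2) ^ k" for k
    proof (induct k)
      case 0 then show ?case by (simp add: v0 s_def)
    next
      case (Suc k)
      have \<Delta>s: "(\<Sum>i\<in>UNIV. wnorm 1 (\<Delta> k i)) \<le> K * (s * (1/2) ^ k)"
        using \<Delta>_norm[of k] Suc mult_left_mono[OF _ K] order_trans by blast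
      have "(\<Sum>i\<in>UNIV. wnorm 1 (v (Suc k) i)) \<le> (\<Sum>i\<in>UNIV. wnorm 1 (v k i) + wnorm 1 (\<Delta> k i))"
        unfolding v_Suc by (rule sum_mono) (rule wn.nm_add)
      also have "\<dots> \<le> 2 * K * s * (1 - (1/2) ^ k) + K * (s * (1/2) ^ k)"
        unfolding sum.distrib using Suc \<Delta>s by (intro add_mono) auto
      also have "\<dots> = 2 * K * s * (1 - (1/2) ^ Suc k)" by (simp add: algebra_simps)
      finally have v_next: "(\<Sum>i\<in>UNIV. wnorm 1 (v (Suc k) i)) \<le> 2 * K * s * (1 - (1/2) ^ Suc k)" .
      have le_r: "wnorm 1 (u i) \<le> \<delta>1" if "(\<Sum>i\<in>UNIV. wnorm 1 (u i)) \<le> 2 * K * s * (1 - (1/2) ^ m)"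
        for u :: "'n \<Rightarrow> 'n mpoly" and m i
      proof -
        have "wnorm 1 (u i) \<le> (\<Sum>i\<in>UNIV. wnorm 1 (u i))" by (rule member_le_sum) auto
        also note that
        also have "2 * K * s * (1 - (1/2) ^ m) \<le> 2 * K * s * 1" using K s(1) by (intro mult_left_mono) auto
        finally show ?thesis using s(2) r(2) by simp
      qed
      let ?err = "subst (\<lambda>i. P i + v (Suc k) i) f - subst (\<lambda>i. P i + v k i) f - (\<Sum>i\<in>UNIV. D i * \<Delta> k i)"
      have "wnorm 1 ?err \<le> \<epsilon> * wn.gap (\<lambda>i. P i + v (Suc k) i) (\<lambda>i. P i + v k i)"
        using \<delta>1(2)[OF near near, of "v (Suc k)" "v k"] le_r[OF v_next] le_r[OF conjunct1[OF Suc]]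
        by (simp add: v_Suc)
      also have "wn.gap (\<lambda>i. P i + v (Suc k) i) (\<lambda>i. P i + v k i) = (\<Sum>i\<in>UNIV. wnorm 1 (\<Delta> k i))"
        by (simp add: wn.gap_def v_Suc)
      also have "\<epsilon> * (\<Sum>i\<in>UNIV. wnorm 1 (\<Delta> k i)) \<le> \<epsilon> * (K * wnorm 1 (e k))"
        using \<Delta>_norm \<epsilon>(1) by simp
      also have "\<dots> \<le> 1 / 2 * wnorm 1 (e k)" using mult_right_mono[OF \<epsilon>(2), of "wnorm 1 (e k)"] by (simp add: mult.assoc)
      finally have err: "wnorm 1 ?err \<le> 1 / 2 * wnorm 1 (e k)" .
      have "e k - (\<Sum>i\<in>UNIV. D i * \<Delta> k i) \<in> mpw N"
        using R(2) e_inv[of k] by (simp add: \<Delta>_def mult.commute)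
      then have "cut N (\<Sum>i\<in>UNIV. D i * \<Delta> k i) = cut N (e k)" by (rule cut_cong[symmetric])
      also have "cut N (e k) = e k" using e_inv[of k] by (intro cut_id) (auto simp: inv_jet_polys_def)
      finally have "cut N ?err = T (v (Suc k)) - T (v k) - e k" by (simp add: cut_diff T_def)
      then have "e (Suc k) = - cut N ?err" by (simp add: e_def)
      then have "wnorm 1 (e (Suc k)) = wnorm 1 (cut N ?err)" by (simp only: wn.nm_minus)
      also have "\<dots> \<le> 1 / 2 * wnorm 1 (e k)" by (rule order_trans[OF wnorm_cut err])
      also have "\<dots> \<le> s * (1/2) ^ Suc k" using Suc by simp
      finally show ?case using v_next by blast
    qed
    have e_lim: "(\<lambda>k. wnorm 1 (e k)) \<longlonglongrightarrow> 0"
    proof (rule tendsto_sandwich[where f = "\<lambda>_. 0" and h = "\<lambda>k. s * (1/2) ^ k"])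
      show "(\<lambda>k. s * (1/2) ^ k) \<longlonglongrightarrow> 0" by (intro tendsto_mult_right_zero LIMSEQ_power_zero) simp
      show "\<forall>\<^sub>F k in sequentially. wnorm 1 (e k) \<le> s * (1/2) ^ k" using inv by simp
    qed simp_all
    have v_le: "wnorm 1 (v k i) \<le> r" for k i
    proof -
      have "wnorm 1 (v k i) \<le> (\<Sum>i\<in>UNIV. wnorm 1 (v k i))" by (rule member_le_sum) auto
      also have "\<dots> \<le> 2 * K * s * (1 - (1/2) ^ k)" using inv by blast
      also have "\<dots> \<le> 2 * K * s * 1" using K s(1) by (intro mult_left_mono) auto
      finally show ?thesis using s(2) by simp
    qed
    \<comment> \<open>The coefficientwise limit of the iterates. Cutting at degree N makes it a
      polynomial and changes nothing, as all iterates have degree below N.\<close>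
    define w where "w i = trunc N (\<lambda>\<alpha>. suminf (\<lambda>k. lookup (\<Delta> k i) \<alpha>))" for i
    have w_lim: "(\<lambda>k. lookup (v k i) \<alpha>) \<longlonglongrightarrow> lookup (w i) \<alpha>" for i \<alpha>
    proof (cases "mdeg \<alpha> < N")
      case True
      have "norm (lookup (\<Delta> k i) \<alpha>) \<le> K * s * (1/2) ^ k" for k
      proof -
        have "wnorm 1 (\<Delta> k i) \<le> (\<Sum>i\<in>UNIV. wnorm 1 (\<Delta> k i))" by (rule member_le_sum) auto
        with \<Delta>_norm[of k] mult_left_mono[OF conjunct2[OF inv[of k]] K] lookup_le_wnorm[of "\<Delta> k i" \<alpha>]
        show ?thesis by (simp add: mult.assoc)
      qed
      moreover have "summable (\<lambda>k. K * s * (1/2 :: real) ^ k)" by (intro summable_mult summable_geometric) simp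
      ultimately have "summable (\<lambda>k. lookup (\<Delta> k i) \<alpha>)" by (rule summable_comparison_test'[rotated])
      then have "(\<lambda>n. \<Sum>k<n. lookup (\<Delta> k i) \<alpha>) \<longlonglongrightarrow> suminf (\<lambda>k. lookup (\<Delta> k i) \<alpha>)" by (rule summable_LIMSEQ)
      moreover have "(\<Sum>k<n. lookup (\<Delta> k i) \<alpha>) = lookup (v n i) \<alpha>" for n
        by (induct n) (simp_all add: v0 v_Suc lookup_add)
      ultimately show ?thesis using True by (simp add: w_def)
    next
      case False
      then have "lookup (v k i) \<alpha> = 0" for k
        using equi_polysD(3)[OF v_equi, of \<alpha> k i] by (auto simp: in_keys_iff)
      with False show ?thesis by (simp add: w_def)
    qed
    have w_equi: "w i \<in> equi_polys N i" for i
      unfolding equi_polys_def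
    proof (intro CollectI ballI)
      fix \<beta> assume "\<beta> \<in> keys (w i)"
      then have nz: "lookup (w i) \<beta> \<noteq> 0" by (simp add: in_keys_iff)
      have "\<exists>k. lookup (v k i) \<beta> \<noteq> 0"
      proof (rule ccontr)
        assume "\<not> ?thesis"
        then have "(\<lambda>k. lookup (v k i) \<beta>) = (\<lambda>_. 0)" by auto
        with w_lim[of i \<beta>] nz show False by (simp add: LIMSEQ_const_iff)
      qed
      then obtain k where "\<beta> \<in> keys (v k i)" by (auto simp: in_keys_iff)
      with v_equi[of k i] show "wt_index i \<beta> \<and> 1 \<le> mdeg \<beta> \<and> mdeg \<beta> < N" by (auto simp: equi_polys_def)
    qed
    have diff_lim: "(\<lambda>k. wnorm 1 (w i - v k i)) \<longlonglongrightarrow> 0" for i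
    proof -
      have "wnorm 1 (w i - v k i) = (\<Sum>\<alpha> | mdeg \<alpha> \<le> N. norm (lookup (w i) \<alpha> - lookup (v k i) \<alpha>))" for k
      proof -
        have "w i - v k i \<in> equi_polys N i" by (rule mp.subspace_diff[OF subspace_equi_polys w_equi v_equi])
        then have "keys (w i - v k i) \<subseteq> {\<alpha>. mdeg \<alpha> \<le> N}" by (auto dest: equi_polysD(3))
        from wnorm_superset[OF finite_mdeg_le this, of 1] show ?thesis by (simp add: lookup_minus)
      qed
      moreover have "(\<lambda>k. \<Sum>\<alpha> | mdeg \<alpha> \<le> N. norm (lookup (w i) \<alpha> - lookup (v k i) \<alpha>)) \<longlonglongrightarrow>
          (\<Sum>\<alpha> | mdeg \<alpha> \<le> N. norm (lookup (w i) \<alpha> - lookup (w i) \<alpha>))"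
        by (intro tendsto_sum tendsto_norm tendsto_diff tendsto_const w_lim)
      ultimately show ?thesis by simp
    qed
    have w_le: "wnorm 1 (w i) \<le> r" for i
    proof (rule LIMSEQ_le_const)
      show "(\<lambda>k. r + wnorm 1 (w i - v k i)) \<longlonglongrightarrow> r" using tendsto_add[OF tendsto_const diff_lim] by fastforce
      show "\<exists>n. \<forall>k\<ge>n. wnorm 1 (w i) \<le> r + wnorm 1 (w i - v k i)"
      proof (intro exI allI impI)
        fix k
        show "wnorm 1 (w i) \<le> r + wnorm 1 (w i - v k i)"
          using wn.nm_add[of "v k i" "w i - v k i"] v_le[of k i] by simp
      qed
    qed
    \<comment> \<open>The Lipschitz bound for substitution carries the vanishing of the errors over
      to the limit.\<close>
    have "wnorm 1 (b - T w) \<le> 0"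
    proof (rule LIMSEQ_le_const)
      show "(\<lambda>k. wnorm 1 (e k) + L * (\<Sum>i\<in>UNIV. wnorm 1 (w i - v k i))) \<longlonglongrightarrow> 0"
        using tendsto_add[OF e_lim tendsto_mult[OF tendsto_const[of L] tendsto_sum[of UNIV "\<lambda>i k. wnorm 1 (w i - v k i)", OF diff_lim]]]
        by simp
      have "wnorm 1 (b - T w) \<le> wnorm 1 (e k) + L * (\<Sum>i\<in>UNIV. wnorm 1 (w i - v k i))" for k
      proof -
        have "wn.near P \<delta>2 (\<lambda>i. P i + w i)" by (rule near[OF order_trans[OF w_le r(3)]])
        moreover have "wn.near P \<delta>2 (\<lambda>i. P i + v k i)" by (rule near[OF order_trans[OF v_le r(3)]])
        ultimately have "wnorm 1 (subst (\<lambda>i. P i + w i) f - subst (\<lambda>i. P i + v k i) f)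
            \<le> L * wn.gap (\<lambda>i. P i + w i) (\<lambda>i. P i + v k i)" using L(3) by blast
        then have "wnorm 1 (T w - T (v k)) \<le> L * (\<Sum>i\<in>UNIV. wnorm 1 (w i - v k i))"
          unfolding T_def cut_diff[symmetric] using wnorm_cut order_trans by (fastforce simp: wn.gap_def)
        moreover have eq: "b - T w = e k - (T w - T (v k))" by (simp add: e_def)
        have "wnorm 1 (b - T w) \<le> wnorm 1 (e k) + wnorm 1 (T w - T (v k))" unfolding eq by (rule wn.nm_diff)
        ultimately show ?thesis by linarith
      qed
      then show "\<exists>n. \<forall>k\<ge>n. wnorm 1 (b - T w) \<le> wnorm 1 (e k) + L * (\<Sum>i\<in>UNIV. wnorm 1 (w i - v k i))" by blast
    qed
    then have "b - T w = 0" by (rule wnorm_eq_0)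
    then have "T w = b" by simp
    moreover have "wnorm 1 (w i) \<le> \<delta>0" for i using w_le[of i] r(4) by simp
    ultimately show ?thesis using w_equi unfolding T_def by blast
  qed
  with \<eta>(1) that show ?thesis by blast
qed

text \<open>Around each point of the orbit, Newton's iteration at the jet \<open>P\<close> of the
  coordinate change reaches all nearby invariant jets. The corrections are equivariant and so small
  that the new jet is again one of a diffeomorphism.\<close>

lemma orbit_open:
  assumes chord: "\<And>i. chord i \<ge> 2" and a: "has_series f a" "invariant_germ G \<xi> f" "f 0 = 0" and r: "r \<ge> 1"
    and ideal: "\<And>h. inv_poly h \<Longrightarrow> lookup h 0 = 0 \<Longrightarrow>
      h \<in> gen_ideal (\<lambda>j. trunc (Suc r) (series_of (partial_deriv f j))) UNIV (Suc r)"
  shows "openin (top_of_set (inv_jets G \<xi> r)) {jet_act r \<Phi> (jet r f) | \<Phi>. \<Phi> \<in> diffeo_jets G \<xi> r}"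
proof -
  define N where "N = Suc r"
  text \<open>One degree more than the jet, so that the partial derivatives are exact up to degree \<open>r\<close>.\<close>
  define p where "p = trunc (Suc N) a"
  have a0: "a 0 = 0" using has_series_0[OF a(1)] a(3) by simp
  have p1: "p \<in> mpw 1" by (simp add: mpw_1_iff[unfolded One_nat_def] p_def a0)
  have p_inv: "homog (\<lambda>_. 1) p"
    unfolding homog_def using invariant_coeffs[OF a(1,2)] by (auto simp: p_def in_keys_iff split: if_splits)
  have pd_p: "pd j p = trunc N (series_of (partial_deriv f j))" for j
    by (rule poly_mapping_eqI)
       (simp add: series_of_eq[OF has_series_partial[OF a(1)]] lookup_pd p_def del: One_nat_def)
  have cov: "covariant j (pd j p)" for j
    unfolding covariant_def
  proof (intro ballI)
    fix \<beta> g assume "\<beta> \<in> keys (pd j p)" and g: "g \<in> carrier G"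
    then have "lookup p (\<beta> + expo j 1) \<noteq> 0" by (auto simp: in_keys_iff lookup_pd)
    from homog_lookup[OF p_inv this g] show "mchar \<xi> \<beta> g * \<xi> j g = 1"
      by (simp add: mchar_add del: One_nat_def)
  qed
  have act: "jet_act r (\<lambda>i. lookup (P i)) (jet r f) = lookup (cut N (subst P p))"
    if P: "\<And>i. P i \<in> mpw 1" "\<And>i \<beta>. \<beta> \<in> keys (P i) \<Longrightarrow> mdeg \<beta> \<le> r" for P
  proof -
    have "cut N (P i) = P i" for i using P(2)[of _ i] by (intro cut_id) (auto simp: N_def less_Suc_eq_le)
    moreover have "cut N (trunc N a) = trunc N a" by (rule poly_mapping_eqI) simp
    \<comment> \<open>\<open>P\<close> has no constant term, so the extra top degree kept in
      \<open>p\<close> does not reach the r-jet of the composition.\<close>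
    moreover have "trunc N a - p \<in> mpw N" by (simp add: mpw_iff lookup_minus p_def)
    from subst_mpw[OF P(1) this] have "subst P (trunc N a) - subst P p \<in> mpw N"
      by (simp only: cst_hom.meval_diff)
    then have "cut N (subst P (trunc N a)) = cut N (subst P p)" by (rule cut_cong)
    ultimately show ?thesis
      unfolding jet_act_eq jet_has_series[OF a(1)] N_def[symmetric] by (simp only:)
  qed
  have p_eq: "pd j p = trunc (Suc r) (series_of (partial_deriv f j))" for j using pd_p by (simp add: N_def)
  show ?thesis
  proof (subst openin_subopen, intro ballI)
    fix x assume "x \<in> {jet_act r \<Phi> (jet r f) | \<Phi>. \<Phi> \<in> diffeo_jets G \<xi> r}"
    then obtain \<Phi> where \<Phi>: "\<Phi> \<in> diffeo_jets G \<xi> r" "x = jet_act r \<Phi> (jet r f)" by blast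
    obtain P Q where P: "\<Phi> = (\<lambda>i. lookup (P i))" "\<forall>i. homog (\<xi> i) (P i)" "\<forall>i. P i \<in> mpw 1"
      "\<forall>i. \<forall>\<beta>\<in>keys (P i). mdeg \<beta> \<le> r"
      and Q: "\<forall>i. homog (\<xi> i) (Q i)" "\<forall>i. Q i \<in> mpw 1" "\<forall>i. subst P (Q i) - mon (expo i 1) \<in> mpw (Suc r)"
      by (rule diffeo_jetsE[OF \<Phi>(1)]) (rule that)
    have Ph: "homog (\<xi> i) (P i)" and P1: "P i \<in> mpw 1" and Pr: "\<beta> \<in> keys (P i) \<Longrightarrow> mdeg \<beta> \<le> r" for i \<beta>
      using P by auto
    have det: "det (linear_part (\<lambda>i. lookup (P i))) \<noteq> 0"
      by (rule linear_part_invertible[OF P1 Q(3)[rule_format]]) (use r in simp)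
    \<comment> \<open>The size allowed for corrections: within it the linear part remains
      invertible.\<close>
    obtain \<delta> where \<delta>: "\<delta> > 0"
      "\<forall>L'. (\<forall>i j. norm (L' $ i $ j - linear_part (\<lambda>i. lookup (P i)) $ i $ j) \<le> \<delta>) \<longrightarrow> det L' \<noteq> 0"
      by (rule det_nonzero_nearby[OF det]) (rule that)
    have surj: "\<exists>v. (\<forall>i. v i \<in> equi_polys N i) \<and> h - (\<Sum>i\<in>UNIV. v i * subst P (pd i p)) \<in> mpw N"
      if h: "h \<in> inv_jet_polys N" for h
      by (rule derivative_surjective[OF chord Ph _ _ _ cov _ P1 h])
         (use Q ideal in \<open>auto simp: N_def p_eq[abs_def]\<close>)
    obtain \<eta> where \<eta>: "\<eta> > 0" "\<forall>b\<in>inv_jet_polys N. wnorm 1 (b - cut N (subst P p)) < \<eta> \<longrightarrow>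
      (\<exists>v. (\<forall>i. v i \<in> equi_polys N i \<and> wnorm 1 (v i) \<le> \<delta>) \<and> cut N (subst (\<lambda>i. P i + v i) p) = b)"
      by (rule locally_surjective[OF Ph P1 p_inv p1 surj \<delta>(1)]) (assumption, rule that)
    have x: "x = lookup (cut N (subst P p))" unfolding \<Phi>(2) P(1) by (rule act[OF P1 Pr])
    \<comment> \<open>Only finitely many coordinates enter, so \<open>U\<close> is open in the
      product topology; on invariant jets the sum is the coefficient norm of the difference.\<close>
    define U where "U = {b :: 'n series. (\<Sum>\<alpha> | mdeg \<alpha> \<le> r. norm (b \<alpha> - x \<alpha>)) < \<eta>}"
    have "continuous_on UNIV (\<lambda>b :: 'n series. \<Sum>\<alpha> | mdeg \<alpha> \<le> r. norm (b \<alpha> - x \<alpha>))"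
      by (intro continuous_intros continuous_on_product_coordinates)
    then have "open U" unfolding U_def by (intro open_Collect_less continuous_on_const)
    then have "openin (top_of_set (inv_jets G \<xi> r)) (inv_jets G \<xi> r \<inter> U)" by (rule openin_open_Int)
    moreover have "x \<in> inv_jets G \<xi> r"
      unfolding inv_jets_eq x N_def[symmetric] by (rule imageI[OF cut_subst_inv_jet[OF Ph P1 p_inv p1]])
    moreover have "x \<in> U" using \<eta>(1) by (simp add: U_def)
    moreover have "inv_jets G \<xi> r \<inter> U \<subseteq> {jet_act r \<Phi> (jet r f) | \<Phi>. \<Phi> \<in> diffeo_jets G \<xi> r}"
    proof
      fix y assume y: "y \<in> inv_jets G \<xi> r \<inter> U"
      then obtain b where b: "b \<in> inv_jet_polys N" "y = lookup b" unfolding inv_jets_eq N_def by blast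
      have "keys (b - cut N (subst P p)) \<subseteq> {\<alpha>. mdeg \<alpha> \<le> r}"
        using mp.subspace_diff[OF subspace_inv_jet_polys b(1) cut_subst_inv_jet[OF Ph P1 p_inv p1]]
        by (auto simp: inv_jet_polys_def N_def less_Suc_eq_le)
      from wnorm_superset[OF finite_mdeg_le this, of 1]
      have "wnorm 1 (b - cut N (subst P p)) < \<eta>"
        using y b(2) x by (simp add: U_def lookup_minus del: lookup_trunc)
      with \<eta>(2) b(1) obtain v where v: "\<And>i. v i \<in> equi_polys N i" "\<And>i. wnorm 1 (v i) \<le> \<delta>"
        "cut N (subst (\<lambda>i. P i + v i) p) = b" by blast
      let ?R = "\<lambda>i. P i + v i"
      have R1: "?R i \<in> mpw 1" for i by (rule is_idealD(2)[OF is_ideal_mpw P1 equi_polysD(2)[OF v(1)]])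
      have Rr: "mdeg \<beta> \<le> r" if "\<beta> \<in> keys (?R i)" for i \<beta>
        using that keys_add[of "P i" "v i"] Pr equi_polysD(3)[OF v(1)] by (fastforce simp: N_def)
      have "det (linear_part (\<lambda>i. lookup (?R i))) \<noteq> 0"
        by (rule \<delta>(2)[THEN spec, THEN mp])
           (auto simp: linear_part_def lookup_add simp del: One_nat_def intro: order_trans[OF lookup_le_wnorm v(2)])
      then have "(\<lambda>i. lookup (?R i)) \<in> diffeo_jets G \<xi> r"
        by (intro diffeo_jetsI homog_add[OF Ph equi_polysD(1)[OF v(1)]] R1 Rr)
      moreover have "jet_act r (\<lambda>i. lookup (?R i)) (jet r f) = y"
        using act[of ?R, OF R1 Rr] unfolding v(3) b(2) .
      ultimately show "y \<in> {jet_act r \<Phi> (jet r f) | \<Phi>. \<Phi> \<in> diffeo_jets G \<xi> r}" by (blast intro: sym)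
    qed
    ultimately show "\<exists>T. openin (top_of_set (inv_jets G \<xi> r)) T \<and> x \<in> T \<and>
        T \<subseteq> {jet_act r \<Phi> (jet r f) | \<Phi>. \<Phi> \<in> diffeo_jets G \<xi> r}" by blast
  qed
qed

section \<open>Lengths of orbits\<close>

lemma orbit_axis: "card (orbit G (diag_act \<xi>) (axis i 1)) = chord i"
proof -
  have "diag_act \<xi> g (axis i 1) = axis i (\<xi> i g)" for g
    by (simp add: diag_act_def axis_def vec_eq_iff)
  then have "orbit G (diag_act \<xi>) (axis i 1) = axis i ` \<xi> i ` carrier G"
    by (auto simp: orbit_def)
  then show ?thesis
    unfolding chord_def by (simp add: card_image inj_on_def axis_eq_axis)
qed

text \<open>Unit vectors on the axes are not fixed, and their orbits have the orders of the
  characters as lengths. The infimum is attained at a point that some group element moves, so its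
  orbit has two elements.\<close>

lemma min_orbit_length_bounds:
  assumes fp: "\<And>x. fixed_point G \<xi> x \<Longrightarrow> x = 0"
  shows "min_orbit_length G \<xi> \<le> chord i" "min_orbit_length G \<xi> \<ge> 2"
proof -
  let ?K = "{card (orbit G (diag_act \<xi>) x) | x. \<not> fixed_point G \<xi> x}"
  have "\<not> fixed_point G \<xi> (axis i 1)" for i using fp[of "axis i 1"] by (auto simp: axis_eq_0_iff)
  then have mem: "chord i \<in> ?K" for i using orbit_axis[of i] by (intro CollectI exI[of _ "axis i 1"]) simp
  show "min_orbit_length G \<xi> \<le> chord i" unfolding min_orbit_length_def by (rule cInf_lower[OF mem]) simp
  have "Inf ?K \<in> ?K" by (rule Inf_nat_def1) (use mem in blast)
  then obtain x where x: "min_orbit_length G \<xi> = card (orbit G (diag_act \<xi>) x)" "\<not> fixed_point G \<xi> x"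
    unfolding min_orbit_length_def by blast
  then obtain g where g: "g \<in> carrier G" "diag_act \<xi> g x \<noteq> x" by (auto simp: fixed_point_def)
  have "diag_act \<xi> \<one>\<^bsub>G\<^esub> x = x" by (simp add: diag_act_def \<xi>_one vec_eq_iff)
  then have "x \<in> orbit G (diag_act \<xi>) x"
    unfolding orbit_def by (intro CollectI exI[of _ "\<one>\<^bsub>G\<^esub>"]) simp
  moreover have "diag_act \<xi> g x \<in> orbit G (diag_act \<xi>) x" unfolding orbit_def using g(1) by blast
  ultimately have "{x, diag_act \<xi> g x} \<subseteq> orbit G (diag_act \<xi>) x" by simp
  moreover have "finite (orbit G (diag_act \<xi>) x)"
    using G(2) by (simp add: orbit_def)
  ultimately have "card {x, diag_act \<xi> g x} \<le> card (orbit G (diag_act \<xi>) x)" by (intro card_mono)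
  with x(1) g(2) show "min_orbit_length G \<xi> \<ge> 2" by simp
qed

end

theorem theorem5p2:
  fixes G :: "('g, 'b) monoid_scheme"
    and \<xi> :: "'n::finite \<Rightarrow> 'g \<Rightarrow> complex"
    and f :: "complex ^ 'n \<Rightarrow> complex"
  assumes "comm_group G" and "finite (carrier G)"
    and "\<And>i. \<xi> i \<in> hom G complex_units"
    and "\<And>x. fixed_point G \<xi> x \<Longrightarrow> x = 0"
    and "analytic_germ f" and "f 0 = 0" and "invariant_germ G \<xi> f"
    and "isolated_singularity f"
    and "milnor_number f = enat (min_orbit_length G \<xi> - 1)"
  shows "equivariantly_stable G \<xi> f"
proof -
  interpret diagonal_action G \<xi> by (rule diagonal_action.intro[OF assms(1-3)])
  define l where "l = min_orbit_length G \<xi>"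
  have l: "l \<ge> 2" "\<And>i. l \<le> chord i" using min_orbit_length_bounds[OF assms(4)] by (simp_all add: l_def)
  have crit: "partial_deriv f i 0 = 0" for i using assms(8) by (simp add: isolated_singularity_def)
  have s: "has_series f (series_of f)" by (rule has_series_series_of[OF assms(5)])
  \<comment> \<open>This bound on r makes N = r + 1 exceed n l, as the algebraic part
    demands.\<close>
  have "openin (top_of_set (inv_jets G \<xi> r)) {jet_act r \<Phi> (jet r f) | \<Phi>. \<Phi> \<in> diffeo_jets G \<xi> r}"
    if r: "r \<ge> CARD('n) * l" for r
  proof (rule orbit_open[OF _ s assms(7,6)])
    show "chord i \<ge> 2" for i using l(1) l(2)[of i] by linarith
    have "CARD('n) * l \<noteq> 0" using l(1) by simp
    with r show "1 \<le> r" by linarith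
    let ?F = "\<lambda>j. trunc (Suc r) (series_of (partial_deriv f j))"
    have pv: "h \<in> pvars UNIV" for h :: "'n mpoly" by (simp add: pvars_def supp_in_def)
    have cov: "covariant j (?F j)" for j
      unfolding covariant_def
    proof (intro ballI)
      fix \<beta> g assume "\<beta> \<in> keys (?F j)" and g: "g \<in> carrier G"
      then have "series_of f (\<beta> + expo j 1) \<noteq> 0"
        by (auto simp: in_keys_iff series_of_eq[OF has_series_partial[OF s]] split: if_splits)
      from invariant_coeffs[OF s assms(7) g this] show "mchar \<xi> \<beta> g * \<xi> j g = 1"
        by (simp add: mchar_add del: One_nat_def)
    qed
    fix h :: "'n mpoly" assume h: "inv_poly h" "lookup h 0 = 0"
    show "h \<in> gen_ideal ?F UNIV (Suc r)"
    proof (rule invariants_in_ideal[OF l(1) _ _ pv cov _ pv h])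
      \<comment> \<open>The natural number subtraction in the hypothesis on the Milnor number is
        exact since l >= 2, so any l polynomials are one more than the dimension.\<close>
      have "Suc (l - 1) = l" using l(1) by simp
      then show "\<exists>c. (\<exists>i<l. c i \<noteq> 0) \<and> (\<Sum>i<l. cst (c i) * k i) \<in> gen_ideal ?F UNIV (Suc r)" for k
        using milnor_dependent[OF assms(5) crit assms(9)[folded l_def], of "Suc r" k] by simp
    qed (use r l(2) in auto)
  qed
  then have "\<forall>\<^sub>F r in sequentially.
      openin (top_of_set (inv_jets G \<xi> r)) {jet_act r \<Phi> (jet r f) | \<Phi>. \<Phi> \<in> diffeo_jets G \<xi> r}"
    unfolding eventually_sequentially by blast
  moreover have "f \<in> inv_max_ideal G \<xi>" using assms(5-7) by (simp add: inv_max_ideal_def)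
  ultimately show ?thesis by (simp add: equivariantly_stable_def)
qed

end
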